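(* Let $K$ be an infinite field and $X=\{x_1,\dots,x_n\}$ a finite set. Let $B$ be a ring that has a proper Noetherian centralizer (i.e. some $b\in B$ has centralizer $C_B(b)\neq B$ which is a Noetherian ring). Then $\mathbb{A}^0_K(X)\equiv B$ if and only if $B$ satisfies the following conditions: (i) the maximal ring of scalars of $B$ is a field, say $K_1$ (in particular $B$ is a $K_1$-algebra); (ii) as a $K_1$-algebra, $B$ is isomorphic to a free associative non-unitary algebra $\mathbb{A}^0_{K_1}(Y)$ for some set $Y$; (iii) $HF(K)\equiv HF(K_1)$ and $|X|=|Y|$.
   Context: $\mathbb{A}^0_F(Z)$ denotes the free associative algebra without unity over a field $F$ with basis $Z$; rings are viewed in the language $\{+,\cdot,0\}$ and $\equiv$ is elementary equivalence. Maximal ring of scalars: for a ring $B$, let $B^2$ be the additive subgroup generated by all products $xy$ and $f_B:B\times B\to B^2$ the multiplication map. Assuming $f_B$ is non-degenerate ($\{x: xB=0\}=\{y:By=0\}=0$), a commutative associative unital ring $P$ is a ring of scalars of $f_B$ if $B$ and $B^2$ are faithful $P$-modules and $f_B$ is $P$-bilinear; a ring of scalars $P$ is maximal if for every ring of scalars $P'$ there is a monomorphism $\mu:P'\to P$ such that each $\alpha\in P'$ acts on $B$ and $B^2$ as $\mu(\alpha)$ does. It is unique up to isomorphism. For a set $A$: $HF_0(A)=A$, $HF_{n+1}(A)=HF_n(A)\cup\{\text{finite subsets of }HF_n(A)\}$, $HF(A)=\bigcup_n HF_n(A)$; for a field $F$, $HF(F)$ is the two-sorted structure $\langle F, HF(F);\in\rangle$.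 *)

theory Defs
  imports "HOL-Algebra.Module" "HOL-Algebra.Generated_Groups"
    "HOL-Library.FSet" "HOL-Library.Equipollence"
begin

section \<open>Rings without unity\<close>

text \<open>Rings are associative but need not have a unity. They are carried by the records of
  HOL-Algebra; the field \<open>one\<close> of such a record is not part of the structure, and no
  definition below reads it.\<close>

locale rng = abelian_group B for B (structure) +
  assumes m_closed: "\<lbrakk>x \<in> carrier B; y \<in> carrier B\<rbrakk> \<Longrightarrow> x \<otimes> y \<in> carrier B"
    and m_assoc: "\<lbrakk>x \<in> carrier B; y \<in> carrier B; z \<in> carrier B\<rbrakk>
          \<Longrightarrow> (x \<otimes> y) \<otimes> z = x \<otimes> (y \<otimes> z)"
    and l_distr: "\<lbrakk>x \<in> carrier B; y \<in> carrier B; z \<in> carrier B\<rbrakk>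
          \<Longrightarrow> (x \<oplus> y) \<otimes> z = x \<otimes> z \<oplus> y \<otimes> z"
    and r_distr: "\<lbrakk>x \<in> carrier B; y \<in> carrier B; z \<in> carrier B\<rbrakk>
          \<Longrightarrow> z \<otimes> (x \<oplus> y) = z \<otimes> x \<oplus> z \<otimes> y"


section \<open>The free associative algebra without unity\<close>

text \<open>Elements are finitely supported functions from the nonempty words over \<open>Z\<close> to \<open>F\<close>,
  extended by zero to all lists. The product is the convolution over all ways of cutting a word
  into a prefix and a suffix; the two trivial cuts contribute zero. The field \<open>one\<close> is a dummy.\<close>

definition free_alg :: "('k, 'm) ring_scheme \<Rightarrow> 'x set \<Rightarrow> ('k, 'x list \<Rightarrow> 'k) module" where
  "free_alg F Z =
    \<lparr> carrier = {f. (\<forall>w. f w \<in> carrier F) \<and> finite {w. f w \<noteq> \<zero>\<^bsub>F\<^esub>} \<and>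
                    (\<forall>w. f w \<noteq> \<zero>\<^bsub>F\<^esub> \<longrightarrow> w \<noteq> [] \<and> set w \<subseteq> Z)},
      mult = (\<lambda>f g w. finsum F (\<lambda>i. f (take i w) \<otimes>\<^bsub>F\<^esub> g (drop i w)) {..length w}),
      one = (\<lambda>_. \<zero>\<^bsub>F\<^esub>),
      zero = (\<lambda>_. \<zero>\<^bsub>F\<^esub>),
      add = (\<lambda>f g w. f w \<oplus>\<^bsub>F\<^esub> g w),
      smult = (\<lambda>a f w. a \<otimes>\<^bsub>F\<^esub> f w) \<rparr>"

definition algebra_isomorphic ::
    "('p, 'q) ring_scheme \<Rightarrow> ('p, 'a, 'c) module_scheme \<Rightarrow> ('p, 'b, 'd) module_scheme \<Rightarrow> bool" where
  "algebra_isomorphic P M N \<longleftrightarrow>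
    (\<exists>h. bij_betw h (carrier M) (carrier N) \<and>
         (\<forall>x\<in>carrier M. \<forall>y\<in>carrier M. h (x \<oplus>\<^bsub>M\<^esub> y) = h x \<oplus>\<^bsub>N\<^esub> h y) \<and>
         (\<forall>x\<in>carrier M. \<forall>y\<in>carrier M. h (x \<otimes>\<^bsub>M\<^esub> y) = h x \<otimes>\<^bsub>N\<^esub> h y) \<and>
         (\<forall>a\<in>carrier P. \<forall>x\<in>carrier M. h (a \<odot>\<^bsub>M\<^esub> x) = a \<odot>\<^bsub>N\<^esub> h x))"


section \<open>Rings of scalars\<close>

definition with_smult ::
    "('b, 'm) ring_scheme \<Rightarrow> ('p \<Rightarrow> 'b \<Rightarrow> 'b) \<Rightarrow> ('p, 'b) module" where
  "with_smult B s =
    \<lparr> carrier = carrier B, mult = mult B, one = one B, zero = zero B, add = add B, smult = s \<rparr>"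

text \<open>The additive subgroup \<open>B\<^sup>2\<close> generated by all products.\<close>

definition square_set :: "('b, 'm) ring_scheme \<Rightarrow> 'b set" where
  "square_set B =
    generate (add_monoid B) {x \<otimes>\<^bsub>B\<^esub> y | x y. x \<in> carrier B \<and> y \<in> carrier B}"

definition nondegenerate :: "('b, 'm) ring_scheme \<Rightarrow> bool" where
  "nondegenerate B \<longleftrightarrow>
    {x \<in> carrier B. \<forall>y\<in>carrier B. x \<otimes>\<^bsub>B\<^esub> y = \<zero>\<^bsub>B\<^esub>} = {\<zero>\<^bsub>B\<^esub>} \<and>
    {y \<in> carrier B. \<forall>x\<in>carrier B. x \<otimes>\<^bsub>B\<^esub> y = \<zero>\<^bsub>B\<^esub>} = {\<zero>\<^bsub>B\<^esub>}"

definition faithful_module :: "('p, 'q) ring_scheme \<Rightarrow> ('p, 'a, 'c) module_scheme \<Rightarrow> bool" where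
  "faithful_module P M \<longleftrightarrow>
    module P M \<and>
    (\<forall>a\<in>carrier P. (\<forall>x\<in>carrier M. a \<odot>\<^bsub>M\<^esub> x = \<zero>\<^bsub>M\<^esub>) \<longrightarrow> a = \<zero>\<^bsub>P\<^esub>)"

definition bilinear_map ::
    "('p, 'q) ring_scheme \<Rightarrow> ('p, 'a, 'c) module_scheme \<Rightarrow> ('p, 'b, 'd) module_scheme
      \<Rightarrow> ('a \<Rightarrow> 'a \<Rightarrow> 'b) \<Rightarrow> bool" where
  "bilinear_map P M N f \<longleftrightarrow>
    (\<forall>x\<in>carrier M. \<forall>y\<in>carrier M. f x y \<in> carrier N) \<and>
    (\<forall>x\<in>carrier M. \<forall>y\<in>carrier M. \<forall>z\<in>carrier M.
        f (x \<oplus>\<^bsub>M\<^esub> y) z = f x z \<oplus>\<^bsub>N\<^esub> f y z \<and> f z (x \<oplus>\<^bsub>M\<^esub> y) = f z x \<oplus>\<^bsub>N\<^esub> f z y) \<and>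
    (\<forall>a\<in>carrier P. \<forall>x\<in>carrier M. \<forall>y\<in>carrier M.
        f (a \<odot>\<^bsub>M\<^esub> x) y = a \<odot>\<^bsub>N\<^esub> f x y \<and> f x (a \<odot>\<^bsub>M\<^esub> y) = a \<odot>\<^bsub>N\<^esub> f x y)"

text \<open>\<open>P\<close> acts on \<open>B\<close> by \<open>s\<close> and on \<open>B\<^sup>2\<close> by \<open>t\<close>. The two actions are independent data, that is,
  \<open>t\<close> is not assumed to be a restriction of \<open>s\<close>.\<close>

definition ring_of_scalars ::
    "('b, 'm) ring_scheme \<Rightarrow> ('p, 'q) ring_scheme \<Rightarrow> ('p \<Rightarrow> 'b \<Rightarrow> 'b) \<Rightarrow> ('p \<Rightarrow> 'b \<Rightarrow> 'b) \<Rightarrow> bool" where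
  "ring_of_scalars B P s t \<longleftrightarrow>
    nondegenerate B \<and> cring P \<and>
    faithful_module P (with_smult B s) \<and>
    faithful_module P ((with_smult B t)\<lparr>carrier := square_set B\<rparr>) \<and>
    bilinear_map P (with_smult B s) ((with_smult B t)\<lparr>carrier := square_set B\<rparr>) (mult B)"

text \<open>A ring of scalars acts faithfully on \<open>B\<close>, so up to isomorphism its elements are functions
  on the type of \<open>B\<close>. Hence it is no restriction that the competitors \<open>P'\<close> have elements of type
  \<open>'b \<Rightarrow> 'b\<close>.\<close>

definition maximal_ring_of_scalars ::
    "('b, 'm) ring_scheme \<Rightarrow> ('p, 'q) ring_scheme \<Rightarrow> ('p \<Rightarrow> 'b \<Rightarrow> 'b) \<Rightarrow> ('p \<Rightarrow> 'b \<Rightarrow> 'b) \<Rightarrow> bool" where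
  "maximal_ring_of_scalars B P s t \<longleftrightarrow>
    ring_of_scalars B P s t \<and>
    (\<forall>(P' :: ('b \<Rightarrow> 'b) ring) s' t'. ring_of_scalars B P' s' t' \<longrightarrow>
      (\<exists>\<mu> \<in> ring_hom P' P. inj_on \<mu> (carrier P') \<and>
        (\<forall>a\<in>carrier P'. (\<forall>x\<in>carrier B. s' a x = s (\<mu> a) x) \<and>
                        (\<forall>x\<in>square_set B. t' a x = t (\<mu> a) x))))"


section \<open>Noetherian centralizers\<close>

definition centralizer :: "('b, 'm) ring_scheme \<Rightarrow> 'b \<Rightarrow> 'b set" where
  "centralizer B b = {x \<in> carrier B. x \<otimes>\<^bsub>B\<^esub> b = b \<otimes>\<^bsub>B\<^esub> x}"

text \<open>Left and right ideals of a subring \<open>C\<close> of \<open>B\<close> are understood in the sense of algebras: they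
  are also closed under the action of every ring of scalars of \<open>B\<close>. For a ring with unity (and
  scalars in it) this closure is automatic, but here it matters. The centralizers in a free
  algebra without unity over \<open>K\<close> look like the ideal of multiples of \<open>u\<close> in \<open>K[u]\<close>; with \<open>V u\<close>
  plus the multiples of \<open>u\<^sup>2\<close> an ideal of it for every additive subgroup \<open>V\<close> of \<open>K\<close>, it never
  satisfies the ascending chain condition on mere ring ideals when \<open>K\<close> is infinite. Closure under
  scalars only removes ideals, so the chain condition on all ring ideals implies the one used
  here.\<close>

definition scalar_closed :: "('b, 'm) ring_scheme \<Rightarrow> 'b set \<Rightarrow> bool" where
  "scalar_closed B I \<longleftrightarrow>
    (\<forall>(P :: ('b \<Rightarrow> 'b) ring) s t. ring_of_scalars B P s t \<longrightarrow>
      (\<forall>a\<in>carrier P. \<forall>x\<in>I. s a x \<in> I))"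

definition left_ideal_in :: "('b, 'm) ring_scheme \<Rightarrow> 'b set \<Rightarrow> 'b set \<Rightarrow> bool" where
  "left_ideal_in B C I \<longleftrightarrow>
    I \<subseteq> C \<and> subgroup I (add_monoid B) \<and> scalar_closed B I \<and>
    (\<forall>c\<in>C. \<forall>x\<in>I. c \<otimes>\<^bsub>B\<^esub> x \<in> I)"

definition right_ideal_in :: "('b, 'm) ring_scheme \<Rightarrow> 'b set \<Rightarrow> 'b set \<Rightarrow> bool" where
  "right_ideal_in B C I \<longleftrightarrow>
    I \<subseteq> C \<and> subgroup I (add_monoid B) \<and> scalar_closed B I \<and>
    (\<forall>c\<in>C. \<forall>x\<in>I. x \<otimes>\<^bsub>B\<^esub> c \<in> I)"

definition ascending_chain_condition :: "('a set \<Rightarrow> bool) \<Rightarrow> bool" where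
  "ascending_chain_condition Q \<longleftrightarrow>
    (\<forall>I :: nat \<Rightarrow> 'a set. (\<forall>n. Q (I n) \<and> I n \<subseteq> I (Suc n)) \<longrightarrow> (\<exists>N. \<forall>n\<ge>N. I n = I N))"

definition noetherian_in :: "('b, 'm) ring_scheme \<Rightarrow> 'b set \<Rightarrow> bool" where
  "noetherian_in B C \<longleftrightarrow>
    ascending_chain_condition (left_ideal_in B C) \<and>
    ascending_chain_condition (right_ideal_in B C)"

definition has_proper_noetherian_centralizer :: "('b, 'm) ring_scheme \<Rightarrow> bool" where
  "has_proper_noetherian_centralizer B \<longleftrightarrow>
    (\<exists>b\<in>carrier B. centralizer B b \<noteq> carrier B \<and> noetherian_in B (centralizer B b))"


section \<open>Elementary equivalence of rings\<close>

text \<open>First-order formulas in the language of \<open>+\<close>, \<open>\<cdot>\<close>, \<open>0\<close>, with variables named by numbers.\<close>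

datatype rterm = RVar nat | RZero | RAdd rterm rterm | RMul rterm rterm

datatype rform = REq rterm rterm | RNeg rform | RAnd rform rform | RAll nat rform

primrec rterm_vars :: "rterm \<Rightarrow> nat set" where
  "rterm_vars (RVar i) = {i}"
| "rterm_vars RZero = {}"
| "rterm_vars (RAdd p q) = rterm_vars p \<union> rterm_vars q"
| "rterm_vars (RMul p q) = rterm_vars p \<union> rterm_vars q"

primrec rform_free :: "rform \<Rightarrow> nat set" where
  "rform_free (REq p q) = rterm_vars p \<union> rterm_vars q"
| "rform_free (RNeg \<phi>) = rform_free \<phi>"
| "rform_free (RAnd \<phi> \<psi>) = rform_free \<phi> \<union> rform_free \<psi>"
| "rform_free (RAll i \<phi>) = rform_free \<phi> - {i}"

primrec rterm_val :: "('a, 'm) ring_scheme \<Rightarrow> (nat \<Rightarrow> 'a) \<Rightarrow> rterm \<Rightarrow> 'a" where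
  "rterm_val R e (RVar i) = e i"
| "rterm_val R e RZero = \<zero>\<^bsub>R\<^esub>"
| "rterm_val R e (RAdd p q) = rterm_val R e p \<oplus>\<^bsub>R\<^esub> rterm_val R e q"
| "rterm_val R e (RMul p q) = rterm_val R e p \<otimes>\<^bsub>R\<^esub> rterm_val R e q"

primrec rform_sat :: "('a, 'm) ring_scheme \<Rightarrow> (nat \<Rightarrow> 'a) \<Rightarrow> rform \<Rightarrow> bool" where
  "rform_sat R e (REq p q) \<longleftrightarrow> rterm_val R e p = rterm_val R e q"
| "rform_sat R e (RNeg \<phi>) \<longleftrightarrow> \<not> rform_sat R e \<phi>"
| "rform_sat R e (RAnd \<phi> \<psi>) \<longleftrightarrow> rform_sat R e \<phi> \<and> rform_sat R e \<psi>"
| "rform_sat R e (RAll i \<phi>) \<longleftrightarrow> (\<forall>a\<in>carrier R. rform_sat R (e(i := a)) \<phi>)"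

definition ring_models :: "('a, 'm) ring_scheme \<Rightarrow> rform \<Rightarrow> bool" where
  "ring_models R \<phi> \<longleftrightarrow> (\<forall>e. range e \<subseteq> carrier R \<longrightarrow> rform_sat R e \<phi>)"

definition ring_elem_equiv :: "('a, 'm) ring_scheme \<Rightarrow> ('b, 'n) ring_scheme \<Rightarrow> bool" where
  "ring_elem_equiv R S \<longleftrightarrow>
    (\<forall>\<phi>. rform_free \<phi> = {} \<longrightarrow> (ring_models R \<phi> \<longleftrightarrow> ring_models S \<phi>))"


section \<open>Hereditarily finite sets\<close>

text \<open>The elements of the ground set are atoms: they have no members and differ from all sets.\<close>

datatype 'a hfset = Atom 'a | FinSet "'a hfset fset"

fun hf_mem :: "'a hfset \<Rightarrow> 'a hfset \<Rightarrow> bool" where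
  "hf_mem u (Atom a) \<longleftrightarrow> False"
| "hf_mem u (FinSet S) \<longleftrightarrow> u |\<in>| S"

primrec HF_level :: "'a set \<Rightarrow> nat \<Rightarrow> 'a hfset set" where
  "HF_level A 0 = Atom ` A"
| "HF_level A (Suc n) = HF_level A n \<union> {FinSet S | S. fset S \<subseteq> HF_level A n}"

definition HF :: "'a set \<Rightarrow> 'a hfset set" where
  "HF A = (\<Union>n. HF_level A n)"

text \<open>The language of the two-sorted structure \<open>\<langle>F, HF(F); \<in>\<rangle>\<close>, where the first sort carries
  the ring operations of \<open>F\<close>. Each sort has its own variables, its own equality and its own
  quantifier; the left argument of membership may be of either sort. The unity of \<open>F\<close> is definable
  and so needs no symbol.\<close>

datatype hform =
    HFEq rterm rterm
  | HSEq nat nat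
  | HFMem rterm nat
  | HSMem nat nat
  | HNeg hform
  | HAnd hform hform
  | HFAll nat hform
  | HSAll nat hform

primrec hform_free_F :: "hform \<Rightarrow> nat set" where
  "hform_free_F (HFEq p q) = rterm_vars p \<union> rterm_vars q"
| "hform_free_F (HSEq i j) = {}"
| "hform_free_F (HFMem p j) = rterm_vars p"
| "hform_free_F (HSMem i j) = {}"
| "hform_free_F (HNeg \<phi>) = hform_free_F \<phi>"
| "hform_free_F (HAnd \<phi> \<psi>) = hform_free_F \<phi> \<union> hform_free_F \<psi>"
| "hform_free_F (HFAll i \<phi>) = hform_free_F \<phi> - {i}"
| "hform_free_F (HSAll i \<phi>) = hform_free_F \<phi>"

primrec hform_free_S :: "hform \<Rightarrow> nat set" where
  "hform_free_S (HFEq p q) = {}"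
| "hform_free_S (HSEq i j) = {i, j}"
| "hform_free_S (HFMem p j) = {j}"
| "hform_free_S (HSMem i j) = {i, j}"
| "hform_free_S (HNeg \<phi>) = hform_free_S \<phi>"
| "hform_free_S (HAnd \<phi> \<psi>) = hform_free_S \<phi> \<union> hform_free_S \<psi>"
| "hform_free_S (HFAll i \<phi>) = hform_free_S \<phi>"
| "hform_free_S (HSAll i \<phi>) = hform_free_S \<phi> - {i}"

primrec hform_sat ::
    "('a, 'm) ring_scheme \<Rightarrow> (nat \<Rightarrow> 'a) \<Rightarrow> (nat \<Rightarrow> 'a hfset) \<Rightarrow> hform \<Rightarrow> bool" where
  "hform_sat F e h (HFEq p q) \<longleftrightarrow> rterm_val F e p = rterm_val F e q"
| "hform_sat F e h (HSEq i j) \<longleftrightarrow> h i = h j"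
| "hform_sat F e h (HFMem p j) \<longleftrightarrow> hf_mem (Atom (rterm_val F e p)) (h j)"
| "hform_sat F e h (HSMem i j) \<longleftrightarrow> hf_mem (h i) (h j)"
| "hform_sat F e h (HNeg \<phi>) \<longleftrightarrow> \<not> hform_sat F e h \<phi>"
| "hform_sat F e h (HAnd \<phi> \<psi>) \<longleftrightarrow> hform_sat F e h \<phi> \<and> hform_sat F e h \<psi>"
| "hform_sat F e h (HFAll i \<phi>) \<longleftrightarrow> (\<forall>a\<in>carrier F. hform_sat F (e(i := a)) h \<phi>)"
| "hform_sat F e h (HSAll i \<phi>) \<longleftrightarrow> (\<forall>u\<in>HF (carrier F). hform_sat F e (h(i := u)) \<phi>)"

definition HF_models :: "('a, 'm) ring_scheme \<Rightarrow> hform \<Rightarrow> bool" where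
  "HF_models F \<phi> \<longleftrightarrow>
    (\<forall>e h. range e \<subseteq> carrier F \<and> range h \<subseteq> HF (carrier F) \<longrightarrow> hform_sat F e h \<phi>)"

definition HF_elem_equiv :: "('a, 'm) ring_scheme \<Rightarrow> ('b, 'n) ring_scheme \<Rightarrow> bool" where
  "HF_elem_equiv F G \<longleftrightarrow>
    (\<forall>\<phi>. hform_free_F \<phi> = {} \<and> hform_free_S \<phi> = {} \<longrightarrow> (HF_models F \<phi> \<longleftrightarrow> HF_models G \<phi>))"

end

theory Submission
  imports Defs
begin

text \<open>Write \<open>A\<close> for the free algebra without unity on letters \<open>x, y, \<dots>\<close>. Finite subsets of \<open>A\<close>
  are coded by pairs of elements, by Chinese remaindering with respect to the right ideals generated
  by \<open>x - a\<close> for scalars \<open>a\<close>; the scalars themselves are definable through the centroid.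
  Quantifying over coded sets, one can interpret \<open>HF(K)\<close> in \<open>A\<close>: an element of \<open>A\<close> is an atom if it
  is a scalar multiple of \<open>x\<close>, and otherwise it is the set of the elements that it codes, equality
  of sets being the existence of a coded bisimulation. Conversely an element of \<open>A\<close> is a finite tree,
  since it is the sum of a linear combination of letters and of products of letters with further
  elements. Such trees are hereditarily finite sets, and the operations on them are definable by
  recursion, so \<open>A\<close> is interpreted in \<open>HF(K)\<close>.

  If \<open>B\<close> is elementarily equivalent to \<open>A\<close>, then it inherits the unique decomposition along letters,
  with coefficients in its centroid, which is a field. What could fail is that the trees are finite.
  In \<open>A\<close> there is, for each noncentral \<open>b\<close>, a coded set that lists the tree and tags its nodes by
  elements commuting with \<open>b\<close>, a child being tagged by the tag of its parent divided by \<open>b\<close>. An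
  infinite branch in \<open>B\<close> would give an infinite sequence \<open>w\<^sub>k = b w\<^sub>k\<^sub>+\<^sub>1\<close> in the centralizer of \<open>b\<close>,
  which contradicts the chain condition on right ideals when \<open>b\<close> is the element with the Noetherian
  centralizer.\<close>

section \<open>Definability in two structures at once\<close>

text \<open>Three obstacles shape the details. Formulas are hardly ever written down: each notion is
  one predicate, defined for all structures at once, and a derivation of \<open>dfb\<close>
  certifies that its two instances come from a common formula. The letters are not definable, so the
  interpreting sentences quantify over all solutions of \<open>free_axioms\<close>. Each solution is
  moved to the letters by an automorphism, and this comes from the very argument that recognizes
  \<open>B\<close> as free, applied to the free algebra itself. Finally there is no unity: scalars
  are visible only as multiples of a letter, a letter takes the place of 1 in the products that
  describe finite sets of scalars, powers of \<open>b\<close> start at exponent 1, and the lack of a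
  left identity is what contradicts an infinite chain of tags. The scalars of \<open>B\<close> are
  found as its centroid, which in a domain is the maximal ring of scalars. Once \<open>B\<close> is
  free over its centroid, only free algebras over two fields remain to be compared.\<close>

definition finitely_supported :: "((nat \<Rightarrow> 'a) \<Rightarrow> 'c) \<Rightarrow> bool" where
  "finitely_supported P \<longleftrightarrow> (\<exists>N. \<forall>e e'. (\<forall>i<N. e i = e' i) \<longrightarrow> P e = P e')"

text \<open>Every index from the bound on is fresh; allowing all larger bounds gives two predicates
  a common fresh index.\<close>

lemma finitely_supportedD:
  "finitely_supported P \<Longrightarrow> \<exists>N. \<forall>n\<ge>N. \<forall>e e'. (\<forall>i<n. e i = e' i) \<longrightarrow> P e = P e'"
  unfolding finitely_supported_def by (meson order_less_le_trans)

lemma finitely_supported_comb: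
  assumes "finitely_supported P" "finitely_supported Q"
  shows "finitely_supported (\<lambda>e. f (P e) (Q e))"
proof -
  obtain a where a: "\<And>e e'. \<forall>i<a. e i = e' i \<Longrightarrow> P e = P e'"
    using assms(1) unfolding finitely_supported_def by blast
  obtain b where b: "\<And>e e'. \<forall>i<b. e i = e' i \<Longrightarrow> Q e = Q e'"
    using assms(2) unfolding finitely_supported_def by blast
  have "f (P e) (Q e) = f (P e') (Q e')" if "\<forall>i<max a b. e i = e' i" for e e'
    using a[of e e'] b[of e e'] that by simp
  then show ?thesis unfolding finitely_supported_def by blast
qed

text \<open>\<open>dfb P Q\<close> says that \<open>P\<close> and \<open>Q\<close> are the interpretations of one and the same formula in
  the structures on \<open>M\<close> and \<open>N\<close>. The valuations are not restricted to the carriers.\<close>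

locale definability =
  fixes M :: "'a set" and N :: "'b set"
    and T :: "((nat \<Rightarrow> 'a) \<Rightarrow> 'a) \<Rightarrow> ((nat \<Rightarrow> 'b) \<Rightarrow> 'b) \<Rightarrow> bool"
    and A :: "((nat \<Rightarrow> 'a) \<Rightarrow> bool) \<Rightarrow> ((nat \<Rightarrow> 'b) \<Rightarrow> bool) \<Rightarrow> bool"
  assumes T_var: "\<And>i. T (\<lambda>e. e i) (\<lambda>e. e i)"
    and T_fs: "\<And>t u. T t u \<Longrightarrow> finitely_supported t \<and> finitely_supported u"
    and A_fs: "\<And>P Q. A P Q \<Longrightarrow> finitely_supported P \<and> finitely_supported Q"
    and A_sub: "\<And>P Q \<sigma> \<tau>. A P Q \<Longrightarrow> (\<And>i. T (\<sigma> i) (\<tau> i)) \<Longrightarrow>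
        A (\<lambda>e. P (\<lambda>i. \<sigma> i e)) (\<lambda>e. Q (\<lambda>i. \<tau> i e))"
begin

inductive dfb :: "((nat \<Rightarrow> 'a) \<Rightarrow> bool) \<Rightarrow> ((nat \<Rightarrow> 'b) \<Rightarrow> bool) \<Rightarrow> bool" where
  dfb_atom: "A P Q \<Longrightarrow> dfb P Q"
| dfb_neg: "dfb P Q \<Longrightarrow> dfb (\<lambda>e. \<not> P e) (\<lambda>e. \<not> Q e)"
| dfb_conj: "dfb P Q \<Longrightarrow> dfb P' Q' \<Longrightarrow> dfb (\<lambda>e. P e \<and> P' e) (\<lambda>e. Q e \<and> Q' e)"
| dfb_alln: "dfb P Q \<Longrightarrow> dfb (\<lambda>e. \<forall>a\<in>M. P (e(i := a))) (\<lambda>e. \<forall>a\<in>N. Q (e(i := a)))"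

lemma dfb_disj: "dfb P Q \<Longrightarrow> dfb P' Q' \<Longrightarrow> dfb (\<lambda>e. P e \<or> P' e) (\<lambda>e. Q e \<or> Q' e)"
  using dfb_neg[OF dfb_conj[OF dfb_neg dfb_neg], of P Q P' Q'] by simp

lemma dfb_imp: "dfb P Q \<Longrightarrow> dfb P' Q' \<Longrightarrow> dfb (\<lambda>e. P e \<longrightarrow> P' e) (\<lambda>e. Q e \<longrightarrow> Q' e)"
  unfolding imp_conv_disj by (rule dfb_disj[OF dfb_neg])

lemma dfb_iff: "dfb P Q \<Longrightarrow> dfb P' Q' \<Longrightarrow> dfb (\<lambda>e. P e \<longleftrightarrow> P' e) (\<lambda>e. Q e \<longleftrightarrow> Q' e)"
  unfolding iff_conv_conj_imp by (rule dfb_conj[OF dfb_imp dfb_imp])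

lemma dfb_exn: "dfb P Q \<Longrightarrow> dfb (\<lambda>e. \<exists>a\<in>M. P (e(i := a))) (\<lambda>e. \<exists>a\<in>N. Q (e(i := a)))"
  using dfb_neg[OF dfb_alln[OF dfb_neg], of P Q i] by simp

lemma dfb_fs: "dfb P Q \<Longrightarrow> finitely_supported P \<and> finitely_supported Q"
proof (induction rule: dfb.induct)
  case (dfb_atom P Q)
  then show ?case by (rule A_fs)
next
  case (dfb_neg P Q)
  then show ?case using finitely_supported_comb[of P P "\<lambda>a b. \<not> a"] finitely_supported_comb[of Q Q "\<lambda>a b. \<not> a"] by simp
next
  case (dfb_conj P Q P' Q')
  then show ?case using finitely_supported_comb[of P P' "(\<and>)"] finitely_supported_comb[of Q Q' "(\<and>)"] by simp
next
  case (dfb_alln P Q j)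
  obtain a where "\<forall>n\<ge>a. \<forall>e e'. (\<forall>i<n. e i = e' i) \<longrightarrow> P e = P e'"
    using finitely_supportedD[OF conjunct1[OF dfb_alln.IH]] by blast
  note a = this[rule_format]
  obtain b where "\<forall>n\<ge>b. \<forall>e e'. (\<forall>i<n. e i = e' i) \<longrightarrow> Q e = Q e'"
    using finitely_supportedD[OF conjunct2[OF dfb_alln.IH]] by blast
  note b = this[rule_format]
  show ?case unfolding finitely_supported_def
  proof (intro conjI exI allI impI)
    fix e e' :: "nat \<Rightarrow> 'a" assume "\<forall>i<a. e i = e' i"
    then have "P (e(j := x)) = P (e'(j := x))" for x by (intro a[OF order_refl]) auto
    then show "(\<forall>a\<in>M. P (e(j := a))) = (\<forall>a\<in>M. P (e'(j := a)))" by simp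
  next
    fix e e' :: "nat \<Rightarrow> 'b" assume "\<forall>i<b. e i = e' i"
    then have "Q (e(j := x)) = Q (e'(j := x))" for x by (intro b[OF order_refl]) auto
    then show "(\<forall>a\<in>N. Q (e(j := a))) = (\<forall>a\<in>N. Q (e'(j := a)))" by simp
  qed
qed

text \<open>Bound variables are named, so a substitution could capture them. Finite support supplies
  a fresh name for the bound variable, to which the induction hypothesis is applied.\<close>

lemma dfb_sub:
  assumes "dfb P Q" and "\<And>i. T (\<sigma> i) (\<tau> i)"
  shows "dfb (\<lambda>e. P (\<lambda>i. \<sigma> i e)) (\<lambda>e. Q (\<lambda>i. \<tau> i e))"
  using assms
proof (induction arbitrary: \<sigma> \<tau> rule: dfb.induct)
  case (dfb_atom P Q)
  then show ?case using A_sub dfb.dfb_atom by blast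
next
  case (dfb_neg P Q)
  then show ?case using dfb.dfb_neg by blast
next
  case (dfb_conj P Q P' Q')
  show ?case by (intro dfb.dfb_conj dfb_conj.IH dfb_conj.prems)
next
  case (dfb_alln P Q j)
  obtain a where "\<forall>n\<ge>a. \<forall>e e'. (\<forall>i<n. e i = e' i) \<longrightarrow> P e = P e'"
    using finitely_supportedD[OF conjunct1[OF dfb_fs[OF dfb_alln.hyps]]] by blast
  note a = this[rule_format]
  obtain b where "\<forall>n\<ge>b. \<forall>e e'. (\<forall>i<n. e i = e' i) \<longrightarrow> Q e = Q e'"
    using finitely_supportedD[OF conjunct2[OF dfb_fs[OF dfb_alln.hyps]]] by blast
  note b = this[rule_format]
  have "\<forall>i. \<exists>k. (\<forall>e e'. (\<forall>l<k. e l = e' l) \<longrightarrow> \<sigma> i e = \<sigma> i e')"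
    using T_fs dfb_alln.prems unfolding finitely_supported_def by blast
  then obtain s where s: "\<And>i e e'. (\<forall>l<s i. e l = e' l) \<Longrightarrow> \<sigma> i e = \<sigma> i e'" by metis
  have "\<forall>i. \<exists>k. (\<forall>e e'. (\<forall>l<k. e l = e' l) \<longrightarrow> \<tau> i e = \<tau> i e')"
    using T_fs dfb_alln.prems unfolding finitely_supported_def by blast
  then obtain t where t: "\<And>i e e'. (\<forall>l<t i. e l = e' l) \<Longrightarrow> \<tau> i e = \<tau> i e'" by metis
  \<comment> \<open>\<open>m\<close> bounds the supports of all terms substituted for variables that
    \<open>P\<close> or \<open>Q\<close> can see, so assigning a value to variable \<open>m\<close>
    changes none of these terms. The bound variable \<open>j\<close> is then renamed to
    \<open>m\<close>.\<close>
  define m where "m = sum s {..<a} + sum t {..<b}"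
  have sm: "s i \<le> m" if "i < a" for i
    using that member_le_sum[of i "{..<a}" s] by (simp add: m_def)
  have tm: "t i \<le> m" if "i < b" for i
    using that member_le_sum[of i "{..<b}" t] by (simp add: m_def)
  let ?\<sigma> = "\<sigma>(j := \<lambda>e. e m)" and ?\<tau> = "\<tau>(j := \<lambda>e. e m)"
  have "dfb (\<lambda>e. P (\<lambda>i. ?\<sigma> i e)) (\<lambda>e. Q (\<lambda>i. ?\<tau> i e))"
    using dfb_alln.prems T_var by (intro dfb_alln.IH) auto
  from dfb.dfb_alln[OF this, of m]
  have *: "dfb (\<lambda>e. \<forall>x\<in>M. P (\<lambda>i. ?\<sigma> i (e(m := x)))) (\<lambda>e. \<forall>x\<in>N. Q (\<lambda>i. ?\<tau> i (e(m := x))))" .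
  have "P (\<lambda>i. ?\<sigma> i (e(m := x))) = P ((\<lambda>i. \<sigma> i e)(j := x))" for e x
    by (rule a[OF order_refl]) (auto intro!: s dest!: sm)
  moreover have "Q (\<lambda>i. ?\<tau> i (e(m := x))) = Q ((\<lambda>i. \<tau> i e)(j := x))" for e x
    by (rule b[OF order_refl]) (auto intro!: t dest!: tm)
  ultimately show ?case using * by simp
qed

text \<open>The bound variable sits at index 0 and the others are shifted, as with de Bruijn
  indices. In this form the rule matches any predicate under a quantifier, and definability of a
  concrete notion follows by applying rules along its syntax.\<close>

lemma dfb_all:
  assumes "dfb (\<lambda>e. P (e 0) (\<lambda>i. e (Suc i))) (\<lambda>e. Q (e 0) (\<lambda>i. e (Suc i)))"
  shows "dfb (\<lambda>e. \<forall>a\<in>M. P a e) (\<lambda>e. \<forall>a\<in>N. Q a e)"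
proof -
  let ?P = "\<lambda>e. P (e 0) (\<lambda>i. e (Suc i))" and ?Q = "\<lambda>e. Q (e 0) (\<lambda>i. e (Suc i))"
  obtain a where "\<forall>n\<ge>a. \<forall>e e'. (\<forall>i<n. e i = e' i) \<longrightarrow> ?P e = ?P e'"
    using finitely_supportedD[OF conjunct1[OF dfb_fs[OF assms]]] by blast
  note a = this[rule_format]
  obtain b where "\<forall>n\<ge>b. \<forall>e e'. (\<forall>i<n. e i = e' i) \<longrightarrow> ?Q e = ?Q e'"
    using finitely_supportedD[OF conjunct2[OF dfb_fs[OF assms]]] by blast
  note b = this[rule_format]
  let ?m = "max a b"
  \<comment> \<open>Undoes the shift: index 0 reads the fresh variable \<open>?m\<close>, index
    \<open>Suc i\<close> reads variable \<open>i\<close>.\<close>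
  have "T (case i of 0 \<Rightarrow> (\<lambda>e. e ?m) | Suc i \<Rightarrow> (\<lambda>e. e i))
          (case i of 0 \<Rightarrow> (\<lambda>e. e ?m) | Suc i \<Rightarrow> (\<lambda>e. e i))" for i
    by (cases i) (auto intro: T_var)
  from dfb_alln[OF dfb_sub[OF assms, where \<sigma> = "\<lambda>i. case i of 0 \<Rightarrow> (\<lambda>e. e ?m) | Suc i \<Rightarrow> (\<lambda>e. e i)"
      and \<tau> = "\<lambda>i. case i of 0 \<Rightarrow> (\<lambda>e. e ?m) | Suc i \<Rightarrow> (\<lambda>e. e i)", OF this], of ?m]
  have *: "dfb (\<lambda>e. \<forall>x\<in>M. P x (e(?m := x))) (\<lambda>e. \<forall>x\<in>N. Q x (e(?m := x)))"
    by (simp add: fun_upd_def)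
  have "P x (e(?m := x)) = P x e" for x e
    using a[of ?m "case_nat x (e(?m := x))" "case_nat x e"] by (simp add: fun_upd_def split: nat.splits)
  moreover have "Q x (e(?m := x)) = Q x e" for x e
    using b[of ?m "case_nat x (e(?m := x))" "case_nat x e"] by (simp add: fun_upd_def split: nat.splits)
  ultimately show ?thesis using * by simp
qed

lemma dfb_ex:
  assumes "dfb (\<lambda>e. P (e 0) (\<lambda>i. e (Suc i))) (\<lambda>e. Q (e 0) (\<lambda>i. e (Suc i)))"
  shows "dfb (\<lambda>e. \<exists>a\<in>M. P a e) (\<lambda>e. \<exists>a\<in>N. Q a e)"
  using dfb_neg[OF dfb_all[where P = "\<lambda>a e. \<not> P a e" and Q = "\<lambda>a e. \<not> Q a e", OF dfb_neg[OF assms]]]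
  by simp

text \<open>Definability need only be derived for variables as arguments; arbitrary terms are then
  substituted.\<close>

lemma dfb_sub2:
  assumes "dfb (\<lambda>e. D (e 0) (e 1)) (\<lambda>e. D' (e 0) (e 1))" "T t t'" "T u u'"
  shows "dfb (\<lambda>e. D (t e) (u e)) (\<lambda>e. D' (t' e) (u' e))"
proof -
  let ?f = "\<lambda>t u i. if i = 0 then t else if i = 1 then u else (\<lambda>e. e i)"
  have "T (?f t u i) (?f t' u' i)" for i using assms(2-) T_var by simp
  from dfb_sub[OF assms(1), where \<sigma> = "?f t u" and \<tau> = "?f t' u'", OF this] show ?thesis by simp
qed

lemma dfb_sub5:
  assumes "dfb (\<lambda>e. D (e 0) (e 1) (e 2) (e 3) (e 4)) (\<lambda>e. D' (e 0) (e 1) (e 2) (e 3) (e 4))"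
    "T t t'" "T u u'" "T v v'" "T w w'" "T y y'"
  shows "dfb (\<lambda>e. D (t e) (u e) (v e) (w e) (y e)) (\<lambda>e. D' (t' e) (u' e) (v' e) (w' e) (y' e))"
proof -
  let ?f = "\<lambda>t u v w y i. if i = 0 then t else if i = 1 then u else if i = 2 then v
    else if i = 3 then w else if i = 4 then y else (\<lambda>e. e i)"
  have "T (?f t u v w y i) (?f t' u' v' w' y' i)" for i using assms(2-) T_var by simp
  from dfb_sub[OF assms(1), where \<sigma> = "?f t u v w y" and \<tau> = "?f t' u' v' w' y'", OF this] show ?thesis by simp
qed

end

section \<open>Formulas in the language of rings\<close>

primrec rterm_subst :: "(nat \<Rightarrow> rterm) \<Rightarrow> rterm \<Rightarrow> rterm" where
  "rterm_subst s (RVar i) = s i"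
| "rterm_subst s RZero = RZero"
| "rterm_subst s (RAdd p q) = RAdd (rterm_subst s p) (rterm_subst s q)"
| "rterm_subst s (RMul p q) = RMul (rterm_subst s p) (rterm_subst s q)"

lemma rterm_val_subst:
  "rterm_val R e (rterm_subst s p) = rterm_val R (\<lambda>i. rterm_val R e (s i)) p"
  by (induction p) auto

lemma rterm_val_cong:
  "(\<And>i. i \<in> rterm_vars p \<Longrightarrow> e i = e' i) \<Longrightarrow> rterm_val R e p = rterm_val R e' p"
  by (induction p) auto

lemma finite_rterm_vars: "finite (rterm_vars p)"
  by (induction p) auto

lemma finitely_supported_rterm_val: "finitely_supported (\<lambda>e. rterm_val R e p)"
proof -
  obtain N where "\<forall>i\<in>rterm_vars p. i < N"
    using finite_rterm_vars finite_nat_set_iff_bounded by blast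
  then have "\<forall>e e'. (\<forall>i<N. e i = e' i) \<longrightarrow> rterm_val R e p = rterm_val R e' p"
    using rterm_val_cong[of p] by blast
  then show ?thesis unfolding finitely_supported_def by blast
qed

lemma finitely_supported_eq: "finitely_supported (\<lambda>e. rterm_val R e p = rterm_val R e q)"
  by (rule finitely_supported_comb[where f = "(=)"]) (rule finitely_supported_rterm_val)+

definition term_pair where
  "term_pair R S t u \<longleftrightarrow> (\<exists>p. t = (\<lambda>e. rterm_val R e p) \<and> u = (\<lambda>e. rterm_val S e p))"

definition eq_pair where
  "eq_pair R S P Q \<longleftrightarrow> (\<exists>p q. P = (\<lambda>e. rterm_val R e p = rterm_val R e q) \<and>
     Q = (\<lambda>e. rterm_val S e p = rterm_val S e q))"

locale ring_pair =
  fixes R :: "('a, 'm) ring_scheme" and S :: "('b, 'n) ring_scheme"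
begin

sublocale definability "carrier R" "carrier S" "term_pair R S" "eq_pair R S"
proof
  show "term_pair R S (\<lambda>e. e i) (\<lambda>e. e i)" for i
    unfolding term_pair_def by (rule exI[of _ "RVar i"]) simp
  show "finitely_supported t \<and> finitely_supported u" if "term_pair R S t u" for t u
    using that finitely_supported_rterm_val[of R] finitely_supported_rterm_val[of S]
    unfolding term_pair_def by auto
  show "finitely_supported P \<and> finitely_supported Q" if "eq_pair R S P Q" for P Q
    using that finitely_supported_eq[of R] finitely_supported_eq[of S] unfolding eq_pair_def by auto
  show "eq_pair R S (\<lambda>e. P (\<lambda>i. \<sigma> i e)) (\<lambda>e. Q (\<lambda>i. \<tau> i e))"
    if ab: "eq_pair R S P Q" "\<And>i. term_pair R S (\<sigma> i) (\<tau> i)" for P Q \<sigma> \<tau>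
  proof -
    obtain s where s: "\<And>i. \<sigma> i = (\<lambda>e. rterm_val R e (s i))" "\<And>i. \<tau> i = (\<lambda>e. rterm_val S e (s i))"
      using ab(2) unfolding term_pair_def by metis
    obtain p q where "P = (\<lambda>e. rterm_val R e p = rterm_val R e q)"
      "Q = (\<lambda>e. rterm_val S e p = rterm_val S e q)" using ab(1) unfolding eq_pair_def by blast
    then show ?thesis unfolding eq_pair_def
      by (intro exI[of _ "rterm_subst s p"] exI[of _ "rterm_subst s q"]) (simp add: s rterm_val_subst)
  qed
qed

lemma T_zero: "term_pair R S (\<lambda>e. \<zero>\<^bsub>R\<^esub>) (\<lambda>e. \<zero>\<^bsub>S\<^esub>)"
  unfolding term_pair_def by (rule exI[of _ RZero]) simp

lemma T_add: "term_pair R S t t' \<Longrightarrow> term_pair R S u u' \<Longrightarrow>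
    term_pair R S (\<lambda>e. t e \<oplus>\<^bsub>R\<^esub> u e) (\<lambda>e. t' e \<oplus>\<^bsub>S\<^esub> u' e)"
  unfolding term_pair_def by (elim exE conjE, rule_tac x = "RAdd p pa" in exI) simp

lemma T_mul: "term_pair R S t t' \<Longrightarrow> term_pair R S u u' \<Longrightarrow>
    term_pair R S (\<lambda>e. t e \<otimes>\<^bsub>R\<^esub> u e) (\<lambda>e. t' e \<otimes>\<^bsub>S\<^esub> u' e)"
  unfolding term_pair_def by (elim exE conjE, rule_tac x = "RMul p pa" in exI) simp

lemma dfb_eq: "term_pair R S t t' \<Longrightarrow> term_pair R S u u' \<Longrightarrow> dfb (\<lambda>e. t e = u e) (\<lambda>e. t' e = u' e)"
  by (rule dfb_atom) (auto simp: term_pair_def eq_pair_def)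

lemmas dfb_simps = T_var T_zero T_add T_mul dfb_eq dfb_neg dfb_conj dfb_disj dfb_imp dfb_iff
  dfb_all dfb_ex

text \<open>Turns a derivation into actual syntax, the same for both rings.\<close>

lemma dfb_formula:
  "dfb P Q \<Longrightarrow> \<exists>\<psi>. P = (\<lambda>e. rform_sat R e \<psi>) \<and> Q = (\<lambda>e. rform_sat S e \<psi>)"
proof (induction rule: dfb.induct)
  case (dfb_atom P Q)
  then obtain p q where "P = (\<lambda>e. rterm_val R e p = rterm_val R e q)"
    "Q = (\<lambda>e. rterm_val S e p = rterm_val S e q)" unfolding eq_pair_def by blast
  then show ?case by (intro exI[of _ "REq p q"]) simp
next
  case (dfb_neg P Q)
  then obtain \<psi> where "P = (\<lambda>e. rform_sat R e \<psi>)" "Q = (\<lambda>e. rform_sat S e \<psi>)" by blast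
  then show ?case by (intro exI[of _ "RNeg \<psi>"]) simp
next
  case (dfb_conj P Q P' Q')
  then obtain \<psi> \<psi>' where "P = (\<lambda>e. rform_sat R e \<psi>)" "Q = (\<lambda>e. rform_sat S e \<psi>)"
    "P' = (\<lambda>e. rform_sat R e \<psi>')" "Q' = (\<lambda>e. rform_sat S e \<psi>')" by blast
  then show ?case by (intro exI[of _ "RAnd \<psi> \<psi>'"]) simp
next
  case (dfb_alln P Q i)
  then obtain \<psi> where "P = (\<lambda>e. rform_sat R e \<psi>)" "Q = (\<lambda>e. rform_sat S e \<psi>)" by blast
  then show ?case by (intro exI[of _ "RAll i \<psi>"]) simp
qed

end

lemma rform_free_bounded: "\<exists>N. rform_free \<psi> \<subseteq> {..<N}"
proof -
  have "finite (rform_free \<psi>)" by (induction \<psi>) (auto simp: finite_rterm_vars)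
  then show ?thesis using finite_nat_set_iff_bounded by (metis lessThan_iff subsetI)
qed

text \<open>Elementary equivalence speaks of sentences only, but the formula behind a constant
  predicate may still have free variables. They are bound by dummy quantifiers.\<close>

primrec ralls :: "nat \<Rightarrow> rform \<Rightarrow> rform" where
  "ralls 0 \<psi> = \<psi>"
| "ralls (Suc n) \<psi> = RAll n (ralls n \<psi>)"

lemma rform_free_ralls: "rform_free (ralls n \<psi>) = rform_free \<psi> - {..<n}"
  by (induction n) (auto simp: lessThan_Suc)

lemma rform_sat_ralls:
  "(\<And>e. rform_sat R e \<psi> = p) \<Longrightarrow> carrier R \<noteq> {} \<Longrightarrow> rform_sat R e (ralls n \<psi>) = p"
  by (induction n arbitrary: e) auto

text \<open>Constant predicates are the semantic form of sentences. The carriers must be nonempty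
  for the dummy quantifiers to preserve truth.\<close>

lemma (in ring_pair) elem_equiv_transfer:
  assumes "ring_elem_equiv R S" "dfb (\<lambda>_. p) (\<lambda>_. q)" "carrier R \<noteq> {}" "carrier S \<noteq> {}"
  shows "p = q"
proof -
  obtain \<psi> where \<psi>: "(\<lambda>_. p) = (\<lambda>e. rform_sat R e \<psi>)" "(\<lambda>_. q) = (\<lambda>e. rform_sat S e \<psi>)"
    using dfb_formula[OF assms(2)] by blast
  obtain N where N: "rform_free \<psi> \<subseteq> {..<N}" using rform_free_bounded by blast
  obtain a b where ab: "a \<in> carrier R" "b \<in> carrier S" using assms by blast
  have "ring_models R (ralls N \<psi>) = p"
    using rform_sat_ralls[of R \<psi> p] assms(3) \<psi>(1) ab
    unfolding ring_models_def by (auto simp: fun_eq_iff intro: exI[of _ "\<lambda>_. a"])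
  moreover have "ring_models S (ralls N \<psi>) = q"
    using rform_sat_ralls[of S \<psi> q] assms(4) \<psi>(2) ab
    unfolding ring_models_def by (auto simp: fun_eq_iff intro: exI[of _ "\<lambda>_. b"])
  ultimately show ?thesis using assms(1) N rform_free_ralls unfolding ring_elem_equiv_def by blast
qed

section \<open>Invariance under isomorphism of rings without unity\<close>

definition ring_iso_map :: "('a \<Rightarrow> 'b) \<Rightarrow> ('a, 'm) ring_scheme \<Rightarrow> ('b, 'n) ring_scheme \<Rightarrow> bool" where
  "ring_iso_map h R S \<longleftrightarrow> bij_betw h (carrier R) (carrier S) \<and>
     (\<forall>x\<in>carrier R. \<forall>y\<in>carrier R. h (x \<oplus>\<^bsub>R\<^esub> y) = h x \<oplus>\<^bsub>S\<^esub> h y \<and> h (x \<otimes>\<^bsub>R\<^esub> y) = h x \<otimes>\<^bsub>S\<^esub> h y)"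

lemma ring_iso_map_zero:
  assumes "ring_iso_map h R S" "rng R" "rng S"
  shows "h \<zero>\<^bsub>R\<^esub> = \<zero>\<^bsub>S\<^esub>"
proof -
  interpret R: rng R by fact
  interpret S: rng S by fact
  have hc: "h \<zero>\<^bsub>R\<^esub> \<in> carrier S" using assms(1) unfolding ring_iso_map_def bij_betw_def by auto
  have "h (\<zero>\<^bsub>R\<^esub> \<oplus>\<^bsub>R\<^esub> \<zero>\<^bsub>R\<^esub>) = h \<zero>\<^bsub>R\<^esub> \<oplus>\<^bsub>S\<^esub> h \<zero>\<^bsub>R\<^esub>"
    using assms(1) unfolding ring_iso_map_def by blast
  then show ?thesis using hc by simp
qed

lemma rterm_val_iso:
  assumes "ring_iso_map h R S" "rng R" "rng S" "range e \<subseteq> carrier R"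
  shows "rterm_val R e p \<in> carrier R \<and> rterm_val S (h \<circ> e) p = h (rterm_val R e p)"
proof -
  interpret R: rng R by fact
  show ?thesis using assms ring_iso_map_zero[OF assms(1-3)]
    by (induction p) (auto simp: ring_iso_map_def R.m_closed)
qed

lemma rform_sat_iso:
  assumes "ring_iso_map h R S" "rng R" "rng S" "range e \<subseteq> carrier R"
  shows "rform_sat S (h \<circ> e) \<psi> = rform_sat R e \<psi>"
  using assms(4)
proof (induction \<psi> arbitrary: e)
  case (REq p q)
  have "inj_on h (carrier R)" using assms(1) unfolding ring_iso_map_def bij_betw_def by blast
  then show ?case unfolding rform_sat.simps
    using rterm_val_iso[OF assms(1-3) REq, of p] rterm_val_iso[OF assms(1-3) REq, of q]
    by (metis inj_on_eq_iff)
next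
  case (RAll i \<psi>)
  have eq: "carrier S = h ` carrier R" using assms(1) unfolding ring_iso_map_def bij_betw_def by blast
  have "rform_sat S ((h \<circ> e)(i := h a)) \<psi> = rform_sat R (e(i := a)) \<psi>" if "a \<in> carrier R" for a
  proof -
    have "range (e(i := a)) \<subseteq> carrier R" using RAll.prems that by auto
    from RAll.IH[OF this] show ?thesis by (simp add: comp_def fun_upd_def if_distrib cong: if_cong)
  qed
  then show ?case unfolding rform_sat.simps eq by blast
qed auto

lemma ring_iso_imp_elem_equiv:
  assumes "ring_iso_map h R S" "rng R" "rng S"
  shows "ring_elem_equiv R S"
proof -
  interpret R: rng R by fact
  have bij: "bij_betw h (carrier R) (carrier S)" using assms(1) unfolding ring_iso_map_def by blast
  have "ring_models R \<phi> = ring_models S \<phi>" for \<phi>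
  proof
    assume L: "ring_models R \<phi>"
    show "ring_models S \<phi>" unfolding ring_models_def
    proof (intro allI impI)
      fix e :: "nat \<Rightarrow> 'b" assume e: "range e \<subseteq> carrier S"
      let ?e = "inv_into (carrier R) h \<circ> e"
      have r: "range ?e \<subseteq> carrier R"
        using e bij_betw_inv_into[OF bij] unfolding bij_betw_def by fastforce
      have "h \<circ> ?e = e" using e bij by (auto simp: fun_eq_iff intro: bij_betw_inv_into_right)
      then show "rform_sat S e \<phi>"
        using rform_sat_iso[OF assms r, of \<phi>] L r unfolding ring_models_def by simp
    qed
  next
    assume L: "ring_models S \<phi>"
    show "ring_models R \<phi>" unfolding ring_models_def
    proof (intro allI impI)
      fix e :: "nat \<Rightarrow> 'a" assume e: "range e \<subseteq> carrier R"
      have "range (h \<circ> e) \<subseteq> carrier S" using e bij unfolding bij_betw_def by auto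
      then show "rform_sat R e \<phi>"
        using rform_sat_iso[OF assms e, of \<phi>] L unfolding ring_models_def by simp
    qed
  qed
  then show ?thesis unfolding ring_elem_equiv_def by blast
qed

lemma ring_elem_equiv_trans: "ring_elem_equiv R S \<Longrightarrow> ring_elem_equiv S T \<Longrightarrow> ring_elem_equiv R T"
  unfolding ring_elem_equiv_def by (intro allI impI, drule_tac x = \<phi> in spec, drule_tac x = \<phi> in spec) simp

lemma ring_elem_equiv_sym: "ring_elem_equiv R S \<Longrightarrow> ring_elem_equiv S R"
  unfolding ring_elem_equiv_def by (intro allI impI, drule_tac x = \<phi> in spec) simp

lemma ring_iso_map_comp:
  assumes "ring_iso_map h R S" "ring_iso_map g S T" shows "ring_iso_map (g \<circ> h) R T"
proof -
  have h: "h x \<in> carrier S" if "x \<in> carrier R" for x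
    using assms(1) that unfolding ring_iso_map_def by (meson bij_betw_apply)
  show ?thesis using assms h bij_betw_trans[of h "carrier R" "carrier S" g "carrier T"]
    unfolding ring_iso_map_def by simp
qed

text \<open>Meant for automorphisms: one that moves a solution of the axioms to the letters carries
  all definable relations along.\<close>

lemma (in ring_pair) dfb_iso:
  assumes "dfb P Q" "ring_iso_map h R S" "rng R" "rng S" "range e \<subseteq> carrier R"
  shows "P e = Q (h \<circ> e)"
proof -
  obtain \<psi> where "P = (\<lambda>e. rform_sat R e \<psi>)" "Q = (\<lambda>e. rform_sat S e \<psi>)"
    using dfb_formula[OF assms(1)] by blast
  then show ?thesis using rform_sat_iso[OF assms(2-5), of \<psi>] by simp
qed

section \<open>The free algebra\<close>

definition conv :: "('k, 'm) ring_scheme \<Rightarrow> ('x list \<Rightarrow> 'k) \<Rightarrow> ('x list \<Rightarrow> 'k) \<Rightarrow> 'x list \<Rightarrow> 'k" where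
  "conv F f g w = finsum F (\<lambda>i. f (take i w) \<otimes>\<^bsub>F\<^esub> g (drop i w)) {..length w}"

lemma free_alg_simps [simp]:
  "mult (free_alg F Z) = conv F" "zero (free_alg F Z) = (\<lambda>_. \<zero>\<^bsub>F\<^esub>)"
  "add (free_alg F Z) = (\<lambda>f g w. f w \<oplus>\<^bsub>F\<^esub> g w)" "smult (free_alg F Z) = (\<lambda>a f w. a \<otimes>\<^bsub>F\<^esub> f w)"
  by (auto simp: free_alg_def conv_def fun_eq_iff)

definition letter :: "('k, 'm) ring_scheme \<Rightarrow> 'x \<Rightarrow> 'x list \<Rightarrow> 'k" where
  "letter F x w = (if w = [x] then \<one>\<^bsub>F\<^esub> else \<zero>\<^bsub>F\<^esub>)"

section \<open>Convolution of functions on words\<close>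

context field
begin

abbreviation coeffs :: "('x \<Rightarrow> 'a) \<Rightarrow> bool" where
  "coeffs f \<equiv> \<forall>w. f w \<in> carrier R"

lemma conv_Nil [simp]: "coeffs f \<Longrightarrow> coeffs g \<Longrightarrow> conv R f g [] = f [] \<otimes> g []"
  by (simp add: conv_def)

text \<open>Splits off the empty prefix; the other cuts of \<open>x # w\<close> are the cuts of
  \<open>w\<close>, with \<open>f\<close> replaced by its derivative at the letter \<open>x\<close>.
  Bilinearity and associativity are inductions along this equation.\<close>

lemma conv_Cons:
  assumes "coeffs f" "coeffs g"
  shows "conv R f g (x # w) = f [] \<otimes> g (x # w) \<oplus> conv R (\<lambda>v. f (x # v)) g w"
proof -
  have "conv R f g (x # w) =
      finsum R (\<lambda>i. f (take i (x # w)) \<otimes> g (drop i (x # w))) {..Suc (length w)}"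
    by (simp add: conv_def)
  also have "\<dots> = finsum R (\<lambda>i. f (take (Suc i) (x # w)) \<otimes> g (drop (Suc i) (x # w))) {..length w}
     \<oplus> f (take 0 (x # w)) \<otimes> g (drop 0 (x # w))"
    using assms by (intro finsum_Suc2) auto
  finally show ?thesis using assms by (simp add: conv_def a_comm finsum_closed)
qed

lemma conv_closed [simp]: "coeffs f \<Longrightarrow> coeffs g \<Longrightarrow> conv R f g w \<in> carrier R"
  by (auto simp: conv_def intro!: finsum_closed)

lemma conv_zero_left [simp]: "coeffs g \<Longrightarrow> conv R (\<lambda>_. \<zero>) g w = \<zero>"
  by (induction w) (simp_all add: conv_Cons)

lemma conv_zero_right [simp]: "coeffs f \<Longrightarrow> conv R f (\<lambda>_. \<zero>) w = \<zero>"
  by (induction w arbitrary: f) (simp_all add: conv_Cons)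

lemma conv_add_left:
  "coeffs f \<Longrightarrow> coeffs f' \<Longrightarrow> coeffs g \<Longrightarrow>
    conv R (\<lambda>w. f w \<oplus> f' w) g w = conv R f g w \<oplus> conv R f' g w"
  by (induction w arbitrary: f f') (simp_all add: conv_Cons l_distr a_ac)

lemma conv_add_right:
  "coeffs f \<Longrightarrow> coeffs g \<Longrightarrow> coeffs g' \<Longrightarrow>
    conv R f (\<lambda>w. g w \<oplus> g' w) w = conv R f g w \<oplus> conv R f g' w"
  by (induction w arbitrary: f) (simp_all add: conv_Cons r_distr a_ac)

lemma conv_smult_left:
  "a \<in> carrier R \<Longrightarrow> coeffs f \<Longrightarrow> coeffs g \<Longrightarrow>
    conv R (\<lambda>w. a \<otimes> f w) g w = a \<otimes> conv R f g w"
  by (induction w arbitrary: f) (simp_all add: conv_Cons r_distr m_assoc)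

lemma conv_smult_right:
  "a \<in> carrier R \<Longrightarrow> coeffs f \<Longrightarrow> coeffs g \<Longrightarrow>
    conv R f (\<lambda>w. a \<otimes> g w) w = a \<otimes> conv R f g w"
  by (induction w arbitrary: f) (simp_all add: conv_Cons r_distr m_ac)

text \<open>The derivative of \<open>conv R f g\<close> at a letter obeys a product rule with the
  summands \<open>f [] \<otimes> ?g\<close> and \<open>conv R ?f g\<close>, so induction on the word
  works if \<open>f\<close> and \<open>g\<close> are arbitrary.\<close>

lemma conv_assoc:
  assumes "coeffs f" "coeffs g" "coeffs h"
  shows "conv R (conv R f g) h w = conv R f (conv R g h) w"
  using assms
proof (induction w arbitrary: f g)
  case Nil
  then show ?case by (simp add: m_assoc)
next
  case (Cons x w)
  let ?f = "\<lambda>v. f (x # v)" and ?g = "\<lambda>v. g (x # v)"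
  have c: "coeffs ?f" "coeffs ?g" using Cons.prems by auto
  have "conv R (conv R f g) h (x # w) =
      f [] \<otimes> g [] \<otimes> h (x # w) \<oplus> conv R (\<lambda>v. f [] \<otimes> ?g v \<oplus> conv R ?f g v) h w"
    using Cons.prems by (simp add: conv_Cons)
  also have "\<dots> = f [] \<otimes> g [] \<otimes> h (x # w) \<oplus> (f [] \<otimes> conv R ?g h w \<oplus> conv R (conv R ?f g) h w)"
    using Cons.prems c by (simp add: conv_add_left conv_smult_left)
  also have "\<dots> = f [] \<otimes> g [] \<otimes> h (x # w) \<oplus> (f [] \<otimes> conv R ?g h w \<oplus> conv R ?f (conv R g h) w)"
    using Cons c by simp
  also have "\<dots> = conv R f (conv R g h) (x # w)"
    using Cons.prems c by (simp add: conv_Cons r_distr m_assoc a_assoc)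
  finally show ?case .
qed

lemma letter_closed [simp]: "letter R x w \<in> carrier R"
  by (simp add: letter_def)

lemma conv_letter_left:
  assumes "coeffs g"
  shows "conv R (letter R x) g (y # w) = (if x = y then g w else \<zero>)"
proof -
  \<comment> \<open>The derivative of a letter is the indicator of the empty word. It acts as a
    unity although it lies outside the algebra.\<close>
  have *: "conv R (\<lambda>v. if v = [] then \<one> else \<zero>) g w = g w"
  proof (cases w)
    case (Cons z v)
    have "coeffs (\<lambda>v. if v = [] then \<one> else \<zero>)" by simp
    then show ?thesis using assms Cons by (simp add: conv_Cons)
  qed (use assms in simp)
  show ?thesis using assms * by (auto simp: conv_Cons) (auto simp: letter_def)
qed

lemma conv_letter_right:
  assumes "coeffs f"
  shows "conv R f (letter R x) (w @ [y]) = (if x = y then f w else \<zero>)"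
  using assms
proof (induction w arbitrary: f)
  case Nil
  then show ?case by (simp add: conv_Cons) (simp add: letter_def)
next
  case (Cons z w)
  then show ?case by (simp add: conv_Cons) (simp add: letter_def)
qed

lemma conv_eq_0:
  assumes "coeffs f" "coeffs g" "\<And>w. k < length w \<Longrightarrow> f w = \<zero>" "\<And>w. m < length w \<Longrightarrow> g w = \<zero>"
    and "k + m < length w"
  shows "conv R f g w = \<zero>"
proof -
  have "f (take i w) \<otimes> g (drop i w) = \<zero>" if "i \<le> length w" for i
  proof (cases "k < i")
    case True
    then show ?thesis using assms that by simp
  next
    case False
    then show ?thesis using assms that by simp
  qed
  then show ?thesis unfolding conv_def by (intro add.finprod_one_eqI) auto
qed

text \<open>Any cut other than the one after \<open>u\<close> has a prefix longer than
  \<open>u\<close> or a suffix longer than \<open>v\<close>. Top coefficients therefore multiply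
  without cancellation.\<close>

lemma conv_top:
  assumes "coeffs f" "coeffs g" "\<And>w. length u < length w \<Longrightarrow> f w = \<zero>"
    and "\<And>w. length v < length w \<Longrightarrow> g w = \<zero>"
  shows "conv R f g (u @ v) = f u \<otimes> g v"
proof -
  let ?w = "u @ v"
  have "f (take i ?w) \<otimes> g (drop i ?w) = (if length u = i then f u \<otimes> g v else \<zero>)"
    if "i \<le> length ?w" for i
  proof (cases "length u < i")
    case True
    then show ?thesis using assms that by (simp del: take_append drop_append)
  next
    case False
    then show ?thesis using assms that by (cases "i = length u") auto
  qed
  then have "conv R f g ?w = finsum R (\<lambda>i. if length u = i then f u \<otimes> g v else \<zero>) {..length ?w}"
    unfolding conv_def using assms(1,2) by (intro finsum_cong') auto
  also have "\<dots> = f u \<otimes> g v" using assms(1,2) by (intro add.finprod_singleton) auto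
  finally show ?thesis .
qed

end

text \<open>Over finitely many letters there are finitely many words of each length, so finite
  support amounts to bounded length, which is easier to maintain.\<close>

lemma free_alg_carrier_iff:
  assumes "finite Z"
  shows "f \<in> carrier (free_alg F Z) \<longleftrightarrow> (\<forall>w. f w \<in> carrier F) \<and> f [] = \<zero>\<^bsub>F\<^esub> \<and>
     (\<forall>w. f w \<noteq> \<zero>\<^bsub>F\<^esub> \<longrightarrow> set w \<subseteq> Z) \<and> (\<exists>k. \<forall>w. k < length w \<longrightarrow> f w = \<zero>\<^bsub>F\<^esub>)"
    (is "?L \<longleftrightarrow> ?R")
proof
  assume L: ?L
  then have fin: "finite {w. f w \<noteq> \<zero>\<^bsub>F\<^esub>}" by (simp add: free_alg_def)
  then have "length w \<le> Max (length ` {w. f w \<noteq> \<zero>\<^bsub>F\<^esub>})" if "f w \<noteq> \<zero>\<^bsub>F\<^esub>" for w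
    using that by (intro Max_ge) auto
  then have "\<exists>k. \<forall>w. k < length w \<longrightarrow> f w = \<zero>\<^bsub>F\<^esub>" by (meson leD)
  moreover have "f [] = \<zero>\<^bsub>F\<^esub>" using L by (auto simp: free_alg_def)
  ultimately show ?R using L by (auto simp: free_alg_def)
next
  assume R: ?R
  then obtain k where k: "\<forall>w. k < length w \<longrightarrow> f w = \<zero>\<^bsub>F\<^esub>" by blast
  have "{w. f w \<noteq> \<zero>\<^bsub>F\<^esub>} \<subseteq> {w. set w \<subseteq> Z \<and> length w \<le> k}"
    using R k by (auto simp: not_less[symmetric])
  then have "finite {w. f w \<noteq> \<zero>\<^bsub>F\<^esub>}"
    using finite_lists_length_le[OF assms] finite_subset by blast
  then show ?L using R by (auto simp: free_alg_def)
qed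

text \<open>Zero gets degree 0. There are no constant terms, so each nonzero element has positive
  degree.\<close>

definition free_deg :: "('k, 'm) ring_scheme \<Rightarrow> ('x list \<Rightarrow> 'k) \<Rightarrow> nat" where
  "free_deg F f = (LEAST k. \<forall>w. k < length w \<longrightarrow> f w = \<zero>\<^bsub>F\<^esub>)"

section \<open>The free algebra as a domain with a degree\<close>

locale free_algebra = field F for F :: "('k, 'm) ring_scheme" (structure) +
  fixes Z :: "'x set"
  assumes finite_Z: "finite Z"
begin

abbreviation "FA \<equiv> free_alg F Z"
abbreviation "FC \<equiv> carrier FA"

lemmas FC_iff = free_alg_carrier_iff[OF finite_Z]

lemma FC_closed [simp]: "f \<in> FC \<Longrightarrow> f w \<in> carrier F"
  by (simp only: FC_iff)

lemma FC_Nil [simp]: "f \<in> FC \<Longrightarrow> f [] = \<zero>"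
  by (simp only: FC_iff)

lemma FC_set: "f \<in> FC \<Longrightarrow> f w \<noteq> \<zero> \<Longrightarrow> set w \<subseteq> Z"
  using FC_iff by blast

lemma FC_I:
  assumes "coeffs f" "f [] = \<zero>" "\<And>w. f w \<noteq> \<zero> \<Longrightarrow> set w \<subseteq> Z" "\<And>w. k < length w \<Longrightarrow> f w = \<zero>"
  shows "f \<in> FC"
  unfolding FC_iff using assms by blast

lemma free_degD: "f \<in> FC \<Longrightarrow> free_deg F f < length w \<Longrightarrow> f w = \<zero>"
proof -
  assume "f \<in> FC"
  then have "\<exists>k. \<forall>w. k < length w \<longrightarrow> f w = \<zero>" by (simp only: FC_iff)
  from LeastI_ex[OF this] show "free_deg F f < length w \<Longrightarrow> f w = \<zero>"
    unfolding free_deg_def by blast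
qed

lemma free_deg_le: "(\<And>w. k < length w \<Longrightarrow> f w = \<zero>) \<Longrightarrow> free_deg F f \<le> k"
  unfolding free_deg_def by (intro Least_le) auto

lemma free_deg_top:
  assumes "f \<in> FC" "f \<noteq> (\<lambda>_. \<zero>)"
  obtains w where "length w = free_deg F f" "f w \<noteq> \<zero>"
proof -
  have "\<exists>w. length w = free_deg F f \<and> f w \<noteq> \<zero>"
  proof (rule ccontr)
    assume *: "\<not> ?thesis"
    show False
    proof (cases "free_deg F f")
      case 0
      then have "f w = \<zero>" for w using free_degD[OF assms(1), of w] FC_Nil[OF assms(1)] by (cases w) auto
      then show False using assms(2) by auto
    next
      case (Suc k)
      have "free_deg F f \<le> k"
        using * free_degD[OF assms(1)] Suc by (intro free_deg_le) (metis Suc_lessI)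
      then show False using Suc by simp
    qed
  qed
  then show thesis using that by blast
qed

lemma free_deg_pos: "f \<in> FC \<Longrightarrow> f \<noteq> (\<lambda>_. \<zero>) \<Longrightarrow> 0 < free_deg F f"
  by (metis FC_Nil free_deg_top length_0_conv neq0_conv)

lemma FA_zero [simp]: "(\<lambda>_. \<zero>) \<in> FC"
  by (subst FC_iff) simp

lemma FA_add [simp]: "f \<in> FC \<Longrightarrow> g \<in> FC \<Longrightarrow> (\<lambda>w. f w \<oplus> g w) \<in> FC"
proof -
  assume a: "f \<in> FC" "g \<in> FC"
  have "f w \<oplus> g w = \<zero>" if "max (free_deg F f) (free_deg F g) < length w" for w
    using that a free_degD[of f w] free_degD[of g w] by simp
  moreover have "set w \<subseteq> Z" if "f w \<oplus> g w \<noteq> \<zero>" for w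
    using FC_set[OF a(1)] FC_set[OF a(2)] that by (metis zero_closed l_zero)
  ultimately show ?thesis using a by (intro FC_I[where k = "max (free_deg F f) (free_deg F g)"]) (auto)
qed

lemma FA_smult [simp]: "a \<in> carrier F \<Longrightarrow> f \<in> FC \<Longrightarrow> (\<lambda>w. a \<otimes> f w) \<in> FC"
proof -
  assume a: "a \<in> carrier F" "f \<in> FC"
  have "a \<otimes> f w = \<zero>" if "free_deg F f < length w" for w
    using that a free_degD[of f w] by simp
  moreover have "set w \<subseteq> Z" if "a \<otimes> f w \<noteq> \<zero>" for w
    using FC_set[OF a(2)] that a(1) by (metis r_null)
  ultimately show ?thesis using a by (intro FC_I[where k = "free_deg F f"]) (auto)
qed

lemma conv_set:
  assumes "coeffs f" "coeffs g" "\<And>w. f w \<noteq> \<zero> \<Longrightarrow> set w \<subseteq> Z" "\<And>w. g w \<noteq> \<zero> \<Longrightarrow> set w \<subseteq> Z"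
    and "conv F f g w \<noteq> \<zero>"
  shows "set w \<subseteq> Z"
  using assms
proof (induction w arbitrary: f)
  case (Cons x w)
  show ?case
  proof (cases "f [] \<otimes> g (x # w) = \<zero>")
    case True
    then have "conv F (\<lambda>v. f (x # v)) g w \<noteq> \<zero>" using Cons.prems by (auto simp: conv_Cons)
    moreover from this obtain v where "f (x # v) \<noteq> \<zero>"
      using conv_zero_left[of g w] Cons.prems(2) ext[of "\<lambda>v. f (x # v)" "\<lambda>_. \<zero>"] by fastforce
    moreover have "set v \<subseteq> Z" if "f (x # v) \<noteq> \<zero>" for v using Cons.prems(3)[OF that] by simp
    ultimately show ?thesis using Cons.IH[of "\<lambda>v. f (x # v)"] Cons.prems(1,2,4) Cons.prems(3)[of "x # v"] by auto
  next
    case False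
    then have "g (x # w) \<noteq> \<zero>" using Cons.prems by auto
    then show ?thesis using Cons.prems by blast
  qed
qed simp

lemma FA_mult [simp]: "f \<in> FC \<Longrightarrow> g \<in> FC \<Longrightarrow> conv F f g \<in> FC"
proof -
  assume a: "f \<in> FC" "g \<in> FC"
  have "conv F f g w = \<zero>" if "free_deg F f + free_deg F g < length w" for w
    using that a free_degD[OF a(1)] free_degD[OF a(2)]
    by (intro conv_eq_0[where k = "free_deg F f" and m = "free_deg F g"]) auto
  moreover have "set w \<subseteq> Z" if "conv F f g w \<noteq> \<zero>" for w
    by (rule conv_set[of f g]) (use a that FC_closed FC_set in blast)+
  ultimately show ?thesis using a by (intro FC_I[where k = "free_deg F f + free_deg F g"]) (auto)
qed

lemma FA_rng: "rng FA"
proof (rule rng.intro)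
  show "abelian_group FA"
  proof (rule abelian_groupI)
    show "\<exists>y\<in>FC. y \<oplus>\<^bsub>FA\<^esub> x = \<zero>\<^bsub>FA\<^esub>" if "x \<in> FC" for x
      by (rule bexI[of _ "\<lambda>w. \<ominus> \<one> \<otimes> x w"])
        (use that FA_smult[of "\<ominus> \<one>" x] in \<open>auto simp: fun_eq_iff l_minus l_neg\<close>)
  qed (auto simp: fun_eq_iff a_ac)
qed (unfold_locales, auto simp: fun_eq_iff conv_assoc conv_add_left conv_add_right)

sublocale FA: rng FA by (rule FA_rng)

lemma conv_top_FC:
  assumes "f \<in> FC" "g \<in> FC" "length u = free_deg F f" "length v = free_deg F g"
  shows "conv F f g (u @ v) = f u \<otimes> g v"
  using assms free_degD[OF assms(1)] free_degD[OF assms(2)] by (intro conv_top) auto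

text \<open>The concatenation of two top words carries the product of the top coefficients, which is
  nonzero in a field.\<close>

lemma conv_nonzero:
  assumes "f \<in> FC" "g \<in> FC" "f \<noteq> (\<lambda>_. \<zero>)" "g \<noteq> (\<lambda>_. \<zero>)"
  shows "conv F f g \<noteq> (\<lambda>_. \<zero>)" "free_deg F (conv F f g) = free_deg F f + free_deg F g"
proof -
  obtain u v where uv: "length u = free_deg F f" "f u \<noteq> \<zero>" "length v = free_deg F g" "g v \<noteq> \<zero>"
    using assms free_deg_top by metis
  then have *: "conv F f g (u @ v) \<noteq> \<zero>" using assms conv_top_FC[of f g u v] integral[of "f u" "g v"] by auto
  then show "conv F f g \<noteq> (\<lambda>_. \<zero>)" by auto
  have "\<not> free_deg F (conv F f g) < length (u @ v)"
    using * free_degD[of "conv F f g" "u @ v"] assms by auto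
  moreover have "free_deg F (conv F f g) \<le> free_deg F f + free_deg F g"
    using assms(1,2) free_degD[OF assms(1)] free_degD[OF assms(2)]
    by (intro free_deg_le conv_eq_0[where k = "free_deg F f" and m = "free_deg F g"]) auto
  ultimately show "free_deg F (conv F f g) = free_deg F f + free_deg F g" using uv by simp
qed

lemma FA_domain: "f \<in> FC \<Longrightarrow> g \<in> FC \<Longrightarrow> conv F f g = (\<lambda>_. \<zero>) \<Longrightarrow> f = (\<lambda>_. \<zero>) \<or> g = (\<lambda>_. \<zero>)"
  using conv_nonzero(1) by blast

lemma letter_FC [simp]: "x \<in> Z \<Longrightarrow> letter F x \<in> FC"
proof -
  assume "x \<in> Z"
  then show ?thesis by (intro FC_I[where k = 1]) (auto simp: letter_def split: if_splits)
qed

lemma letter_nonzero [simp]: "letter F x \<noteq> (\<lambda>_. \<zero>)"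
  by (auto simp: letter_def fun_eq_iff)

lemma deg_letter [simp]: "x \<in> Z \<Longrightarrow> free_deg F (letter F x) = 1"
proof -
  assume x: "x \<in> Z"
  have "free_deg F (letter F x) \<le> 1" by (intro free_deg_le) (auto simp: letter_def)
  moreover have "0 < free_deg F (letter F x)" using x by (intro free_deg_pos) auto
  ultimately show ?thesis by simp
qed

text \<open>The component \<open>f\<^sub>x\<close> in the decomposition of \<open>f\<close> into a linear combination of letters plus
  the sum of the products \<open>x f\<^sub>x\<close>.\<close>

definition child :: "'x \<Rightarrow> ('x list \<Rightarrow> 'k) \<Rightarrow> 'x list \<Rightarrow> 'k" where
  "child x f w = (if w = [] then \<zero> else f (x # w))"

lemma child_FC [simp]: "f \<in> FC \<Longrightarrow> child x f \<in> FC"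
proof -
  assume a: "f \<in> FC"
  have "child x f w = \<zero>" if "free_deg F f < length w" for w
    using that free_degD[OF a, of "x # w"] by (auto simp: child_def)
  moreover have "set w \<subseteq> Z" if "child x f w \<noteq> \<zero>" for w
    using FC_set[OF a, of "x # w"] that by (auto simp: child_def split: if_splits)
  ultimately show ?thesis using a by (intro FC_I[where k = "free_deg F f"]) (auto simp: child_def)
qed

lemma free_deg_child: "f \<in> FC \<Longrightarrow> free_deg F (child x f) \<le> free_deg F f - 1"
  using free_degD[of f] by (intro free_deg_le) (auto simp: child_def)

end

section \<open>First-order axioms of free algebras\<close>

text \<open>In a free algebra with letter \<open>x\<close> this says that \<open>l\<close> is a scalar multiple of \<open>x\<close>; in
  general it says that \<open>l\<close> is the image of \<open>x\<close> under an element of the centroid.\<close>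

definition scalar_rel :: "('a, 'm) ring_scheme \<Rightarrow> 'a \<Rightarrow> 'a \<Rightarrow> bool" where
  "scalar_rel R x l \<longleftrightarrow> (\<forall>z\<in>carrier R. \<exists>w\<in>carrier R. z \<otimes>\<^bsub>R\<^esub> l = w \<otimes>\<^bsub>R\<^esub> x \<and>
     (\<forall>z'\<in>carrier R. z \<otimes>\<^bsub>R\<^esub> (z' \<otimes>\<^bsub>R\<^esub> l) = w \<otimes>\<^bsub>R\<^esub> (z' \<otimes>\<^bsub>R\<^esub> x)))"

text \<open>The pair \<open>(c, p)\<close> codes the finite set of those \<open>m\<close> for which \<open>c\<close> is congruent to
  \<open>y m\<close> modulo the right ideal generated by \<open>x - a\<close>, for some scalar \<open>a\<close> such that this right
  ideal contains \<open>p\<close>. Multiplying everything by \<open>x\<close> from the right replaces \<open>a\<close> by the element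
  \<open>l = a x\<close> of the algebra.\<close>

definition coded :: "('a, 'm) ring_scheme \<Rightarrow> 'a \<Rightarrow> 'a \<Rightarrow> 'a \<Rightarrow> 'a \<Rightarrow> 'a \<Rightarrow> bool" where
  "coded R x y c p m \<longleftrightarrow> (\<exists>l\<in>carrier R. \<exists>q\<in>carrier R. \<exists>s\<in>carrier R. scalar_rel R x l \<and>
     p \<otimes>\<^bsub>R\<^esub> x \<oplus>\<^bsub>R\<^esub> q \<otimes>\<^bsub>R\<^esub> l = x \<otimes>\<^bsub>R\<^esub> (q \<otimes>\<^bsub>R\<^esub> x) \<and>
     c \<otimes>\<^bsub>R\<^esub> x \<oplus>\<^bsub>R\<^esub> s \<otimes>\<^bsub>R\<^esub> l = y \<otimes>\<^bsub>R\<^esub> (m \<otimes>\<^bsub>R\<^esub> x) \<oplus>\<^bsub>R\<^esub> x \<otimes>\<^bsub>R\<^esub> (s \<otimes>\<^bsub>R\<^esub> x))"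

text \<open>Peels off the letters from the last to the first. \<open>Q\<close> constrains the
  cofactors of the letters, which are the children in the tree.\<close>

primrec decomp :: "('a, 'm) ring_scheme \<Rightarrow> (nat \<Rightarrow> 'a) \<Rightarrow> nat \<Rightarrow> ('a \<Rightarrow> bool) \<Rightarrow> 'a \<Rightarrow> bool" where
  "decomp R x 0 Q s \<longleftrightarrow> s = \<zero>\<^bsub>R\<^esub>"
| "decomp R x (Suc n) Q s \<longleftrightarrow> (\<exists>t\<in>carrier R. \<exists>a\<in>carrier R. \<exists>r\<in>carrier R.
     scalar_rel R (x n) t \<and> Q a \<and> s = t \<oplus>\<^bsub>R\<^esub> (x n \<otimes>\<^bsub>R\<^esub> a \<oplus>\<^bsub>R\<^esub> r) \<and> decomp R x n Q r)"

text \<open>A zero child ends its branch and needs no tag. The element \<open>x v + y a\<close>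
  serves as the ordered pair of tag and node; in a free algebra its components can be
  recovered.\<close>

definition child_ok :: "('a, 'm) ring_scheme \<Rightarrow> 'a \<Rightarrow> 'a \<Rightarrow> 'a \<Rightarrow> 'a \<Rightarrow> 'a \<Rightarrow> 'a \<Rightarrow> 'a \<Rightarrow> bool" where
  "child_ok R b x y c p w a \<longleftrightarrow> a = \<zero>\<^bsub>R\<^esub> \<or> (\<exists>v\<in>carrier R. w = b \<otimes>\<^bsub>R\<^esub> v \<and>
     coded R x y c p (x \<otimes>\<^bsub>R\<^esub> v \<oplus>\<^bsub>R\<^esub> y \<otimes>\<^bsub>R\<^esub> a))"

text \<open>The absence of a left identity is the statement that an endlessly divisible tag will
  contradict.\<close>

definition ax_domain :: "('a, 'm) ring_scheme \<Rightarrow> bool" where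
  "ax_domain R \<longleftrightarrow>
     (\<forall>a\<in>carrier R. \<forall>c\<in>carrier R. a \<otimes>\<^bsub>R\<^esub> c = \<zero>\<^bsub>R\<^esub> \<longrightarrow> a = \<zero>\<^bsub>R\<^esub> \<or> c = \<zero>\<^bsub>R\<^esub>) \<and>
     \<not> (\<exists>u\<in>carrier R. \<forall>y\<in>carrier R. u \<otimes>\<^bsub>R\<^esub> y = y)"

text \<open>For \<open>l = \<alpha> x\<close> the witness is the multiple of \<open>x\<close> by the
  inverse of \<alpha>. This makes the centroid a field.\<close>

definition ax_inverse :: "('a, 'm) ring_scheme \<Rightarrow> 'a \<Rightarrow> bool" where
  "ax_inverse R x \<longleftrightarrow> (\<forall>l\<in>carrier R. scalar_rel R x l \<and> l \<noteq> \<zero>\<^bsub>R\<^esub> \<longrightarrow>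
     (\<exists>m\<in>carrier R. scalar_rel R x m \<and> l \<otimes>\<^bsub>R\<^esub> m = x \<otimes>\<^bsub>R\<^esub> x))"

text \<open>Independence of the letters in triangular form: in a vanishing combination of the
  letters up to \<open>k\<close> the part of the letter \<open>k\<close> vanishes, and induction on
  \<open>k\<close> clears the rest.\<close>

definition ax_unique :: "('a, 'm) ring_scheme \<Rightarrow> (nat \<Rightarrow> 'a) \<Rightarrow> nat \<Rightarrow> bool" where
  "ax_unique R x k \<longleftrightarrow> x k \<noteq> \<zero>\<^bsub>R\<^esub> \<and>
     (\<forall>t\<in>carrier R. \<forall>a\<in>carrier R. \<forall>s\<in>carrier R. scalar_rel R (x k) t \<and>
       decomp R x k (\<lambda>_. True) s \<and> t \<oplus>\<^bsub>R\<^esub> (x k \<otimes>\<^bsub>R\<^esub> a \<oplus>\<^bsub>R\<^esub> s) = \<zero>\<^bsub>R\<^esub> \<longrightarrow> t = \<zero>\<^bsub>R\<^esub> \<and> a = \<zero>\<^bsub>R\<^esub>)"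

text \<open>Iterated decomposition turns \<open>a\<close> into a tree. Its finiteness is not a first-order
  property, but it can be reduced to one descending chain: a coded set contains \<open>a\<close> and all its
  iterated children, each tagged by an element \<open>w\<close> of the centralizer of \<open>b\<close>, and going to a
  child divides the tag by \<open>b\<close>. If that centralizer is Noetherian, then no tag can be divided by
  \<open>b\<close> forever.\<close>

definition ax_depth :: "('a, 'm) ring_scheme \<Rightarrow> nat \<Rightarrow> 'a \<Rightarrow> (nat \<Rightarrow> 'a) \<Rightarrow> bool" where
  "ax_depth R n b x \<longleftrightarrow> (\<forall>a\<in>carrier R. \<exists>c\<in>carrier R. \<exists>p\<in>carrier R. \<exists>w\<in>carrier R.
     coded R (x 0) (x 1) c p (x 0 \<otimes>\<^bsub>R\<^esub> w \<oplus>\<^bsub>R\<^esub> x 1 \<otimes>\<^bsub>R\<^esub> a) \<and>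
     (\<forall>w\<in>carrier R. \<forall>s\<in>carrier R. coded R (x 0) (x 1) c p (x 0 \<otimes>\<^bsub>R\<^esub> w \<oplus>\<^bsub>R\<^esub> x 1 \<otimes>\<^bsub>R\<^esub> s) \<longrightarrow>
        w \<noteq> \<zero>\<^bsub>R\<^esub> \<and> w \<otimes>\<^bsub>R\<^esub> b = b \<otimes>\<^bsub>R\<^esub> w \<and> decomp R x n (\<lambda>a. child_ok R b (x 0) (x 1) c p w a) s))"

text \<open>Finite sets cannot be quantified over, but all of them arise from the empty set by
  adjoining elements, an induction carried out outside the formula. A nonzero \<open>p\<close> keeps
  the coded set finite. The axiom also passes on what the infinity of the field was needed
  for.\<close>

definition ax_sets :: "('a, 'm) ring_scheme \<Rightarrow> 'a \<Rightarrow> 'a \<Rightarrow> bool" where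
  "ax_sets R x y \<longleftrightarrow>
     (\<exists>c\<in>carrier R. \<exists>p\<in>carrier R. p \<noteq> \<zero>\<^bsub>R\<^esub> \<and> (\<forall>m\<in>carrier R. \<not> coded R x y c p m)) \<and>
     (\<forall>c\<in>carrier R. \<forall>p\<in>carrier R. \<forall>m\<in>carrier R. p \<noteq> \<zero>\<^bsub>R\<^esub> \<longrightarrow>
        (\<exists>c'\<in>carrier R. \<exists>p'\<in>carrier R. p' \<noteq> \<zero>\<^bsub>R\<^esub> \<and>
           (\<forall>m'\<in>carrier R. coded R x y c' p' m' \<longleftrightarrow> coded R x y c p m' \<or> m' = m)))"

definition free_axioms :: "('a, 'm) ring_scheme \<Rightarrow> nat \<Rightarrow> 'a \<Rightarrow> (nat \<Rightarrow> 'a) \<Rightarrow> bool" where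
  "free_axioms R n b x \<longleftrightarrow> ax_domain R \<and> ax_inverse R (x 0) \<and> (\<forall>k<n. ax_unique R x k) \<and>
     ax_depth R n b x \<and> ax_sets R (x 0) (x 1)"

context ring_pair
begin

lemma dfb_true: "dfb (\<lambda>_. True) (\<lambda>_. True)"
  using dfb_eq[OF T_zero T_zero] by simp

lemma dfb_bounded_all:
  "(\<And>k. k < n \<Longrightarrow> dfb (P k) (Q k)) \<Longrightarrow> dfb (\<lambda>e. \<forall>k<n. P k e) (\<lambda>e. \<forall>k<(n::nat). Q k e)"
proof (induction n)
  case 0
  then show ?case using dfb_true by simp
next
  case (Suc n)
  have "dfb (\<lambda>e. P n e \<and> (\<forall>k<n. P k e)) (\<lambda>e. Q n e \<and> (\<forall>k<n. Q k e))"
    using Suc by (intro dfb_conj) auto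
  then show ?case by (simp add: All_less_Suc)
qed

lemma dfb_scalar_rel:
  "term_pair R S t t' \<Longrightarrow> term_pair R S u u' \<Longrightarrow>
    dfb (\<lambda>e. scalar_rel R (t e) (u e)) (\<lambda>e. scalar_rel S (t' e) (u' e))"
  by (rule dfb_sub2) (unfold scalar_rel_def, (rule dfb_simps)+)

lemma dfb_coded:
  "term_pair R S t t' \<Longrightarrow> term_pair R S u u' \<Longrightarrow> term_pair R S v v' \<Longrightarrow> term_pair R S w w' \<Longrightarrow>
    term_pair R S y y' \<Longrightarrow>
    dfb (\<lambda>e. coded R (t e) (u e) (v e) (w e) (y e)) (\<lambda>e. coded S (t' e) (u' e) (v' e) (w' e) (y' e))"
  by (rule dfb_sub5) (unfold coded_def, (rule dfb_scalar_rel dfb_simps)+)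

text \<open>The number of letters is not a variable of the language, so the formula is unrolled by
  induction on \<open>n\<close>. Each round adds three quantifiers, hence the three successors and
  the arbitrary \<open>f\<close> and \<open>k\<close>.\<close>

lemma dfb_decomp:
  assumes "dfb (\<lambda>e. Q (e 0) (\<lambda>i. e (Suc i))) (\<lambda>e. Q' (e 0) (\<lambda>i. e (Suc i)))"
  shows "dfb (\<lambda>e. decomp R (\<lambda>i. e (f i)) n (\<lambda>a. Q a e) (e k)) (\<lambda>e. decomp S (\<lambda>i. e (f i)) n (\<lambda>a. Q' a e) (e k))"
  using assms
proof (induction n arbitrary: f k Q Q')
  case 0
  show ?case unfolding decomp.simps by (rule dfb_simps)+
next
  case (Suc n)
  let ?s = "\<lambda>j k i e. if i = 0 then e j else e (i + k)"
  have s: "term_pair R S (\<lambda>e. ?s j k i e) (\<lambda>e. ?s j k i e)" for i j k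
    using T_var by (cases "i = 0") auto
  have 1: "dfb (\<lambda>e. Q (e (Suc 0)) (\<lambda>i. e (Suc (Suc (Suc i)))))
      (\<lambda>e. Q' (e (Suc 0)) (\<lambda>i. e (Suc (Suc (Suc i)))))"
    using dfb_sub[OF Suc.prems, where \<sigma> = "\<lambda>i e. ?s 1 2 i e" and \<tau> = "\<lambda>i e. ?s 1 2 i e", OF s] by simp
  have 2: "dfb (\<lambda>e. Q (e 0) (\<lambda>i. e (Suc (Suc (Suc (Suc i))))))
      (\<lambda>e. Q' (e 0) (\<lambda>i. e (Suc (Suc (Suc (Suc i))))))"
    using dfb_sub[OF Suc.prems, where \<sigma> = "\<lambda>i e. ?s 0 3 i e" and \<tau> = "\<lambda>i e. ?s 0 3 i e", OF s]
    by (simp add: eval_nat_numeral)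
  have 3: "dfb (\<lambda>e. decomp R (\<lambda>i. e (Suc (Suc (Suc (f i))))) n (\<lambda>a. Q a (\<lambda>i. e (Suc (Suc (Suc i))))) (e 0))
      (\<lambda>e. decomp S (\<lambda>i. e (Suc (Suc (Suc (f i))))) n (\<lambda>a. Q' a (\<lambda>i. e (Suc (Suc (Suc i))))) (e 0))"
    by (rule Suc.IH[where Q = "\<lambda>a e. Q a (\<lambda>i. e (Suc (Suc (Suc i))))"
        and Q' = "\<lambda>a e. Q' a (\<lambda>i. e (Suc (Suc (Suc i))))" and f = "\<lambda>i. Suc (Suc (Suc (f i)))"])
      (rule 2)
  show ?case unfolding decomp.simps
    by (rule dfb_ex dfb_conj dfb_scalar_rel T_var 1 3 dfb_eq T_add T_mul)+
qed

lemma dfb_child_ok: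
  "dfb (\<lambda>e. child_ok R (e i1) (e i2) (e i3) (e i4) (e i5) (e i6) (e i7))
    (\<lambda>e. child_ok S (e i1) (e i2) (e i3) (e i4) (e i5) (e i6) (e i7))"
  unfolding child_ok_def by (rule dfb_coded dfb_simps)+

lemma dfb_free_axioms:
  "dfb (\<lambda>e. free_axioms R n (e k) (\<lambda>i. e (f i))) (\<lambda>e. free_axioms S n (e k) (\<lambda>i. e (f i)))"
proof -
  have 1: "dfb (\<lambda>e. ax_domain R) (\<lambda>e. ax_domain S)"
    unfolding ax_domain_def by (rule dfb_simps)+
  have 2: "dfb (\<lambda>e. ax_inverse R (e i)) (\<lambda>e. ax_inverse S (e i))" for i
    unfolding ax_inverse_def by (rule dfb_scalar_rel dfb_simps)+
  have 3: "dfb (\<lambda>e. ax_unique R (\<lambda>i. e (f i)) j) (\<lambda>e. ax_unique S (\<lambda>i. e (f i)) j)" for j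
    unfolding ax_unique_def
    by (rule dfb_scalar_rel dfb_simps dfb_decomp[where f = "\<lambda>i. Suc (Suc (Suc (f i)))"
          and Q = "\<lambda>_ _. True" and Q' = "\<lambda>_ _. True"] dfb_true)+
  \<comment> \<open>The quantifiers in scope, innermost first, bind \<open>s\<close>, the inner
    \<open>w\<close>, the outer \<open>w\<close>, \<open>p\<close>, \<open>c\<close> and
    \<open>a\<close>. Inside \<open>Q\<close> this puts the inner \<open>w\<close> at index 1,
    \<open>p\<close> at 3, \<open>c\<close> at 4, and shifts the parameters by six.\<close>
  have 4: "dfb (\<lambda>e. ax_depth R n (e k) (\<lambda>i. e (f i))) (\<lambda>e. ax_depth S n (e k) (\<lambda>i. e (f i)))"
    unfolding ax_depth_def
    by (rule dfb_coded dfb_simps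
        dfb_decomp[where f = "\<lambda>i. Suc (Suc (Suc (Suc (Suc (Suc (f i))))))"
         and Q = "\<lambda>a e. child_ok R (e (Suc (Suc (Suc (Suc (Suc (Suc k)))))))
            (e (Suc (Suc (Suc (Suc (Suc (Suc (f 0)))))))) (e (Suc (Suc (Suc (Suc (Suc (Suc (f 1))))))))
            (e (Suc (Suc (Suc (Suc 0))))) (e (Suc (Suc (Suc 0)))) (e (Suc 0)) a"
         and Q' = "\<lambda>a e. child_ok S (e (Suc (Suc (Suc (Suc (Suc (Suc k)))))))
            (e (Suc (Suc (Suc (Suc (Suc (Suc (f 0)))))))) (e (Suc (Suc (Suc (Suc (Suc (Suc (f 1))))))))
            (e (Suc (Suc (Suc (Suc 0))))) (e (Suc (Suc (Suc 0)))) (e (Suc 0)) a"]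
        dfb_child_ok)+
  have 5: "dfb (\<lambda>e. ax_sets R (e i) (e j)) (\<lambda>e. ax_sets S (e i) (e j))" for i j
    unfolding ax_sets_def by (rule dfb_coded dfb_simps)+
  show ?thesis unfolding free_axioms_def
    by (rule dfb_conj 1 2 dfb_bounded_all 3 4 5)+
qed

end

section \<open>Recognizing free algebras\<close>

context rng
begin

lemma zero_mult [simp]: "x \<in> carrier B \<Longrightarrow> \<zero> \<otimes> x = \<zero>"
proof -
  assume x: "x \<in> carrier B"
  have "\<zero> \<otimes> x \<oplus> \<zero> \<otimes> x = \<zero> \<otimes> x \<oplus> \<zero>" using l_distr[of \<zero> \<zero> x] x m_closed by simp
  then show ?thesis using x m_closed by (simp del: r_zero)
qed

lemma mult_zero [simp]: "x \<in> carrier B \<Longrightarrow> x \<otimes> \<zero> = \<zero>"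
proof -
  assume x: "x \<in> carrier B"
  have "x \<otimes> \<zero> \<oplus> x \<otimes> \<zero> = x \<otimes> \<zero> \<oplus> \<zero>" using r_distr[of \<zero> \<zero> x] x m_closed by simp
  then show ?thesis using x m_closed by (simp del: r_zero)
qed

end

text \<open>\<open>cf_mult\<close> is the expansion (\<alpha> x + x a) b = x (\<alpha> b + a b) at
  each letter x: a product has no linear part. \<open>depth_induct\<close> says that the tree of
  iterated children is finite, with zero as its end.\<close>

locale letter_decomposition = field F for F :: "('k, 'm) ring_scheme" (structure) +
  fixes A :: "('a, 'n) ring_scheme" and sm :: "'k \<Rightarrow> 'a \<Rightarrow> 'a" and n :: nat
    and cf :: "nat \<Rightarrow> 'a \<Rightarrow> 'k" and ch :: "nat \<Rightarrow> 'a \<Rightarrow> 'a"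
  assumes rng_A: "rng A"
    and sm_closed [simp]: "\<And>\<alpha> a. \<alpha> \<in> carrier F \<Longrightarrow> a \<in> carrier A \<Longrightarrow> sm \<alpha> a \<in> carrier A"
    and cf_closed [simp]: "\<And>i a. i < n \<Longrightarrow> a \<in> carrier A \<Longrightarrow> cf i a \<in> carrier F"
    and ch_closed [simp]: "\<And>i a. i < n \<Longrightarrow> a \<in> carrier A \<Longrightarrow> ch i a \<in> carrier A"
    and cf_add: "\<And>i a b. i < n \<Longrightarrow> a \<in> carrier A \<Longrightarrow> b \<in> carrier A \<Longrightarrow>
        cf i (a \<oplus>\<^bsub>A\<^esub> b) = cf i a \<oplus> cf i b \<and> ch i (a \<oplus>\<^bsub>A\<^esub> b) = ch i a \<oplus>\<^bsub>A\<^esub> ch i b"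
    and cf_mult: "\<And>i a b. i < n \<Longrightarrow> a \<in> carrier A \<Longrightarrow> b \<in> carrier A \<Longrightarrow>
        cf i (a \<otimes>\<^bsub>A\<^esub> b) = \<zero> \<and> ch i (a \<otimes>\<^bsub>A\<^esub> b) = sm (cf i a) b \<oplus>\<^bsub>A\<^esub> ch i a \<otimes>\<^bsub>A\<^esub> b"
    and cf_sm: "\<And>i \<alpha> a. i < n \<Longrightarrow> \<alpha> \<in> carrier F \<Longrightarrow> a \<in> carrier A \<Longrightarrow>
        cf i (sm \<alpha> a) = \<alpha> \<otimes> cf i a \<and> ch i (sm \<alpha> a) = sm \<alpha> (ch i a)"
    and parts_zero: "\<And>a. a \<in> carrier A \<Longrightarrow> (\<And>i. i < n \<Longrightarrow> cf i a = \<zero> \<and> ch i a = \<zero>\<^bsub>A\<^esub>) \<Longrightarrow> a = \<zero>\<^bsub>A\<^esub>"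
    and parts_ex: "\<And>\<alpha> c. (\<And>i. i < n \<Longrightarrow> \<alpha> i \<in> carrier F \<and> c i \<in> carrier A) \<Longrightarrow>
        \<exists>a\<in>carrier A. \<forall>i<n. cf i a = \<alpha> i \<and> ch i a = c i"
    and depth_induct: "\<And>P a. a \<in> carrier A \<Longrightarrow> P \<zero>\<^bsub>A\<^esub> \<Longrightarrow>
        (\<And>a. a \<in> carrier A \<Longrightarrow> (\<And>i. i < n \<Longrightarrow> P (ch i a)) \<Longrightarrow> P a) \<Longrightarrow> P a"
begin

sublocale A: rng A by (rule rng_A)

sublocale free_algebra F "{..<n}" by unfold_locales auto

primrec lt :: "nat list \<Rightarrow> 'a \<Rightarrow> 'k" where
  "lt [] a = \<zero>"
| "lt (i # w) a = (if i < n then if w = [] then cf i a else lt w (ch i a) else \<zero>)"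

lemma lt_closed [simp]: "a \<in> carrier A \<Longrightarrow> lt w a \<in> carrier F"
  by (induction w arbitrary: a) auto

lemma lt_add: "a \<in> carrier A \<Longrightarrow> b \<in> carrier A \<Longrightarrow> lt w (a \<oplus>\<^bsub>A\<^esub> b) = lt w a \<oplus> lt w b"
  by (induction w arbitrary: a b) (auto simp: cf_add)

lemma lt_sm: "\<alpha> \<in> carrier F \<Longrightarrow> a \<in> carrier A \<Longrightarrow> lt w (sm \<alpha> a) = \<alpha> \<otimes> lt w a"
  by (induction w arbitrary: a) (auto simp: cf_sm)

lemma conv_scalar:
  assumes "\<alpha> \<in> carrier F" "coeffs g"
  shows "conv F (\<lambda>v. if v = [] then \<alpha> else \<zero>) g w = \<alpha> \<otimes> g w"
  using assms by (cases w) (simp_all add: conv_Cons)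

lemma lt_mult:
  "a \<in> carrier A \<Longrightarrow> b \<in> carrier A \<Longrightarrow> lt w (a \<otimes>\<^bsub>A\<^esub> b) = conv F (\<lambda>w. lt w a) (\<lambda>w. lt w b) w"
proof (induction w arbitrary: a)
  case Nil
  then show ?case by simp
next
  case (Cons i w)
  show ?case
  proof (cases "i < n")
    case True
    \<comment> \<open>The derivative at the letter \<open>i\<close> consists of the coefficient,
      placed at the empty word, and the child.\<close>
    have eq: "(\<lambda>v. lt (i # v) a) = (\<lambda>v. (if v = [] then cf i a else \<zero>) \<oplus> lt v (ch i a))"
      using True Cons.prems by (auto simp: fun_eq_iff)
    have "conv F (\<lambda>w. lt w a) (\<lambda>w. lt w b) (i # w) = conv F (\<lambda>v. lt (i # v) a) (\<lambda>w. lt w b) w"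
      using Cons.prems by (simp add: conv_Cons del: lt.simps(2))
    also have "\<dots> = cf i a \<otimes> lt w b \<oplus> lt w (ch i a \<otimes>\<^bsub>A\<^esub> b)"
      unfolding eq using Cons True by (subst conv_add_left) (auto simp: conv_scalar)
    also have "\<dots> = lt (i # w) (a \<otimes>\<^bsub>A\<^esub> b)"
      using Cons.prems True by (auto simp: cf_mult lt_add lt_sm A.m_closed)
    finally show ?thesis by simp
  next
    case False
    then have eq: "(\<lambda>v. lt (i # v) a) = (\<lambda>v. \<zero>)" by (auto simp: fun_eq_iff)
    have "conv F (\<lambda>w. lt w a) (\<lambda>w. lt w b) (i # w) = conv F (\<lambda>v. lt (i # v) a) (\<lambda>w. lt w b) w"
      using Cons.prems by (simp add: conv_Cons del: lt.simps(2))
    then show ?thesis unfolding eq using Cons.prems False by simp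
  qed
qed

lemma lt_zero [simp]: "lt w \<zero>\<^bsub>A\<^esub> = \<zero>"
proof -
  have "lt w (\<zero>\<^bsub>A\<^esub> \<oplus>\<^bsub>A\<^esub> \<zero>\<^bsub>A\<^esub>) = lt w \<zero>\<^bsub>A\<^esub> \<oplus> lt w \<zero>\<^bsub>A\<^esub>" by (rule lt_add) auto
  then show ?thesis by simp
qed

text \<open>An element of infinite depth could vanish at every word without being zero;
  \<open>depth_induct\<close> excludes this by reducing to the children.\<close>

lemma lt_eq_0_imp:
  assumes "a \<in> carrier A" "\<And>w. lt w a = \<zero>" shows "a = \<zero>\<^bsub>A\<^esub>"
proof -
  have "(\<forall>w. lt w a = \<zero>) \<longrightarrow> a = \<zero>\<^bsub>A\<^esub>"
  proof (rule depth_induct[where P = "\<lambda>a. (\<forall>w. lt w a = \<zero>) \<longrightarrow> a = \<zero>\<^bsub>A\<^esub>", OF assms(1)])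
    fix a assume a: "a \<in> carrier A" "\<And>i. i < n \<Longrightarrow> (\<forall>w. lt w (ch i a) = \<zero>) \<longrightarrow> ch i a = \<zero>\<^bsub>A\<^esub>"
    show "(\<forall>w. lt w a = \<zero>) \<longrightarrow> a = \<zero>\<^bsub>A\<^esub>"
    proof
      assume z: "\<forall>w. lt w a = \<zero>"
      show "a = \<zero>\<^bsub>A\<^esub>"
      proof (rule parts_zero[OF a(1)])
        fix i assume i: "i < n"
        have "lt w (ch i a) = \<zero>" for w using z[rule_format, of "i # w"] i by (cases w) auto
        then show "cf i a = \<zero> \<and> ch i a = \<zero>\<^bsub>A\<^esub>" using a(2)[OF i] z[rule_format, of "[i]"] i by auto
      qed
    qed
  qed auto
  then show ?thesis using assms(2) by blast
qed

lemma lt_bounded: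
  assumes "a \<in> carrier A" shows "\<exists>k. \<forall>w. k < length w \<longrightarrow> lt w a = \<zero>"
proof (rule depth_induct[where P = "\<lambda>a. \<exists>k. \<forall>w. k < length w \<longrightarrow> lt w a = \<zero>", OF assms])
  fix a assume a: "a \<in> carrier A" "\<And>i. i < n \<Longrightarrow> \<exists>k. \<forall>w. k < length w \<longrightarrow> lt w (ch i a) = \<zero>"
  define k where "k i = (SOME k. \<forall>w. k < length w \<longrightarrow> lt w (ch i a) = \<zero>)" for i
  have k: "lt w (ch i a) = \<zero>" if "i < n" "k i < length w" for i w
    using someI_ex[OF a(2)[OF that(1)]] that(2) unfolding k_def by blast
  \<comment> \<open>The sum of the bounds for the children is a common bound for all of them; one
    more for the first letter.\<close>
  have "lt w a = \<zero>" if "Suc (sum k {..<n}) < length w" for w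
  proof (cases w)
    case (Cons i v)
    have "k i \<le> sum k {..<n}" if "i < n" using that by (intro member_le_sum) auto
    then show ?thesis using that k[of i v] Cons by auto
  qed simp
  then show "\<exists>k. \<forall>w. k < length w \<longrightarrow> lt w a = \<zero>" by blast
qed auto

lemma lt_FC: "a \<in> carrier A \<Longrightarrow> (\<lambda>w. lt w a) \<in> FC"
proof -
  assume a: "a \<in> carrier A"
  have "lt w a \<noteq> \<zero> \<Longrightarrow> set w \<subseteq> {..<n}" for w
    using a by (induction w arbitrary: a) (auto split: if_splits)
  moreover obtain k where "\<And>w. k < length w \<Longrightarrow> lt w a = \<zero>" using lt_bounded[OF a] by blast
  ultimately show ?thesis using a by (intro FC_I[where k = k]) auto
qed

lemma lt_surj: "f \<in> FC \<Longrightarrow> free_deg F f \<le> k \<Longrightarrow> \<exists>a\<in>carrier A. (\<lambda>w. lt w a) = f"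
proof (induction k arbitrary: f)
  case 0
  then have "f = (\<lambda>_. \<zero>)" using free_deg_pos by fastforce
  then show ?case by (intro bexI[of _ "\<zero>\<^bsub>A\<^esub>"]) auto
next
  case (Suc k)
  have "\<exists>a\<in>carrier A. (\<lambda>w. lt w a) = child i f" for i
    using Suc.prems free_deg_child[OF Suc.prems(1), of i] by (intro Suc.IH) auto
  then obtain c where c: "\<And>i. c i \<in> carrier A" "\<And>i. (\<lambda>w. lt w (c i)) = child i f" by metis
  obtain a where a: "a \<in> carrier A" "\<And>i. i < n \<Longrightarrow> cf i a = f [i] \<and> ch i a = c i"
    using parts_ex[of "\<lambda>i. f [i]" c] c Suc.prems by auto
  have "lt w a = f w" for w
  proof (cases w)
    case Nil
    then show ?thesis using Suc.prems by simp
  next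
    case (Cons i v)
    have "f (i # v) = \<zero>" if "\<not> i < n"
      using FC_set[OF Suc.prems(1), of "i # v"] that by auto
    then show ?thesis using Cons a fun_cong[OF c(2)[of i], of v] by (auto simp: child_def)
  qed
  then show ?case using a by blast
qed

lemma lt_iso: "ring_iso_map (\<lambda>a w. lt w a) A (free_alg F {..<n})"
proof -
  have "inj_on (\<lambda>a w. lt w a) (carrier A)"
  proof (rule inj_onI)
    fix a b assume ab: "a \<in> carrier A" "b \<in> carrier A" "(\<lambda>w. lt w a) = (\<lambda>w. lt w b)"
    have e: "(a \<ominus>\<^bsub>A\<^esub> b) \<oplus>\<^bsub>A\<^esub> b = a" using ab by (simp add: A.minus_eq A.a_assoc A.l_neg)
    have "lt w (a \<ominus>\<^bsub>A\<^esub> b) = \<zero>" for w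
    proof -
      have "lt w (a \<ominus>\<^bsub>A\<^esub> b) \<oplus> lt w b = lt w a" using lt_add[of "a \<ominus>\<^bsub>A\<^esub> b" b w] ab e by simp
      then have "lt w (a \<ominus>\<^bsub>A\<^esub> b) \<oplus> lt w b = \<zero> \<oplus> lt w b" using ab fun_cong[OF ab(3), of w] by simp
      then show ?thesis using ab by (simp del: l_zero)
    qed
    then have "a \<ominus>\<^bsub>A\<^esub> b = \<zero>\<^bsub>A\<^esub>" using lt_eq_0_imp[of "a \<ominus>\<^bsub>A\<^esub> b"] ab by simp
    then show "a = b" using e ab by simp
  qed
  moreover have "(\<lambda>a w. lt w a) ` carrier A = FC" using lt_FC lt_surj[OF _ order_refl] by fastforce
  ultimately show ?thesis unfolding ring_iso_map_def bij_betw_def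
    by (auto simp: fun_eq_iff lt_add lt_mult)
qed

end

text \<open>Has two instances: the free algebra with its own scalars, where \<open>wf_tags\<close>
  comes from the degree and the result is an automorphism, and \<open>B\<close> with its centroid,
  where \<open>wf_tags\<close> comes from the Noetherian centralizer.\<close>

locale axiomatic_free_algebra = field F for F :: "('k, 'm) ring_scheme" (structure) +
  fixes A :: "('a, 'n) ring_scheme" and sm :: "'k \<Rightarrow> 'a \<Rightarrow> 'a" and n :: nat
    and b :: 'a and x :: "nat \<Rightarrow> 'a"
  assumes rng_A: "rng A"
    and free_ax: "free_axioms A n b x"
    and x_closed: "\<And>i. i < n \<Longrightarrow> x i \<in> carrier A"
    and n_ge: "2 \<le> n"
    and sm_closed [simp]: "\<And>\<alpha> a. \<alpha> \<in> carrier F \<Longrightarrow> a \<in> carrier A \<Longrightarrow> sm \<alpha> a \<in> carrier A"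
    and sm_add1: "\<And>\<alpha> \<beta> a. \<alpha> \<in> carrier F \<Longrightarrow> \<beta> \<in> carrier F \<Longrightarrow> a \<in> carrier A \<Longrightarrow>
        sm (\<alpha> \<oplus> \<beta>) a = sm \<alpha> a \<oplus>\<^bsub>A\<^esub> sm \<beta> a"
    and sm_add2: "\<And>\<alpha> a c. \<alpha> \<in> carrier F \<Longrightarrow> a \<in> carrier A \<Longrightarrow> c \<in> carrier A \<Longrightarrow>
        sm \<alpha> (a \<oplus>\<^bsub>A\<^esub> c) = sm \<alpha> a \<oplus>\<^bsub>A\<^esub> sm \<alpha> c"
    and sm_assoc: "\<And>\<alpha> \<beta> a. \<alpha> \<in> carrier F \<Longrightarrow> \<beta> \<in> carrier F \<Longrightarrow> a \<in> carrier A \<Longrightarrow>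
        sm \<alpha> (sm \<beta> a) = sm (\<alpha> \<otimes> \<beta>) a"
    and sm_mult1: "\<And>\<alpha> a c. \<alpha> \<in> carrier F \<Longrightarrow> a \<in> carrier A \<Longrightarrow> c \<in> carrier A \<Longrightarrow>
        sm \<alpha> a \<otimes>\<^bsub>A\<^esub> c = sm \<alpha> (a \<otimes>\<^bsub>A\<^esub> c)"
    and sm_mult2: "\<And>\<alpha> a c. \<alpha> \<in> carrier F \<Longrightarrow> a \<in> carrier A \<Longrightarrow> c \<in> carrier A \<Longrightarrow>
        a \<otimes>\<^bsub>A\<^esub> sm \<alpha> c = sm \<alpha> (a \<otimes>\<^bsub>A\<^esub> c)"
    and scalar_iff: "\<And>i l. i < n \<Longrightarrow> l \<in> carrier A \<Longrightarrow>
        scalar_rel A (x i) l \<longleftrightarrow> (\<exists>\<alpha>\<in>carrier F. l = sm \<alpha> (x i))"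
    and sm_faithful: "\<And>i \<alpha>. i < n \<Longrightarrow> \<alpha> \<in> carrier F \<Longrightarrow> sm \<alpha> (x i) = \<zero>\<^bsub>A\<^esub> \<Longrightarrow> \<alpha> = \<zero>"
    and wf_tags: "wf {(v, w). v \<in> carrier A \<and> w \<in> carrier A \<and> v \<noteq> \<zero>\<^bsub>A\<^esub> \<and> w \<noteq> \<zero>\<^bsub>A\<^esub> \<and>
        v \<otimes>\<^bsub>A\<^esub> b = b \<otimes>\<^bsub>A\<^esub> v \<and> w \<otimes>\<^bsub>A\<^esub> b = b \<otimes>\<^bsub>A\<^esub> w \<and> w = b \<otimes>\<^bsub>A\<^esub> v}"
begin

sublocale A: rng A by (rule rng_A)

lemmas A_ac = A.a_comm A.a_assoc A.a_lcomm

primrec comb :: "(nat \<Rightarrow> 'k) \<Rightarrow> (nat \<Rightarrow> 'a) \<Rightarrow> nat \<Rightarrow> 'a" where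
  "comb \<alpha> a 0 = \<zero>\<^bsub>A\<^esub>"
| "comb \<alpha> a (Suc k) = sm (\<alpha> k) (x k) \<oplus>\<^bsub>A\<^esub> (x k \<otimes>\<^bsub>A\<^esub> a k \<oplus>\<^bsub>A\<^esub> comb \<alpha> a k)"

definition admissible :: "(nat \<Rightarrow> 'k) \<Rightarrow> (nat \<Rightarrow> 'a) \<Rightarrow> nat \<Rightarrow> bool" where
  "admissible \<alpha> a k \<longleftrightarrow> k \<le> n \<and> (\<forall>i<k. \<alpha> i \<in> carrier F \<and> a i \<in> carrier A)"

lemma admissible_Suc: "admissible \<alpha> a (Suc k) \<longleftrightarrow>
    admissible \<alpha> a k \<and> k < n \<and> \<alpha> k \<in> carrier F \<and> a k \<in> carrier A \<and> x k \<in> carrier A"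
  unfolding admissible_def using x_closed by (auto simp: less_Suc_eq)

lemma comb_closed [simp]: "admissible \<alpha> a k \<Longrightarrow> comb \<alpha> a k \<in> carrier A"
  by (induction k) (auto simp: admissible_Suc A.m_closed)

lemma comb_cong: "(\<And>i. i < k \<Longrightarrow> \<alpha> i = \<beta> i \<and> a i = c i) \<Longrightarrow> comb \<alpha> a k = comb \<beta> c k"
  by (induction k) auto

lemma comb_add:
  "admissible \<alpha> a k \<Longrightarrow> admissible \<beta> c k \<Longrightarrow>
    comb (\<lambda>i. \<alpha> i \<oplus> \<beta> i) (\<lambda>i. a i \<oplus>\<^bsub>A\<^esub> c i) k = comb \<alpha> a k \<oplus>\<^bsub>A\<^esub> comb \<beta> c k"
  by (induction k) (auto simp: admissible_Suc sm_add1 A.r_distr A_ac A.m_closed)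

lemma sm_zero [simp]: "a \<in> carrier A \<Longrightarrow> sm \<zero> a = \<zero>\<^bsub>A\<^esub>"
proof -
  assume a: "a \<in> carrier A"
  have "sm \<zero> a \<oplus>\<^bsub>A\<^esub> sm \<zero> a = sm \<zero> a \<oplus>\<^bsub>A\<^esub> \<zero>\<^bsub>A\<^esub>" using sm_add1[of \<zero> \<zero> a] a by simp
  then show ?thesis using a by (simp del: A.r_zero)
qed

lemma comb_mult:
  "admissible \<alpha> a k \<Longrightarrow> c \<in> carrier A \<Longrightarrow>
    comb \<alpha> a k \<otimes>\<^bsub>A\<^esub> c = comb (\<lambda>_. \<zero>) (\<lambda>i. sm (\<alpha> i) c \<oplus>\<^bsub>A\<^esub> a i \<otimes>\<^bsub>A\<^esub> c) k"
proof (induction k)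
  case (Suc k)
  then have o: "admissible \<alpha> a k" "k < n" "\<alpha> k \<in> carrier F" "a k \<in> carrier A" "x k \<in> carrier A"
    by (auto simp: admissible_Suc)
  have "comb \<alpha> a (Suc k) \<otimes>\<^bsub>A\<^esub> c = sm (\<alpha> k) (x k) \<otimes>\<^bsub>A\<^esub> c \<oplus>\<^bsub>A\<^esub>
      (x k \<otimes>\<^bsub>A\<^esub> a k \<otimes>\<^bsub>A\<^esub> c \<oplus>\<^bsub>A\<^esub> comb \<alpha> a k \<otimes>\<^bsub>A\<^esub> c)"
    using o Suc.prems by (simp add: A.l_distr A.m_closed)
  \<comment> \<open>The scalar is pushed past the letter, so that it becomes part of the
    child.\<close>
  also have "sm (\<alpha> k) (x k) \<otimes>\<^bsub>A\<^esub> c = x k \<otimes>\<^bsub>A\<^esub> sm (\<alpha> k) c"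
    using o Suc.prems by (simp add: sm_mult1 sm_mult2)
  finally have *: "comb \<alpha> a (Suc k) \<otimes>\<^bsub>A\<^esub> c = x k \<otimes>\<^bsub>A\<^esub> sm (\<alpha> k) c \<oplus>\<^bsub>A\<^esub>
      (x k \<otimes>\<^bsub>A\<^esub> a k \<otimes>\<^bsub>A\<^esub> c \<oplus>\<^bsub>A\<^esub> comb \<alpha> a k \<otimes>\<^bsub>A\<^esub> c)" .
  have "comb \<alpha> a k \<otimes>\<^bsub>A\<^esub> c \<in> carrier A" using o Suc.prems by (simp add: A.m_closed)
  then show ?case unfolding * using o Suc
    by (simp add: A.r_distr A.m_closed A.m_assoc A.a_assoc)
qed simp

lemma comb_sm:
  "admissible \<alpha> a k \<Longrightarrow> \<gamma> \<in> carrier F \<Longrightarrow>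
    sm \<gamma> (comb \<alpha> a k) = comb (\<lambda>i. \<gamma> \<otimes> \<alpha> i) (\<lambda>i. sm \<gamma> (a i)) k"
proof (induction k)
  case 0
  have "sm \<gamma> \<zero>\<^bsub>A\<^esub> \<oplus>\<^bsub>A\<^esub> sm \<gamma> \<zero>\<^bsub>A\<^esub> = sm \<gamma> \<zero>\<^bsub>A\<^esub> \<oplus>\<^bsub>A\<^esub> \<zero>\<^bsub>A\<^esub>"
    using sm_add2[of \<gamma> "\<zero>\<^bsub>A\<^esub>" "\<zero>\<^bsub>A\<^esub>"] 0 by simp
  then show ?case using 0 by (simp del: A.r_zero)
qed (auto simp: admissible_Suc sm_add2 sm_mult2 sm_assoc A.m_closed)

lemma decomp_comb:
  "k \<le> n \<Longrightarrow> decomp A x k Q s \<longleftrightarrow> (\<exists>\<alpha> a. admissible \<alpha> a k \<and> (\<forall>i<k. Q (a i)) \<and> s = comb \<alpha> a k)"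
proof (induction k arbitrary: s)
  case 0
  then show ?case by (auto simp: admissible_def)
next
  case (Suc k)
  then have k: "k < n" "k \<le> n" by auto
  show ?case
  proof
    assume "decomp A x (Suc k) Q s"
    then obtain t c r where 1: "t \<in> carrier A" "c \<in> carrier A" "scalar_rel A (x k) t" "Q c"
      "s = t \<oplus>\<^bsub>A\<^esub> (x k \<otimes>\<^bsub>A\<^esub> c \<oplus>\<^bsub>A\<^esub> r)" "decomp A x k Q r" by auto
    obtain \<alpha> a where 2: "admissible \<alpha> a k" "\<forall>i<k. Q (a i)" "r = comb \<alpha> a k" using Suc.IH[OF k(2)] 1(6) by blast
    obtain \<gamma> where 3: "\<gamma> \<in> carrier F" "t = sm \<gamma> (x k)" using 1 scalar_iff[OF k(1)] by blast
    have "comb (\<alpha>(k := \<gamma>)) (a(k := c)) k = comb \<alpha> a k" by (rule comb_cong) auto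
    then have "s = comb (\<alpha>(k := \<gamma>)) (a(k := c)) (Suc k)" using 1 2 3 by simp
    moreover have "admissible (\<alpha>(k := \<gamma>)) (a(k := c)) (Suc k)" using 1 2 3 k by (auto simp: admissible_def less_Suc_eq)
    moreover have "\<forall>i<Suc k. Q ((a(k := c)) i)" using 1 2 by (auto simp: less_Suc_eq)
    ultimately show "\<exists>\<alpha> a. admissible \<alpha> a (Suc k) \<and> (\<forall>i<Suc k. Q (a i)) \<and> s = comb \<alpha> a (Suc k)" by blast
  next
    assume "\<exists>\<alpha> a. admissible \<alpha> a (Suc k) \<and> (\<forall>i<Suc k. Q (a i)) \<and> s = comb \<alpha> a (Suc k)"
    then obtain \<alpha> a where 1: "admissible \<alpha> a (Suc k)" "\<forall>i<Suc k. Q (a i)" "s = comb \<alpha> a (Suc k)" by blast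
    then have 2: "admissible \<alpha> a k" "\<alpha> k \<in> carrier F" "a k \<in> carrier A" "x k \<in> carrier A" by (auto simp: admissible_Suc)
    have "decomp A x k Q (comb \<alpha> a k)" using Suc.IH[OF k(2)] 1(2) 2(1) less_SucI by blast
    moreover have "scalar_rel A (x k) (sm (\<alpha> k) (x k))" using scalar_iff[OF k(1)] 2 by auto
    ultimately show "decomp A x (Suc k) Q s" unfolding decomp.simps 1(3) comb.simps
      using 1(2) 2 by (intro bexI[of _ "sm (\<alpha> k) (x k)"] bexI[of _ "a k"] bexI[of _ "comb \<alpha> a k"]) auto
  qed
qed

lemma comb_eq_0: "admissible \<alpha> a k \<Longrightarrow> comb \<alpha> a k = \<zero>\<^bsub>A\<^esub> \<Longrightarrow> i < k \<Longrightarrow> \<alpha> i = \<zero> \<and> a i = \<zero>\<^bsub>A\<^esub>"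
proof (induction k)
  case (Suc k)
  then have o: "admissible \<alpha> a k" "k < n" "\<alpha> k \<in> carrier F" "a k \<in> carrier A" "x k \<in> carrier A"
    by (auto simp: admissible_Suc)
  have "decomp A x k (\<lambda>_. True) (comb \<alpha> a k)" using decomp_comb[of k] o by auto
  moreover have "scalar_rel A (x k) (sm (\<alpha> k) (x k))" using scalar_iff[of k] o by auto
  moreover have "ax_unique A x k" using free_ax o unfolding free_axioms_def by blast
  ultimately have *: "sm (\<alpha> k) (x k) = \<zero>\<^bsub>A\<^esub>" "a k = \<zero>\<^bsub>A\<^esub>"
    using Suc.prems(2) o comb_closed[OF o(1)] sm_closed[OF o(3,5)]
    unfolding ax_unique_def comb.simps by blast+
  then have "\<alpha> k = \<zero>" using sm_faithful o by blast
  moreover have "comb \<alpha> a k = \<zero>\<^bsub>A\<^esub>" using Suc.prems * o by simp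
  ultimately show ?case using Suc.IH[OF o(1)] Suc.prems * by (auto simp: less_Suc_eq)
qed simp

lemma comb_inj:
  assumes "admissible \<alpha> a n" "admissible \<beta> c n" "comb \<alpha> a n = comb \<beta> c n" "i < n"
  shows "\<alpha> i = \<beta> i \<and> a i = c i"
proof -
  let ?\<gamma> = "\<lambda>i. \<alpha> i \<ominus> \<beta> i" and ?d = "\<lambda>i. a i \<ominus>\<^bsub>A\<^esub> c i"
  have o: "admissible ?\<gamma> ?d n" using assms(1,2) by (auto simp: admissible_def)
  have e: "?\<gamma> i \<oplus> \<beta> i = \<alpha> i \<and> ?d i \<oplus>\<^bsub>A\<^esub> c i = a i" if "i < n" for i
    using assms(1,2) that unfolding admissible_def
    by (auto simp: A.minus_eq A.a_assoc A.l_neg minus_eq a_assoc l_neg)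
  have "comb ?\<gamma> ?d n \<oplus>\<^bsub>A\<^esub> comb \<beta> c n = comb \<alpha> a n"
    unfolding comb_add[OF o assms(2), symmetric] using e by (intro comb_cong) auto
  then have "comb ?\<gamma> ?d n = \<zero>\<^bsub>A\<^esub>"
    using assms(3) o assms(2) by (metis A.add.l_cancel_one' A.add.m_comm comb_closed)
  then have "?\<gamma> i = \<zero> \<and> ?d i = \<zero>\<^bsub>A\<^esub>" using comb_eq_0[OF o _ assms(4)] by simp
  then show ?thesis using e[OF assms(4)] assms(1,2,4) unfolding admissible_def by auto
qed

definition parts :: "'a \<Rightarrow> (nat \<Rightarrow> 'k) \<times> (nat \<Rightarrow> 'a)" where
  "parts s = (SOME (\<alpha>, a). admissible \<alpha> a n \<and> s = comb \<alpha> a n)"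

definition "cf i s = fst (parts s) i"
definition "ch i s = snd (parts s) i"

text \<open>Existence of decompositions has no axiom of its own: it is the depth axiom at the root
  of the tree of \<open>s\<close>.\<close>

lemma decomp_ex: "s \<in> carrier A \<Longrightarrow> \<exists>\<alpha> a. admissible \<alpha> a n \<and> s = comb \<alpha> a n"
proof -
  assume s: "s \<in> carrier A"
  have "ax_depth A n b x" using free_ax unfolding free_axioms_def by blast
  from bspec[OF this[unfolded ax_depth_def] s] obtain Q where "decomp A x n Q s"
    using s by (elim bexE conjE) blast
  then show ?thesis using decomp_comb by blast
qed

lemma parts_admissible: "s \<in> carrier A \<Longrightarrow> admissible (\<lambda>i. cf i s) (\<lambda>i. ch i s) n \<and> s = comb (\<lambda>i. cf i s) (\<lambda>i. ch i s) n"
proof -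
  assume "s \<in> carrier A"
  then obtain \<alpha> a where *: "admissible \<alpha> a n \<and> s = comb \<alpha> a n" using decomp_ex by blast
  show ?thesis unfolding cf_def ch_def parts_def
    using someI[of "\<lambda>(\<alpha>, a). admissible \<alpha> a n \<and> s = comb \<alpha> a n" "(\<alpha>, a)"] * by (auto simp: case_prod_unfold)
qed

lemma parts_comb:
  assumes "admissible \<alpha> a n" "i < n" shows "cf i (comb \<alpha> a n) = \<alpha> i \<and> ch i (comb \<alpha> a n) = a i"
  using parts_admissible[OF comb_closed[OF assms(1)]] comb_inj[OF _ assms(1) _ assms(2)] by metis

lemma parts_eq:
  "admissible \<alpha> a n \<Longrightarrow> s = comb \<alpha> a n \<Longrightarrow> i < n \<Longrightarrow> cf i s = \<alpha> i \<and> ch i s = a i"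
  using parts_comb by blast

text \<open>The elements carry no rank, their tags do: well-founded induction runs on the tag, for
  all nodes that the coded set pairs with it. Untagged children are zero and covered by the base
  case.\<close>

lemma depth_induct:
  assumes "s \<in> carrier A" "P \<zero>\<^bsub>A\<^esub>" "\<And>a. a \<in> carrier A \<Longrightarrow> (\<And>i. i < n \<Longrightarrow> P (ch i a)) \<Longrightarrow> P a"
  shows "P s"
proof -
  have "ax_depth A n b x" using free_ax unfolding free_axioms_def by blast
  from bspec[OF this[unfolded ax_depth_def] assms(1)]
  obtain c p w where w: "w \<in> carrier A"
      "coded A (x 0) (x 1) c p (x 0 \<otimes>\<^bsub>A\<^esub> w \<oplus>\<^bsub>A\<^esub> x 1 \<otimes>\<^bsub>A\<^esub> s)"
    and "\<forall>w\<in>carrier A. \<forall>s\<in>carrier A. coded A (x 0) (x 1) c p (x 0 \<otimes>\<^bsub>A\<^esub> w \<oplus>\<^bsub>A\<^esub> x 1 \<otimes>\<^bsub>A\<^esub> s) \<longrightarrow>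
        w \<noteq> \<zero>\<^bsub>A\<^esub> \<and> w \<otimes>\<^bsub>A\<^esub> b = b \<otimes>\<^bsub>A\<^esub> w \<and> decomp A x n (\<lambda>a. child_ok A b (x 0) (x 1) c p w a) s"
    by (elim bexE conjE) (rule that)
  note cl = this(3)[rule_format]
  have "\<forall>s\<in>carrier A. w \<in> carrier A \<longrightarrow>
      coded A (x 0) (x 1) c p (x 0 \<otimes>\<^bsub>A\<^esub> w \<oplus>\<^bsub>A\<^esub> x 1 \<otimes>\<^bsub>A\<^esub> s) \<longrightarrow> P s" for w
    using wf_tags
  proof (induction w rule: wf_induct_rule)
    case (less w)
    show ?case
    proof (intro ballI impI)
      fix s assume s: "s \<in> carrier A" and w: "w \<in> carrier A"
        and cd: "coded A (x 0) (x 1) c p (x 0 \<otimes>\<^bsub>A\<^esub> w \<oplus>\<^bsub>A\<^esub> x 1 \<otimes>\<^bsub>A\<^esub> s)"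
      from cl[OF w s cd] have 1: "w \<noteq> \<zero>\<^bsub>A\<^esub>" "w \<otimes>\<^bsub>A\<^esub> b = b \<otimes>\<^bsub>A\<^esub> w"
        "decomp A x n (\<lambda>a. child_ok A b (x 0) (x 1) c p w a) s" by auto
      then obtain \<alpha> a where 2: "admissible \<alpha> a n" "\<forall>i<n. child_ok A b (x 0) (x 1) c p w (a i)" "s = comb \<alpha> a n"
        using decomp_comb by blast
      show "P s"
      proof (rule assms(3)[OF s])
        fix i assume i: "i < n"
        have ch: "ch i s = a i" "a i \<in> carrier A" using parts_comb[OF 2(1) i] 2 i by (auto simp: admissible_def)
        show "P (ch i s)"
        proof (cases "a i = \<zero>\<^bsub>A\<^esub>")
          case True
          then show ?thesis using ch assms(2) by simp
        next
          case False
          then obtain v where v: "v \<in> carrier A" "w = b \<otimes>\<^bsub>A\<^esub> v"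
            "coded A (x 0) (x 1) c p (x 0 \<otimes>\<^bsub>A\<^esub> v \<oplus>\<^bsub>A\<^esub> x 1 \<otimes>\<^bsub>A\<^esub> a i)"
            using 2(2) i unfolding child_ok_def by blast
          show ?thesis unfolding ch(1) using less[of v] cl[OF v(1) ch(2) v(3)] 1 v w ch by blast
        qed
      qed
    qed
  qed
  then show ?thesis using w assms(1) by blast
qed

sublocale letter_decomposition F A sm n cf ch
proof
  fix i a c assume i: "i < n" and a: "a \<in> carrier A"
  have o: "admissible (\<lambda>i. cf i a) (\<lambda>i. ch i a) n" and ea: "a = comb (\<lambda>i. cf i a) (\<lambda>i. ch i a) n"
    using parts_admissible[OF a] by auto
  show "cf i a \<in> carrier F" "ch i a \<in> carrier A" using o i by (auto simp: admissible_def)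
  show "cf i (sm \<alpha> a) = \<alpha> \<otimes> cf i a \<and> ch i (sm \<alpha> a) = sm \<alpha> (ch i a)" if "\<alpha> \<in> carrier F" for \<alpha>
  proof (rule parts_eq[OF _ _ i])
    show "admissible (\<lambda>i. \<alpha> \<otimes> cf i a) (\<lambda>i. sm \<alpha> (ch i a)) n" using o that by (auto simp: admissible_def)
    show "sm \<alpha> a = comb (\<lambda>i. \<alpha> \<otimes> cf i a) (\<lambda>i. sm \<alpha> (ch i a)) n"
      using comb_sm[OF o that] ea by simp
  qed
  assume c: "c \<in> carrier A"
  have o': "admissible (\<lambda>i. cf i c) (\<lambda>i. ch i c) n" and ec: "c = comb (\<lambda>i. cf i c) (\<lambda>i. ch i c) n"
    using parts_admissible[OF c] by auto
  show "cf i (a \<oplus>\<^bsub>A\<^esub> c) = cf i a \<oplus> cf i c \<and> ch i (a \<oplus>\<^bsub>A\<^esub> c) = ch i a \<oplus>\<^bsub>A\<^esub> ch i c"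
  proof (rule parts_eq[OF _ _ i])
    show "admissible (\<lambda>i. cf i a \<oplus> cf i c) (\<lambda>i. ch i a \<oplus>\<^bsub>A\<^esub> ch i c) n" using o o' by (auto simp: admissible_def)
    show "a \<oplus>\<^bsub>A\<^esub> c = comb (\<lambda>i. cf i a \<oplus> cf i c) (\<lambda>i. ch i a \<oplus>\<^bsub>A\<^esub> ch i c) n"
      using comb_add[OF o o'] ea ec by simp
  qed
  show "cf i (a \<otimes>\<^bsub>A\<^esub> c) = \<zero> \<and> ch i (a \<otimes>\<^bsub>A\<^esub> c) = sm (cf i a) c \<oplus>\<^bsub>A\<^esub> ch i a \<otimes>\<^bsub>A\<^esub> c"
  proof (rule parts_eq[OF _ _ i])
    show "admissible (\<lambda>_. \<zero>) (\<lambda>i. sm (cf i a) c \<oplus>\<^bsub>A\<^esub> ch i a \<otimes>\<^bsub>A\<^esub> c) n"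
      using o c by (auto simp: admissible_def A.m_closed)
    show "a \<otimes>\<^bsub>A\<^esub> c = comb (\<lambda>_. \<zero>) (\<lambda>i. sm (cf i a) c \<oplus>\<^bsub>A\<^esub> ch i a \<otimes>\<^bsub>A\<^esub> c) n"
      using comb_mult[OF o c] ea by simp
  qed
next
  fix a assume a: "a \<in> carrier A" "\<And>i. i < n \<Longrightarrow> cf i a = \<zero> \<and> ch i a = \<zero>\<^bsub>A\<^esub>"
  have "comb (\<lambda>_. \<zero>) (\<lambda>_. \<zero>\<^bsub>A\<^esub>) k = \<zero>\<^bsub>A\<^esub>" if "k \<le> n" for k
    using that x_closed by (induction k) auto
  moreover have "comb (\<lambda>i. cf i a) (\<lambda>i. ch i a) n = comb (\<lambda>_. \<zero>) (\<lambda>_. \<zero>\<^bsub>A\<^esub>) n"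
    using a by (intro comb_cong) auto
  ultimately show "a = \<zero>\<^bsub>A\<^esub>" using parts_admissible[OF a(1)] by simp
next
  fix \<alpha> :: "nat \<Rightarrow> 'k" and c assume "\<And>i. i < n \<Longrightarrow> \<alpha> i \<in> carrier F \<and> c i \<in> carrier A"
  then have "admissible \<alpha> c n" by (auto simp: admissible_def)
  then show "\<exists>a\<in>carrier A. \<forall>i<n. cf i a = \<alpha> i \<and> ch i a = c i"
    using parts_comb by (intro bexI[of _ "comb \<alpha> c n"]) auto
qed (use rng_A depth_induct in auto)

lemma lt_x:
  assumes "i < n" shows "(\<lambda>w. lt w (x i)) = letter F i"
proof -
  have i: "x i \<in> carrier A" using assms x_closed by blast
  \<comment> \<open>That \<open>\<one>\<close> acts as the identity is not assumed. It holds on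
    \<open>x i\<close> because \<open>x i\<close> is itself a scalar multiple of
    \<open>x i\<close>.\<close>
  have sm1: "sm \<one> (x i) = x i"
  proof -
    have "scalar_rel A (x i) (x i)"
      unfolding scalar_rel_def by (intro ballI bexI[of _ "_ :: 'a"] conjI) auto
    then obtain \<alpha> where \<alpha>: "\<alpha> \<in> carrier F" "x i = sm \<alpha> (x i)" using scalar_iff[OF assms i] by blast
    have "sm \<one> (x i) = sm \<one> (sm \<alpha> (x i))" using \<alpha>(2) by simp
    also have "\<dots> = x i" using sm_assoc[of \<one> \<alpha> "x i"] \<alpha> i by simp
    finally show ?thesis .
  qed
  let ?\<delta> = "\<lambda>j. if j = i then \<one> else \<zero>"
  have c: "comb ?\<delta> (\<lambda>_. \<zero>\<^bsub>A\<^esub>) k = (if i < k then x i else \<zero>\<^bsub>A\<^esub>)" if "k \<le> n" for k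
    using that i x_closed sm1 by (induction k) (auto simp: less_Suc_eq)
  have "cf j (x i) = ?\<delta> j \<and> ch j (x i) = \<zero>\<^bsub>A\<^esub>" if "j < n" for j
    using that c[of n] assms by (intro parts_eq) (auto simp: admissible_def)
  then have "lt w (x i) = letter F i w" for w
    using assms by (cases w) (auto simp: letter_def)
  then show ?thesis by blast
qed

end

section \<open>Free algebras satisfy the axioms\<close>

locale free_algebra_fin = field F for F :: "('k, 'm) ring_scheme" (structure) +
  fixes n :: nat
  assumes n_ge_2: "2 \<le> n"
begin

sublocale free_algebra F "{..<n}" by unfold_locales auto

abbreviation X :: "nat \<Rightarrow> nat list \<Rightarrow> 'k" where "X \<equiv> letter F"

lemma X_FC [simp]: "X 0 \<in> FC" "X 1 \<in> FC" "X (Suc 0) \<in> FC"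
  using n_ge_2 by (auto intro!: letter_FC)

lemma X_FC' [simp]: "i < n \<Longrightarrow> X i \<in> FC"
  by (intro letter_FC) simp

abbreviation sml :: "'k \<Rightarrow> (nat list \<Rightarrow> 'k) \<Rightarrow> nat list \<Rightarrow> 'k" where
  "sml \<alpha> f \<equiv> (\<lambda>w. \<alpha> \<otimes> f w)"

lemma eq_if_diff_zero: "a \<oplus> \<ominus> \<one> \<otimes> b = \<zero> \<Longrightarrow> a \<in> carrier F \<Longrightarrow> b \<in> carrier F \<Longrightarrow> a = b"
proof -
  assume a: "a \<oplus> \<ominus> \<one> \<otimes> b = \<zero>" "a \<in> carrier F" "b \<in> carrier F"
  have "a = (a \<oplus> \<ominus> \<one> \<otimes> b) \<oplus> b" using a(2,3) by algebra
  then show "a = b" using a by simp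
qed

section \<open>Cancellation and the definability of scalars\<close>

lemma conv_cancel_right:
  assumes "f \<in> FC" "g \<in> FC" "y \<in> FC" "y \<noteq> (\<lambda>_. \<zero>)" "conv F f y = conv F g y"
  shows "f = g"
proof -
  let ?d = "\<lambda>w. f w \<oplus> \<ominus> \<one> \<otimes> g w"
  have d: "?d \<in> FC" using assms by (intro FA_add FA_smult) auto
  have "conv F ?d y w = \<zero>" for w
    using assms conv_add_left[of f "sml (\<ominus> \<one>) g" y w] conv_smult_left[of "\<ominus> \<one>" g y w]
      fun_cong[OF assms(5), of w] by (simp add: l_minus r_neg)
  then have "?d = (\<lambda>_. \<zero>)" using conv_nonzero(1)[OF d assms(3) _ assms(4)] by blast
  then have "f w \<oplus> \<ominus> \<one> \<otimes> g w = \<zero>" for w by meson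
  then have "f w = g w" for w using assms(1,2) by (rule_tac eq_if_diff_zero) auto
  then show ?thesis by blast
qed

lemma conv_cancel_left:
  assumes "f \<in> FC" "g \<in> FC" "y \<in> FC" "y \<noteq> (\<lambda>_. \<zero>)" "conv F y f = conv F y g"
  shows "f = g"
proof -
  let ?d = "\<lambda>w. f w \<oplus> \<ominus> \<one> \<otimes> g w"
  have d: "?d \<in> FC" using assms by (intro FA_add FA_smult) auto
  have "conv F y ?d w = \<zero>" for w
    using assms conv_add_right[of y f "sml (\<ominus> \<one>) g" w] conv_smult_right[of "\<ominus> \<one>" y g w]
      fun_cong[OF assms(5), of w] by (simp add: l_minus r_neg)
  then have "?d = (\<lambda>_. \<zero>)" using conv_nonzero(1)[OF assms(3) d assms(4)] by blast
  then have "f w \<oplus> \<ominus> \<one> \<otimes> g w = \<zero>" for w by meson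
  then have "f w = g w" for w using assms(1,2) by (rule_tac eq_if_diff_zero) auto
  then show ?thesis by blast
qed

lemma scalar_rel_smult:
  assumes "\<alpha> \<in> carrier F" "y \<in> FC" shows "scalar_rel FA y (sml \<alpha> y)"
  unfolding scalar_rel_def
proof
  fix z assume z: "z \<in> FC"
  show "\<exists>w\<in>FC. z \<otimes>\<^bsub>FA\<^esub> sml \<alpha> y = w \<otimes>\<^bsub>FA\<^esub> y \<and>
     (\<forall>z'\<in>FC. z \<otimes>\<^bsub>FA\<^esub> (z' \<otimes>\<^bsub>FA\<^esub> sml \<alpha> y) = w \<otimes>\<^bsub>FA\<^esub> (z' \<otimes>\<^bsub>FA\<^esub> y))"
  proof (intro bexI[of _ "sml \<alpha> z"] conjI ballI)
    show "z \<otimes>\<^bsub>FA\<^esub> sml \<alpha> y = sml \<alpha> z \<otimes>\<^bsub>FA\<^esub> y"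
      using assms z by (auto simp: fun_eq_iff conv_smult_right conv_smult_left)
    fix z' assume z': "z' \<in> FC"
    have "conv F z' (sml \<alpha> y) = sml \<alpha> (conv F z' y)"
      using assms z' by (auto simp: fun_eq_iff conv_smult_right)
    moreover have "conv F z (sml \<alpha> (conv F z' y)) = conv F (sml \<alpha> z) (conv F z' y)"
      using assms z z' by (auto simp: fun_eq_iff conv_smult_right conv_smult_left)
    ultimately show "z \<otimes>\<^bsub>FA\<^esub> (z' \<otimes>\<^bsub>FA\<^esub> sml \<alpha> y) = sml \<alpha> z \<otimes>\<^bsub>FA\<^esub> (z' \<otimes>\<^bsub>FA\<^esub> y)" by simp
  qed (use assms z in auto)
qed

text \<open>Compares coefficients at \<open>0 # k # v\<close> for the two probes \<open>X 0\<close>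
  and \<open>X 1\<close>. A word of \<open>l\<close> must end in \<open>i\<close>, and a letter
  before that end would have to equal both probes. With a single letter, multiplication by that
  letter would lie in the centroid as well.\<close>

lemma scalar_rel_letter:
  assumes l: "l \<in> FC" and i: "i < n" and sc: "scalar_rel FA (X i) l"
  shows "l = sml (l [i]) (X i)"
proof -
  have Xi: "X i \<in> FC" using i by simp
  obtain w where w: "w \<in> FC"
    and e: "\<And>z'. z' \<in> FC \<Longrightarrow> conv F (X 0) (conv F z' l) = conv F w (conv F z' (X i))"
    using sc X_FC(1) unfolding scalar_rel_def free_alg_simps by meson
  have lv: "l v = conv F (conv F w (X k)) (X i) (0 # k # v)" if "k < 2" for k v
  proof -
    have k: "X k \<in> FC" using that n_ge_2 by simp
    have "conv F (conv F w (X k)) (X i) (0 # k # v) = conv F (X 0) (conv F (X k) l) (0 # k # v)"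
      using e[OF k] conv_assoc[of w "X k" "X i"] w k Xi by simp
    also have "\<dots> = l v" using l k by (simp add: conv_letter_left)
    finally show ?thesis by simp
  qed
  have z: "l v = \<zero>" if v: "v \<noteq> [i]" for v
  proof (cases v rule: rev_cases)
    case Nil
    then show ?thesis using l by simp
  next
    case (snoc u q)
    have s: "l v = (if i = q then conv F w (X k) (0 # k # u) else \<zero>)" if "k < 2" for k
      using lv[OF that, of v] conv_letter_right[of "conv F w (X k)" i "0 # k # u" q] snoc w that n_ge_2 by simp
    show ?thesis
    proof (cases u rule: rev_cases)
      case Nil
      then show ?thesis using s[of 0] v snoc by auto
    next
      case (snoc u' p)
      have "conv F w (X k) (0 # k # u) = (if k = p then w (0 # k # u') else \<zero>)" if "k < 2" for k
        using conv_letter_right[of w k "0 # k # u'" p] snoc w that n_ge_2 by simp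
      then show ?thesis using s[of 0] s[of 1] by (cases "p = 0") auto
    qed
  qed
  show ?thesis
  proof
    fix v show "l v = l [i] \<otimes> X i v" using z[of v] l by (auto simp: letter_def)
  qed
qed

text \<open>If \<open>X 0 l = w y\<close>, then \<open>w\<close> is related to the letter
  \<open>X 0\<close> as \<open>l\<close> is to \<open>y\<close>. By the case of a letter
  \<open>w\<close> is a multiple of \<open>X 0\<close>, and cancelling \<open>X 0\<close> from the
  left determines \<open>l\<close>.\<close>

lemma scalar_rel_iff:
  assumes l: "l \<in> FC" and y: "y \<in> FC" "y \<noteq> (\<lambda>_. \<zero>)"
  shows "scalar_rel FA y l \<longleftrightarrow> (\<exists>\<alpha>\<in>carrier F. l = sml \<alpha> y)"
proof
  assume sc: "scalar_rel FA y l"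
  obtain w where w: "w \<in> FC" "conv F (X 0) l = conv F w y"
    and w2: "\<And>z'. z' \<in> FC \<Longrightarrow> conv F (X 0) (conv F z' l) = conv F w (conv F z' y)"
    using sc X_FC(1) unfolding scalar_rel_def free_alg_simps by meson
  have as: "conv F f (conv F g h) = conv F (conv F f g) h" if "f \<in> FC" "g \<in> FC" "h \<in> FC" for f g h
    using that conv_assoc[of f g h] by (auto simp: fun_eq_iff)
  have "scalar_rel FA (X 0) w"
    unfolding scalar_rel_def free_alg_simps
  proof
    fix z assume z: "z \<in> FC"
    obtain v where v: "v \<in> FC" and v2: "\<And>z'. z' \<in> FC \<Longrightarrow> conv F z (conv F z' l) = conv F v (conv F z' y)"
      using sc z unfolding scalar_rel_def free_alg_simps by meson
    show "\<exists>v\<in>FC. conv F z w = conv F v (X 0) \<and> (\<forall>z'\<in>FC. conv F z (conv F z' w) = conv F v (conv F z' (X 0)))"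
    proof (intro bexI[of _ v] conjI ballI)
      have "conv F (conv F z w) y = conv F z (conv F (X 0) l)" using w z y as[of z w y] by simp
      also have "\<dots> = conv F (conv F v (X 0)) y" using v2[of "X 0"] as[of v "X 0" y] v y by simp
      finally show "conv F z w = conv F v (X 0)"
        using conv_cancel_right[of _ _ y] z w v y by simp
      fix z' assume z': "z' \<in> FC"
      have "conv F (conv F z (conv F z' w)) y = conv F z (conv F (conv F z' (X 0)) l)"
        using w z z' y l as[of z "conv F z' w" y] as[of z' w y] as[of z' "X 0" l] by simp
      also have "\<dots> = conv F (conv F v (conv F z' (X 0))) y"
        using v2[of "conv F z' (X 0)"] as[of v "conv F z' (X 0)" y] v y z' by simp
      finally show "conv F z (conv F z' w) = conv F v (conv F z' (X 0))"
        using conv_cancel_right[of _ _ y] z w v y z' by simp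
    qed (rule v)
  qed
  then have e: "w = sml (w [0]) (X 0)" using scalar_rel_letter[of w 0] w n_ge_2 by simp
  have "conv F w y = sml (w [0]) (conv F (X 0) y)"
    by (subst e) (use w y in \<open>auto simp: fun_eq_iff conv_smult_left\<close>)
  then have "conv F (X 0) l = conv F (X 0) (sml (w [0]) y)"
    using w y by (auto simp: fun_eq_iff conv_smult_right)
  then have "l = sml (w [0]) y" using l y w by (rule_tac conv_cancel_left[of _ _ "X 0"]) auto
  then show "\<exists>\<alpha>\<in>carrier F. l = sml \<alpha> y" using w by (intro bexI[of _ "w [0]"]) auto
qed (use scalar_rel_smult y in blast)

text \<open>Left multiplication by \<open>x - \<mu>\<close>, where \<open>x\<close> is the first letter, and congruence modulo its image.\<close>

definition L :: "'k \<Rightarrow> (nat list \<Rightarrow> 'k) \<Rightarrow> nat list \<Rightarrow> 'k" where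
  "L \<mu> q w = conv F (X 0) q w \<oplus> \<ominus> \<mu> \<otimes> q w"

definition cng :: "'k \<Rightarrow> (nat list \<Rightarrow> 'k) \<Rightarrow> (nat list \<Rightarrow> 'k) \<Rightarrow> bool" where
  "cng \<mu> f g \<longleftrightarrow> (\<exists>s\<in>FC. \<forall>w. f w = g w \<oplus> L \<mu> s w)"

lemma L_FC [simp]: "\<mu> \<in> carrier F \<Longrightarrow> q \<in> FC \<Longrightarrow> L \<mu> q \<in> FC"
proof -
  assume "\<mu> \<in> carrier F" "q \<in> FC"
  then have "(\<lambda>w. conv F (X 0) q w \<oplus> \<ominus> \<mu> \<otimes> q w) \<in> FC" by (intro FA_add FA_smult FA_mult) auto
  moreover have "L \<mu> q = (\<lambda>w. conv F (X 0) q w \<oplus> \<ominus> \<mu> \<otimes> q w)" by (auto simp: L_def)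
  ultimately show ?thesis by simp
qed

lemma L_closed [simp]: "\<mu> \<in> carrier F \<Longrightarrow> q \<in> FC \<Longrightarrow> L \<mu> q w \<in> carrier F"
  by (rule FC_closed[OF L_FC])

lemma L_add: "\<mu> \<in> carrier F \<Longrightarrow> q \<in> FC \<Longrightarrow> r \<in> FC \<Longrightarrow> L \<mu> (\<lambda>w. q w \<oplus> r w) w = L \<mu> q w \<oplus> L \<mu> r w"
  unfolding L_def by (simp add: conv_add_right r_distr a_ac)

lemma L_sml: "\<mu> \<in> carrier F \<Longrightarrow> \<alpha> \<in> carrier F \<Longrightarrow> q \<in> FC \<Longrightarrow> L \<mu> (sml \<alpha> q) w = \<alpha> \<otimes> L \<mu> q w"
  unfolding L_def by (simp add: conv_smult_right r_distr m_ac)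

lemma L_change:
  assumes "\<mu> \<in> carrier F" "\<nu> \<in> carrier F" "q \<in> FC"
  shows "L \<mu> q w = L \<nu> q w \<oplus> (\<nu> \<ominus> \<mu>) \<otimes> q w"
proof -
  have c: "conv F (X 0) q w \<in> carrier F" "q w \<in> carrier F" using assms by auto
  show ?thesis unfolding L_def using c assms(1,2) by algebra
qed

lemma L_commute:
  assumes "\<mu> \<in> carrier F" "\<nu> \<in> carrier F" "q \<in> FC"
  shows "L \<mu> (L \<nu> q) w = L \<nu> (L \<mu> q) w"
proof -
  have e: "conv F (X 0) (L \<mu> q) w = conv F (X 0) (conv F (X 0) q) w \<oplus> \<ominus> \<mu> \<otimes> conv F (X 0) q w"
    if "\<mu> \<in> carrier F" for \<mu>
  proof -
    have "L \<mu> q = (\<lambda>w. conv F (X 0) q w \<oplus> \<ominus> \<mu> \<otimes> q w)" by (auto simp: L_def)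
    then show ?thesis using that assms by (simp add: conv_add_right conv_smult_right)
  qed
  have c: "conv F (X 0) (conv F (X 0) q) w \<in> carrier F" "conv F (X 0) q w \<in> carrier F" "q w \<in> carrier F"
    using assms by auto
  show ?thesis unfolding L_def[of \<mu> "L \<nu> q"] L_def[of \<nu> "L \<mu> q"] e[OF assms(1)] e[OF assms(2)] L_def[of _ q]
    using c assms(1,2) by algebra
qed

lemma cng_refl: "f \<in> FC \<Longrightarrow> \<mu> \<in> carrier F \<Longrightarrow> cng \<mu> f f"
  unfolding cng_def by (intro bexI[of _ "\<lambda>_. \<zero>"]) (auto simp: L_def)

lemma cng_trans:
  assumes "cng \<mu> f g" "cng \<mu> g h" "\<mu> \<in> carrier F" "f \<in> FC" "g \<in> FC" "h \<in> FC" shows "cng \<mu> f h"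
proof -
  obtain s t where "s \<in> FC" "t \<in> FC" "\<forall>w. f w = g w \<oplus> L \<mu> s w" "\<forall>w. g w = h w \<oplus> L \<mu> t w"
    using assms unfolding cng_def by blast
  then show ?thesis unfolding cng_def using assms
    by (intro bexI[of _ "\<lambda>w. t w \<oplus> s w"]) (auto simp: L_add a_assoc)
qed

lemma cng_add:
  assumes "cng \<mu> f g" "cng \<mu> f' g'" "\<mu> \<in> carrier F" "f \<in> FC" "g \<in> FC" "f' \<in> FC" "g' \<in> FC"
  shows "cng \<mu> (\<lambda>w. f w \<oplus> f' w) (\<lambda>w. g w \<oplus> g' w)"
proof -
  obtain s t where "s \<in> FC" "t \<in> FC" "\<forall>w. f w = g w \<oplus> L \<mu> s w" "\<forall>w. f' w = g' w \<oplus> L \<mu> t w"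
    using assms unfolding cng_def by blast
  then show ?thesis unfolding cng_def using assms
    by (intro bexI[of _ "\<lambda>w. s w \<oplus> t w"]) (auto simp: L_add a_ac)
qed

lemma cng_sml:
  assumes "cng \<mu> f g" "\<mu> \<in> carrier F" "\<alpha> \<in> carrier F" "f \<in> FC" "g \<in> FC"
  shows "cng \<mu> (sml \<alpha> f) (sml \<alpha> g)"
proof -
  obtain s where "s \<in> FC" "\<forall>w. f w = g w \<oplus> L \<mu> s w"
    using assms unfolding cng_def by blast
  then show ?thesis unfolding cng_def using assms
    by (intro bexI[of _ "sml \<alpha> s"]) (auto simp: L_sml r_distr)
qed

lemma cng_sym:
  assumes "cng \<mu> f g" "\<mu> \<in> carrier F" "f \<in> FC" "g \<in> FC" shows "cng \<mu> g f"
proof -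
  obtain s where s: "s \<in> FC" "\<forall>w. f w = g w \<oplus> L \<mu> s w"
    using assms unfolding cng_def by blast
  have "g w = f w \<oplus> L \<mu> (sml (\<ominus> \<one>) s) w" for w
  proof -
    have c: "g w \<in> carrier F" "L \<mu> s w \<in> carrier F" using assms s(1) by auto
    have e: "L \<mu> (sml (\<ominus> \<one>) s) w = \<ominus> \<one> \<otimes> L \<mu> s w"
      using assms s(1) by (intro L_sml) auto
    show ?thesis unfolding e using s(2) c by (simp add: l_minus a_assoc r_neg)
  qed
  then show ?thesis unfolding cng_def using s by (intro bexI[of _ "sml (\<ominus> \<one>) s"]) auto
qed

lemma cng_L: "\<mu> \<in> carrier F \<Longrightarrow> s \<in> FC \<Longrightarrow> cng \<mu> (L \<mu> s) (\<lambda>_. \<zero>)"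
  unfolding cng_def by (intro bexI[of _ s]) auto

lemma cng_zeroD: "cng \<mu> f (\<lambda>_. \<zero>) \<Longrightarrow> \<mu> \<in> carrier F \<Longrightarrow> \<exists>s\<in>FC. f = L \<mu> s"
  unfolding cng_def by (auto simp: fun_eq_iff)

lemma L_top:
  assumes "\<mu> \<in> carrier F" "q \<in> FC" "free_deg F q \<le> length w"
  shows "L \<mu> q (0 # w) = q w"
  using assms free_degD[OF assms(2), of "0 # w"] by (simp add: L_def conv_letter_left)

lemma L_nonzero:
  assumes "\<mu> \<in> carrier F" "q \<in> FC" "q \<noteq> (\<lambda>_. \<zero>)"
  shows "L \<mu> q \<noteq> (\<lambda>_. \<zero>)" "free_deg F q < free_deg F (L \<mu> q)"
proof -
  obtain w where w: "length w = free_deg F q" "q w \<noteq> \<zero>" using free_deg_top[OF assms(2,3)] by blast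
  then have "L \<mu> q (0 # w) \<noteq> \<zero>" using L_top[OF assms(1,2), of w] by simp
  moreover from this have "\<not> free_deg F (L \<mu> q) < length (0 # w)"
    using free_degD[OF L_FC[OF assms(1,2)], of "0 # w"] by blast
  ultimately show "L \<mu> q \<noteq> (\<lambda>_. \<zero>)" "free_deg F q < free_deg F (L \<mu> q)" using w by auto
qed

text \<open>The right ideals generated by the second letter and by x - \<mu> intersect in zero: a
  nonzero element of the latter has a top word that begins with 0.\<close>

lemma L_eq_letter:
  assumes "\<mu> \<in> carrier F" "s \<in> FC" "m \<in> FC" "conv F (X 1) m = L \<mu> s"
  shows "m = (\<lambda>_. \<zero>)"
proof -
  have "s = (\<lambda>_. \<zero>)"
  proof (rule ccontr)
    assume "s \<noteq> (\<lambda>_. \<zero>)"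
    then obtain w where w: "length w = free_deg F s" "s w \<noteq> \<zero>" using free_deg_top[OF assms(2)] by blast
    then have "L \<mu> s (0 # w) \<noteq> \<zero>" using L_top[OF assms(1,2), of w] by simp
    moreover have "conv F (X 1) m (0 # w) = \<zero>" using conv_letter_left[of m 1 0 w] assms(3) by simp
    ultimately show False using assms(4) by simp
  qed
  then have "L \<mu> s = (\<lambda>_. \<zero>)" using assms(1) by (intro ext) (simp add: L_def)
  then have "conv F (X 1) m = (\<lambda>_. \<zero>)" using assms(4) by simp
  then show ?thesis using FA_domain[of "X 1" m] assms by simp
qed

text \<open>Each scalar thus contributes at most one element to a coded set.\<close>

lemma cng_unique:
  assumes "cng \<mu> (conv F (X 1) m) (conv F (X 1) m')" "\<mu> \<in> carrier F" "m \<in> FC" "m' \<in> FC"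
  shows "m = m'"
proof -
  let ?d = "\<lambda>w. m w \<oplus> \<ominus> \<one> \<otimes> m' w"
  have d: "?d \<in> FC" using assms by (intro FA_add FA_smult) auto
  obtain s where s: "s \<in> FC" "\<forall>w. conv F (X 1) m w = conv F (X 1) m' w \<oplus> L \<mu> s w"
    using assms unfolding cng_def by blast
  have "conv F (X 1) ?d w = L \<mu> s w" for w
  proof -
    have c: "conv F (X 1) m' w \<in> carrier F" "L \<mu> s w \<in> carrier F" using assms s by auto
    have "conv F (X 1) ?d w = conv F (X 1) m w \<oplus> \<ominus> \<one> \<otimes> conv F (X 1) m' w"
      using assms conv_add_right[of "X 1" m "sml (\<ominus> \<one>) m'" w] conv_smult_right[of "\<ominus> \<one>" "X 1" m' w]
      by simp
    also have "\<dots> = L \<mu> s w" using s(2)[rule_format, of w] c by simp algebra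
    finally show ?thesis .
  qed
  then have "?d = (\<lambda>_. \<zero>)" using L_eq_letter[OF assms(2) s(1) d] by blast
  then have "m w \<oplus> \<ominus> \<one> \<otimes> m' w = \<zero>" for w by meson
  then have "m w = m' w" for w using assms(3,4) by (rule_tac eq_if_diff_zero) auto
  then show ?thesis by blast
qed

lemma coded_iff:
  assumes "c \<in> FC" "p \<in> FC" "m \<in> FC"
  shows "coded FA (X 0) (X 1) c p m \<longleftrightarrow>
    (\<exists>\<mu>\<in>carrier F. cng \<mu> p (\<lambda>_. \<zero>) \<and> cng \<mu> c (conv F (X 1) m))"
proof -
  have as: "conv F f (conv F g h) = conv F (conv F f g) h" if "f \<in> FC" "g \<in> FC" "h \<in> FC" for f g h
    using that conv_assoc[of f g h] by (auto simp: fun_eq_iff)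
  have sc: "scalar_rel FA (X 0) l \<longleftrightarrow> (\<exists>\<mu>\<in>carrier F. l = sml \<mu> (X 0))" if "l \<in> FC" for l
    using scalar_rel_iff[OF that] by simp
  \<comment> \<open>Both equations in \<open>coded\<close> carry a factor \<open>X 0\<close> on the
    right, which can be cancelled; what remains is the congruence modulo x - \<mu>.\<close>
  have key: "(\<lambda>w. conv F f (X 0) w \<oplus> conv F q (sml \<mu> (X 0)) w) =
        (\<lambda>w. conv F g (X 0) w \<oplus> conv F (X 0) (conv F q (X 0)) w) \<longleftrightarrow> (\<forall>w. f w = g w \<oplus> L \<mu> q w)"
    if "f \<in> FC" "g \<in> FC" "q \<in> FC" "\<mu> \<in> carrier F" for f g q \<mu>
  proof -
    have 1: "(\<lambda>w. conv F f (X 0) w \<oplus> conv F q (sml \<mu> (X 0)) w) = conv F (\<lambda>w. f w \<oplus> \<mu> \<otimes> q w) (X 0)"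
      using that by (auto simp: fun_eq_iff conv_add_left conv_smult_left conv_smult_right)
    have 2: "(\<lambda>w. conv F g (X 0) w \<oplus> conv F (X 0) (conv F q (X 0)) w) =
        conv F (\<lambda>w. g w \<oplus> conv F (X 0) q w) (X 0)"
      using that as[of "X 0" q "X 0"] by (auto simp: fun_eq_iff conv_add_left)
    have "conv F (\<lambda>w. f w \<oplus> \<mu> \<otimes> q w) (X 0) = conv F (\<lambda>w. g w \<oplus> conv F (X 0) q w) (X 0) \<longleftrightarrow>
       (\<lambda>w. f w \<oplus> \<mu> \<otimes> q w) = (\<lambda>w. g w \<oplus> conv F (X 0) q w)"
      using that conv_cancel_right[of "\<lambda>w. f w \<oplus> \<mu> \<otimes> q w" "\<lambda>w. g w \<oplus> conv F (X 0) q w" "X 0"] by auto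
    moreover have "f w \<oplus> \<mu> \<otimes> q w = g w \<oplus> conv F (X 0) q w \<longleftrightarrow> f w = g w \<oplus> L \<mu> q w" for w
    proof -
      have c: "f w \<in> carrier F" "g w \<in> carrier F" "q w \<in> carrier F" "conv F (X 0) q w \<in> carrier F"
        using that by auto
      show ?thesis unfolding L_def
      proof
        assume h: "f w \<oplus> \<mu> \<otimes> q w = g w \<oplus> conv F (X 0) q w"
        have "f w = (f w \<oplus> \<mu> \<otimes> q w) \<ominus> \<mu> \<otimes> q w" using c that(4) by algebra
        also have "\<dots> = g w \<oplus> (conv F (X 0) q w \<oplus> \<ominus> \<mu> \<otimes> q w)" unfolding h using c that(4) by algebra
        finally show "f w = g w \<oplus> (conv F (X 0) q w \<oplus> \<ominus> \<mu> \<otimes> q w)" .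
      next
        assume h: "f w = g w \<oplus> (conv F (X 0) q w \<oplus> \<ominus> \<mu> \<otimes> q w)"
        show "f w \<oplus> \<mu> \<otimes> q w = g w \<oplus> conv F (X 0) q w" unfolding h using c that(4) by algebra
      qed
    qed
    ultimately show ?thesis unfolding 1 2 by (auto simp: fun_eq_iff)
  qed
  have k1: "conv F p (X 0) \<oplus>\<^bsub>FA\<^esub> conv F q (sml \<mu> (X 0)) = conv F (X 0) (conv F q (X 0)) \<longleftrightarrow>
      (\<forall>w. p w = \<zero> \<oplus> L \<mu> q w)" if "q \<in> FC" "\<mu> \<in> carrier F" for q \<mu>
    using key[of p "\<lambda>_. \<zero>" q \<mu>] assms that by simp
  have k2: "conv F c (X 0) \<oplus>\<^bsub>FA\<^esub> conv F q (sml \<mu> (X 0)) =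
      conv F (X 1) (conv F m (X 0)) \<oplus>\<^bsub>FA\<^esub> conv F (X 0) (conv F q (X 0)) \<longleftrightarrow>
      (\<forall>w. c w = conv F (X 1) m w \<oplus> L \<mu> q w)" if "q \<in> FC" "\<mu> \<in> carrier F" for q \<mu>
    using key[of c "conv F (X 1) m" q \<mu>] as[of "X 1" m "X 0"] assms that by simp
  show ?thesis
  proof
    assume "coded FA (X 0) (X 1) c p m"
    then obtain l q s where *: "l \<in> FC" "q \<in> FC" "s \<in> FC" "scalar_rel FA (X 0) l"
      "conv F p (X 0) \<oplus>\<^bsub>FA\<^esub> conv F q l = conv F (X 0) (conv F q (X 0))"
      "conv F c (X 0) \<oplus>\<^bsub>FA\<^esub> conv F s l = conv F (X 1) (conv F m (X 0)) \<oplus>\<^bsub>FA\<^esub> conv F (X 0) (conv F s (X 0))"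
      unfolding coded_def free_alg_simps(1) by blast
    then obtain \<mu> where "\<mu> \<in> carrier F" "l = sml \<mu> (X 0)" using sc by blast
    then show "\<exists>\<mu>\<in>carrier F. cng \<mu> p (\<lambda>_. \<zero>) \<and> cng \<mu> c (conv F (X 1) m)"
      unfolding cng_def using k1[OF *(2)] k2[OF *(3)] * by blast
  next
    assume "\<exists>\<mu>\<in>carrier F. cng \<mu> p (\<lambda>_. \<zero>) \<and> cng \<mu> c (conv F (X 1) m)"
    then obtain \<mu> q s where *: "\<mu> \<in> carrier F" "q \<in> FC" "s \<in> FC" "\<forall>w. p w = \<zero> \<oplus> L \<mu> q w"
      "\<forall>w. c w = conv F (X 1) m w \<oplus> L \<mu> s w" unfolding cng_def by blast
    have l: "sml \<mu> (X 0) \<in> FC" "scalar_rel FA (X 0) (sml \<mu> (X 0))" using * sc by auto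
    show "coded FA (X 0) (X 1) c p m" unfolding coded_def free_alg_simps(1)
      by (rule bexI[OF _ l(1)], rule bexI[OF _ *(2)], rule bexI[OF _ *(3)])
        (use l(2) k1[OF *(2,1)] k2[OF *(3,1)] *(4,5) in blast)
  qed
qed
end

section \<open>Roots, and interpolation of finite sets\<close>

context free_algebra_fin
begin

lemma nonzero_inv: "\<alpha> \<in> carrier F \<Longrightarrow> \<alpha> \<noteq> \<zero> \<Longrightarrow> \<exists>\<beta>\<in>carrier F. \<beta> \<otimes> \<alpha> = \<one>"
  using field_Units by (metis Diff_iff Units_inv_closed Units_l_inv singletonD)

lemma minus_nonzero: "a \<in> carrier F \<Longrightarrow> b \<in> carrier F \<Longrightarrow> a \<noteq> b \<Longrightarrow> a \<ominus> b \<noteq> \<zero>"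
proof
  assume a: "a \<in> carrier F" "b \<in> carrier F" "a \<noteq> b" "a \<ominus> b = \<zero>"
  have "a = (a \<ominus> b) \<oplus> b" using a(1,2) by algebra
  then show False using a by simp
qed

lemma cng_zero_sml:
  assumes "cng \<mu> (sml \<alpha> f) (\<lambda>_. \<zero>)" "\<mu> \<in> carrier F" "\<alpha> \<in> carrier F" "\<alpha> \<noteq> \<zero>" "f \<in> FC"
  shows "cng \<mu> f (\<lambda>_. \<zero>)"
proof -
  obtain \<beta> where \<beta>: "\<beta> \<in> carrier F" "\<beta> \<otimes> \<alpha> = \<one>" using nonzero_inv assms by blast
  have "cng \<mu> (sml \<beta> (sml \<alpha> f)) (sml \<beta> (\<lambda>_. \<zero>))"
    by (rule cng_sml) (use assms \<beta> in auto)
  moreover have "sml \<beta> (sml \<alpha> f) = f"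
    using assms \<beta> by (intro ext) (simp add: m_assoc[symmetric])
  moreover have "sml \<beta> (\<lambda>_. \<zero>) = (\<lambda>_. \<zero>)" using \<beta> by simp
  ultimately show ?thesis by simp
qed

definition roots :: "(nat list \<Rightarrow> 'k) \<Rightarrow> 'k set" where
  "roots p = {\<mu> \<in> carrier F. cng \<mu> p (\<lambda>_. \<zero>)}"

text \<open>As for polynomials: from p = (x - \<nu>) q = (x - \<mu>) r follows (\<mu> - \<nu>) q =
  (x - \<mu>) (r - q), so each root other than \<nu> is a root of \<open>q\<close>, which has
  smaller degree.\<close>

lemma finite_roots: "p \<in> FC \<Longrightarrow> p \<noteq> (\<lambda>_. \<zero>) \<Longrightarrow> finite (roots p)"
proof (induction "free_deg F p" arbitrary: p rule: less_induct)
  case less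
  show ?case
  proof (cases "roots p = {}")
    case False
    then obtain \<nu> q where \<nu>: "\<nu> \<in> carrier F" and q: "q \<in> FC" "p = L \<nu> q"
      unfolding roots_def using cng_zeroD by blast
    have q0: "q \<noteq> (\<lambda>_. \<zero>)"
    proof
      assume "q = (\<lambda>_. \<zero>)"
      then have "L \<nu> q = (\<lambda>_. \<zero>)" using \<nu> by (intro ext) (simp add: L_def)
      then show False using q less.prems by simp
    qed
    have fin: "finite (roots q)" using less.hyps[OF _ q(1) q0] L_nonzero[OF \<nu> q(1) q0] q(2) by simp
    have "roots p \<subseteq> insert \<nu> (roots q)"
    proof
      fix \<mu> assume "\<mu> \<in> roots p"
      then obtain r where \<mu>: "\<mu> \<in> carrier F" and r: "r \<in> FC" "p = L \<mu> r"
        unfolding roots_def using cng_zeroD by blast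
      show "\<mu> \<in> insert \<nu> (roots q)"
      proof (cases "\<mu> = \<nu>")
        case False
        let ?\<gamma> = "\<mu> \<ominus> \<nu>"
        have \<gamma>: "?\<gamma> \<in> carrier F" "?\<gamma> \<noteq> \<zero>" using \<mu> \<nu> False minus_nonzero by auto
        have "?\<gamma> \<otimes> q w = \<zero> \<oplus> L \<mu> (\<lambda>w. r w \<oplus> \<ominus> \<one> \<otimes> q w) w" for w
        proof -
          have "L \<mu> (\<lambda>w. r w \<oplus> \<ominus> \<one> \<otimes> q w) w = L \<mu> r w \<oplus> \<ominus> \<one> \<otimes> L \<mu> q w"
            using \<mu> r q L_add[of \<mu> r "sml (\<ominus> \<one>) q" w] L_sml[of \<mu> "\<ominus> \<one>" q w] by simp
          also have "L \<mu> r w = L \<mu> q w \<oplus> ?\<gamma> \<otimes> q w"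
            using fun_cong[OF trans[OF q(2)[symmetric] r(2)], of w] L_change[OF \<nu> \<mu> q(1)] by simp
          also have "L \<mu> q w \<oplus> ?\<gamma> \<otimes> q w \<oplus> \<ominus> \<one> \<otimes> L \<mu> q w = ?\<gamma> \<otimes> q w"
          proof -
            have "L \<mu> q w \<in> carrier F" "q w \<in> carrier F" using \<mu> q by auto
            then show ?thesis using \<mu> \<nu> by algebra
          qed
          finally have "L \<mu> (\<lambda>w. r w \<oplus> \<ominus> \<one> \<otimes> q w) w = ?\<gamma> \<otimes> q w" .
          then show ?thesis using \<gamma> q(1) by simp
        qed
        moreover have "(\<lambda>w. r w \<oplus> \<ominus> \<one> \<otimes> q w) \<in> FC" using r q by (intro FA_add FA_smult) auto
        ultimately have "cng \<mu> (sml ?\<gamma> q) (\<lambda>_. \<zero>)" unfolding cng_def by blast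
        then have "cng \<mu> q (\<lambda>_. \<zero>)" using cng_zero_sml \<mu> \<gamma> q(1) by blast
        then show ?thesis using \<mu> by (simp add: roots_def)
      qed simp
    qed
    then show ?thesis using fin finite_subset by blast
  qed simp
qed

text \<open>There are finitely many roots of \<open>p\<close>, and \<open>cng_unique\<close> leaves
  one element for each.\<close>

lemma finite_coded:
  assumes "c \<in> FC" "p \<in> FC" "p \<noteq> (\<lambda>_. \<zero>)"
  shows "finite {m \<in> FC. coded FA (X 0) (X 1) c p m}"
proof -
  have "finite {m \<in> FC. cng \<mu> c (conv F (X 1) m)}" if \<mu>: "\<mu> \<in> carrier F" for \<mu>
  proof (cases "\<exists>m. m \<in> FC \<and> cng \<mu> c (conv F (X 1) m)")
    case True
    then obtain m where m: "m \<in> FC" "cng \<mu> c (conv F (X 1) m)" by blast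
    have "m' = m" if m': "m' \<in> FC" "cng \<mu> c (conv F (X 1) m')" for m'
    proof (rule cng_unique[OF _ \<mu> m'(1) m(1)])
      show "cng \<mu> (conv F (X 1) m') (conv F (X 1) m)"
        by (rule cng_trans[OF cng_sym[OF m'(2) \<mu>] m(2) \<mu>]) (use assms m m' in auto)
    qed
    then have "{m \<in> FC. cng \<mu> c (conv F (X 1) m)} \<subseteq> {m}" by blast
    then show ?thesis using finite_subset by blast
  next
    case False
    then have "{m \<in> FC. cng \<mu> c (conv F (X 1) m)} = {}" by blast
    then show ?thesis by (simp only: finite.emptyI)
  qed
  then have "finite (\<Union>\<mu>\<in>roots p. {m \<in> FC. cng \<mu> c (conv F (X 1) m)})"
    using finite_roots[OF assms(2,3)] by (intro finite_UN_I) (auto simp: roots_def)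
  moreover have "{m \<in> FC. coded FA (X 0) (X 1) c p m} \<subseteq>
      (\<Union>\<mu>\<in>roots p. {m \<in> FC. cng \<mu> c (conv F (X 1) m)})"
    using coded_iff[OF assms(1,2)] unfolding roots_def by blast
  ultimately show ?thesis using finite_subset by blast
qed

text \<open>In c = y m + (x - \<mu>) s, words that begin with the first letter bound the degree of
  \<open>s\<close>, and words that begin with the second one then bound \<open>m\<close>. This
  permits decoding by recursion on the degree.\<close>

lemma cng_deg:
  assumes "cng \<mu> c (conv F (X 1) m)" "\<mu> \<in> carrier F" "c \<in> FC" "m \<in> FC"
  shows "free_deg F m \<le> free_deg F c"
proof -
  obtain s where s: "s \<in> FC" "\<And>w. c w = conv F (X 1) m w \<oplus> L \<mu> s w"
    using assms(1) unfolding cng_def by blast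
  have sz: "s w = \<zero>" if "free_deg F c \<le> length w" for w
  proof (rule ccontr)
    assume "s w \<noteq> \<zero>"
    then have s0: "s \<noteq> (\<lambda>_. \<zero>)" and le: "length w \<le> free_deg F s"
      using free_degD[OF s(1), of w] leI by auto
    obtain v where v: "length v = free_deg F s" "s v \<noteq> \<zero>" using free_deg_top[OF s(1) s0] by blast
    have "conv F (X 1) m (0 # v) = \<zero>" using conv_letter_left[of m 1 0 v] assms(4) by simp
    then have "c (0 # v) = s v" using s L_top[OF assms(2) s(1), of v] v by simp
    then show False using free_degD[OF assms(3), of "0 # v"] v le that by auto
  qed
  show ?thesis
  proof (rule free_deg_le)
    fix w :: "nat list" assume w: "free_deg F c < length w"
    have "c (1 # w) = \<zero>" using free_degD[OF assms(3), of "1 # w"] w by simp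
    moreover have "L \<mu> s (1 # w) = \<zero>"
      using conv_letter_left[of s 0 1 w] sz[of "1 # w"] s(1) assms(2) w by (simp add: L_def)
    moreover have "conv F (X 1) m (1 # w) = m w" using conv_letter_left[of m 1 1 w] assms(4) by simp
    ultimately show "m w = \<zero>" using s(2)[of "1 # w"] assms(4) by simp
  qed
qed

text \<open>Abstracts the product of the operators \<open>L \<mu>\<close> over \<open>\<mu> \<in> \<Lambda>\<close>: modulo \<open>x - \<mu>\<close> it is
  multiplication by a scalar, which vanishes exactly when \<open>\<mu> \<in> \<Lambda>\<close>.\<close>

definition annihilator :: "((nat list \<Rightarrow> 'k) \<Rightarrow> nat list \<Rightarrow> 'k) \<Rightarrow> 'k set \<Rightarrow> bool" where
  "annihilator T \<Lambda> \<longleftrightarrow> (\<forall>d\<in>FC. T d \<in> FC) \<and> (\<forall>d\<in>FC. \<forall>\<mu>\<in>\<Lambda>. cng \<mu> (T d) (\<lambda>_. \<zero>)) \<and>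
     (\<forall>\<mu>\<in>carrier F. \<exists>\<alpha>\<in>carrier F. (\<mu> \<notin> \<Lambda> \<longrightarrow> \<alpha> \<noteq> \<zero>) \<and> (\<forall>d\<in>FC. cng \<mu> (T d) (sml \<alpha> d)))"

lemma annihilator_empty: "annihilator (\<lambda>d. d) {}"
  unfolding annihilator_def
proof (intro conjI ballI)
  fix \<mu> assume \<mu>: "\<mu> \<in> carrier F"
  have "cng \<mu> d (sml \<one> d)" if "d \<in> FC" for d
  proof -
    have "sml \<one> d = d" using that by (intro ext) simp
    then show ?thesis using cng_refl[OF that \<mu>] by simp
  qed
  then show "\<exists>\<alpha>\<in>carrier F. (\<mu> \<notin> {} \<longrightarrow> \<alpha> \<noteq> \<zero>) \<and> (\<forall>d\<in>FC. cng \<mu> d (sml \<alpha> d))"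
    by (intro bexI[OF _ one_closed] conjI impI ballI) (simp_all only: one_not_zero not_False_eq_True)
qed auto

lemma cng_L_cong:
  assumes "cng \<nu> f (\<lambda>_. \<zero>)" "\<nu> \<in> carrier F" "\<mu> \<in> carrier F" "f \<in> FC"
  shows "cng \<nu> (L \<mu> f) (\<lambda>_. \<zero>)"
proof -
  obtain s where s: "s \<in> FC" "f = L \<nu> s" using cng_zeroD[OF assms(1,2)] by blast
  have "L \<mu> f = L \<nu> (L \<mu> s)" unfolding s(2) using L_commute[OF assms(3,2) s(1)] by blast
  then show ?thesis using cng_L[of \<nu> "L \<mu> s"] assms s by simp
qed

text \<open>Modulo x - \<nu> the operator \<open>L \<mu>\<close> is multiplication by \<nu> - \<mu>,
  and the scalars of a composition multiply.\<close>

lemma annihilator_insert: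
  assumes T: "annihilator T \<Lambda>" and \<mu>: "\<mu> \<in> carrier F" and \<Lambda>: "\<Lambda> \<subseteq> carrier F"
  shows "annihilator (\<lambda>d. L \<mu> (T d)) (insert \<mu> \<Lambda>)"
  unfolding annihilator_def
proof (intro conjI ballI)
  fix d assume d: "d \<in> FC"
  have Td: "T d \<in> FC" using T d unfolding annihilator_def by blast
  then show "L \<mu> (T d) \<in> FC" using \<mu> by simp
  fix \<nu> assume \<nu>: "\<nu> \<in> insert \<mu> \<Lambda>"
  show "cng \<nu> (L \<mu> (T d)) (\<lambda>_. \<zero>)"
  proof (cases "\<nu> = \<mu>")
    case True
    then show ?thesis using cng_L[OF \<mu> Td] by simp
  next
    case False
    then have "\<nu> \<in> \<Lambda>" using \<nu> by blast
    then have "cng \<nu> (T d) (\<lambda>_. \<zero>)" using T d unfolding annihilator_def by blast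
    then show ?thesis using cng_L_cong \<mu> \<Lambda> \<open>\<nu> \<in> \<Lambda>\<close> Td by blast
  qed
next
  fix \<nu> assume \<nu>: "\<nu> \<in> carrier F"
  obtain \<alpha> where \<alpha>: "\<alpha> \<in> carrier F" "\<nu> \<notin> \<Lambda> \<Longrightarrow> \<alpha> \<noteq> \<zero>" "\<And>d. d \<in> FC \<Longrightarrow> cng \<nu> (T d) (sml \<alpha> d)"
    using T \<nu> unfolding annihilator_def by blast
  let ?\<gamma> = "\<nu> \<ominus> \<mu>"
  have \<gamma>: "?\<gamma> \<in> carrier F" "\<nu> \<noteq> \<mu> \<Longrightarrow> ?\<gamma> \<noteq> \<zero>" using \<nu> \<mu> minus_nonzero by auto
  have "cng \<nu> (L \<mu> (T d)) (sml (?\<gamma> \<otimes> \<alpha>) d)" if d: "d \<in> FC" for d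
  proof -
    have Td: "T d \<in> FC" using T d unfolding annihilator_def by blast
    have 1: "cng \<nu> (L \<mu> (T d)) (sml ?\<gamma> (T d))"
      unfolding cng_def using Td L_change[OF \<mu> \<nu> Td] \<nu> \<gamma>(1)
      by (intro bexI[of _ "T d"]) (auto simp: a_comm)
    have "cng \<nu> (sml ?\<gamma> (T d)) (sml ?\<gamma> (sml \<alpha> d))"
      by (rule cng_sml[OF \<alpha>(3)[OF d] \<nu> \<gamma>(1) Td]) (use \<alpha>(1) d in simp)
    moreover have "sml ?\<gamma> (sml \<alpha> d) = sml (?\<gamma> \<otimes> \<alpha>) d" using \<gamma>(1) \<alpha>(1) d by (intro ext) (simp add: m_assoc)
    ultimately show ?thesis
      using cng_trans[OF 1 _ \<nu>, of "sml (?\<gamma> \<otimes> \<alpha>) d"] Td d \<mu> \<gamma>(1) \<alpha>(1) by simp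
  qed
  moreover have "?\<gamma> \<otimes> \<alpha> \<noteq> \<zero>" if "\<nu> \<notin> insert \<mu> \<Lambda>"
    using that \<alpha>(1,2) \<gamma> integral by blast
  ultimately show "\<exists>\<alpha>\<in>carrier F. (\<nu> \<notin> insert \<mu> \<Lambda> \<longrightarrow> \<alpha> \<noteq> \<zero>) \<and> (\<forall>d\<in>FC. cng \<nu> (L \<mu> (T d)) (sml \<alpha> d))"
    using \<gamma>(1) \<alpha>(1) by (intro bexI[of _ "?\<gamma> \<otimes> \<alpha>"]) auto
qed

text \<open>The product of the x - \<mu> would be \<open>T\<close> applied to 1, which does not
  exist. \<open>X 0\<close> replaces 1: it lies in none of the right ideals, since a nonzero
  multiple of x - \<mu> has degree at least 2.\<close>

lemma annihilator_roots:
  assumes "annihilator T \<Lambda>" "\<Lambda> \<subseteq> carrier F" shows "roots (T (X 0)) = \<Lambda>"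
proof
  show "\<Lambda> \<subseteq> roots (T (X 0))" using assms X_FC(1) unfolding annihilator_def roots_def by blast
  show "roots (T (X 0)) \<subseteq> \<Lambda>"
  proof
    fix \<mu> assume "\<mu> \<in> roots (T (X 0))"
    then have \<mu>: "\<mu> \<in> carrier F" "cng \<mu> (T (X 0)) (\<lambda>_. \<zero>)" by (auto simp: roots_def)
    show "\<mu> \<in> \<Lambda>"
    proof (rule ccontr)
      assume "\<mu> \<notin> \<Lambda>"
      then obtain \<alpha> where \<alpha>: "\<alpha> \<in> carrier F" "\<alpha> \<noteq> \<zero>" "cng \<mu> (T (X 0)) (sml \<alpha> (X 0))"
        using assms(1) \<mu>(1) X_FC(1) unfolding annihilator_def by blast
      have Tx: "T (X 0) \<in> FC" using assms X_FC(1) unfolding annihilator_def by blast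
      have "cng \<mu> (sml \<alpha> (X 0)) (\<lambda>_. \<zero>)"
        by (rule cng_trans[OF cng_sym[OF \<alpha>(3) \<mu>(1)] \<mu>(2) \<mu>(1)]) (use Tx \<alpha> in auto)
      then have "cng \<mu> (X 0) (\<lambda>_. \<zero>)" using cng_zero_sml \<mu> \<alpha> X_FC(1) by blast
      then obtain s where s: "s \<in> FC" "X 0 = L \<mu> s" using cng_zeroD \<mu> by blast
      have "L \<mu> (\<lambda>_. \<zero>) = (\<lambda>_. \<zero>)" using \<mu>(1) by (intro ext) (simp add: L_def)
      then have "s \<noteq> (\<lambda>_. \<zero>)" using letter_nonzero[of 0] s(2) by metis
      then have "free_deg F s < free_deg F (X 0)" "0 < free_deg F s"
        using L_nonzero[OF \<mu>(1) s(1)] s free_deg_pos by auto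
      then show False using deg_letter[of 0] n_ge_2 by simp
    qed
  qed
qed

lemma coded_roots:
  "c \<in> FC \<Longrightarrow> p \<in> FC \<Longrightarrow> m \<in> FC \<Longrightarrow>
    coded FA (X 0) (X 1) c p m \<longleftrightarrow> (\<exists>\<mu>\<in>roots p. cng \<mu> c (conv F (X 1) m))"
  using coded_iff unfolding roots_def by blast

text \<open>The congruence is required at all scalars, not only at the nodes in \<Lambda>: a node
  added later must already find \<open>c\<close> congruent to some multiple of the second
  letter.\<close>

definition interpolates where
  "interpolates \<Lambda> T c S \<longleftrightarrow> finite \<Lambda> \<and> \<Lambda> \<subseteq> carrier F \<and> annihilator T \<Lambda> \<and> T (X 0) \<noteq> (\<lambda>_. \<zero>) \<and> c \<in> FC \<and>
     (\<forall>\<mu>\<in>carrier F. \<exists>m\<in>FC. cng \<mu> c (conv F (X 1) m)) \<and>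
     (\<forall>m\<in>FC. (\<exists>\<mu>\<in>\<Lambda>. cng \<mu> c (conv F (X 1) m)) \<longleftrightarrow> m \<in> S)"

text \<open>Newton interpolation. The correction \<open>T (y e)\<close> vanishes at the old nodes
  and can be adjusted freely at one new node.\<close>

lemma interpolates_exist:
  assumes "infinite (carrier F)" "finite S" "S \<subseteq> FC"
  shows "\<exists>\<Lambda> T c. interpolates \<Lambda> T c S"
  using assms(2,3)
proof (induction S)
  case empty
  have "cng \<mu> (\<lambda>_. \<zero>) (conv F (X 1) (\<lambda>_. \<zero>))" if "\<mu> \<in> carrier F" for \<mu>
  proof -
    have "conv F (X 1) (\<lambda>_. \<zero>) = (\<lambda>_. \<zero>)" by (intro ext) simp
    then show ?thesis using cng_refl[of "\<lambda>_. \<zero>" \<mu>] that by simp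
  qed
  then have "interpolates {} (\<lambda>d. d) (\<lambda>_. \<zero>) {}"
    unfolding interpolates_def using annihilator_empty letter_nonzero FA_zero
    by (intro conjI ballI bexI[of _ "\<lambda>_. \<zero>"]) simp_all
  then show ?case by blast
next
  case (insert m0 S)
  then obtain \<Lambda> T c where ip: "interpolates \<Lambda> T c S" by auto
  then have \<Lambda>: "finite \<Lambda>" "\<Lambda> \<subseteq> carrier F" and T: "annihilator T \<Lambda>" "T (X 0) \<noteq> (\<lambda>_. \<zero>)"
    and c: "c \<in> FC" by (auto simp: interpolates_def)
  have good: "\<exists>m\<in>FC. cng \<mu> c (conv F (X 1) m)" if "\<mu> \<in> carrier F" for \<mu>
    using ip that unfolding interpolates_def by blast
  have S: "(\<exists>\<mu>\<in>\<Lambda>. cng \<mu> c (conv F (X 1) m)) \<longleftrightarrow> m \<in> S" if "m \<in> FC" for m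
    using ip that unfolding interpolates_def by blast
  have m0: "m0 \<in> FC" using insert.prems by simp
  have Tc: "T d \<in> FC" if "d \<in> FC" for d using T(1) that unfolding annihilator_def by blast
  obtain \<mu> where \<mu>: "\<mu> \<in> carrier F" "\<mu> \<notin> \<Lambda>" using assms(1) \<Lambda> by (meson ex_new_if_finite finite_subset subsetI)
  obtain m1 where m1: "m1 \<in> FC" "cng \<mu> c (conv F (X 1) m1)" using good \<mu> by blast
  obtain \<alpha> where \<alpha>: "\<alpha> \<in> carrier F" "\<alpha> \<noteq> \<zero>" "\<And>d. d \<in> FC \<Longrightarrow> cng \<mu> (T d) (sml \<alpha> d)"
    using T(1) \<mu> unfolding annihilator_def by blast
  obtain \<beta> where \<beta>: "\<beta> \<in> carrier F" "\<beta> \<otimes> \<alpha> = \<one>" using nonzero_inv \<alpha> by blast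
  \<comment> \<open>\<beta> inverts the scalar \<alpha> by which \<open>T\<close> acts at the new
    node, so the correction adds y (m0 - m1) to the present residue y m1 there.\<close>
  define e where "e = sml \<beta> (\<lambda>w. m0 w \<oplus> \<ominus> \<one> \<otimes> m1 w)"
  have dm: "(\<lambda>w. m0 w \<oplus> \<ominus> \<one> \<otimes> m1 w) \<in> FC" using m0 m1 by (intro FA_add FA_smult) auto
  have e: "e \<in> FC" unfolding e_def using dm \<beta>(1) by (rule FA_smult[rotated])
  have Xm: "conv F (X 1) m \<in> FC" if "m \<in> FC" for m using that by (intro FA_mult) auto
  define c' where "c' = (\<lambda>w. c w \<oplus> T (conv F (X 1) e) w)"
  have Te: "T (conv F (X 1) e) \<in> FC" using Tc Xm e by blast
  have c': "c' \<in> FC" unfolding c'_def using c Te by (rule FA_add)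
  have sX: "sml \<gamma> (conv F (X 1) m) = conv F (X 1) (sml \<gamma> m)" if "\<gamma> \<in> carrier F" "m \<in> FC" for \<gamma> m
    using that by (auto simp: fun_eq_iff conv_smult_right)
  have aX: "(\<lambda>w. conv F (X 1) m w \<oplus> conv F (X 1) m' w) = conv F (X 1) (\<lambda>w. m w \<oplus> m' w)"
    if "m \<in> FC" "m' \<in> FC" for m m'
    using that by (auto simp: fun_eq_iff conv_add_right)
  have old: "cng \<nu> c' (conv F (X 1) m) \<longleftrightarrow> cng \<nu> c (conv F (X 1) m)" if "\<nu> \<in> \<Lambda>" "m \<in> FC" for \<nu> m
  proof -
    have \<nu>: "\<nu> \<in> carrier F" using that \<Lambda> by blast
    have "cng \<nu> (T (conv F (X 1) e)) (\<lambda>_. \<zero>)" using T(1) that(1) Xm[OF e] unfolding annihilator_def by blast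
    from cng_add[OF cng_refl[OF c \<nu>] this \<nu> c c Te FA_zero]
    have 1: "cng \<nu> c' c" unfolding c'_def using c by simp
    show ?thesis
      using cng_trans[OF 1 _ \<nu> c' c, of "conv F (X 1) m"]
        cng_trans[OF cng_sym[OF 1 \<nu> c' c] _ \<nu> c c', of "conv F (X 1) m"] Xm[OF that(2)] by blast
  qed
  have gd: "cng \<nu> c' (conv F (X 1) (\<lambda>w. m w \<oplus> \<gamma> \<otimes> e w))"
    if "cng \<nu> c (conv F (X 1) m)" "\<And>d. d \<in> FC \<Longrightarrow> cng \<nu> (T d) (sml \<gamma> d)" "\<nu> \<in> carrier F" "m \<in> FC" "\<gamma> \<in> carrier F"
    for \<nu> m \<gamma>
  proof -
    have "cng \<nu> (T (conv F (X 1) e)) (conv F (X 1) (sml \<gamma> e))" using that(2)[OF Xm[OF e]] sX[OF that(5) e] by simp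
    from cng_add[OF that(1) this that(3) c Xm[OF that(4)] Te Xm[OF FA_smult[OF that(5) e]]]
    show ?thesis unfolding c'_def using aX[OF that(4) FA_smult[OF that(5) e]] by simp
  qed
  have "\<exists>m\<in>FC. cng \<nu> c' (conv F (X 1) m)" if \<nu>: "\<nu> \<in> carrier F" for \<nu>
  proof -
    obtain m where m: "m \<in> FC" "cng \<nu> c (conv F (X 1) m)" using good \<nu> by blast
    obtain \<gamma> where \<gamma>: "\<gamma> \<in> carrier F" "\<And>d. d \<in> FC \<Longrightarrow> cng \<nu> (T d) (sml \<gamma> d)"
      using T(1) \<nu> unfolding annihilator_def by blast
    show ?thesis using gd[OF m(2) \<gamma>(2) \<nu> m(1) \<gamma>(1)] FA_add[OF m(1) FA_smult[OF \<gamma>(1) e]] by blast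
  qed
  moreover have new: "cng \<mu> c' (conv F (X 1) m0)"
  proof -
    have "m1 w \<oplus> \<alpha> \<otimes> e w = m0 w" for w
    proof -
      have k: "m0 w \<in> carrier F" "m1 w \<in> carrier F" using m0 m1 by auto
      have "\<alpha> \<otimes> e w = \<beta> \<otimes> \<alpha> \<otimes> (m0 w \<oplus> \<ominus> \<one> \<otimes> m1 w)"
        unfolding e_def using k \<alpha>(1) \<beta>(1) by algebra
      then have "m1 w \<oplus> \<alpha> \<otimes> e w = m1 w \<oplus> (m0 w \<oplus> \<ominus> \<one> \<otimes> m1 w)" using \<beta>(2) k by simp
      also have "\<dots> = m0 w" using k by algebra
      finally show ?thesis .
    qed
    then show ?thesis using gd[OF m1(2) \<alpha>(3) \<mu>(1) m1(1) \<alpha>(1)] by simp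
  qed
  moreover have "(\<exists>\<nu>\<in>insert \<mu> \<Lambda>. cng \<nu> c' (conv F (X 1) m)) \<longleftrightarrow> m \<in> insert m0 S" if m: "m \<in> FC" for m
  proof -
    have "cng \<mu> c' (conv F (X 1) m) \<longleftrightarrow> m = m0"
    proof
      assume a: "cng \<mu> c' (conv F (X 1) m)"
      show "m = m0"
        by (rule cng_unique[OF cng_trans[OF cng_sym[OF a \<mu>(1) c' Xm[OF m]] new \<mu>(1) Xm[OF m] c' Xm[OF m0]]
              \<mu>(1) m m0])
    qed (use new in simp)
    then show ?thesis using old[OF _ m] S[OF m] by blast
  qed
  moreover have "L \<mu> (T (X 0)) \<noteq> (\<lambda>_. \<zero>)" using L_nonzero(1)[OF \<mu>(1) Tc[OF X_FC(1)] T(2)] .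
  ultimately have "interpolates (insert \<mu> \<Lambda>) (\<lambda>d. L \<mu> (T d)) c' (insert m0 S)"
    unfolding interpolates_def using annihilator_insert[OF T(1) \<mu>(1) \<Lambda>(2)] \<Lambda> \<mu>(1) c' by blast
  then show ?case by blast
qed

lemma interpolation:
  assumes "infinite (carrier F)" "finite S" "S \<subseteq> FC"
  shows "\<exists>c\<in>FC. \<exists>p\<in>FC. p \<noteq> (\<lambda>_. \<zero>) \<and> (\<forall>m\<in>FC. coded FA (X 0) (X 1) c p m \<longleftrightarrow> m \<in> S)"
proof -
  obtain \<Lambda> T c where *: "\<Lambda> \<subseteq> carrier F" "annihilator T \<Lambda>" "T (X 0) \<noteq> (\<lambda>_. \<zero>)" "c \<in> FC"
     "\<forall>m\<in>FC. (\<exists>\<mu>\<in>\<Lambda>. cng \<mu> c (conv F (X 1) m)) \<longleftrightarrow> m \<in> S"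
    using interpolates_exist[OF assms] unfolding interpolates_def by blast
  have T: "T (X 0) \<in> FC" using *(2) X_FC(1) unfolding annihilator_def by blast
  show ?thesis using *(3,4,5) T coded_roots[OF *(4) T] annihilator_roots[OF *(2,1)]
    by (intro bexI[of _ c] bexI[of _ "T (X 0)"]) auto
qed

lemma ax_sets_letters: "infinite (carrier F) \<Longrightarrow> ax_sets FA (X 0) (X 1)"
  unfolding ax_sets_def free_alg_simps(2)
proof (intro conjI ballI impI)
  assume inf: "infinite (carrier F)"
  show "\<exists>c\<in>FC. \<exists>p\<in>FC. p \<noteq> (\<lambda>_. \<zero>) \<and> (\<forall>m\<in>FC. \<not> coded FA (X 0) (X 1) c p m)"
    using interpolation[OF inf, of "{}"] by simp
  fix c p m assume a: "c \<in> FC" "p \<in> FC" "m \<in> FC" "p \<noteq> (\<lambda>_. \<zero>)"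
  show "\<exists>c'\<in>FC. \<exists>p'\<in>FC. p' \<noteq> (\<lambda>_. \<zero>) \<and>
      (\<forall>m'\<in>FC. coded FA (X 0) (X 1) c' p' m' = (coded FA (X 0) (X 1) c p m' \<or> m' = m))"
    using interpolation[OF inf, of "insert m {m \<in> FC. coded FA (X 0) (X 1) c p m}"]
      finite_coded[OF a(1,2,4)] a(3) by auto
qed

section \<open>Verification of the axioms for the letters\<close>

lemma decomp_FA:
  "k \<le> n \<Longrightarrow> s \<in> FC \<Longrightarrow> (\<And>i w. k \<le> i \<Longrightarrow> s (i # w) = \<zero>) \<Longrightarrow> (\<And>i. i < k \<Longrightarrow> Q (child i s)) \<Longrightarrow>
    decomp FA X k Q s"
proof (induction k arbitrary: s)
  case 0
  then have "s w = \<zero>" for w by (cases w) auto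
  then show ?case by auto
next
  case (Suc k)
  \<comment> \<open>The part of \<open>s\<close> on words that begin with a letter below
    \<open>k\<close>; the letter \<open>k\<close> itself is split off.\<close>
  let ?r = "\<lambda>w. case w of [] \<Rightarrow> \<zero> | i # v \<Rightarrow> if i < k then s w else \<zero>"
  have rc: "coeffs ?r" using Suc.prems(2) by (auto split: list.split)
  have r: "?r \<in> FC"
  proof (rule FC_I[where k = "free_deg F s", OF rc])
    show "set w \<subseteq> {..<n}" if "?r w \<noteq> \<zero>" for w
      using that FC_set[OF Suc.prems(2), of w] by (auto split: list.splits if_splits)
    show "?r w = \<zero>" if "free_deg F s < length w" for w
      using free_degD[OF Suc.prems(2) that] by (auto split: list.splits)
  qed simp
  have eq: "s = sml (s [k]) (X k) \<oplus>\<^bsub>FA\<^esub> (X k \<otimes>\<^bsub>FA\<^esub> child k s \<oplus>\<^bsub>FA\<^esub> ?r)"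
  proof
    fix w show "s w = (sml (s [k]) (X k) \<oplus>\<^bsub>FA\<^esub> (X k \<otimes>\<^bsub>FA\<^esub> child k s \<oplus>\<^bsub>FA\<^esub> ?r)) w"
    proof (cases w)
      case Nil
      then show ?thesis using Suc.prems(1,2) by (simp add: letter_def)
    next
      case (Cons i v)
      have "conv F (X k) (child k s) (i # v) = (if k = i then child k s v else \<zero>)"
        using Suc.prems(2) by (simp add: conv_letter_left)
      moreover have "s (i # v) = \<zero>" if "i > k" using Suc.prems(3)[of i v] that by simp
      ultimately show ?thesis using Cons Suc.prems(2)
        by (cases "i < k"; cases "i = k"; cases "v = []") (auto simp: letter_def child_def)
    qed
  qed
  have ch: "child i ?r = child i s" if "i < k" for i
    using that by (auto simp: child_def fun_eq_iff)
  have "decomp FA X k Q ?r"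
    by (rule Suc.IH[OF _ r]) (use Suc.prems(1,4) ch in \<open>auto\<close>)
  moreover have "scalar_rel FA (X k) (sml (s [k]) (X k))" "sml (s [k]) (X k) \<in> FC"
    using scalar_rel_smult[of "s [k]" "X k"] Suc.prems(1,2) by auto
  ultimately show ?case unfolding decomp.simps
    using eq r child_FC[OF Suc.prems(2), of k] Suc.prems(4)[of k]
    by (intro bexI[of _ "sml (s [k]) (X k)"] bexI[of _ "child k s"] bexI[of _ ?r]) auto
qed

lemma decomp_FA_D:
  "decomp FA X k Q s \<Longrightarrow> k \<le> n \<Longrightarrow> s \<in> FC \<and> (\<forall>i w. k \<le> i \<longrightarrow> s (i # w) = \<zero>)"
proof (induction k arbitrary: s)
  case (Suc k)
  then obtain t a r where *: "t \<in> FC" "a \<in> FC" "r \<in> FC" "scalar_rel FA (X k) t"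
    "s = t \<oplus>\<^bsub>FA\<^esub> (X k \<otimes>\<^bsub>FA\<^esub> a \<oplus>\<^bsub>FA\<^esub> r)" "decomp FA X k Q r" unfolding decomp.simps by blast
  have r: "r (i # w) = \<zero>" if "k \<le> i" for i w using Suc.IH[OF *(6)] Suc.prems(2) that by simp
  obtain \<alpha> where \<alpha>: "\<alpha> \<in> carrier F" "t = sml \<alpha> (X k)"
    using scalar_rel_iff[OF *(1)] *(4) Suc.prems(2) by auto
  have Xk: "X k \<in> FC" using Suc.prems(2) by simp
  have "s \<in> FC" unfolding *(5) using * Xk by simp
  moreover have "s (i # w) = \<zero>" if "Suc k \<le> i" for i w
    unfolding *(5) using r[of i w] conv_letter_left[of a k i w] *(2) \<alpha> that by (simp add: letter_def)
  ultimately show ?case by blast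
qed auto

lemma ax_unique_letters: "k < n \<Longrightarrow> ax_unique FA X k"
  unfolding ax_unique_def free_alg_simps(2)
proof (intro conjI ballI impI; (elim conjE)?)
  fix t a s assume k: "k < n" and f: "t \<in> FC" "a \<in> FC" "s \<in> FC" and sc: "scalar_rel FA (X k) t"
    and d: "decomp FA X k (\<lambda>_. True) s" and e: "t \<oplus>\<^bsub>FA\<^esub> (X k \<otimes>\<^bsub>FA\<^esub> a \<oplus>\<^bsub>FA\<^esub> s) = (\<lambda>_. \<zero>)"
  obtain \<alpha> where \<alpha>: "\<alpha> \<in> carrier F" "t = sml \<alpha> (X k)"
    using scalar_rel_iff[OF f(1)] sc k by auto
  have s: "s (k # w) = \<zero>" for w using decomp_FA_D[OF d] k by simp
  have ew: "\<alpha> \<otimes> X k (k # w) \<oplus> a w = \<zero>" for w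
    using fun_cong[OF e, of "k # w"] conv_letter_left[of a k k w] f s \<alpha> by simp
  have \<alpha>0: "\<alpha> = \<zero>" using ew[of "[]"] \<alpha>(1) f by (simp add: letter_def)
  then have "a w = \<zero>" for w using ew[of w] f by simp
  then show "t = (\<lambda>_. \<zero>)" "a = (\<lambda>_. \<zero>)" using \<alpha> \<alpha>0 by auto
qed simp

lemma ax_inverse_letter: "ax_inverse FA (X 0)"
  unfolding ax_inverse_def free_alg_simps(2)
proof (intro ballI impI; elim conjE)
  fix l assume l: "l \<in> FC" "scalar_rel FA (X 0) l" "l \<noteq> (\<lambda>_. \<zero>)"
  obtain \<alpha> where \<alpha>: "\<alpha> \<in> carrier F" "l = sml \<alpha> (X 0)"
    using scalar_rel_iff[OF l(1)] l(2) by auto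
  then have "\<alpha> \<noteq> \<zero>" using l(3) by auto
  then obtain \<beta> where \<beta>: "\<beta> \<in> carrier F" "\<beta> \<otimes> \<alpha> = \<one>" using nonzero_inv \<alpha> by blast
  have "conv F (sml \<alpha> (X 0)) (sml \<beta> (X 0)) w = conv F (X 0) (X 0) w" for w
  proof -
    have "conv F (sml \<alpha> (X 0)) (sml \<beta> (X 0)) w = (\<beta> \<otimes> \<alpha>) \<otimes> conv F (X 0) (X 0) w"
      using \<alpha> \<beta>(1) by (simp add: conv_smult_left conv_smult_right m_ac)
    then show ?thesis using \<beta>(2) by simp
  qed
  then show "\<exists>m\<in>FC. scalar_rel FA (X 0) m \<and> l \<otimes>\<^bsub>FA\<^esub> m = X 0 \<otimes>\<^bsub>FA\<^esub> X 0"
    unfolding \<alpha>(2) using scalar_rel_smult[OF \<beta>(1) X_FC(1)] \<beta>(1)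
    by (intro bexI[of _ "sml \<beta> (X 0)"]) auto
qed

lemma ax_domain_FA: "ax_domain FA"
  unfolding ax_domain_def free_alg_simps(1,2)
proof (intro conjI ballI impI notI)
  show "a = (\<lambda>_. \<zero>) \<or> c = (\<lambda>_. \<zero>)" if "a \<in> FC" "c \<in> FC" "conv F a c = (\<lambda>_. \<zero>)" for a c
    using FA_domain that by blast
  assume "\<exists>u\<in>FC. \<forall>y\<in>FC. conv F u y = y"
  then obtain u where u: "u \<in> FC" "conv F u (X 0) = X 0" using X_FC(1) by blast
  have "conv F u (X 0) ([] @ [0]) = \<zero>" using conv_letter_right[of u 0 "[]" 0] u(1) by simp
  then show False using u(2) by (simp add: letter_def)
qed

text \<open>The node of the tree of \<open>a\<close> reached by the path \<open>v\<close>, that is,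
  an iterated child. As for \<open>child\<close>, the value at the empty word is cleared, because it
  belongs to the coefficient.\<close>

definition suffix_part :: "nat list \<Rightarrow> (nat list \<Rightarrow> 'k) \<Rightarrow> nat list \<Rightarrow> 'k" where
  "suffix_part v a w = (if w = [] then \<zero> else a (v @ w))"

lemma suffix_part_FC: "a \<in> FC \<Longrightarrow> suffix_part v a \<in> FC"
proof (rule FC_I[where k = "free_deg F a"])
  assume a: "a \<in> FC"
  show "set w \<subseteq> {..<n}" if "suffix_part v a w \<noteq> \<zero>" for w
    using that FC_set[OF a, of "v @ w"] by (auto simp: suffix_part_def split: if_splits)
  show "suffix_part v a w = \<zero>" if "free_deg F a < length w" for w
    using free_degD[OF a, of "v @ w"] that by (auto simp: suffix_part_def)
qed (auto simp: suffix_part_def)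

lemma child_suffix_part: "child i (suffix_part v a) = suffix_part (v @ [i]) a"
  by (auto simp: child_def suffix_part_def fun_eq_iff)

text \<open>The exponent is shifted by one: \<open>bpow b k\<close> is the power of \<open>b\<close>
  with exponent k + 1, since there is no power with exponent 0.\<close>

primrec bpow :: "(nat list \<Rightarrow> 'k) \<Rightarrow> nat \<Rightarrow> nat list \<Rightarrow> 'k" where
  "bpow b 0 = b"
| "bpow b (Suc k) = conv F b (bpow b k)"

lemma bpow_FC: "b \<in> FC \<Longrightarrow> bpow b k \<in> FC"
  by (induction k) auto

lemma bpow_nonzero: "b \<in> FC \<Longrightarrow> b \<noteq> (\<lambda>_. \<zero>) \<Longrightarrow> bpow b k \<noteq> (\<lambda>_. \<zero>)"
proof (induction k)
  case (Suc k)
  then show ?case using conv_nonzero(1)[of b "bpow b k"] bpow_FC by simp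
qed simp

lemma bpow_commute: "b \<in> FC \<Longrightarrow> conv F (bpow b k) b = conv F b (bpow b k)"
proof (induction k)
  case (Suc k)
  have "conv F (conv F b (bpow b k)) b = conv F b (conv F (bpow b k) b)"
    using conv_assoc[of b "bpow b k" b] Suc.prems bpow_FC[OF Suc.prems] by (auto simp: fun_eq_iff)
  then show ?case using Suc by simp
qed simp

text \<open>Makes x c + y p an ordered pair, with the children as projections.\<close>

lemma pair_inject:
  assumes "c \<in> FC" "p \<in> FC"
    and "a = (\<lambda>w. conv F (X 0) c w \<oplus> conv F (X 1) p w)"
  shows "child 0 a = c" "child 1 a = p"
  using assms conv_letter_left[of c 0 0] conv_letter_left[of c 0 1]
    conv_letter_left[of p 1 0] conv_letter_left[of p 1 1]
  by (auto simp: child_def fun_eq_iff)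

lemma ax_depth_letters:
  assumes inf: "infinite (carrier F)" and b: "b \<in> FC" "b \<noteq> (\<lambda>_. \<zero>)"
  shows "ax_depth FA n b X"
  unfolding ax_depth_def
proof
  fix a assume a: "a \<in> FC"
  let ?d = "free_deg F a" and ?pr = "\<lambda>w s. X 0 \<otimes>\<^bsub>FA\<^esub> w \<oplus>\<^bsub>FA\<^esub> X 1 \<otimes>\<^bsub>FA\<^esub> s"
  let ?V = "{v. set v \<subseteq> {..<n} \<and> length v \<le> ?d}"
  \<comment> \<open>A node at depth \<open>length v\<close> is tagged by a power of \<open>b\<close>
    that loses one factor with each step down. At depth \<open>?d\<close> the tag is still
    \<open>b\<close> itself, and by the choice of \<open>?d\<close> as the degree all further
    children are zero.\<close>
  let ?S = "(\<lambda>v. ?pr (bpow b (?d - length v)) (suffix_part v a)) ` ?V"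
  have pr: "?pr w s \<in> FC" if "w \<in> FC" "s \<in> FC" for w s
    using that by (auto intro!: FA_add FA_mult)
  have pi: "w = w' \<and> s = s'" if "?pr w s = ?pr w' s'" "w \<in> FC" "s \<in> FC" "w' \<in> FC" "s' \<in> FC" for w s w' s'
    using pair_inject[OF that(2,3), of "?pr w s"] pair_inject[OF that(4,5), of "?pr w' s'"] that(1)
    by (metis free_alg_simps(1,3))
  have S: "finite ?S" "?S \<subseteq> FC"
    using finite_lists_length_le[of "{..<n}" ?d] pr bpow_FC[OF b(1)] suffix_part_FC[OF a] by auto
  obtain c p where cp: "c \<in> FC" "p \<in> FC" "\<And>m. m \<in> FC \<Longrightarrow> coded FA (X 0) (X 1) c p m \<longleftrightarrow> m \<in> ?S"
    using interpolation[OF inf S] by blast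
  have cl: "w \<noteq> \<zero>\<^bsub>FA\<^esub> \<and> w \<otimes>\<^bsub>FA\<^esub> b = b \<otimes>\<^bsub>FA\<^esub> w \<and>
      decomp FA X n (\<lambda>a. child_ok FA b (X 0) (X 1) c p w a) s"
    if ws: "w \<in> FC" "s \<in> FC" and "coded FA (X 0) (X 1) c p (?pr w s)" for w s
  proof -
    have "?pr w s \<in> ?S" using that cp(3) pr by blast
    then obtain v where v: "set v \<subseteq> {..<n}" "length v \<le> ?d"
      "?pr w s = ?pr (bpow b (?d - length v)) (suffix_part v a)" by blast
    then have e: "w = bpow b (?d - length v)" "s = suffix_part v a"
      using pi[OF _ ws bpow_FC[OF b(1)] suffix_part_FC[OF a]] by auto
    have "decomp FA X n (\<lambda>a. child_ok FA b (X 0) (X 1) c p w a) s"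
    proof (rule decomp_FA[OF order_refl ws(2)])
      show "s (i # u) = \<zero>" if "n \<le> i" for i u
        using FC_set[OF ws(2), of "i # u"] that by auto
      fix i assume i: "i < n"
      show "child_ok FA b (X 0) (X 1) c p w (child i s)"
      proof (cases "length v = ?d")
        case True
        have "child i s = (\<lambda>_. \<zero>)" unfolding e child_suffix_part
          using free_degD[OF a] True by (auto simp: suffix_part_def fun_eq_iff)
        then show ?thesis by (simp add: child_ok_def)
      next
        case False
        let ?w = "bpow b (?d - length (v @ [i]))"
        have "Suc (?d - length (v @ [i])) = ?d - length v" using False v(2) by simp
        then have "w = b \<otimes>\<^bsub>FA\<^esub> ?w" unfolding e using bpow.simps(2)[of b "?d - length (v @ [i])"] by simp
        moreover have "v @ [i] \<in> ?V" using False v i by simp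
        then have "?pr ?w (child i s) \<in> ?S" unfolding e child_suffix_part by blast
        then have "coded FA (X 0) (X 1) c p (?pr ?w (child i s))"
          using cp(3)[OF pr[OF bpow_FC[OF b(1)] child_FC[OF ws(2)]]] by blast
        ultimately show ?thesis unfolding child_ok_def using bpow_FC[OF b(1)] by blast
      qed
    qed
    then show ?thesis unfolding e using bpow_nonzero[OF b] bpow_commute[OF b(1)] by simp
  qed
  have "a = suffix_part [] a" using a by (auto simp: suffix_part_def fun_eq_iff)
  then have "?pr (bpow b ?d) a \<in> ?S" by (intro image_eqI[of _ _ "[]"]) auto
  then have "coded FA (X 0) (X 1) c p (?pr (bpow b ?d) a)" using cp(3)[OF pr[OF bpow_FC[OF b(1)] a]] by blast
  then show "\<exists>c\<in>FC. \<exists>p\<in>FC. \<exists>w\<in>FC. coded FA (X 0) (X 1) c p (?pr w a) \<and>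
      (\<forall>w\<in>FC. \<forall>s\<in>FC. coded FA (X 0) (X 1) c p (?pr w s) \<longrightarrow>
        w \<noteq> \<zero>\<^bsub>FA\<^esub> \<and> w \<otimes>\<^bsub>FA\<^esub> b = b \<otimes>\<^bsub>FA\<^esub> w \<and>
        decomp FA X n (\<lambda>a. child_ok FA b (X 0) (X 1) c p w a) s)"
    using cp(1,2) cl bpow_FC[OF b(1)]
    by (intro bexI[of _ c] bexI[of _ p] bexI[of _ "bpow b ?d"]) auto
qed

theorem free_axioms_letters:
  "infinite (carrier F) \<Longrightarrow> b \<in> FC \<Longrightarrow> b \<noteq> (\<lambda>_. \<zero>) \<Longrightarrow> free_axioms FA n b X"
  unfolding free_axioms_def
  using ax_domain_FA ax_inverse_letter ax_unique_letters ax_depth_letters ax_sets_letters by blast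

text \<open>The axioms recognize free generators: any solution of them is the image of the letters under
  an automorphism. This makes the interpretation below independent of the chosen solution.\<close>

theorem free_axioms_automorphism:
  assumes ax: "free_axioms FA n b x" and b: "b \<in> FC" and x: "\<And>i. i < n \<Longrightarrow> x i \<in> FC"
  shows "\<exists>h. ring_iso_map h FA FA \<and> (\<forall>i<n. h (x i) = X i)"
proof -
  have nz: "x i \<noteq> (\<lambda>_. \<zero>)" if "i < n" for i
    using ax that unfolding free_axioms_def ax_unique_def free_alg_simps(2) by blast
  interpret ax: axiomatic_free_algebra F FA "\<lambda>\<alpha> f w. \<alpha> \<otimes> f w" n b x
  proof (unfold_locales)
    show "scalar_rel FA (x i) l \<longleftrightarrow> (\<exists>\<alpha>\<in>carrier F. l = sml \<alpha> (x i))" if "i < n" "l \<in> FC" for i l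
      using scalar_rel_iff[OF that(2) x[OF that(1)] nz[OF that(1)]] .
    show "\<alpha> = \<zero>" if i: "i < n" "\<alpha> \<in> carrier F" "sml \<alpha> (x i) = \<zero>\<^bsub>FA\<^esub>" for i \<alpha>
    proof -
      obtain w where "x i w \<noteq> \<zero>" using nz[OF i(1)] by auto
      moreover have "\<alpha> \<otimes> x i w = \<zero>" using fun_cong[OF i(3), of w] by simp
      ultimately show ?thesis using integral[of \<alpha> "x i w"] i(2) x[OF i(1)] by auto
    qed
    let ?W = "{(v, w). v \<in> FC \<and> w \<in> FC \<and> v \<noteq> \<zero>\<^bsub>FA\<^esub> \<and> w \<noteq> \<zero>\<^bsub>FA\<^esub> \<and>
        v \<otimes>\<^bsub>FA\<^esub> b = b \<otimes>\<^bsub>FA\<^esub> v \<and> w \<otimes>\<^bsub>FA\<^esub> b = b \<otimes>\<^bsub>FA\<^esub> w \<and> w = b \<otimes>\<^bsub>FA\<^esub> v}"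
    \<comment> \<open>Division by \<open>b\<close> lowers the degree. Here \<open>b\<close> is
      nonzero because \<open>b v\<close> is, so for \<open>b = 0\<close> the relation is
      empty.\<close>
    have "wf (?W \<inter> {(v, w). b \<in> FC})"
    proof (rule wf_subset[OF wf_measure[of "free_deg F"]], clarify)
      fix v assume a: "v \<in> FC" "v \<noteq> \<zero>\<^bsub>FA\<^esub>" "b \<otimes>\<^bsub>FA\<^esub> v \<noteq> \<zero>\<^bsub>FA\<^esub>" "b \<in> FC"
      then have "b \<noteq> (\<lambda>_. \<zero>)" by auto
      then show "(v, b \<otimes>\<^bsub>FA\<^esub> v) \<in> measure (free_deg F)"
        using conv_nonzero(2)[of b v] free_deg_pos[of b] a by simp
    qed
    then show "wf ?W" using b by simp
  qed (use n_ge_2 ax x in \<open>auto simp: fun_eq_iff l_distr r_distr m_assoc conv_smult_left conv_smult_right\<close>)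
  show ?thesis using ax.lt_iso ax.lt_x by blast
qed

end

section \<open>Interpreting hereditarily finite sets in a free algebra\<close>

lemma HF_level_mono: "m \<le> k \<Longrightarrow> HF_level A m \<subseteq> HF_level A k"
  by (induction k) (auto simp: le_Suc_eq)

lemma HF_Atom [simp]: "Atom a \<in> HF A \<longleftrightarrow> a \<in> A"
proof -
  have "Atom a \<in> HF_level A k \<longleftrightarrow> a \<in> A" for k by (induction k) auto
  then show ?thesis by (auto simp: HF_def)
qed

lemma HF_FinSet [simp]: "FinSet S \<in> HF A \<longleftrightarrow> fset S \<subseteq> HF A"
proof
  assume "FinSet S \<in> HF A"
  then obtain k where "FinSet S \<in> HF_level A k" by (auto simp: HF_def)
  then have "fset S \<subseteq> HF_level A k"
    by (induction k) (auto dest: subsetD)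
  then show "fset S \<subseteq> HF A" by (auto simp: HF_def)
next
  assume S: "fset S \<subseteq> HF A"
  have fin: "\<exists>k. T \<subseteq> HF_level A k" if "finite T" "T \<subseteq> HF A" for T
    using that
  proof (induction T)
    case (insert v T)
    then obtain k l where "T \<subseteq> HF_level A k" "v \<in> HF_level A l" by (auto simp: HF_def)
    then have "insert v T \<subseteq> HF_level A (max k l)"
      using HF_level_mono[of k "max k l" A] HF_level_mono[of l "max k l" A] by auto
    then show ?case by blast
  qed simp
  obtain k where "fset S \<subseteq> HF_level A k" using fin[OF finite_fset S] by blast
  then have "FinSet S \<in> HF_level A (Suc k)" by simp
  then show "FinSet S \<in> HF A" unfolding HF_def by blast
qed

lemma hform_sat_cong:
  "(\<And>i. i \<in> hform_free_F \<phi> \<Longrightarrow> e i = e' i) \<Longrightarrow> (\<And>i. i \<in> hform_free_S \<phi> \<Longrightarrow> h i = h' i) \<Longrightarrow>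
    hform_sat F e h \<phi> = hform_sat F e' h' \<phi>"
proof (induction \<phi> arbitrary: e e' h h')
  case (HFEq p q)
  then show ?case using rterm_val_cong[of p e e' F] rterm_val_cong[of q e e' F] by simp
next
  case (HFMem p j)
  then show ?case using rterm_val_cong[of p e e' F] by simp
next
  case (HNeg \<phi>)
  have "hform_sat F e h \<phi> = hform_sat F e' h' \<phi>" by (rule HNeg.IH) (use HNeg.prems in auto)
  then show ?case by simp
next
  case (HAnd \<phi> \<psi>)
  have "hform_sat F e h \<phi> = hform_sat F e' h' \<phi>" by (rule HAnd.IH(1)) (use HAnd.prems in auto)
  moreover have "hform_sat F e h \<psi> = hform_sat F e' h' \<psi>" by (rule HAnd.IH(2)) (use HAnd.prems in auto)
  ultimately show ?case by simp
next
  case (HFAll i \<phi>)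
  have "hform_sat F (e(i := a)) h \<phi> = hform_sat F (e'(i := a)) h' \<phi>" for a
    by (rule HFAll.IH) (use HFAll.prems in auto)
  then show ?case by simp
next
  case (HSAll i \<phi>)
  have "hform_sat F e (h(i := a)) \<phi> = hform_sat F e' (h'(i := a)) \<phi>" for a
    by (rule HSAll.IH) (use HSAll.prems in auto)
  then show ?case by simp
qed auto

lemma HF_models_closed:
  assumes "hform_free_F \<phi> = {}" "hform_free_S \<phi> = {}" "range e \<subseteq> carrier F" "range h \<subseteq> HF (carrier F)"
  shows "HF_models F \<phi> \<longleftrightarrow> hform_sat F e h \<phi>"
proof -
  have "hform_sat F e' h' \<phi> = hform_sat F e h \<phi>" for e' h'
    by (rule hform_sat_cong) (use assms(1,2) in auto)
  then show ?thesis unfolding HF_models_def using assms(3,4) by auto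
qed

text \<open>An element that is no pair with nonzero second component simply has no members, so no
  element has to be excluded.\<close>

definition set_mem :: "('a, 'm) ring_scheme \<Rightarrow> 'a \<Rightarrow> 'a \<Rightarrow> 'a \<Rightarrow> 'a \<Rightarrow> bool" where
  "set_mem R x y a m \<longleftrightarrow> (\<exists>c\<in>carrier R. \<exists>p\<in>carrier R. a = x \<otimes>\<^bsub>R\<^esub> c \<oplus>\<^bsub>R\<^esub> y \<otimes>\<^bsub>R\<^esub> p \<and>
     p \<noteq> \<zero>\<^bsub>R\<^esub> \<and> coded R x y c p m)"

definition bisim :: "('a, 'm) ring_scheme \<Rightarrow> 'a \<Rightarrow> 'a \<Rightarrow> 'a \<Rightarrow> 'a \<Rightarrow> 'a \<Rightarrow> 'a \<Rightarrow> bool" where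
  "bisim R x y c p a b \<longleftrightarrow> (scalar_rel R x a \<and> scalar_rel R x b \<and> a = b) \<or>
     (\<not> scalar_rel R x a \<and> \<not> scalar_rel R x b \<and>
      (\<forall>m\<in>carrier R. set_mem R x y a m \<longrightarrow>
        (\<exists>m'\<in>carrier R. set_mem R x y b m' \<and> coded R x y c p (x \<otimes>\<^bsub>R\<^esub> m \<oplus>\<^bsub>R\<^esub> y \<otimes>\<^bsub>R\<^esub> m'))) \<and>
      (\<forall>m'\<in>carrier R. set_mem R x y b m' \<longrightarrow>
        (\<exists>m\<in>carrier R. set_mem R x y a m \<and> coded R x y c p (x \<otimes>\<^bsub>R\<^esub> m \<oplus>\<^bsub>R\<^esub> y \<otimes>\<^bsub>R\<^esub> m'))))"

definition set_eq :: "('a, 'm) ring_scheme \<Rightarrow> 'a \<Rightarrow> 'a \<Rightarrow> 'a \<Rightarrow> 'a \<Rightarrow> bool" where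
  "set_eq R x y a b \<longleftrightarrow> (\<exists>c\<in>carrier R. \<exists>p\<in>carrier R.
     coded R x y c p (x \<otimes>\<^bsub>R\<^esub> a \<oplus>\<^bsub>R\<^esub> y \<otimes>\<^bsub>R\<^esub> b) \<and>
     (\<forall>a\<in>carrier R. \<forall>b\<in>carrier R. coded R x y c p (x \<otimes>\<^bsub>R\<^esub> a \<oplus>\<^bsub>R\<^esub> y \<otimes>\<^bsub>R\<^esub> b) \<longrightarrow> bisim R x y c p a b))"

definition set_in :: "('a, 'm) ring_scheme \<Rightarrow> 'a \<Rightarrow> 'a \<Rightarrow> 'a \<Rightarrow> 'a \<Rightarrow> bool" where
  "set_in R x y u v \<longleftrightarrow> (\<exists>m\<in>carrier R. set_mem R x y v m \<and> set_eq R x y m u)"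

text \<open>Scalars are represented by multiples of the letter x. The product of \<beta> x and
  \<gamma> x is (\<beta> \<gamma> x) x, and the last factor x is divided out to obtain a
  representative again.\<close>

primrec term_code :: "('a, 'm) ring_scheme \<Rightarrow> rterm \<Rightarrow> (nat \<Rightarrow> 'a) \<Rightarrow> 'a \<Rightarrow> bool" where
  "term_code R (RVar i) e a \<longleftrightarrow> a = e (2 * i + 2)"
| "term_code R RZero e a \<longleftrightarrow> a = \<zero>\<^bsub>R\<^esub>"
| "term_code R (RAdd p q) e a \<longleftrightarrow> (\<exists>b\<in>carrier R. \<exists>c\<in>carrier R.
     term_code R p e b \<and> term_code R q e c \<and> a = b \<oplus>\<^bsub>R\<^esub> c)"
| "term_code R (RMul p q) e a \<longleftrightarrow> (\<exists>b\<in>carrier R. \<exists>c\<in>carrier R.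
     term_code R p e b \<and> term_code R q e c \<and> scalar_rel R (e 0) a \<and> b \<otimes>\<^bsub>R\<^esub> c = a \<otimes>\<^bsub>R\<^esub> e 0)"

text \<open>Variables 0 and 1 hold the two letters; field variable \<open>i\<close> becomes variable \<open>2 i + 2\<close> and
  set variable \<open>i\<close> becomes variable \<open>2 i + 3\<close>.\<close>

primrec hf_interp :: "('a, 'm) ring_scheme \<Rightarrow> hform \<Rightarrow> (nat \<Rightarrow> 'a) \<Rightarrow> bool" where
  "hf_interp R (HFEq p q) e \<longleftrightarrow> (\<exists>a\<in>carrier R. term_code R p e a \<and> term_code R q e a)"
| "hf_interp R (HSEq i j) e \<longleftrightarrow> set_eq R (e 0) (e 1) (e (2 * i + 3)) (e (2 * j + 3))"
| "hf_interp R (HFMem p j) e \<longleftrightarrow> (\<exists>a\<in>carrier R. term_code R p e a \<and> set_in R (e 0) (e 1) a (e (2 * j + 3)))"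
| "hf_interp R (HSMem i j) e \<longleftrightarrow> set_in R (e 0) (e 1) (e (2 * i + 3)) (e (2 * j + 3))"
| "hf_interp R (HNeg \<phi>) e \<longleftrightarrow> \<not> hf_interp R \<phi> e"
| "hf_interp R (HAnd \<phi> \<psi>) e \<longleftrightarrow> hf_interp R \<phi> e \<and> hf_interp R \<psi> e"
| "hf_interp R (HFAll i \<phi>) e \<longleftrightarrow> (\<forall>a\<in>carrier R. scalar_rel R (e 0) a \<longrightarrow> hf_interp R \<phi> (e(2 * i + 2 := a)))"
| "hf_interp R (HSAll i \<phi>) e \<longleftrightarrow> (\<forall>a\<in>carrier R. hf_interp R \<phi> (e(2 * i + 3 := a)))"

section \<open>Definability of the interpretation\<close>

context ring_pair
begin

lemma dfb_set_mem:
  "dfb (\<lambda>e. set_mem R (e i) (e j) (e k) (e l)) (\<lambda>e. set_mem S (e i) (e j) (e k) (e l))"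
  unfolding set_mem_def by (rule dfb_coded dfb_simps)+

lemma dfb_bisim:
  "dfb (\<lambda>e. bisim R (e i1) (e i2) (e i3) (e i4) (e i5) (e i6))
    (\<lambda>e. bisim S (e i1) (e i2) (e i3) (e i4) (e i5) (e i6))"
  unfolding bisim_def by (rule dfb_coded dfb_scalar_rel dfb_set_mem dfb_simps)+

lemma dfb_set_eq:
  "dfb (\<lambda>e. set_eq R (e i) (e j) (e k) (e l)) (\<lambda>e. set_eq S (e i) (e j) (e k) (e l))"
  unfolding set_eq_def by (rule dfb_coded dfb_bisim dfb_simps)+

lemma dfb_set_in:
  "dfb (\<lambda>e. set_in R (e i) (e j) (e k) (e l)) (\<lambda>e. set_in S (e i) (e j) (e k) (e l))"
  unfolding set_in_def by (rule dfb_set_mem dfb_set_eq dfb_simps)+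

lemma dfb_term_code:
  "dfb (\<lambda>e. term_code R p (\<lambda>i. e (f i)) (e k)) (\<lambda>e. term_code S p (\<lambda>i. e (f i)) (e k))"
proof (induction p arbitrary: f k)
  case (RAdd p q)
  show ?case unfolding term_code.simps
    by (rule dfb_simps RAdd.IH(1)[where f = "\<lambda>i. Suc (Suc (f i))"]
        RAdd.IH(2)[where f = "\<lambda>i. Suc (Suc (f i))"])+
next
  case (RMul p q)
  show ?case unfolding term_code.simps
    by (rule dfb_simps dfb_scalar_rel RMul.IH(1)[where f = "\<lambda>i. Suc (Suc (f i))"]
        RMul.IH(2)[where f = "\<lambda>i. Suc (Suc (f i))"])+
qed (unfold term_code.simps, (rule dfb_simps)+)

lemma dfb_hf_interp: "dfb (\<lambda>e. hf_interp R \<phi> e) (\<lambda>e. hf_interp S \<phi> e)"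
proof (induction \<phi>)
  case (HFEq p q)
  show ?case unfolding hf_interp.simps by (rule dfb_ex dfb_conj dfb_term_code[where f = Suc])+
next
  case (HFMem p j)
  show ?case unfolding hf_interp.simps by (rule dfb_ex dfb_conj dfb_set_in dfb_term_code[where f = Suc])+
next
  case (HFAll i \<phi>)
  have "dfb (\<lambda>e. scalar_rel R (e 0) (e (2 * i + 2)) \<longrightarrow> hf_interp R \<phi> e)
      (\<lambda>e. scalar_rel S (e 0) (e (2 * i + 2)) \<longrightarrow> hf_interp S \<phi> e)"
    by (rule dfb_imp[OF dfb_scalar_rel[OF T_var T_var] HFAll.IH])
  from dfb_alln[OF this, of "2 * i + 2"] show ?case by (simp add: fun_upd_def)
next
  case (HSAll i \<phi>)
  from dfb_alln[OF HSAll.IH, of "2 * i + 3"] show ?case by (simp add: fun_upd_def)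
next
  case (HNeg \<phi>)
  then show ?case unfolding hf_interp.simps by (rule dfb_neg)
next
  case (HAnd \<phi> \<psi>)
  then show ?case unfolding hf_interp.simps by (rule dfb_conj)
qed (unfold hf_interp.simps, (rule dfb_set_eq dfb_set_in)+)

lemma dfb_ax_sets: "dfb (\<lambda>e. ax_sets R (e i) (e j)) (\<lambda>e. ax_sets S (e i) (e j))"
  unfolding ax_sets_def by (rule dfb_coded dfb_simps)+

text \<open>A tuple of letters is quantified as one function on the first \<open>n\<close>
  variables; the induction unrolls it into single quantifiers.\<close>

lemma dfb_ex_block:
  "dfb P Q \<Longrightarrow> dfb (\<lambda>e. \<exists>a. (\<forall>i<n. a i \<in> carrier R) \<and> P (\<lambda>i. if i < n then a i else e i))
     (\<lambda>e. \<exists>a. (\<forall>i<n. a i \<in> carrier S) \<and> Q (\<lambda>i. if i < (n::nat) then a i else e i))"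
proof (induction n arbitrary: P Q)
  case 0
  then show ?case by simp
next
  case (Suc n)
  have *: "(\<exists>a. (\<forall>i<Suc n. a i \<in> C) \<and> P (\<lambda>i. if i < Suc n then a i else e i)) \<longleftrightarrow>
     (\<exists>a. (\<forall>i<n. a i \<in> C) \<and> (\<exists>b\<in>C. P ((\<lambda>i. if i < n then a i else e i)(n := b))))"
    (is "?A \<longleftrightarrow> ?B") for C :: "'c set" and P e
  proof
    assume ?A
    then obtain a where a: "\<forall>i<Suc n. a i \<in> C" "P (\<lambda>i. if i < Suc n then a i else e i)" by blast
    have "(\<lambda>i. if i < Suc n then a i else e i) = (\<lambda>i. if i < n then a i else e i)(n := a n)"
      by (auto simp: less_Suc_eq)
    then show ?B using a by (intro exI[of _ a] conjI bexI[of _ "a n"]) auto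
  next
    assume ?B
    then obtain a b where a: "\<forall>i<n. a i \<in> C" "b \<in> C" "P ((\<lambda>i. if i < n then a i else e i)(n := b))" by blast
    have "(\<lambda>i. if i < Suc n then (a(n := b)) i else e i) = (\<lambda>i. if i < n then a i else e i)(n := b)"
      by (auto simp: less_Suc_eq)
    then show ?A using a by (intro exI[of _ "a(n := b)"]) (auto simp: less_Suc_eq)
  qed
  show ?case unfolding * by (rule Suc.IH[OF dfb_exn[OF Suc.prems]])
qed

end

text \<open>Assumes the coding axiom instead of an infinite field: for a field known only through an
  elementarily equivalent algebra this axiom is what is available.\<close>

locale coding_free_algebra = free_algebra_fin +
  assumes sets: "ax_sets FA (X 0) (X 1)"
begin

lemma coding:
  assumes "finite S" "S \<subseteq> FC"
  shows "\<exists>c\<in>FC. \<exists>p\<in>FC. p \<noteq> (\<lambda>_. \<zero>) \<and> (\<forall>m\<in>FC. coded FA (X 0) (X 1) c p m \<longleftrightarrow> m \<in> S)"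
  using assms
proof (induction S)
  case empty
  then show ?case using sets unfolding ax_sets_def free_alg_simps(2) by simp
next
  case (insert m S)
  then obtain c p where cp: "c \<in> FC" "p \<in> FC" "p \<noteq> (\<lambda>_. \<zero>)" "\<forall>m\<in>FC. coded FA (X 0) (X 1) c p m \<longleftrightarrow> m \<in> S"
    by auto
  have m: "m \<in> FC" using insert.prems by simp
  have "\<forall>c\<in>FC. \<forall>p\<in>FC. \<forall>m\<in>FC. p \<noteq> (\<lambda>_. \<zero>) \<longrightarrow> (\<exists>c'\<in>FC. \<exists>p'\<in>FC. p' \<noteq> (\<lambda>_. \<zero>) \<and>
      (\<forall>m'\<in>FC. coded FA (X 0) (X 1) c' p' m' \<longleftrightarrow> coded FA (X 0) (X 1) c p m' \<or> m' = m))"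
    using sets unfolding ax_sets_def free_alg_simps(2) by (rule conjunct2)
  from this[rule_format, OF cp(1,2) m cp(3)]
  obtain c' p' where "c' \<in> FC" "p' \<in> FC" "p' \<noteq> (\<lambda>_. \<zero>)"
      "\<forall>m'\<in>FC. coded FA (X 0) (X 1) c' p' m' \<longleftrightarrow> coded FA (X 0) (X 1) c p m' \<or> m' = m"
    by (elim bexE conjE) (rule that)
  note c' = this
  have "\<forall>m'\<in>FC. coded FA (X 0) (X 1) c' p' m' \<longleftrightarrow> m' \<in> insert m S"
  proof
    fix m' assume m': "m' \<in> FC"
    show "coded FA (X 0) (X 1) c' p' m' \<longleftrightarrow> m' \<in> insert m S"
      using bspec[OF c'(4) m'] bspec[OF cp(4) m'] by auto
  qed
  then show ?case using c'(1,2,3) by (intro bexI[of _ c'] bexI[of _ p'] conjI)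
qed

abbreviation pr :: "(nat list \<Rightarrow> 'a) \<Rightarrow> (nat list \<Rightarrow> 'a) \<Rightarrow> nat list \<Rightarrow> 'a" where
  "pr c p \<equiv> X 0 \<otimes>\<^bsub>FA\<^esub> c \<oplus>\<^bsub>FA\<^esub> X 1 \<otimes>\<^bsub>FA\<^esub> p"

lemma pr_FC: "c \<in> FC \<Longrightarrow> p \<in> FC \<Longrightarrow> pr c p \<in> FC"
  by (auto intro!: FA_add FA_mult)

lemma pr_inject:
  assumes "c \<in> FC" "p \<in> FC" "c' \<in> FC" "p' \<in> FC" "pr c p = pr c' p'" shows "c = c' \<and> p = p'"
  using pair_inject[OF assms(1,2), of "pr c p"] pair_inject[OF assms(3,4), of "pr c p"] assms(5)
  by (simp add: fun_eq_iff)

definition mems :: "(nat list \<Rightarrow> 'a) \<Rightarrow> (nat list \<Rightarrow> 'a) set" where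
  "mems a = {m \<in> FC. set_mem FA (X 0) (X 1) a m}"

lemma mems_pr:
  assumes "c \<in> FC" "p \<in> FC" "p \<noteq> (\<lambda>_. \<zero>)"
  shows "mems (pr c p) = {m \<in> FC. coded FA (X 0) (X 1) c p m}"
proof -
  have "set_mem FA (X 0) (X 1) (pr c p) m \<longleftrightarrow> coded FA (X 0) (X 1) c p m" for m
    unfolding set_mem_def free_alg_simps(2)
    using pr_inject[OF assms(1,2)] assms by blast
  then show ?thesis by (simp add: mems_def)
qed

lemma mems_cases:
  assumes "mems a \<noteq> {}"
  obtains c p where "c \<in> FC" "p \<in> FC" "p \<noteq> (\<lambda>_. \<zero>)" "a = pr c p"
  using assms unfolding mems_def set_mem_def free_alg_simps(2) by blast

lemma finite_mems: "finite (mems a)"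
proof (cases "mems a = {}")
  case False
  then obtain c p where cp: "c \<in> FC" "p \<in> FC" "p \<noteq> (\<lambda>_. \<zero>)" "a = pr c p" by (rule mems_cases)
  show ?thesis unfolding cp(4) mems_pr[OF cp(1-3)] by (rule finite_coded[OF cp(1-3)])
qed simp

lemma pr_nonscalar:
  assumes "c \<in> FC" "p \<in> FC" "p \<noteq> (\<lambda>_. \<zero>)" shows "\<not> scalar_rel FA (X 0) (pr c p)"
proof
  assume "scalar_rel FA (X 0) (pr c p)"
  then obtain \<alpha> where \<alpha>: "\<alpha> \<in> carrier F" "pr c p = sml \<alpha> (X 0)"
    using scalar_rel_iff[OF pr_FC[OF assms(1,2)]] by auto
  have "child 1 (pr c p) w = \<zero>" for w unfolding \<alpha>(2) using \<alpha>(1) by (simp add: child_def letter_def)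
  then have "p = (\<lambda>_. \<zero>)" using pair_inject[OF assms(1,2), of "pr c p"] by (simp add: fun_eq_iff)
  then show False using assms(3) by simp
qed

text \<open>A member is bounded by the first component \<open>c\<close> through
  \<open>cng_deg\<close>, and \<open>c\<close> is a child of \<open>a\<close>.\<close>

lemma mems_deg:
  assumes "m \<in> mems a" shows "free_deg F m < free_deg F a"
proof -
  obtain c p where cp: "c \<in> FC" "p \<in> FC" "p \<noteq> (\<lambda>_. \<zero>)" "a = pr c p"
    using mems_cases assms by blast
  have m: "m \<in> FC" "coded FA (X 0) (X 1) c p m" using assms mems_pr[OF cp(1-3)] cp(4) by auto
  then obtain \<mu> where "\<mu> \<in> carrier F" "cng \<mu> c (conv F (X 1) m)" using coded_iff[OF cp(1,2)] by blast
  then have 1: "free_deg F m \<le> free_deg F c" using cng_deg cp(1) m(1) by blast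
  have a: "a \<in> FC" unfolding cp(4) using pr_FC cp(1,2) by blast
  have ca: "child 0 a = c" "child 1 a = p" using pair_inject[OF cp(1,2), of a] cp(4) by auto
  have 2: "free_deg F c \<le> free_deg F a - 1" using free_deg_child[OF a, of 0] ca by simp
  have "child 1 (\<lambda>_. \<zero>) = (\<lambda>_. \<zero>)" by (intro ext) (simp add: child_def)
  then have "a \<noteq> (\<lambda>_. \<zero>)" using ca(2) cp(3) by metis
  then have "0 < free_deg F a" using free_deg_pos[OF a] by blast
  then show ?thesis using 1 2 by linarith
qed

primrec dec_upto :: "nat \<Rightarrow> (nat list \<Rightarrow> 'a) \<Rightarrow> 'a hfset" where
  "dec_upto 0 a = (if scalar_rel FA (X 0) a then Atom (a [0]) else FinSet {||})"
| "dec_upto (Suc k) a = (if scalar_rel FA (X 0) a then Atom (a [0])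
     else FinSet (Abs_fset (dec_upto k ` mems a)))"

text \<open>Every element decodes to a hereditarily finite set, so that the interpretation needs no
  formula for its domain. Members have smaller degree, so the depth can be bounded by the degree.\<close>

definition dec :: "(nat list \<Rightarrow> 'a) \<Rightarrow> 'a hfset" where
  "dec a = dec_upto (free_deg F a) a"

lemma dec_upto_stable: "free_deg F a \<le> k \<Longrightarrow> free_deg F a \<le> l \<Longrightarrow> dec_upto k a = dec_upto l a"
proof (induction k arbitrary: l a)
  case 0
  then have "mems a = {}" using mems_deg by fastforce
  then show ?case by (cases l) (auto simp: bot_fset_def)
next
  case (Suc k)
  show ?case
  proof (cases l)
    case 0
    then have "mems a = {}" using mems_deg Suc.prems by fastforce
    then show ?thesis using 0 by (auto simp: bot_fset_def)
  next
    case l: (Suc l')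
    have "dec_upto k m = dec_upto l' m" if "m \<in> mems a" for m
      using mems_deg[OF that] Suc.prems l by (intro Suc.IH) auto
    then have "dec_upto k ` mems a = dec_upto l' ` mems a" by (intro image_cong) auto
    then show ?thesis using l by simp
  qed
qed

lemma dec_eq: "dec a = (if scalar_rel FA (X 0) a then Atom (a [0]) else FinSet (Abs_fset (dec ` mems a)))"
proof -
  have "dec a = dec_upto (Suc (free_deg F a)) a" unfolding dec_def by (rule dec_upto_stable) auto
  moreover have "dec_upto (free_deg F a) m = dec m" if "m \<in> mems a" for m
    unfolding dec_def using mems_deg[OF that] by (intro dec_upto_stable) auto
  then have "dec_upto (free_deg F a) ` mems a = dec ` mems a" by (intro image_cong) auto
  ultimately show ?thesis by simp
qed

lemma dec_scalar: "\<alpha> \<in> carrier F \<Longrightarrow> dec (sml \<alpha> (X 0)) = Atom \<alpha>"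
  using dec_eq[of "sml \<alpha> (X 0)"] scalar_rel_smult[of \<alpha> "X 0"] by (simp add: letter_def)

lemma fset_Abs_dec: "fset (Abs_fset (dec ` mems a)) = dec ` mems a"
  using finite_mems by (intro Abs_fset_inverse) simp

lemma dec_mem: "hf_mem u (dec a) \<longleftrightarrow> \<not> scalar_rel FA (X 0) a \<and> u \<in> dec ` mems a"
  by (subst dec_eq) (use fset_Abs_dec in auto)

lemma dec_HF: "a \<in> FC \<Longrightarrow> dec a \<in> HF (carrier F)"
proof (induction "free_deg F a" arbitrary: a rule: less_induct)
  case less
  have "dec m \<in> HF (carrier F)" if "m \<in> mems a" for m
    using less.hyps[OF mems_deg[OF that]] that by (simp add: mems_def)
  then show ?case using less.prems by (subst dec_eq) (auto simp: fset_Abs_dec)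
qed

lemma dec_surj: "u \<in> HF (carrier F) \<Longrightarrow> \<exists>a\<in>FC. dec a = u"
proof (induction u)
  case (Atom \<alpha>)
  then show ?case using dec_scalar[of \<alpha>] by (intro bexI[of _ "sml \<alpha> (X 0)"]) auto
next
  case (FinSet S)
  then have "\<forall>v\<in>fset S. \<exists>a\<in>FC. dec a = v" by auto
  then obtain g where g: "\<forall>v\<in>fset S. g v \<in> FC \<and> dec (g v) = v" by metis
  then obtain c p where cp: "c \<in> FC" "p \<in> FC" "p \<noteq> (\<lambda>_. \<zero>)"
    "\<forall>m\<in>FC. coded FA (X 0) (X 1) c p m \<longleftrightarrow> m \<in> g ` fset S"
    using coding[of "g ` fset S"] by auto
  have "mems (pr c p) = g ` fset S" unfolding mems_pr[OF cp(1-3)] using cp(4) g by auto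
  then have "dec ` mems (pr c p) = fset S" using g by (auto simp: image_image)
  then have "dec (pr c p) = FinSet S"
    using dec_eq[of "pr c p"] pr_nonscalar[OF cp(1-3)] by (simp add: fset_inverse)
  then show ?case using pr_FC[OF cp(1,2)] by blast
qed

text \<open>The transitive closure of membership below \<open>a\<close> is finite because degrees
  drop. This is needed since a bisimulation has to be a finite coded set.\<close>

lemma finite_closure:
  "a \<in> FC \<Longrightarrow> \<exists>D. finite D \<and> D \<subseteq> FC \<and> a \<in> D \<and> (\<forall>b\<in>D. mems b \<subseteq> D)"
proof (induction "free_deg F a" arbitrary: a rule: less_induct)
  case less
  have "\<forall>m\<in>mems a. \<exists>D. finite D \<and> D \<subseteq> FC \<and> m \<in> D \<and> (\<forall>b\<in>D. mems b \<subseteq> D)"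
    using less.hyps mems_deg by (auto simp: mems_def)
  then obtain D where D: "\<forall>m\<in>mems a. finite (D m) \<and> D m \<subseteq> FC \<and> m \<in> D m \<and> (\<forall>b\<in>D m. mems b \<subseteq> D m)"
    by metis
  let ?U = "insert a (\<Union>m\<in>mems a. D m)"
  have "mems b \<subseteq> ?U" if b: "b \<in> ?U" for b
  proof (cases "b = a")
    case True
    then show ?thesis using D by blast
  next
    case False
    then obtain m where "m \<in> mems a" "b \<in> D m" using b by blast
    then show ?thesis using D by blast
  qed
  moreover have "finite ?U" using D finite_mems[of a] by blast
  moreover have "?U \<subseteq> FC" using D less.prems by blast
  ultimately show ?case by blast
qed

lemma dec_eq_iff:
  assumes "a \<in> FC" "b \<in> FC"
  shows "dec a = dec b \<longleftrightarrow> (scalar_rel FA (X 0) a \<and> scalar_rel FA (X 0) b \<and> a = b) \<or>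
     (\<not> scalar_rel FA (X 0) a \<and> \<not> scalar_rel FA (X 0) b \<and> dec ` mems a = dec ` mems b)"
proof -
  have 1: "a = b" if "scalar_rel FA (X 0) a" "scalar_rel FA (X 0) b" "a [0] = b [0]"
    using scalar_rel_letter[OF assms(1) _ that(1)] scalar_rel_letter[OF assms(2) _ that(2)] that(3) n_ge_2 by simp
  have 2: "Abs_fset (dec ` mems a) = Abs_fset (dec ` mems b) \<longleftrightarrow> dec ` mems a = dec ` mems b"
    using fset_Abs_dec by metis
  show ?thesis unfolding dec_eq[of a] dec_eq[of b] using 1 2 by auto
qed

text \<open>A coded bisimulation forces equal decodings by induction on the degree of the first
  component. Conversely, the pairs with equal decodings within two finite closures form a finite
  bisimulation.\<close>

lemma set_eq_iff_dec:
  assumes ab: "a \<in> FC" "b \<in> FC"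
  shows "set_eq FA (X 0) (X 1) a b \<longleftrightarrow> dec a = dec b"
proof
  assume "set_eq FA (X 0) (X 1) a b"
  then obtain c p where cp: "c \<in> FC" "p \<in> FC" "coded FA (X 0) (X 1) c p (pr a b)"
    and cl: "\<forall>a\<in>FC. \<forall>b\<in>FC. coded FA (X 0) (X 1) c p (pr a b) \<longrightarrow> bisim FA (X 0) (X 1) c p a b"
    unfolding set_eq_def by blast
  have "dec a = dec b" if "a \<in> FC" "b \<in> FC" "coded FA (X 0) (X 1) c p (pr a b)" for a b
    using that
  proof (induction "free_deg F a" arbitrary: a b rule: less_induct)
    case less
    have bs: "bisim FA (X 0) (X 1) c p a b" using cl less.prems by blast
    have IH: "dec m = dec m'" if "m \<in> mems a" "m' \<in> mems b" "coded FA (X 0) (X 1) c p (pr m m')" for m m'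
      using less.hyps[OF mems_deg[OF that(1)] _ _ that(3)] that(1,2) by (simp add: mems_def)
    show ?case unfolding dec_eq_iff[OF less.prems(1,2)]
    proof (cases "scalar_rel FA (X 0) a \<and> scalar_rel FA (X 0) b \<and> a = b")
      case False
      then have ns: "\<not> scalar_rel FA (X 0) a" "\<not> scalar_rel FA (X 0) b"
        and m1: "\<And>m. m \<in> mems a \<Longrightarrow> \<exists>m'\<in>mems b. coded FA (X 0) (X 1) c p (pr m m')"
        and m2: "\<And>m'. m' \<in> mems b \<Longrightarrow> \<exists>m\<in>mems a. coded FA (X 0) (X 1) c p (pr m m')"
        using bs unfolding bisim_def mems_def by blast+
      have "dec ` mems a \<subseteq> dec ` mems b"
      proof
        fix u assume "u \<in> dec ` mems a"
        then obtain m where m: "m \<in> mems a" "u = dec m" by blast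
        then obtain m' where "m' \<in> mems b" "coded FA (X 0) (X 1) c p (pr m m')" using m1 by blast
        then show "u \<in> dec ` mems b" using IH[OF m(1)] m(2) by simp
      qed
      moreover have "dec ` mems b \<subseteq> dec ` mems a"
      proof
        fix u assume "u \<in> dec ` mems b"
        then obtain m' where m: "m' \<in> mems b" "u = dec m'" by blast
        then obtain m where "m \<in> mems a" "coded FA (X 0) (X 1) c p (pr m m')" using m2 by blast
        then have "m \<in> mems a" "dec m = u" using IH[OF _ m(1)] m(2) by auto
        then show "u \<in> dec ` mems a" by blast
      qed
      ultimately show "(scalar_rel FA (X 0) a \<and> scalar_rel FA (X 0) b \<and> a = b) \<or>
        (\<not> scalar_rel FA (X 0) a \<and> \<not> scalar_rel FA (X 0) b \<and> dec ` mems a = dec ` mems b)" using ns by blast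
    qed simp
  qed
  then show "dec a = dec b" using ab cp(3) by blast
next
  assume e: "dec a = dec b"
  obtain D where D: "finite D" "D \<subseteq> FC" "a \<in> D" "\<And>d. d \<in> D \<Longrightarrow> mems d \<subseteq> D"
    using finite_closure[OF ab(1)] by blast
  obtain E where E: "finite E" "E \<subseteq> FC" "b \<in> E" "\<And>d. d \<in> E \<Longrightarrow> mems d \<subseteq> E"
    using finite_closure[OF ab(2)] by blast
  let ?W = "(\<lambda>(a, b). pr a b) ` {(a, b) \<in> D \<times> E. dec a = dec b}"
  have "{(a, b) \<in> D \<times> E. dec a = dec b} \<subseteq> D \<times> E" by blast
  then have "finite {(a, b) \<in> D \<times> E. dec a = dec b}" using D(1) E(1) finite_subset by blast
  then have W1: "finite ?W" by (rule finite_imageI)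
  have W2: "?W \<subseteq> FC"
  proof
    fix m assume "m \<in> ?W"
    then obtain u v where "u \<in> D" "v \<in> E" "m = pr u v" by auto
    then show "m \<in> FC" using D(2) E(2) pr_FC[of u v] by blast
  qed
  from coding[OF W1 W2] obtain c p where cp: "c \<in> FC" "p \<in> FC"
    and cW: "\<forall>m\<in>FC. coded FA (X 0) (X 1) c p m \<longleftrightarrow> m \<in> ?W"
    by (elim bexE conjE) (rule that)
  have W: "coded FA (X 0) (X 1) c p (pr u v) \<longleftrightarrow> u \<in> D \<and> v \<in> E \<and> dec u = dec v" if uv: "u \<in> FC" "v \<in> FC" for u v
  proof -
    have "coded FA (X 0) (X 1) c p (pr u v) \<longleftrightarrow> pr u v \<in> ?W" by (rule bspec[OF cW pr_FC[OF uv]])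
    also have "\<dots> \<longleftrightarrow> u \<in> D \<and> v \<in> E \<and> dec u = dec v"
    proof
      assume "pr u v \<in> ?W"
      then obtain u' v' where w: "u' \<in> D" "v' \<in> E" "dec u' = dec v'" "pr u v = pr u' v'" by auto
      then have "u = u' \<and> v = v'" using pr_inject[OF uv] D(2) E(2) by blast
      then show "u \<in> D \<and> v \<in> E \<and> dec u = dec v" using w by blast
    next
      assume "u \<in> D \<and> v \<in> E \<and> dec u = dec v"
      then have "(u, v) \<in> {(a, b) \<in> D \<times> E. dec a = dec b}" by blast
      then show "pr u v \<in> ?W" by (rule rev_image_eqI) simp
    qed
    finally show ?thesis .
  qed
  have cl: "bisim FA (X 0) (X 1) c p u v"
    if uv: "u \<in> FC" "v \<in> FC" and w: "coded FA (X 0) (X 1) c p (pr u v)" for u v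
  proof -
    have w': "u \<in> D" "v \<in> E" "dec u = dec v" using w W[OF uv] by auto
    have mD: "m \<in> D \<and> m \<in> FC" if "m \<in> mems u" for m using D(4)[OF w'(1)] that by (auto simp: mems_def)
    have mE: "m \<in> E \<and> m \<in> FC" if "m \<in> mems v" for m using E(4)[OF w'(2)] that by (auto simp: mems_def)
    show ?thesis
    proof (cases "scalar_rel FA (X 0) u \<and> scalar_rel FA (X 0) v \<and> u = v")
      case True
      then show ?thesis by (simp add: bisim_def)
    next
      case False
      then have ns: "\<not> scalar_rel FA (X 0) u" "\<not> scalar_rel FA (X 0) v" and im: "dec ` mems u = dec ` mems v"
        using dec_eq_iff[OF uv] w'(3) by blast+
      have "\<exists>m'\<in>FC. set_mem FA (X 0) (X 1) v m' \<and> coded FA (X 0) (X 1) c p (pr m m')"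
        if "m \<in> FC" "set_mem FA (X 0) (X 1) u m" for m
      proof -
        have m: "m \<in> mems u" using that by (simp add: mems_def)
        then have "dec m \<in> dec ` mems v" using im by blast
        then obtain m' where m': "m' \<in> mems v" "dec m = dec m'" by blast
        then have "coded FA (X 0) (X 1) c p (pr m m')" using W mD[OF m] mE[OF m'(1)] by blast
        then show ?thesis using m'(1) unfolding mems_def by blast
      qed
      moreover have "\<exists>m\<in>FC. set_mem FA (X 0) (X 1) u m \<and> coded FA (X 0) (X 1) c p (pr m m')"
        if "m' \<in> FC" "set_mem FA (X 0) (X 1) v m'" for m'
      proof -
        have m': "m' \<in> mems v" using that by (simp add: mems_def)
        then have "dec m' \<in> dec ` mems u" using im by blast
        then obtain m where m: "m \<in> mems u" "dec m' = dec m" by blast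
        then have "coded FA (X 0) (X 1) c p (pr m m')" using W mD[OF m(1)] mE[OF m'] by auto
        then show ?thesis using m(1) unfolding mems_def by blast
      qed
      ultimately show ?thesis unfolding bisim_def using ns by blast
    qed
  qed
  have "coded FA (X 0) (X 1) c p (pr a b)" using W[OF ab] D(3) E(3) e by blast
  then show "set_eq FA (X 0) (X 1) a b" unfolding set_eq_def using cp(1,2) cl by blast
qed

lemma set_in_iff_dec:
  assumes "u \<in> FC" "v \<in> FC"
  shows "set_in FA (X 0) (X 1) u v \<longleftrightarrow> hf_mem (dec u) (dec v)"
proof -
  have "set_in FA (X 0) (X 1) u v \<longleftrightarrow> (\<exists>m\<in>mems v. dec m = dec u)"
    unfolding set_in_def mems_def using set_eq_iff_dec assms by blast
  also have "\<dots> \<longleftrightarrow> hf_mem (dec u) (dec v)"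
  proof -
    have "mems v = {}" if "scalar_rel FA (X 0) v" using that pr_nonscalar mems_cases by metis
    then show ?thesis unfolding dec_mem by (auto simp: image_iff eq_commute)
  qed
  finally show ?thesis .
qed

section \<open>Correctness of the interpretation\<close>

lemma term_code_iff:
  assumes "e 0 = X 0" "\<And>i. f i \<in> carrier F" "\<And>i. e (2 * i + 2) = sml (f i) (X 0)" "a \<in> FC"
  shows "rterm_val F f p \<in> carrier F \<and> (term_code FA p e a \<longleftrightarrow> a = sml (rterm_val F f p) (X 0))"
  using assms(4)
proof (induction p arbitrary: a)
  case (RVar i)
  then show ?case using assms(2,3) by simp
next
  case RZero
  have "sml \<zero> (X 0) = (\<lambda>_. \<zero>)" by (intro ext) simp
  then show ?case by simp
next
  case (RAdd p q)
  let ?p = "rterm_val F f p" and ?q = "rterm_val F f q"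
  have c: "?p \<in> carrier F" "?q \<in> carrier F" using RAdd.IH FA_zero by blast+
  have "term_code FA (RAdd p q) e a \<longleftrightarrow> a = (\<lambda>w. sml ?p (X 0) w \<oplus> sml ?q (X 0) w)"
    unfolding term_code.simps free_alg_simps(3)
    using RAdd.IH c FA_smult[OF c(1) X_FC(1)] FA_smult[OF c(2) X_FC(1)] by blast
  moreover have "(\<lambda>w. sml ?p (X 0) w \<oplus> sml ?q (X 0) w) = sml (?p \<oplus> ?q) (X 0)"
    using c by (intro ext) (simp add: l_distr)
  ultimately show ?case using c by simp
next
  case (RMul p q)
  let ?p = "rterm_val F f p" and ?q = "rterm_val F f q"
  have c: "?p \<in> carrier F" "?q \<in> carrier F" using RMul.IH FA_zero by blast+
  have e: "conv F (sml ?p (X 0)) (sml ?q (X 0)) = conv F (sml (?p \<otimes> ?q) (X 0)) (X 0)"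
    using c by (intro ext) (simp add: conv_smult_left conv_smult_right m_assoc)
  have "term_code FA (RMul p q) e a \<longleftrightarrow> scalar_rel FA (X 0) a \<and>
      conv F (sml ?p (X 0)) (sml ?q (X 0)) = conv F a (X 0)"
    unfolding term_code.simps free_alg_simps(1) assms(1)
    using RMul.IH c FA_smult[OF c(1) X_FC(1)] FA_smult[OF c(2) X_FC(1)] by blast
  also have "\<dots> \<longleftrightarrow> a = sml (?p \<otimes> ?q) (X 0)"
  proof
    assume *: "scalar_rel FA (X 0) a \<and> conv F (sml ?p (X 0)) (sml ?q (X 0)) = conv F a (X 0)"
    show "a = sml (?p \<otimes> ?q) (X 0)"
      by (rule conv_cancel_right[OF RMul.prems _ X_FC(1) letter_nonzero]) (use * e c in auto)
  next
    assume "a = sml (?p \<otimes> ?q) (X 0)"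
    then show "scalar_rel FA (X 0) a \<and> conv F (sml ?p (X 0)) (sml ?q (X 0)) = conv F a (X 0)"
      using e scalar_rel_smult[of "?p \<otimes> ?q" "X 0"] c by simp
  qed
  finally show ?case using c by simp
qed

lemma hf_interp_iff:
  assumes "e 0 = X 0" "e 1 = X 1" "\<And>i. f i \<in> carrier F" "\<And>i. e (2 * i + 2) = sml (f i) (X 0)"
    and "\<And>i. e (2 * i + 3) \<in> FC \<and> h i = dec (e (2 * i + 3))"
  shows "hf_interp FA \<phi> e \<longleftrightarrow> hform_sat F f h \<phi>"
  using assms
proof (induction \<phi> arbitrary: e f h)
  case (HFEq p q)
  note tc = term_code_iff[where e = e and f = f, OF HFEq(1,3,4)]
  have c: "rterm_val F f p \<in> carrier F" "rterm_val F f q \<in> carrier F" using tc FA_zero by blast+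
  have "hf_interp FA (HFEq p q) e \<longleftrightarrow> sml (rterm_val F f p) (X 0) = sml (rterm_val F f q) (X 0)"
  proof -
    have "term_code FA p e a \<longleftrightarrow> a = sml (rterm_val F f p) (X 0)"
      "term_code FA q e a \<longleftrightarrow> a = sml (rterm_val F f q) (X 0)" if "a \<in> FC" for a
      using conjunct2[OF tc[OF that, of p]] conjunct2[OF tc[OF that, of q]] .
    then show ?thesis unfolding hf_interp.simps using FA_smult[OF c(1) X_FC(1)] by metis
  qed
  also have "\<dots> \<longleftrightarrow> rterm_val F f p = rterm_val F f q"
    using dec_scalar[OF c(1)] dec_scalar[OF c(2)] by (metis hfset.inject(1))
  finally show ?case by simp
next
  case (HSEq i j)
  have "e (2 * i + 3) \<in> FC" "e (2 * j + 3) \<in> FC" "h i = dec (e (2 * i + 3))" "h j = dec (e (2 * j + 3))"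
    using HSEq(5) by blast+
  then show ?case using set_eq_iff_dec HSEq(1,2) by simp
next
  case (HFMem p j)
  note tc = term_code_iff[where e = e and f = f, OF HFMem(1,3,4)]
  have c: "rterm_val F f p \<in> carrier F" using tc FA_zero by blast
  have j: "e (2 * j + 3) \<in> FC" "h j = dec (e (2 * j + 3))" using HFMem(5) by blast+
  have "hf_interp FA (HFMem p j) e \<longleftrightarrow> set_in FA (X 0) (X 1) (sml (rterm_val F f p) (X 0)) (e (2 * j + 3))"
  proof -
    have "term_code FA p e a \<longleftrightarrow> a = sml (rterm_val F f p) (X 0)" if "a \<in> FC" for a
      using conjunct2[OF tc[OF that, of p]] .
    then show ?thesis unfolding hf_interp.simps HFMem(1,2) using FA_smult[OF c X_FC(1)] by metis
  qed
  then show ?case using set_in_iff_dec[OF FA_smult[OF c X_FC(1)] j(1)] dec_scalar[OF c] j(2) by simp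
next
  case (HSMem i j)
  have "e (2 * i + 3) \<in> FC" "e (2 * j + 3) \<in> FC" "h i = dec (e (2 * i + 3))" "h j = dec (e (2 * j + 3))"
    using HSMem(5) by blast+
  then show ?case using set_in_iff_dec HSMem(1,2) by simp
next
  case (HNeg \<phi>)
  show ?case using HNeg.IH[OF HNeg.prems] by simp
next
  case (HAnd \<phi> \<psi>)
  show ?case using HAnd.IH(1)[OF HAnd.prems] HAnd.IH(2)[OF HAnd.prems] by simp
next
  case (HFAll i \<phi>)
  have IH: "hf_interp FA \<phi> (e(2 * i + 2 := sml \<alpha> (X 0))) \<longleftrightarrow> hform_sat F (f(i := \<alpha>)) h \<phi>"
    if "\<alpha> \<in> carrier F" for \<alpha>
  proof (rule HFAll.IH)
    have ne: "2 * j + 3 \<noteq> 2 * i + 2" for j by presburger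
    show "(e(2 * i + 2 := sml \<alpha> (X 0))) (2 * j + 3) \<in> FC \<and>
        h j = dec ((e(2 * i + 2 := sml \<alpha> (X 0))) (2 * j + 3))" for j
      using HFAll.prems(5)[of j] ne by (simp del: add_2_eq_Suc')
    show "(f(i := \<alpha>)) j \<in> carrier F" for j using HFAll.prems(3) that by simp
    show "(e(2 * i + 2 := sml \<alpha> (X 0))) (2 * j + 2) = sml ((f(i := \<alpha>)) j) (X 0)" for j
      using HFAll.prems(4)[of j] by simp
  qed (use HFAll.prems(1,2) in auto)
  have sc: "scalar_rel FA (X 0) a \<longleftrightarrow> (\<exists>\<alpha>\<in>carrier F. a = sml \<alpha> (X 0))" if "a \<in> FC" for a
    using scalar_rel_iff[OF that X_FC(1) letter_nonzero] .
  show ?case unfolding hf_interp.simps hform_sat.simps HFAll.prems(1)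
  proof
    assume l: "\<forall>a\<in>FC. scalar_rel FA (X 0) a \<longrightarrow> hf_interp FA \<phi> (e(2 * i + 2 := a))"
    show "\<forall>a\<in>carrier F. hform_sat F (f(i := a)) h \<phi>"
    proof
      fix \<alpha> assume \<alpha>: "\<alpha> \<in> carrier F"
      have "sml \<alpha> (X 0) \<in> FC" "scalar_rel FA (X 0) (sml \<alpha> (X 0))"
        using \<alpha> scalar_rel_smult[OF \<alpha> X_FC(1)] by auto
      then show "hform_sat F (f(i := \<alpha>)) h \<phi>" using l IH[OF \<alpha>] by blast
    qed
  next
    assume r: "\<forall>a\<in>carrier F. hform_sat F (f(i := a)) h \<phi>"
    show "\<forall>a\<in>FC. scalar_rel FA (X 0) a \<longrightarrow> hf_interp FA \<phi> (e(2 * i + 2 := a))"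
    proof (intro ballI impI)
      fix a assume a: "a \<in> FC" "scalar_rel FA (X 0) a"
      then obtain \<alpha> where \<alpha>: "\<alpha> \<in> carrier F" "a = sml \<alpha> (X 0)" using sc by blast
      show "hf_interp FA \<phi> (e(2 * i + 2 := a))" unfolding \<alpha>(2) using IH[OF \<alpha>(1)] r \<alpha>(1) by blast
    qed
  qed
next
  case (HSAll i \<phi>)
  have IH: "hf_interp FA \<phi> (e(2 * i + 3 := a)) \<longleftrightarrow> hform_sat F f (h(i := dec a)) \<phi>"
    if "a \<in> FC" for a
  proof (rule HSAll.IH)
    have ne: "2 * j + 2 \<noteq> 2 * i + 3" for j by presburger
    show "(e(2 * i + 3 := a)) (2 * j + 2) = sml (f j) (X 0)" for j
      using HSAll.prems(4)[of j] ne by (simp del: add_2_eq_Suc')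
    show "(e(2 * i + 3 := a)) (2 * j + 3) \<in> FC \<and> (h(i := dec a)) j = dec ((e(2 * i + 3 := a)) (2 * j + 3))" for j
      using HSAll.prems(5)[of j] that by simp
  qed (use HSAll.prems(1,2,3) in auto)
  show ?case unfolding hf_interp.simps hform_sat.simps
  proof
    assume l: "\<forall>a\<in>FC. hf_interp FA \<phi> (e(2 * i + 3 := a))"
    show "\<forall>u\<in>HF (carrier F). hform_sat F f (h(i := u)) \<phi>"
    proof
      fix u assume "u \<in> HF (carrier F)"
      then obtain a where a: "a \<in> FC" "dec a = u" using dec_surj by blast
      show "hform_sat F f (h(i := u)) \<phi>" using l a(1) IH[OF a(1)] unfolding a(2) by blast
    qed
  next
    assume r: "\<forall>u\<in>HF (carrier F). hform_sat F f (h(i := u)) \<phi>"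
    show "\<forall>a\<in>FC. hf_interp FA \<phi> (e(2 * i + 3 := a))"
      using r IH dec_HF by blast
  qed
qed

end

text \<open>Zero is a term of the language, so this valuation can be substituted into a definable
  predicate. It also suits both sorts: as the scalar multiple 0 of the letter, and as an element
  that decodes to some set.\<close>

definition letter_env :: "('a, 'm) ring_scheme \<Rightarrow> 'a \<Rightarrow> 'a \<Rightarrow> nat \<Rightarrow> 'a" where
  "letter_env R x y i = (if i = 0 then x else if i = 1 then y else \<zero>\<^bsub>R\<^esub>)"

context free_algebra_fin
begin

text \<open>An automorphism moves \<open>x\<close> to the letters. It carries the coding axiom and
  the definable interpretation along, and at the letters decoding applies.\<close>

lemma hf_interp_iff_models:
  assumes ax: "free_axioms FA n b x" and b: "b \<in> FC" and x: "\<And>i. i < n \<Longrightarrow> x i \<in> FC"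
    and \<phi>: "hform_free_F \<phi> = {}" "hform_free_S \<phi> = {}"
  shows "hf_interp FA \<phi> (letter_env FA (x 0) (x 1)) \<longleftrightarrow> HF_models F \<phi>"
proof -
  interpret ring_pair FA FA .
  obtain h where h: "ring_iso_map h FA FA" "\<And>i. i < n \<Longrightarrow> h (x i) = X i"
    using free_axioms_automorphism[OF ax b x] by blast
  have xs: "x 0 \<in> FC" "x 1 \<in> FC" using x n_ge_2 by auto
  have rg: "range (letter_env FA (x 0) (x 1)) \<subseteq> FC" using xs by (auto simp: letter_env_def)
  have he: "h \<circ> letter_env FA (x 0) (x 1) = letter_env FA (X 0) (X 1)"
    using h(2)[of 0] h(2)[of 1] n_ge_2 ring_iso_map_zero[OF h(1) FA_rng FA_rng]
    by (auto simp: letter_env_def fun_eq_iff)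
  have "ax_sets FA (x 0) (x 1)" using ax unfolding free_axioms_def by blast
  then have "ax_sets FA (X 0) (X 1)"
    using dfb_iso[OF dfb_ax_sets[of 0 1] h(1) FA_rng FA_rng rg] unfolding he by (simp add: letter_env_def)
  then interpret coding_free_algebra F n by unfold_locales
  have z: "sml \<zero> (X 0) = (\<lambda>_. \<zero>)" by (intro ext) simp
  have "hf_interp FA \<phi> (letter_env FA (x 0) (x 1)) \<longleftrightarrow> hf_interp FA \<phi> (letter_env FA (X 0) (X 1))"
    using dfb_iso[OF dfb_hf_interp h(1) FA_rng FA_rng rg, of \<phi>] unfolding he .
  also have "\<dots> \<longleftrightarrow> hform_sat F (\<lambda>_. \<zero>) (\<lambda>_. dec (\<lambda>_. \<zero>)) \<phi>"
    by (rule hf_interp_iff) (auto simp: letter_env_def z)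
  also have "\<dots> \<longleftrightarrow> HF_models F \<phi>"
    by (rule HF_models_closed[OF \<phi>, symmetric]) (auto simp: dec_HF)
  finally show ?thesis .
qed

end

section \<open>Quantifying over the solutions of the axioms\<close>

lemma decomp_cong: "(\<And>i. i < k \<Longrightarrow> x i = x' i) \<Longrightarrow> decomp R x k Q s \<longleftrightarrow> decomp R x' k Q s"
proof (induction k arbitrary: s)
  case (Suc k)
  have "decomp R x k Q r \<longleftrightarrow> decomp R x' k Q r" for r using Suc by simp
  then show ?case using Suc.prems[of k] by simp
qed simp

lemma free_axioms_cong:
  assumes "\<And>i. i < n \<Longrightarrow> x i = x' i" "2 \<le> n"
  shows "free_axioms R n b x \<longleftrightarrow> free_axioms R n b x'"
proof -
  have "x 0 = x' 0" "x 1 = x' 1" using assms by auto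
  moreover have "decomp R x k Q s \<longleftrightarrow> decomp R x' k Q s" if "k \<le> n" for k Q s
    using assms(1) that by (intro decomp_cong) auto
  ultimately show ?thesis
    unfolding free_axioms_def ax_unique_def ax_depth_def using assms(1) by simp
qed

text \<open>The block holds the letters at indices below \<open>n\<close> and the element
  \<open>b\<close> at index \<open>n\<close>. Sending the indices from \<open>n\<close> on to 0
  leaves no variable outside the block, so the predicate is a sentence.\<close>

definition interp_sentence :: "('a, 'm) ring_scheme \<Rightarrow> nat \<Rightarrow> hform \<Rightarrow> bool" where
  "interp_sentence R n \<phi> \<longleftrightarrow> (\<exists>a. (\<forall>i<Suc n. a i \<in> carrier R) \<and>
     free_axioms R n (a n) (\<lambda>i. a (if i < n then i else 0)) \<and> hf_interp R \<phi> (letter_env R (a 0) (a 1)))"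

lemma (in ring_pair) dfb_interp_sentence:
  fixes n :: nat
  assumes "2 \<le> n"
  shows "dfb (\<lambda>_. interp_sentence R n \<phi>) (\<lambda>_. interp_sentence S n \<phi>)"
proof -
  let ?g = "\<lambda>i. if i < n then i else (0::nat)"
  have sub: "dfb (\<lambda>e. hf_interp R \<phi> (letter_env R (e 0) (e 1))) (\<lambda>e. hf_interp S \<phi> (letter_env S (e 0) (e 1)))"
  proof (rule dfb_sub[OF dfb_hf_interp, where \<sigma> = "\<lambda>i e. letter_env R (e 0) (e 1) i"
        and \<tau> = "\<lambda>i e. letter_env S (e 0) (e 1) i"])
    fix i show "term_pair R S (\<lambda>e. letter_env R (e 0) (e 1) i) (\<lambda>e. letter_env S (e 0) (e 1) i)"
      unfolding letter_env_def using T_var T_zero by (cases "i = 0"; cases "i = 1") auto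
  qed
  have g: "(if (if i < n then i else 0) < Suc n then a (if i < n then i else 0) else e (if i < n then i else 0))
      = a (if i < n then i else 0)" for i and a e :: "nat \<Rightarrow> 'c"
    by simp
  have n: "n < Suc n" "(0::nat) < Suc n" "1 < Suc n" using assms by auto
  from dfb_ex_block[OF dfb_conj[OF dfb_free_axioms[of n n ?g] sub], of "Suc n"]
  show ?thesis unfolding interp_sentence_def g if_P[OF n(1)] if_P[OF n(2)] if_P[OF n(3)] .
qed

context free_algebra_fin
begin

lemma interp_sentence_iff:
  assumes "hform_free_F \<phi> = {}" "hform_free_S \<phi> = {}"
  shows "interp_sentence FA n \<phi> \<longleftrightarrow> (\<exists>b x. b \<in> FC \<and> (\<forall>i<n. x i \<in> FC) \<and> free_axioms FA n b x) \<and> HF_models F \<phi>"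
proof
  assume "interp_sentence FA n \<phi>"
  then obtain a where a: "\<forall>i<Suc n. a i \<in> FC" "free_axioms FA n (a n) (\<lambda>i. a (if i < n then i else 0))"
    "hf_interp FA \<phi> (letter_env FA (a 0) (a 1))" unfolding interp_sentence_def by blast
  have "free_axioms FA n (a n) a" 
    using a(2) free_axioms_cong[of n "\<lambda>i. a (if i < n then i else 0)" a FA "a n", OF _ n_ge_2] by simp
  moreover from this have "HF_models F \<phi>" using hf_interp_iff_models[of "a n" a \<phi>] a(1,3) assms by simp
  ultimately show "(\<exists>b x. b \<in> FC \<and> (\<forall>i<n. x i \<in> FC) \<and> free_axioms FA n b x) \<and> HF_models F \<phi>" using a(1)
    by (intro conjI exI[of _ "a n"] exI[of _ a]) auto
next
  assume "(\<exists>b x. b \<in> FC \<and> (\<forall>i<n. x i \<in> FC) \<and> free_axioms FA n b x) \<and> HF_models F \<phi>"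
  then obtain b x where *: "b \<in> FC" "\<And>i. i < n \<Longrightarrow> x i \<in> FC" "free_axioms FA n b x" "HF_models F \<phi>" by blast
  let ?a = "\<lambda>i. if i < n then x i else b"
  have "hf_interp FA \<phi> (letter_env FA (?a 0) (?a 1))"
    using hf_interp_iff_models[OF *(3,1,2) assms] *(4) n_ge_2 by simp
  moreover have "free_axioms FA n (?a n) (\<lambda>i. ?a (if i < n then i else 0))"
    using *(3) free_axioms_cong[of n x "\<lambda>i. ?a (if i < n then i else 0)" FA b, OF _ n_ge_2] by simp
  ultimately show "interp_sentence FA n \<phi>" unfolding interp_sentence_def using *(1,2)
    by (intro exI[of _ ?a] conjI) auto
qed

end

theorem elem_equiv_imp_HF_elem_equiv:
  fixes n :: nat
  assumes F: "field F" "infinite (carrier F)" and G: "field G" and n: "2 \<le> n"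
    and eq: "ring_elem_equiv (free_alg F {..<n}) (free_alg G {..<n})"
  shows "HF_elem_equiv F G"
proof -
  interpret F: free_algebra_fin F n using F(1) n by (simp add: free_algebra_fin_def free_algebra_fin_axioms_def)
  interpret G: free_algebra_fin G n using G n by (simp add: free_algebra_fin_def free_algebra_fin_axioms_def)
  interpret ring_pair "free_alg F {..<n}" "free_alg G {..<n}" .
  have tr: "interp_sentence (free_alg F {..<n}) n \<phi> = interp_sentence (free_alg G {..<n}) n \<phi>" for \<phi>
    using elem_equiv_transfer[OF eq dfb_interp_sentence[OF n]] F.FA_zero G.FA_zero by blast
  have EF: "\<exists>b x. b \<in> F.FC \<and> (\<forall>i<n. x i \<in> F.FC) \<and> free_axioms F.FA n b x"
    using F.free_axioms_letters[OF F(2) F.X_FC(1) F.letter_nonzero] F.X_FC(1) F.X_FC' by blast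
  \<comment> \<open>A trivially true sentence reduces \<open>interp_sentence\<close> to the
    solvability of the axioms, which is thereby carried over to the algebra over
    \<open>G\<close>.\<close>
  let ?\<phi> = "HFAll 0 (HFEq (RVar 0) (RVar 0))"
  have "interp_sentence (free_alg F {..<n}) n ?\<phi>"
    using F.interp_sentence_iff[of ?\<phi>] EF by (simp add: HF_models_def)
  then have EG: "\<exists>b x. b \<in> G.FC \<and> (\<forall>i<n. x i \<in> G.FC) \<and> free_axioms G.FA n b x"
    using tr G.interp_sentence_iff[of ?\<phi>] by simp
  have "HF_models F \<phi> = HF_models G \<phi>" if "hform_free_F \<phi> = {}" "hform_free_S \<phi> = {}" for \<phi>
    using F.interp_sentence_iff[OF that] G.interp_sentence_iff[OF that] EF EG tr[of \<phi>] by blast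
  then show ?thesis unfolding HF_elem_equiv_def by blast
qed

section \<open>Interpreting a free algebra in hereditarily finite sets\<close>

text \<open>The field operations become relations on atoms, so that the interpretation works with
  variables of the set sort alone.\<close>

definition atom_add :: "('k, 'm) ring_scheme \<Rightarrow> 'k hfset \<Rightarrow> 'k hfset \<Rightarrow> 'k hfset \<Rightarrow> bool" where
  "atom_add F u v w \<longleftrightarrow> (\<exists>a\<in>carrier F. \<exists>b\<in>carrier F. u = Atom a \<and> v = Atom b \<and> w = Atom (a \<oplus>\<^bsub>F\<^esub> b))"

definition atom_mult :: "('k, 'm) ring_scheme \<Rightarrow> 'k hfset \<Rightarrow> 'k hfset \<Rightarrow> 'k hfset \<Rightarrow> bool" where
  "atom_mult F u v w \<longleftrightarrow> (\<exists>a\<in>carrier F. \<exists>b\<in>carrier F. u = Atom a \<and> v = Atom b \<and> w = Atom (a \<otimes>\<^bsub>F\<^esub> b))"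

definition var_pair where
  "var_pair t u \<longleftrightarrow> (\<exists>i::nat. t = (\<lambda>e. e i) \<and> u = (\<lambda>e. e i))"

definition hf_atomic where
  "hf_atomic F G P Q \<longleftrightarrow> (\<exists>i j k :: nat.
     (P = (\<lambda>e. e i = e j) \<and> Q = (\<lambda>e. e i = e j)) \<or>
     (P = (\<lambda>e. hf_mem (e i) (e j)) \<and> Q = (\<lambda>e. hf_mem (e i) (e j))) \<or>
     (P = (\<lambda>e. atom_add F (e i) (e j) (e k)) \<and> Q = (\<lambda>e. atom_add G (e i) (e j) (e k))) \<or>
     (P = (\<lambda>e. atom_mult F (e i) (e j) (e k)) \<and> Q = (\<lambda>e. atom_mult G (e i) (e j) (e k))))"

lemma hf_atomic_intros:
  "hf_atomic F G (\<lambda>e. e i = e j) (\<lambda>e. e i = e j)"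
  "hf_atomic F G (\<lambda>e. hf_mem (e i) (e j)) (\<lambda>e. hf_mem (e i) (e j))"
  "hf_atomic F G (\<lambda>e. atom_add F (e i) (e j) (e k)) (\<lambda>e. atom_add G (e i) (e j) (e k))"
  "hf_atomic F G (\<lambda>e. atom_mult F (e i) (e j) (e k)) (\<lambda>e. atom_mult G (e i) (e j) (e k))"
  unfolding hf_atomic_def by blast+

locale hf_pair = F: field F + G: field G for F :: "('k, 'm) ring_scheme" and G :: "('l, 'n) ring_scheme"

lemma finitely_supported_vars: "finitely_supported (\<lambda>e. f (e (i::nat)) (e j) (e k))"
  unfolding finitely_supported_def by (rule exI[of _ "Suc (i + j + k)"]) simp

sublocale hf_pair \<subseteq> definability "HF (carrier F)" "HF (carrier G)" var_pair "hf_atomic F G"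
proof
  show "var_pair (\<lambda>e. e i) (\<lambda>e. e i)" for i by (auto simp: var_pair_def)
  show "finitely_supported t \<and> finitely_supported u" if "var_pair t u"
    for t :: "(nat \<Rightarrow> 'k hfset) \<Rightarrow> 'k hfset" and u :: "(nat \<Rightarrow> 'l hfset) \<Rightarrow> 'l hfset"
    using that finitely_supported_vars[of "\<lambda>x y z. x"] finitely_supported_vars[of "\<lambda>x y z. x"]
    by (auto simp: var_pair_def)
  show "finitely_supported P \<and> finitely_supported Q" if a: "hf_atomic F G P Q" for P Q
  proof -
    note v = finitely_supported_vars[of "\<lambda>x y z. x = y"] finitely_supported_vars[of "\<lambda>x y z. hf_mem x y"]
    show ?thesis using a unfolding hf_atomic_def
      by (elim exE disjE conjE; hypsubst) (intro conjI v finitely_supported_vars[of "atom_add _"]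
        finitely_supported_vars[of "atom_mult _"])+
  qed
  show "hf_atomic F G (\<lambda>e. P (\<lambda>i. \<sigma> i e)) (\<lambda>e. Q (\<lambda>i. \<tau> i e))"
    if a: "hf_atomic F G P Q" and s: "\<And>i. var_pair (\<sigma> i) (\<tau> i)" for P Q \<sigma> \<tau>
  proof -
    obtain f where f: "\<And>i. \<sigma> i = (\<lambda>e. e (f i))" "\<And>i. \<tau> i = (\<lambda>e. e (f i))"
      using s unfolding var_pair_def by metis
    obtain i j k where "(P = (\<lambda>e. e i = e j) \<and> Q = (\<lambda>e. e i = e j)) \<or>
     (P = (\<lambda>e. hf_mem (e i) (e j)) \<and> Q = (\<lambda>e. hf_mem (e i) (e j))) \<or>
     (P = (\<lambda>e. atom_add F (e i) (e j) (e k)) \<and> Q = (\<lambda>e. atom_add G (e i) (e j) (e k))) \<or>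
     (P = (\<lambda>e. atom_mult F (e i) (e j) (e k)) \<and> Q = (\<lambda>e. atom_mult G (e i) (e j) (e k)))"
      using a unfolding hf_atomic_def by blast
    then show ?thesis unfolding hf_atomic_def f
      by (intro exI[of _ "f i"] exI[of _ "f j"] exI[of _ "f k"]) auto
  qed
qed

text \<open>There is no equality between the two sorts. Instead some set contains the field element
  \<open>p\<close> and has the value of variable \<open>i\<close> as its only member.\<close>

definition is_atom_form :: "rterm \<Rightarrow> nat \<Rightarrow> hform" where
  "is_atom_form p i = HNeg (HSAll (Suc i) (HNeg (HAnd (HFMem p (Suc i)) (HAnd (HSMem i (Suc i))
     (HSAll (Suc (Suc i)) (HNeg (HAnd (HSMem (Suc (Suc i)) (Suc i)) (HNeg (HSEq (Suc (Suc i)) i)))))))))"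

lemma hform_sat_is_atom:
  assumes "rterm_val F f p \<in> carrier F"
  shows "hform_sat F f e (is_atom_form p i) \<longleftrightarrow> e i = Atom (rterm_val F f p)"
proof -
  let ?a = "Atom (rterm_val F f p)"
  have "hform_sat F f e (is_atom_form p i) \<longleftrightarrow> (\<exists>z\<in>HF (carrier F). hf_mem ?a z \<and> hf_mem (e i) z \<and>
      (\<forall>v\<in>HF (carrier F). hf_mem v z \<longrightarrow> v = e i))"
    by (auto simp: is_atom_form_def)
  also have "\<dots> \<longleftrightarrow> e i = ?a"
  proof
    assume "e i = ?a"
    then show "\<exists>z\<in>HF (carrier F). hf_mem ?a z \<and> hf_mem (e i) z \<and> (\<forall>v\<in>HF (carrier F). hf_mem v z \<longrightarrow> v = e i)"
      using assms by (intro bexI[of _ "FinSet {|?a|}"]) auto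
  qed (use assms in auto)
  finally show ?thesis .
qed

definition atom_op_form :: "rterm \<Rightarrow> nat \<Rightarrow> nat \<Rightarrow> nat \<Rightarrow> hform" where
  "atom_op_form p i j k = HNeg (HFAll 0 (HFAll 1 (HNeg (HAnd (is_atom_form (RVar 0) i)
     (HAnd (is_atom_form (RVar 1) j) (is_atom_form p k))))))"

lemma (in field) hform_sat_atom_op:
  shows "hform_sat R f e (atom_op_form (RAdd (RVar 0) (RVar 1)) i j k) \<longleftrightarrow> atom_add R (e i) (e j) (e k)"
    and "hform_sat R f e (atom_op_form (RMul (RVar 0) (RVar 1)) i j k) \<longleftrightarrow> atom_mult R (e i) (e j) (e k)"
  unfolding atom_op_form_def atom_add_def atom_mult_def by (simp_all add: hform_sat_is_atom) blast+

text \<open>Field variables occur only bound, inside \<open>atom_op_form\<close>, so truth does not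
  depend on the valuation \<open>f\<close>.\<close>

lemma (in hf_pair) dfb_formula:
  "dfb P Q \<Longrightarrow> \<exists>\<psi>. (\<forall>f e. P e = hform_sat F f e \<psi>) \<and> (\<forall>f e. Q e = hform_sat G f e \<psi>)"
proof (induction rule: dfb.induct)
  case (dfb_atom P Q)
  then obtain i j k where "(P = (\<lambda>e. e i = e j) \<and> Q = (\<lambda>e. e i = e j)) \<or>
     (P = (\<lambda>e. hf_mem (e i) (e j)) \<and> Q = (\<lambda>e. hf_mem (e i) (e j))) \<or>
     (P = (\<lambda>e. atom_add F (e i) (e j) (e k)) \<and> Q = (\<lambda>e. atom_add G (e i) (e j) (e k))) \<or>
     (P = (\<lambda>e. atom_mult F (e i) (e j) (e k)) \<and> Q = (\<lambda>e. atom_mult G (e i) (e j) (e k)))"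
    unfolding hf_atomic_def by blast
  then show ?case
  proof (elim disjE conjE)
    assume "P = (\<lambda>e. e i = e j)" "Q = (\<lambda>e. e i = e j)"
    then show ?thesis by (intro exI[of _ "HSEq i j"]) simp
  next
    assume "P = (\<lambda>e. hf_mem (e i) (e j))" "Q = (\<lambda>e. hf_mem (e i) (e j))"
    then show ?thesis by (intro exI[of _ "HSMem i j"]) simp
  next
    assume "P = (\<lambda>e. atom_add F (e i) (e j) (e k))" "Q = (\<lambda>e. atom_add G (e i) (e j) (e k))"
    then show ?thesis using F.hform_sat_atom_op(1) G.hform_sat_atom_op(1)
      by (intro exI[of _ "atom_op_form (RAdd (RVar 0) (RVar 1)) i j k"]) simp
  next
    assume "P = (\<lambda>e. atom_mult F (e i) (e j) (e k))" "Q = (\<lambda>e. atom_mult G (e i) (e j) (e k))"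
    then show ?thesis using F.hform_sat_atom_op(2) G.hform_sat_atom_op(2)
      by (intro exI[of _ "atom_op_form (RMul (RVar 0) (RVar 1)) i j k"]) simp
  qed
next
  case (dfb_neg P Q)
  then obtain \<psi> where "\<forall>f e. P e = hform_sat F f e \<psi>" "\<forall>f e. Q e = hform_sat G f e \<psi>" by blast
  then show ?case by (intro exI[of _ "HNeg \<psi>"]) simp
next
  case (dfb_conj P Q P' Q')
  then obtain \<psi> \<psi>' where "\<forall>f e. P e = hform_sat F f e \<psi>" "\<forall>f e. Q e = hform_sat G f e \<psi>"
    "\<forall>f e. P' e = hform_sat F f e \<psi>'" "\<forall>f e. Q' e = hform_sat G f e \<psi>'" by blast
  then show ?case by (intro exI[of _ "HAnd \<psi> \<psi>'"]) simp
next
  case (dfb_alln P Q i)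
  then obtain \<psi> where "\<forall>f e. P e = hform_sat F f e \<psi>" "\<forall>f e. Q e = hform_sat G f e \<psi>" by blast
  then show ?case by (intro exI[of _ "HSAll i \<psi>"]) simp
qed

primrec halls :: "nat \<Rightarrow> hform \<Rightarrow> hform" where
  "halls 0 \<psi> = \<psi>"
| "halls (Suc n) \<psi> = HFAll n (HSAll n (halls n \<psi>))"

lemma hform_free_halls:
  "hform_free_F (halls n \<psi>) = hform_free_F \<psi> - {..<n}" "hform_free_S (halls n \<psi>) = hform_free_S \<psi> - {..<n}"
  by (induction n) (auto simp: lessThan_Suc)

lemma hform_free_bounded: "\<exists>N. hform_free_F \<psi> \<subseteq> {..<N} \<and> hform_free_S \<psi> \<subseteq> {..<N}"
proof -
  have "finite (hform_free_F \<psi> \<union> hform_free_S \<psi>)" by (induction \<psi>) (auto simp: finite_rterm_vars)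
  then obtain N where "\<forall>i\<in>hform_free_F \<psi> \<union> hform_free_S \<psi>. i < N" using finite_nat_set_iff_bounded by blast
  then show ?thesis by blast
qed

lemma hform_sat_halls:
  "(\<And>f e. hform_sat F f e \<psi> = p) \<Longrightarrow> a \<in> carrier F \<Longrightarrow> hform_sat F f e (halls n \<psi>) = p"
proof (induction n arbitrary: f e)
  case (Suc n)
  have "hform_sat F f e (halls n \<psi>) = p" for f e by (rule Suc.IH[OF Suc.prems])
  moreover have "Atom a \<in> HF (carrier F)" using Suc.prems(2) by simp
  ultimately show ?case using Suc.prems(2) unfolding halls.simps hform_sat.simps by blast
qed simp

lemma (in hf_pair) elem_equiv_transfer:
  assumes "HF_elem_equiv F G" "dfb (\<lambda>_. p) (\<lambda>_. q)"
  shows "p = q"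
proof -
  obtain \<psi> where \<psi>: "\<forall>f e. p = hform_sat F f e \<psi>" "\<forall>f e. q = hform_sat G f e \<psi>"
    using dfb_formula[OF assms(2)] by blast
  obtain N where N: "hform_free_F \<psi> \<subseteq> {..<N}" "hform_free_S \<psi> \<subseteq> {..<N}" using hform_free_bounded by blast
  let ?\<psi> = "halls N \<psi>"
  have fr: "hform_free_F ?\<psi> = {}" "hform_free_S ?\<psi> = {}" using N hform_free_halls by auto
  have "HF_models F ?\<psi> = hform_sat F (\<lambda>_. \<zero>\<^bsub>F\<^esub>) (\<lambda>_. Atom \<zero>\<^bsub>F\<^esub>) ?\<psi>"
    by (rule HF_models_closed[OF fr]) auto
  also have "\<dots> = p" by (rule hform_sat_halls[of _ _ _ "\<zero>\<^bsub>F\<^esub>"]) (use \<psi>(1) in auto)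
  finally have 1: "HF_models F ?\<psi> = p" .
  have "HF_models G ?\<psi> = hform_sat G (\<lambda>_. \<zero>\<^bsub>G\<^esub>) (\<lambda>_. Atom \<zero>\<^bsub>G\<^esub>) ?\<psi>"
    by (rule HF_models_closed[OF fr]) auto
  also have "\<dots> = q" by (rule hform_sat_halls[of _ _ _ "\<zero>\<^bsub>G\<^esub>"]) (use \<psi>(2) in auto)
  finally have "HF_models G ?\<psi> = q" .
  then show ?thesis using 1 assms(1) fr unfolding HF_elem_equiv_def by blast
qed

text \<open>Only atoms take part in addition; for an atom the witness \<open>v\<close> is the zero
  of the field.\<close>

definition is_atom :: "('k, 'm) ring_scheme \<Rightarrow> 'k hfset \<Rightarrow> bool" where
  "is_atom F u \<longleftrightarrow> (\<exists>v\<in>HF (carrier F). atom_add F u v u)"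

definition hf_empty :: "('k, 'm) ring_scheme \<Rightarrow> 'k hfset \<Rightarrow> bool" where
  "hf_empty F u \<longleftrightarrow> \<not> is_atom F u \<and> (\<forall>v\<in>HF (carrier F). \<not> hf_mem v u)"

definition hf_upair :: "('k, 'm) ring_scheme \<Rightarrow> 'k hfset \<Rightarrow> 'k hfset \<Rightarrow> 'k hfset \<Rightarrow> bool" where
  "hf_upair F z a b \<longleftrightarrow> \<not> is_atom F z \<and> (\<forall>v\<in>HF (carrier F). hf_mem v z \<longleftrightarrow> v = a \<or> v = b)"

definition hf_opair :: "('k, 'm) ring_scheme \<Rightarrow> 'k hfset \<Rightarrow> 'k hfset \<Rightarrow> 'k hfset \<Rightarrow> bool" where
  "hf_opair F p a b \<longleftrightarrow> (\<exists>y\<in>HF (carrier F). \<exists>z\<in>HF (carrier F).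
     hf_upair F y a a \<and> hf_upair F z a b \<and> hf_upair F p y z)"

text \<open>Iterated singletons of the empty set, the Zermelo numerals, serve as names of the
  letters.\<close>

primrec hf_tag :: "('k, 'm) ring_scheme \<Rightarrow> nat \<Rightarrow> 'k hfset \<Rightarrow> bool" where
  "hf_tag F 0 u \<longleftrightarrow> hf_empty F u"
| "hf_tag F (Suc i) u \<longleftrightarrow> (\<exists>v\<in>HF (carrier F). hf_tag F i v \<and> hf_upair F u v v)"

definition hf_entry :: "('k, 'm) ring_scheme \<Rightarrow> nat \<Rightarrow> 'k hfset \<Rightarrow> 'k hfset \<Rightarrow> bool" where
  "hf_entry F i u v \<longleftrightarrow> (\<exists>g\<in>HF (carrier F). \<exists>p\<in>HF (carrier F). hf_tag F i g \<and> hf_opair F p g v \<and> hf_mem p u)"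

text \<open>The coefficient and the child at a letter carry the same tag and are told apart by being
  an atom or a set. If there is no unique entry, the default applies;
  \<open>atom_add F a a a\<close> singles out the zero.\<close>

definition hf_cf :: "('k, 'm) ring_scheme \<Rightarrow> nat \<Rightarrow> 'k hfset \<Rightarrow> 'k hfset \<Rightarrow> bool" where
  "hf_cf F i u a \<longleftrightarrow>
     (is_atom F a \<and> hf_entry F i u a \<and> (\<forall>b\<in>HF (carrier F). is_atom F b \<and> hf_entry F i u b \<longrightarrow> b = a)) \<or>
     (atom_add F a a a \<and> \<not> (\<exists>b\<in>HF (carrier F). is_atom F b \<and> hf_entry F i u b \<and>
        (\<forall>c\<in>HF (carrier F). is_atom F c \<and> hf_entry F i u c \<longrightarrow> c = b)))"

definition hf_ch :: "('k, 'm) ring_scheme \<Rightarrow> nat \<Rightarrow> 'k hfset \<Rightarrow> 'k hfset \<Rightarrow> bool" where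
  "hf_ch F i u a \<longleftrightarrow>
     (\<not> is_atom F a \<and> hf_entry F i u a \<and> (\<forall>b\<in>HF (carrier F). \<not> is_atom F b \<and> hf_entry F i u b \<longrightarrow> b = a)) \<or>
     (hf_empty F a \<and> \<not> (\<exists>b\<in>HF (carrier F). \<not> is_atom F b \<and> hf_entry F i u b \<and>
        (\<forall>c\<in>HF (carrier F). \<not> is_atom F c \<and> hf_entry F i u c \<longrightarrow> c = b)))"

definition hf_in2 :: "('k, 'm) ring_scheme \<Rightarrow> 'k hfset \<Rightarrow> 'k hfset \<Rightarrow> 'k hfset \<Rightarrow> bool" where
  "hf_in2 F W u v \<longleftrightarrow> (\<exists>p\<in>HF (carrier F). hf_opair F p u v \<and> hf_mem p W)"

definition hf_in3 :: "('k, 'm) ring_scheme \<Rightarrow> 'k hfset \<Rightarrow> 'k hfset \<Rightarrow> 'k hfset \<Rightarrow> 'k hfset \<Rightarrow> bool" where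
  "hf_in3 F W u v w \<longleftrightarrow> (\<exists>p\<in>HF (carrier F). hf_opair F p v w \<and> hf_in2 F W u p)"

text \<open>\<open>hf_lin_step\<close> and \<open>hf_mult_step\<close> say that \<open>W\<close> is closed under passing from a tuple to its
  children; such a \<open>W\<close> witnesses by recursion on words the relations
  \<open>w = \<alpha> u + v\<close> and \<open>w = u g\<close> between the elements coded by its tuples.\<close>

definition hf_lin_step :: "('k, 'm) ring_scheme \<Rightarrow> nat \<Rightarrow> 'k hfset \<Rightarrow> 'k hfset \<Rightarrow> 'k hfset \<Rightarrow> 'k hfset \<Rightarrow> 'k hfset \<Rightarrow> bool" where
  "hf_lin_step F i \<alpha> W u v w \<longleftrightarrow>
     (\<exists>a\<in>HF (carrier F). \<exists>b\<in>HF (carrier F). \<exists>c\<in>HF (carrier F). \<exists>d\<in>HF (carrier F).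
       hf_cf F i u a \<and> hf_cf F i v b \<and> hf_cf F i w c \<and> atom_mult F \<alpha> a d \<and> atom_add F d b c) \<and>
     (\<exists>u'\<in>HF (carrier F). \<exists>v'\<in>HF (carrier F). \<exists>w'\<in>HF (carrier F).
       hf_ch F i u u' \<and> hf_ch F i v v' \<and> hf_ch F i w w' \<and> hf_in3 F W u' v' w')"

definition hf_lin :: "('k, 'm) ring_scheme \<Rightarrow> nat \<Rightarrow> 'k hfset \<Rightarrow> 'k hfset \<Rightarrow> 'k hfset \<Rightarrow> 'k hfset \<Rightarrow> bool" where
  "hf_lin F n \<alpha> u v w \<longleftrightarrow> (\<exists>W\<in>HF (carrier F). hf_in3 F W u v w \<and>
     (\<forall>u\<in>HF (carrier F). \<forall>v\<in>HF (carrier F). \<forall>w\<in>HF (carrier F). hf_in3 F W u v w \<longrightarrow>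
        (\<forall>i<n. hf_lin_step F i \<alpha> W u v w)))"

definition hf_mult_step :: "('k, 'm) ring_scheme \<Rightarrow> nat \<Rightarrow> nat \<Rightarrow> 'k hfset \<Rightarrow> 'k hfset \<Rightarrow> 'k hfset \<Rightarrow> 'k hfset \<Rightarrow> bool" where
  "hf_mult_step F n i g W u w \<longleftrightarrow>
     (\<exists>z\<in>HF (carrier F). atom_add F z z z \<and> hf_cf F i w z) \<and>
     (\<exists>a\<in>HF (carrier F). \<exists>u'\<in>HF (carrier F). \<exists>w'\<in>HF (carrier F). \<exists>p\<in>HF (carrier F).
       hf_cf F i u a \<and> hf_ch F i u u' \<and> hf_ch F i w w' \<and> hf_in2 F W u' p \<and> hf_lin F n a g p w')"

definition hf_mult :: "('k, 'm) ring_scheme \<Rightarrow> nat \<Rightarrow> 'k hfset \<Rightarrow> 'k hfset \<Rightarrow> 'k hfset \<Rightarrow> bool" where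
  "hf_mult F n g u w \<longleftrightarrow> (\<exists>W\<in>HF (carrier F). hf_in2 F W u w \<and>
     (\<forall>u\<in>HF (carrier F). \<forall>w\<in>HF (carrier F). hf_in2 F W u w \<longrightarrow> (\<forall>i<n. hf_mult_step F n i g W u w)))"

text \<open>The case \<alpha> = 1 of the linear relation; 1 is singled out as the neutral
  atom.\<close>

definition hf_sum :: "('k, 'm) ring_scheme \<Rightarrow> nat \<Rightarrow> 'k hfset \<Rightarrow> 'k hfset \<Rightarrow> 'k hfset \<Rightarrow> bool" where
  "hf_sum F n u v w \<longleftrightarrow> (\<exists>\<alpha>\<in>HF (carrier F). is_atom F \<alpha> \<and>
     (\<forall>b\<in>HF (carrier F). is_atom F b \<longrightarrow> atom_mult F \<alpha> b b) \<and> hf_lin F n \<alpha> u v w)"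

primrec hf_term :: "('k, 'm) ring_scheme \<Rightarrow> nat \<Rightarrow> rterm \<Rightarrow> (nat \<Rightarrow> 'k hfset) \<Rightarrow> 'k hfset \<Rightarrow> bool" where
  "hf_term F n (RVar i) e u \<longleftrightarrow> u = e i"
| "hf_term F n RZero e u \<longleftrightarrow> hf_empty F u"
| "hf_term F n (RAdd p q) e u \<longleftrightarrow> (\<exists>v\<in>HF (carrier F). \<exists>w\<in>HF (carrier F).
     hf_term F n p e v \<and> hf_term F n q e w \<and> hf_sum F n v w u)"
| "hf_term F n (RMul p q) e u \<longleftrightarrow> (\<exists>v\<in>HF (carrier F). \<exists>w\<in>HF (carrier F).
     hf_term F n p e v \<and> hf_term F n q e w \<and> hf_mult F n w v u)"

text \<open>Different sets may code the same element, so equality is interpreted as u + 0 = v, with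
  the empty set as a code of 0.\<close>

primrec alg_interp :: "('k, 'm) ring_scheme \<Rightarrow> nat \<Rightarrow> rform \<Rightarrow> (nat \<Rightarrow> 'k hfset) \<Rightarrow> bool" where
  "alg_interp F n (REq p q) e \<longleftrightarrow> (\<exists>u\<in>HF (carrier F). \<exists>v\<in>HF (carrier F). \<exists>z\<in>HF (carrier F).
     hf_term F n p e u \<and> hf_term F n q e v \<and> hf_empty F z \<and> hf_sum F n u z v)"
| "alg_interp F n (RNeg \<phi>) e \<longleftrightarrow> \<not> alg_interp F n \<phi> e"
| "alg_interp F n (RAnd \<phi> \<psi>) e \<longleftrightarrow> alg_interp F n \<phi> e \<and> alg_interp F n \<psi> e"
| "alg_interp F n (RAll i \<phi>) e \<longleftrightarrow> (\<forall>a\<in>HF (carrier F). alg_interp F n \<phi> (e(i := a)))"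

section \<open>Definability of the coded operations\<close>

context hf_pair
begin

lemma dfb_atomic:
  "dfb (\<lambda>e. e i = e j) (\<lambda>e. e i = e j)"
  "dfb (\<lambda>e. hf_mem (e i) (e j)) (\<lambda>e. hf_mem (e i) (e j))"
  "dfb (\<lambda>e. atom_add F (e i) (e j) (e k)) (\<lambda>e. atom_add G (e i) (e j) (e k))"
  "dfb (\<lambda>e. atom_mult F (e i) (e j) (e k)) (\<lambda>e. atom_mult G (e i) (e j) (e k))"
  by (rule dfb_atom[OF hf_atomic_intros(1)], rule dfb_atom[OF hf_atomic_intros(2)],
    rule dfb_atom[OF hf_atomic_intros(3)], rule dfb_atom[OF hf_atomic_intros(4)])

lemmas dfb_simps = dfb_atomic dfb_neg dfb_conj dfb_disj dfb_imp dfb_iff dfb_all dfb_ex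

lemma dfb_bounded_all:
  "(\<And>k. k < n \<Longrightarrow> dfb (P k) (Q k)) \<Longrightarrow> dfb (\<lambda>e. \<forall>k<n. P k e) (\<lambda>e. \<forall>k<(n::nat). Q k e)"
proof (induction n)
  case 0
  have "dfb (\<lambda>_. True) (\<lambda>_. True)" using dfb_atomic(1)[of 0 0] by simp
  then show ?case by simp
next
  case (Suc n)
  have "dfb (\<lambda>e. P n e \<and> (\<forall>k<n. P k e)) (\<lambda>e. Q n e \<and> (\<forall>k<n. Q k e))"
    using Suc by (intro dfb_conj) auto
  then show ?case by (simp add: All_less_Suc)
qed

lemma dfb_is_atom: "dfb (\<lambda>e. is_atom F (e i)) (\<lambda>e. is_atom G (e i))"
  unfolding is_atom_def by (rule dfb_simps)+

lemma dfb_hf_empty: "dfb (\<lambda>e. hf_empty F (e i)) (\<lambda>e. hf_empty G (e i))"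
  unfolding hf_empty_def by (rule dfb_is_atom dfb_simps)+

lemma dfb_hf_upair: "dfb (\<lambda>e. hf_upair F (e i) (e j) (e k)) (\<lambda>e. hf_upair G (e i) (e j) (e k))"
  unfolding hf_upair_def by (rule dfb_is_atom dfb_simps)+

lemma dfb_hf_opair: "dfb (\<lambda>e. hf_opair F (e i) (e j) (e k)) (\<lambda>e. hf_opair G (e i) (e j) (e k))"
  unfolding hf_opair_def by (rule dfb_hf_upair dfb_simps)+

lemma dfb_hf_tag: "dfb (\<lambda>e. hf_tag F k (e i)) (\<lambda>e. hf_tag G k (e i))"
proof (induction k arbitrary: i)
  case (Suc k)
  show ?case unfolding hf_tag.simps by (rule Suc.IH dfb_hf_upair dfb_simps)+
qed (simp add: dfb_hf_empty)

lemma dfb_hf_entry: "dfb (\<lambda>e. hf_entry F k (e i) (e j)) (\<lambda>e. hf_entry G k (e i) (e j))"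
  unfolding hf_entry_def by (rule dfb_hf_tag dfb_hf_opair dfb_simps)+

lemma dfb_hf_cf: "dfb (\<lambda>e. hf_cf F k (e i) (e j)) (\<lambda>e. hf_cf G k (e i) (e j))"
  unfolding hf_cf_def by (rule dfb_hf_entry dfb_is_atom dfb_simps)+

lemma dfb_hf_ch: "dfb (\<lambda>e. hf_ch F k (e i) (e j)) (\<lambda>e. hf_ch G k (e i) (e j))"
  unfolding hf_ch_def by (rule dfb_hf_entry dfb_is_atom dfb_hf_empty dfb_simps)+

lemma dfb_hf_in2: "dfb (\<lambda>e. hf_in2 F (e i) (e j) (e k)) (\<lambda>e. hf_in2 G (e i) (e j) (e k))"
  unfolding hf_in2_def by (rule dfb_hf_opair dfb_simps)+

lemma dfb_hf_in3: "dfb (\<lambda>e. hf_in3 F (e i) (e j) (e k) (e l)) (\<lambda>e. hf_in3 G (e i) (e j) (e k) (e l))"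
  unfolding hf_in3_def by (rule dfb_hf_opair dfb_hf_in2 dfb_simps)+

lemma dfb_hf_lin_step:
  "dfb (\<lambda>e. hf_lin_step F i (e i1) (e i2) (e i3) (e i4) (e i5))
    (\<lambda>e. hf_lin_step G i (e i1) (e i2) (e i3) (e i4) (e i5))"
  unfolding hf_lin_step_def by (rule dfb_hf_cf dfb_hf_ch dfb_hf_in3 dfb_simps)+

lemma dfb_hf_lin:
  "dfb (\<lambda>e. hf_lin F n (e i1) (e i2) (e i3) (e i4)) (\<lambda>e. hf_lin G n (e i1) (e i2) (e i3) (e i4))"
  unfolding hf_lin_def by (rule dfb_hf_in3 dfb_bounded_all dfb_hf_lin_step dfb_simps)+

lemma dfb_hf_mult_step:
  "dfb (\<lambda>e. hf_mult_step F n i (e i1) (e i2) (e i3) (e i4))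
    (\<lambda>e. hf_mult_step G n i (e i1) (e i2) (e i3) (e i4))"
  unfolding hf_mult_step_def by (rule dfb_hf_cf dfb_hf_ch dfb_hf_in2 dfb_hf_lin dfb_simps)+

lemma dfb_hf_mult:
  "dfb (\<lambda>e. hf_mult F n (e i1) (e i2) (e i3)) (\<lambda>e. hf_mult G n (e i1) (e i2) (e i3))"
  unfolding hf_mult_def by (rule dfb_hf_in2 dfb_bounded_all dfb_hf_mult_step dfb_simps)+

lemma dfb_hf_sum:
  "dfb (\<lambda>e. hf_sum F n (e i1) (e i2) (e i3)) (\<lambda>e. hf_sum G n (e i1) (e i2) (e i3))"
  unfolding hf_sum_def by (rule dfb_is_atom dfb_hf_lin dfb_simps)+

lemma dfb_hf_term:
  fixes g :: "nat \<Rightarrow> nat"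
  shows "dfb (\<lambda>e. hf_term F n p (\<lambda>i. e (g i)) (e k)) (\<lambda>e. hf_term G n p (\<lambda>i. e (g i)) (e k))"
proof (induction p arbitrary: g k)
  case (RAdd p q)
  show ?case unfolding hf_term.simps
    by (rule dfb_hf_sum dfb_conj dfb_ex RAdd.IH(1)[of "\<lambda>i. Suc (Suc (g i))"]
        RAdd.IH(2)[of "\<lambda>i. Suc (Suc (g i))"])+
next
  case (RMul p q)
  show ?case unfolding hf_term.simps
    by (rule dfb_hf_mult dfb_conj dfb_ex RMul.IH(1)[of "\<lambda>i. Suc (Suc (g i))"]
        RMul.IH(2)[of "\<lambda>i. Suc (Suc (g i))"])+
qed (unfold hf_term.simps, (rule dfb_atomic dfb_hf_empty)+)

lemma dfb_alg_interp: "dfb (\<lambda>e. alg_interp F n \<phi> e) (\<lambda>e. alg_interp G n \<phi> e)"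
proof (induction \<phi>)
  case (REq p q)
  show ?case unfolding alg_interp.simps
    by (rule dfb_ex dfb_conj dfb_hf_sum dfb_hf_empty dfb_hf_term[where g = "\<lambda>i. Suc (Suc (Suc i))"])+
next
  case (RNeg \<phi>)
  then show ?case unfolding alg_interp.simps by (rule dfb_neg)
next
  case (RAnd \<phi> \<psi>)
  then show ?case unfolding alg_interp.simps by (rule dfb_conj)
next
  case (RAll i \<phi>)
  then show ?case unfolding alg_interp.simps by (rule dfb_alln)
qed

end

section \<open>Pairs, tags and entries of sets\<close>

primrec hrank :: "'a hfset \<Rightarrow> nat" where
  "hrank (Atom a) = 0"
| "hrank (FinSet S) = Suc (Max (insert 0 (fset (hrank |`| S))))"

lemma hrank_mem: "hf_mem v u \<Longrightarrow> hrank v < hrank u"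
proof (cases u)
  case (FinSet S)
  assume "hf_mem v u"
  then have "hrank v \<in> insert 0 (fset (hrank |`| S))" using FinSet by auto
  then have "hrank v \<le> Max (insert 0 (fset (hrank |`| S)))" by (intro Max_ge) auto
  then show ?thesis using FinSet by simp
qed simp

text \<open>The Kuratowski pair; singletons are written as unordered pairs to match
  \<open>hf_opair\<close>.\<close>

definition kpair :: "'a hfset \<Rightarrow> 'a hfset \<Rightarrow> 'a hfset" where
  "kpair a b = FinSet {|FinSet {|a, a|}, FinSet {|a, b|}|}"

lemma kpair_inject [simp]: "kpair a b = kpair c d \<longleftrightarrow> a = c \<and> b = d"
proof
  assume "kpair a b = kpair c d"
  then have "{{a, a}, {a, b}} = {{c, c}, {c, d}}"
    unfolding kpair_def hfset.inject by (metis (no_types, lifting) bot_fset.rep_eq finsert.rep_eq hfset.inject(2) fdoubleton_eq_iff)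
  then show "a = c \<and> b = d" by (auto simp: doubleton_eq_iff)
qed simp

lemma hrank_kpair: "hf_mem (kpair a b) u \<Longrightarrow> hrank b < hrank u"
proof -
  assume "hf_mem (kpair a b) u"
  then have "hrank (kpair a b) < hrank u" by (rule hrank_mem)
  moreover have "hrank b < hrank (FinSet {|a, b|})" by (rule hrank_mem) simp
  moreover have "hrank (FinSet {|a, b|}) < hrank (kpair a b)" by (rule hrank_mem) (simp add: kpair_def)
  ultimately show ?thesis by linarith
qed

primrec tagset :: "nat \<Rightarrow> 'a hfset" where
  "tagset 0 = FinSet {||}"
| "tagset (Suc i) = FinSet {|tagset i, tagset i|}"

lemma tagset_inject [simp]: "tagset i = tagset j \<longleftrightarrow> i = j"
proof -
  have r: "hrank (tagset k) = Suc k" for k by (induction k) auto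
  show ?thesis using r[of i] r[of j] by (metis old.nat.inject)
qed

definition pick :: "('a \<Rightarrow> bool) \<Rightarrow> 'a \<Rightarrow> 'a" where
  "pick P d = (if \<exists>!x. P x then THE x. P x else d)"

text \<open>Unfolds a definite description with default into the first-order shape of
  \<open>hf_cf\<close> and \<open>hf_ch\<close>.\<close>

lemma pick_iff:
  "a = pick P d \<longleftrightarrow> (P a \<and> (\<forall>b. P b \<longrightarrow> b = a)) \<or> (a = d \<and> \<not> (\<exists>b. P b \<and> (\<forall>c. P c \<longrightarrow> c = b)))"
proof (cases "\<exists>!x. P x")
  case True
  then obtain x where x: "P x" "\<And>y. P y \<Longrightarrow> y = x" by blast
  then have "(THE x. P x) = x" by blast
  then have "pick P d = x" using True by (simp add: pick_def)
  then show ?thesis using x by blast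
next
  case False
  then have pd: "pick P d = d" unfolding pick_def by (rule if_not_P)
  have "\<not> (\<exists>b. P b \<and> (\<forall>c. P c \<longrightarrow> c = b))" using False by blast
  then show ?thesis unfolding pd by blast
qed

lemma pick_cases: "P (pick P d) \<or> pick P d = d"
  using pick_iff[of "pick P d" P d] by blast

definition atom_of :: "'a hfset \<Rightarrow> 'a" where
  "atom_of u = (case u of Atom a \<Rightarrow> a | FinSet _ \<Rightarrow> undefined)"

definition cf_atom :: "('k, 'm) ring_scheme \<Rightarrow> nat \<Rightarrow> 'k hfset \<Rightarrow> 'k hfset" where
  "cf_atom F i u = pick (\<lambda>v. (\<exists>a. v = Atom a) \<and> hf_mem (kpair (tagset i) v) u) (Atom \<zero>\<^bsub>F\<^esub>)"

text \<open>A hereditarily finite set \<open>u\<close> codes the element with coefficient \<open>hcf F i u\<close> at the \<open>i\<close>-th letter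
  and with the element coded by \<open>hch i u\<close> as its \<open>i\<close>-th child. Ill-formed entries count as zero, so
  every set is a code.\<close>

definition hcf :: "('k, 'm) ring_scheme \<Rightarrow> nat \<Rightarrow> 'k hfset \<Rightarrow> 'k" where
  "hcf F i u = atom_of (cf_atom F i u)"

definition hch :: "nat \<Rightarrow> 'k hfset \<Rightarrow> 'k hfset" where
  "hch i u = pick (\<lambda>v. \<not> (\<exists>a. v = Atom a) \<and> hf_mem (kpair (tagset i) v) u) (FinSet {||})"

lemma cf_atom_eq: "cf_atom F i u = Atom (hcf F i u)"
proof -
  have "\<exists>a. cf_atom F i u = Atom a"
    using pick_cases[of "\<lambda>v. (\<exists>a. v = Atom a) \<and> hf_mem (kpair (tagset i) v) u" "Atom \<zero>\<^bsub>F\<^esub>"]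
    unfolding cf_atom_def by blast
  then show ?thesis by (auto simp: hcf_def atom_of_def)
qed

lemma HF_mem: "u \<in> HF A \<Longrightarrow> hf_mem v u \<Longrightarrow> v \<in> HF A"
  by (cases u) auto

lemma HF_kpair [simp]: "kpair a b \<in> HF A \<longleftrightarrow> a \<in> HF A \<and> b \<in> HF A"
  by (auto simp: kpair_def)

lemma HF_tagset [simp]: "tagset i \<in> HF A"
  by (induction i) auto

lemma hch_HF: "u \<in> HF A \<Longrightarrow> hch i u \<in> HF A"
proof -
  assume u: "u \<in> HF A"
  show ?thesis using pick_cases[of "\<lambda>v. \<not> (\<exists>a. v = Atom a) \<and> hf_mem (kpair (tagset i) v) u" "FinSet {||}"]
    HF_mem[OF u, of "kpair (tagset i) (hch i u)"] unfolding hch_def[symmetric] by auto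
qed

lemma hch_rank: "hch i u = FinSet {||} \<or> hrank (hch i u) < hrank u"
  using pick_cases[of "\<lambda>v. \<not> (\<exists>a. v = Atom a) \<and> hf_mem (kpair (tagset i) v) u" "FinSet {||}"]
    hrank_kpair[of "tagset i" "hch i u" u] unfolding hch_def[symmetric] by auto

lemma hch_empty [simp]: "hch i (FinSet {||}) = FinSet {||}"
  using pick_cases[of "\<lambda>v. \<not> (\<exists>a. v = Atom a) \<and> hf_mem (kpair (tagset i) v) (FinSet {||})" "FinSet {||}"]
  unfolding hch_def[symmetric] by auto

lemma hcf_empty [simp]: "hcf F i (FinSet {||}) = \<zero>\<^bsub>F\<^esub>"
proof -
  have "cf_atom F i (FinSet {||}) = Atom \<zero>\<^bsub>F\<^esub>"
    using pick_cases[of "\<lambda>v. (\<exists>a. v = Atom a) \<and> hf_mem (kpair (tagset i) v) (FinSet {||})" "Atom \<zero>\<^bsub>F\<^esub>"]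
    unfolding cf_atom_def[symmetric] by auto
  then show ?thesis by (simp add: cf_atom_eq)
qed

text \<open>Ranks drop along children until the empty set is reached, which is its own child. The
  finite closures supply the tuples of the witnesses \<open>W\<close>.\<close>

lemma hch_closure:
  fixes n :: nat
  shows "u \<in> HF A \<Longrightarrow> \<exists>D. finite D \<and> D \<subseteq> HF A \<and> u \<in> D \<and> (\<forall>v\<in>D. \<forall>i<n. hch i v \<in> D)"
proof (induction "hrank u" arbitrary: u rule: less_induct)
  case less
  let ?Q = "\<lambda>i D. finite D \<and> D \<subseteq> HF A \<and> hch i u \<in> D \<and> (\<forall>v\<in>D. \<forall>i<n. hch i v \<in> D)"
  have ex: "\<exists>D. ?Q i D" for i
  proof (cases "hch i u = FinSet {||}")
    case True
    then show ?thesis by (intro exI[of _ "{FinSet {||}}"]) auto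
  next
    case False
    then show ?thesis using less.hyps[of "hch i u"] hch_rank[of i u] hch_HF[OF less.prems] by blast
  qed
  define D where "D i = (SOME D. ?Q i D)" for i
  have D: "?Q i (D i)" for i unfolding D_def by (rule someI_ex[OF ex])
  let ?U = "insert u (\<Union>i<n. D i)"
  have "\<forall>i<n. hch i v \<in> ?U" if v: "v \<in> ?U" for v
  proof (cases "v = u")
    case True
    then show ?thesis using D by blast
  next
    case False
    then obtain j where "j < n" "v \<in> D j" using v by blast
    then show ?thesis using D by blast
  qed
  moreover have "finite ?U" using D by blast
  moreover have "?U \<subseteq> HF A" using D less.prems by blast
  ultimately show ?case by blast
qed

section \<open>The element of the free algebra coded by a set\<close>

locale hf_coding = field F for F :: "('k, 'm) ring_scheme" (structure) +
  fixes n :: nat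
begin

sublocale free_algebra F "{..<n}" by unfold_locales auto

abbreviation "M \<equiv> HF (carrier F)"

lemma is_atom_iff: "u \<in> M \<Longrightarrow> is_atom F u \<longleftrightarrow> (\<exists>a. u = Atom a)"
proof
  assume "u \<in> M" "\<exists>a. u = Atom a"
  then obtain a where "u = Atom a" "a \<in> carrier F" by auto
  then show "is_atom F u" unfolding is_atom_def atom_add_def by (intro bexI[of _ "Atom \<zero>"]) auto
qed (auto simp: is_atom_def atom_add_def)

lemma hf_empty_iff: "u \<in> M \<Longrightarrow> hf_empty F u \<longleftrightarrow> u = FinSet {||}"
  unfolding hf_empty_def by (cases u) (auto simp: is_atom_iff HF_mem)

lemma hf_upair_iff:
  assumes "z \<in> M" "a \<in> M" "b \<in> M" shows "hf_upair F z a b \<longleftrightarrow> z = FinSet {|a, b|}"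
proof (cases z)
  case (FinSet S)
  have "(\<forall>v\<in>M. v |\<in>| S \<longleftrightarrow> v = a \<or> v = b) \<longleftrightarrow> S = {|a, b|}"
    using assms FinSet by (auto simp: fset_eq_iff)
  then show ?thesis using FinSet is_atom_iff[OF assms(1)] by (simp add: hf_upair_def)
qed (use assms in \<open>auto simp: hf_upair_def is_atom_iff\<close>)

lemma hf_opair_iff:
  assumes "p \<in> M" "a \<in> M" "b \<in> M" shows "hf_opair F p a b \<longleftrightarrow> p = kpair a b"
proof
  assume "hf_opair F p a b"
  then obtain y z where "y \<in> M" "z \<in> M" "hf_upair F y a a" "hf_upair F z a b" "hf_upair F p y z"
    unfolding hf_opair_def by blast
  then show "p = kpair a b" using assms by (simp add: hf_upair_iff kpair_def)
next
  assume p: "p = kpair a b"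
  show "hf_opair F p a b" unfolding hf_opair_def
    using assms p by (intro bexI[of _ "FinSet {|a, a|}"] bexI[of _ "FinSet {|a, b|}"])
      (auto simp: hf_upair_iff kpair_def)
qed

lemma hf_tag_iff: "u \<in> M \<Longrightarrow> hf_tag F i u \<longleftrightarrow> u = tagset i"
  by (induction i arbitrary: u) (auto simp: hf_empty_iff hf_upair_iff)

lemma hf_entry_iff: "u \<in> M \<Longrightarrow> v \<in> M \<Longrightarrow> hf_entry F i u v \<longleftrightarrow> hf_mem (kpair (tagset i) v) u"
  unfolding hf_entry_def using HF_mem[of u "carrier F"] by (auto simp: hf_tag_iff hf_opair_iff)

lemma entry_HF: "u \<in> M \<Longrightarrow> hf_mem (kpair g v) u \<Longrightarrow> v \<in> M"
  using HF_mem[of u "carrier F" "kpair g v"] by simp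

lemma hcf_closed [simp]: "u \<in> M \<Longrightarrow> hcf F i u \<in> carrier F"
proof -
  assume u: "u \<in> M"
  have "cf_atom F i u \<in> M"
    using pick_cases[of "\<lambda>v. (\<exists>a. v = Atom a) \<and> hf_mem (kpair (tagset i) v) u" "Atom \<zero>"] entry_HF[OF u]
    unfolding cf_atom_def[symmetric] by auto
  then show ?thesis by (simp add: cf_atom_eq)
qed

lemma hf_cf_iff:
  assumes "u \<in> M" "a \<in> M" shows "hf_cf F i u a \<longleftrightarrow> a = Atom (hcf F i u)"
proof -
  let ?P = "\<lambda>v. (\<exists>a. v = Atom a) \<and> hf_mem (kpair (tagset i) v) u"
  have P: "v \<in> M \<and> is_atom F v \<and> hf_entry F i u v \<longleftrightarrow> ?P v" for v
    using entry_HF[OF assms(1)] hf_entry_iff[OF assms(1), of v] is_atom_iff[of v] by blast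
  have z: "atom_add F a a a \<longleftrightarrow> a = Atom \<zero>"
    using assms(2) by (auto simp: atom_add_def)
  have "hf_cf F i u a \<longleftrightarrow> (?P a \<and> (\<forall>b. ?P b \<longrightarrow> b = a)) \<or> (a = Atom \<zero> \<and> \<not> (\<exists>b. ?P b \<and> (\<forall>c. ?P c \<longrightarrow> c = b)))"
    unfolding hf_cf_def z P[symmetric] using assms(2) by blast
  also have "\<dots> \<longleftrightarrow> a = cf_atom F i u" unfolding cf_atom_def by (rule pick_iff[symmetric])
  finally show ?thesis by (simp add: cf_atom_eq)
qed

lemma hf_ch_iff:
  assumes "u \<in> M" "a \<in> M" shows "hf_ch F i u a \<longleftrightarrow> a = hch i u"
proof -
  let ?P = "\<lambda>v. \<not> (\<exists>a. v = Atom a) \<and> hf_mem (kpair (tagset i) v) u"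
  have P: "v \<in> M \<and> \<not> is_atom F v \<and> hf_entry F i u v \<longleftrightarrow> ?P v" for v
    using entry_HF[OF assms(1)] hf_entry_iff[OF assms(1), of v] is_atom_iff[of v] by blast
  have "hf_ch F i u a \<longleftrightarrow> (?P a \<and> (\<forall>b. ?P b \<longrightarrow> b = a)) \<or> (a = FinSet {||} \<and> \<not> (\<exists>b. ?P b \<and> (\<forall>c. ?P c \<longrightarrow> c = b)))"
    unfolding hf_ch_def hf_empty_iff[OF assms(2)] P[symmetric] using assms(2) by blast
  also have "\<dots> \<longleftrightarrow> a = hch i u" unfolding hch_def by (rule pick_iff[symmetric])
  finally show ?thesis .
qed

lemma hf_in2_iff: "W \<in> M \<Longrightarrow> u \<in> M \<Longrightarrow> v \<in> M \<Longrightarrow> hf_in2 F W u v \<longleftrightarrow> hf_mem (kpair u v) W"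
  unfolding hf_in2_def by (auto simp: hf_opair_iff)

lemma hf_in3_iff:
  "W \<in> M \<Longrightarrow> u \<in> M \<Longrightarrow> v \<in> M \<Longrightarrow> w \<in> M \<Longrightarrow> hf_in3 F W u v w \<longleftrightarrow> hf_mem (kpair u (kpair v w)) W"
  unfolding hf_in3_def by (auto simp: hf_opair_iff hf_in2_iff)

primrec hval :: "nat list \<Rightarrow> 'k hfset \<Rightarrow> 'k" where
  "hval [] u = \<zero>"
| "hval (i # w) u = (if i < n then if w = [] then hcf F i u else hval w (hch i u) else \<zero>)"

lemma hval_closed [simp]: "u \<in> M \<Longrightarrow> hval w u \<in> carrier F"
  by (induction w arbitrary: u) (auto simp: hch_HF)

lemma hval_empty [simp]: "hval w (FinSet {||}) = \<zero>"
  by (induction w) auto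

lemma hval_bounded: "hrank u < length w \<Longrightarrow> hval w u = \<zero>"
proof (induction w arbitrary: u)
  case (Cons i w)
  show ?case
  proof (cases "hch i u = FinSet {||} \<or> w = []")
    case True
    have "hcf F i u = \<zero>" if "w = []"
    proof -
      have "hrank u = 0" using Cons.prems that by simp
      then have "\<not> hf_mem v u" for v using hrank_mem[of v u] by auto
      then have "cf_atom F i u = Atom \<zero>"
        using pick_cases[of "\<lambda>v. (\<exists>a. v = Atom a) \<and> hf_mem (kpair (tagset i) v) u" "Atom \<zero>"]
        unfolding cf_atom_def[symmetric] by auto
      then show ?thesis by (simp add: cf_atom_eq)
    qed
    then show ?thesis using True by auto
  next
    case False
    then have "hrank (hch i u) < length w" using hch_rank[of i u] Cons.prems by auto
    then show ?thesis using Cons.IH[of "hch i u"] False by simp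
  qed
qed simp

definition V :: "'k hfset \<Rightarrow> nat list \<Rightarrow> 'k" where
  "V u = (\<lambda>w. hval w u)"

lemma V_FC [simp]: "u \<in> M \<Longrightarrow> V u \<in> FC"
proof -
  assume u: "u \<in> M"
  have "hval w u \<noteq> \<zero> \<Longrightarrow> set w \<subseteq> {..<n}" for w
    using u by (induction w arbitrary: u) (auto split: if_splits intro: hch_HF)
  then show ?thesis unfolding V_def using hval_bounded[of u] u by (intro FC_I[where k = "hrank u"]) auto
qed

lemma V_child: "i < n \<Longrightarrow> child i (V u) = V (hch i u)"
  by (auto simp: child_def V_def fun_eq_iff)

lemma V_single: "i < n \<Longrightarrow> V u [i] = hcf F i u"
  by (simp add: V_def)

text \<open>The prescribed children must be sets: an atom among them would count as a
  coefficient.\<close>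

lemma hch_build:
  assumes "\<And>i. i < n \<Longrightarrow> \<alpha> i \<in> carrier F" "\<And>i. i < n \<Longrightarrow> c i \<in> M \<and> (\<forall>a. c i \<noteq> Atom a)"
  shows "\<exists>u\<in>M. (\<forall>a. u \<noteq> Atom a) \<and> (\<forall>i<n. hcf F i u = \<alpha> i \<and> hch i u = c i)"
proof -
  let ?S = "(\<lambda>i. kpair (tagset i) (Atom (\<alpha> i))) ` {..<n} \<union> (\<lambda>i. kpair (tagset i) (c i)) ` {..<n}"
  let ?u = "FinSet (Abs_fset ?S)"
  have fs: "fset (Abs_fset ?S) = ?S" by (rule Abs_fset_inverse) simp
  have u: "?u \<in> M" using assms fs by auto
  have mem: "hf_mem (kpair (tagset i) v) ?u \<longleftrightarrow> v = Atom (\<alpha> i) \<or> v = c i" if "i < n" for i v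
    using that fs by auto
  have "hcf F i ?u = \<alpha> i \<and> hch i ?u = c i" if i: "i < n" for i
  proof
    have ne: "Atom a \<noteq> c i" for a using assms(2)[OF i] by metis
    have "Atom (\<alpha> i) = cf_atom F i ?u"
      unfolding cf_atom_def pick_iff mem[OF i] using assms(2)[OF i] ne by auto
    then show "hcf F i ?u = \<alpha> i" by (simp add: cf_atom_eq)
    have "c i = hch i ?u"
      unfolding hch_def pick_iff mem[OF i] using assms(2)[OF i] ne by auto
    then show "hch i ?u = c i" by simp
  qed
  then show ?thesis using u by (intro bexI[of _ ?u]) auto
qed

text \<open>That the code is not an atom is carried along for \<open>hch_build\<close> in the
  induction step.\<close>

lemma V_surj_aux: "f \<in> FC \<Longrightarrow> free_deg F f \<le> k \<Longrightarrow> \<exists>u\<in>M. (\<forall>a. u \<noteq> Atom a) \<and> V u = f"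
proof (induction k arbitrary: f)
  case 0
  then have "f = (\<lambda>_. \<zero>)" using free_deg_pos by fastforce
  then show ?case by (intro bexI[of _ "FinSet {||}"]) (auto simp: V_def)
next
  case (Suc k)
  have "\<exists>u\<in>M. (\<forall>a. u \<noteq> Atom a) \<and> V u = child i f" for i
    using Suc.prems free_deg_child[OF Suc.prems(1), of i] by (intro Suc.IH) auto
  then obtain c where c: "\<And>i. c i \<in> M" "\<And>i a. c i \<noteq> Atom a" "\<And>i. V (c i) = child i f" by metis
  obtain u where u: "u \<in> M" "\<And>a. u \<noteq> Atom a" "\<And>i. i < n \<Longrightarrow> hcf F i u = f [i] \<and> hch i u = c i"
    using hch_build[of "\<lambda>i. f [i]" c] c Suc.prems by auto
  have "V u w = f w" for w
  proof (cases w)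
    case Nil
    then show ?thesis using Suc.prems by (simp add: V_def)
  next
    case (Cons i v)
    have "f (i # v) = \<zero>" if "\<not> i < n"
      using FC_set[OF Suc.prems(1), of "i # v"] that by auto
    then show ?thesis using Cons u(3)[of i] fun_cong[OF c(3)[of i], of v] by (auto simp: child_def V_def)
  qed
  then have "V u = f" by blast
  then show ?case using u(1,2) by blast
qed

lemma V_surj: "f \<in> FC \<Longrightarrow> \<exists>u\<in>M. V u = f"
  using V_surj_aux[OF _ order_refl] by blast

lemma finset_in_M: "finite S \<Longrightarrow> S \<subseteq> M \<Longrightarrow> \<exists>W\<in>M. \<forall>v. hf_mem v W \<longleftrightarrow> v \<in> S"
  using Abs_fset_inverse[of S] by (intro bexI[of _ "FinSet (Abs_fset S)"]) auto

lemma hf_lin_step_iff: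
  assumes "W \<in> M" "u \<in> M" "v \<in> M" "w \<in> M" "\<alpha> \<in> carrier F"
  shows "hf_lin_step F i (Atom \<alpha>) W u v w \<longleftrightarrow> hcf F i w = \<alpha> \<otimes> hcf F i u \<oplus> hcf F i v \<and>
    hf_mem (kpair (hch i u) (kpair (hch i v) (hch i w))) W"
proof -
  have ch: "hch i u \<in> M" "hch i v \<in> M" "hch i w \<in> M" using assms hch_HF by auto
  have "(\<exists>a\<in>M. \<exists>b\<in>M. \<exists>c\<in>M. \<exists>d\<in>M. hf_cf F i u a \<and> hf_cf F i v b \<and> hf_cf F i w c \<and>
      atom_mult F (Atom \<alpha>) a d \<and> atom_add F d b c) \<longleftrightarrow>
      (\<exists>d\<in>M. atom_mult F (Atom \<alpha>) (Atom (hcf F i u)) d \<and> atom_add F d (Atom (hcf F i v)) (Atom (hcf F i w)))"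
    using assms by (auto simp: hf_cf_iff)
  also have "\<dots> \<longleftrightarrow> hcf F i w = \<alpha> \<otimes> hcf F i u \<oplus> hcf F i v"
    using assms by (auto simp: atom_mult_def atom_add_def)
  finally have 1: "(\<exists>a\<in>M. \<exists>b\<in>M. \<exists>c\<in>M. \<exists>d\<in>M. hf_cf F i u a \<and> hf_cf F i v b \<and> hf_cf F i w c \<and>
      atom_mult F (Atom \<alpha>) a d \<and> atom_add F d b c) \<longleftrightarrow> hcf F i w = \<alpha> \<otimes> hcf F i u \<oplus> hcf F i v" .
  have 2: "(\<exists>u'\<in>M. \<exists>v'\<in>M. \<exists>w'\<in>M. hf_ch F i u u' \<and> hf_ch F i v v' \<and> hf_ch F i w w' \<and> hf_in3 F W u' v' w') \<longleftrightarrow>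
      hf_mem (kpair (hch i u) (kpair (hch i v) (hch i w))) W"
    using assms ch by (auto simp: hf_ch_iff hf_in3_iff)
  show ?thesis unfolding hf_lin_step_def 1 2 ..
qed

text \<open>A closed \<open>W\<close> passes the relation down along every word. Conversely, the
  triples from the three child closures for which the relation holds at all words form a finite
  closed \<open>W\<close>.\<close>

lemma hf_lin_iff:
  assumes "\<alpha> \<in> carrier F" "u0 \<in> M" "v0 \<in> M" "w0 \<in> M"
  shows "hf_lin F n (Atom \<alpha>) u0 v0 w0 \<longleftrightarrow> (\<forall>x. hval x w0 = \<alpha> \<otimes> hval x u0 \<oplus> hval x v0)"
proof
  assume "hf_lin F n (Atom \<alpha>) u0 v0 w0"
  then obtain W where W: "W \<in> M" "hf_in3 F W u0 v0 w0"
    and st: "\<forall>u\<in>M. \<forall>v\<in>M. \<forall>w\<in>M. hf_in3 F W u v w \<longrightarrow> (\<forall>i<n. hf_lin_step F i (Atom \<alpha>) W u v w)"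
    unfolding hf_lin_def by blast
  have "hval x w = \<alpha> \<otimes> hval x u \<oplus> hval x v"
    if "u \<in> M" "v \<in> M" "w \<in> M" "hf_mem (kpair u (kpair v w)) W" for x u v w
    using that
  proof (induction x arbitrary: u v w)
    case Nil
    then show ?case using assms(1) by simp
  next
    case (Cons i x)
    show ?case
    proof (cases "i < n")
      case True
      have "hf_in3 F W u v w" using hf_in3_iff[OF W(1) Cons.prems(1-3)] Cons.prems(4) by blast
      then have "hf_lin_step F i (Atom \<alpha>) W u v w" using st Cons.prems True by blast
      then have s: "hcf F i w = \<alpha> \<otimes> hcf F i u \<oplus> hcf F i v"
        "hf_mem (kpair (hch i u) (kpair (hch i v) (hch i w))) W"
        using hf_lin_step_iff[OF W(1) Cons.prems(1-3) assms(1)] by auto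
      show ?thesis using Cons.IH[OF _ _ _ s(2)] Cons.prems hch_HF s(1) True by auto
    qed (use assms(1) in simp)
  qed
  then show "\<forall>x. hval x w0 = \<alpha> \<otimes> hval x u0 \<oplus> hval x v0"
    using W(2) hf_in3_iff[OF W(1) assms(2-4)] assms by blast
next
  assume eq: "\<forall>x. hval x w0 = \<alpha> \<otimes> hval x u0 \<oplus> hval x v0"
  obtain A where A: "finite A" "A \<subseteq> M" "u0 \<in> A" "\<forall>v\<in>A. \<forall>i<n. hch i v \<in> A"
    using hch_closure[OF assms(2), of n] by (elim exE conjE) (rule that)
  obtain B where B: "finite B" "B \<subseteq> M" "v0 \<in> B" "\<forall>v\<in>B. \<forall>i<n. hch i v \<in> B"
    using hch_closure[OF assms(3), of n] by (elim exE conjE) (rule that)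
  obtain C where C: "finite C" "C \<subseteq> M" "w0 \<in> C" "\<forall>v\<in>C. \<forall>i<n. hch i v \<in> C"
    using hch_closure[OF assms(4), of n] by (elim exE conjE) (rule that)
  let ?R = "\<lambda>u v w. \<forall>x. hval x w = \<alpha> \<otimes> hval x u \<oplus> hval x v"
  let ?T = "{(u, v, w) \<in> A \<times> B \<times> C. ?R u v w}"
  let ?S = "(\<lambda>(u, v, w). kpair u (kpair v w)) ` ?T"
  have "?T \<subseteq> A \<times> B \<times> C" by blast
  moreover have "finite (A \<times> B \<times> C)" using A(1) B(1) C(1) by blast
  ultimately have "finite ?T" by (rule finite_subset)
  then have "finite ?S" by (rule finite_imageI)
  moreover have "?S \<subseteq> M" using A(2) B(2) C(2) by auto
  ultimately obtain W where W: "W \<in> M" "\<forall>v. hf_mem v W \<longleftrightarrow> v \<in> ?S" using finset_in_M[of ?S] by blast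
  have mW: "hf_mem (kpair u (kpair v w)) W \<longleftrightarrow> u \<in> A \<and> v \<in> B \<and> w \<in> C \<and> ?R u v w" for u v w
  proof -
    have "kpair u (kpair v w) \<in> ?S \<longleftrightarrow> (u, v, w) \<in> ?T" by (auto simp: image_iff)
    then show ?thesis using W(2) by simp
  qed
  have "hf_lin_step F i (Atom \<alpha>) W u v w"
    if i: "i < n" and uvw: "u \<in> M" "v \<in> M" "w \<in> M" "hf_mem (kpair u (kpair v w)) W" for u v w i
  proof -
    have m: "u \<in> A" "v \<in> B" "w \<in> C" "?R u v w" using uvw(4) mW by auto
    have "hcf F i w = \<alpha> \<otimes> hcf F i u \<oplus> hcf F i v" using m(4)[rule_format, of "[i]"] i by simp
    moreover have "hval x (hch i w) = \<alpha> \<otimes> hval x (hch i u) \<oplus> hval x (hch i v)" for x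
      using m(4)[rule_format, of "i # x"] i assms(1) by (cases "x = []") auto
    ultimately show ?thesis unfolding hf_lin_step_iff[OF W(1) uvw(1-3) assms(1)] mW
      using m A(4) B(4) C(4) i by blast
  qed
  moreover have "hf_in3 F W u0 v0 w0"
    unfolding hf_in3_iff[OF W(1) assms(2-4)] mW using A(3) B(3) C(3) eq by blast
  ultimately show "hf_lin F n (Atom \<alpha>) u0 v0 w0"
    unfolding hf_lin_def using hf_in3_iff[OF W(1)] W(1) by (intro bexI[of _ W]) auto
qed

lemma conv_child:
  assumes "f \<in> FC" "g \<in> FC"
  shows "conv F f g (i # x) = f [i] \<otimes> g x \<oplus> conv F (child i f) g x"
proof -
  have "(\<lambda>v. f (i # v)) = (\<lambda>v. (if v = [] then f [i] else \<zero>) \<oplus> child i f v)"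
    using assms by (auto simp: child_def fun_eq_iff)
  moreover have "conv F (\<lambda>v. if v = [] then f [i] else \<zero>) g x = f [i] \<otimes> g x"
    using assms by (cases x) (simp_all add: conv_Cons)
  ultimately show ?thesis using assms
    by (simp add: conv_Cons conv_add_left)
qed

text \<open>\<open>p\<close> stands for the product of the child of \<open>u\<close> with
  \<open>g\<close>; the child of the whole product is this plus a multiple of \<open>g\<close>. The
  recursion runs in the left factor only.\<close>

lemma hf_mult_step_iff:
  assumes "W \<in> M" "u \<in> M" "w \<in> M" "g \<in> M"
  shows "hf_mult_step F n i g W u w \<longleftrightarrow> hcf F i w = \<zero> \<and> (\<exists>p\<in>M. hf_mem (kpair (hch i u) p) W \<and>
    (\<forall>x. hval x (hch i w) = hcf F i u \<otimes> hval x g \<oplus> hval x p))"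
proof -
  have ch: "hch i u \<in> M" "hch i w \<in> M" "hcf F i u \<in> carrier F" using assms hch_HF by auto
  have 1: "(\<exists>z\<in>M. atom_add F z z z \<and> hf_cf F i w z) \<longleftrightarrow> hcf F i w = \<zero>"
    using assms by (auto simp: hf_cf_iff atom_add_def)
  have 2: "(\<exists>a\<in>M. \<exists>u'\<in>M. \<exists>w'\<in>M. \<exists>p\<in>M. hf_cf F i u a \<and> hf_ch F i u u' \<and> hf_ch F i w w' \<and> hf_in2 F W u' p \<and>
      hf_lin F n a g p w') \<longleftrightarrow> (\<exists>p\<in>M. hf_in2 F W (hch i u) p \<and> hf_lin F n (Atom (hcf F i u)) g p (hch i w))"
    using assms ch by (auto simp: hf_cf_iff hf_ch_iff)
  show ?thesis unfolding hf_mult_step_def 1 2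
    using hf_in2_iff[OF assms(1) ch(1)] hf_lin_iff[OF ch(3) assms(4) _ ch(2)] by blast
qed

lemma hf_mult_iff:
  assumes "g \<in> M" "u0 \<in> M" "w0 \<in> M"
  shows "hf_mult F n g u0 w0 \<longleftrightarrow> V w0 = conv F (V u0) (V g)"
proof
  assume "hf_mult F n g u0 w0"
  then obtain W where W: "W \<in> M" "hf_in2 F W u0 w0"
    and st: "\<forall>u\<in>M. \<forall>w\<in>M. hf_in2 F W u w \<longrightarrow> (\<forall>i<n. hf_mult_step F n i g W u w)"
    unfolding hf_mult_def by blast
  have "hval x w = conv F (V u) (V g) x" if "u \<in> M" "w \<in> M" "hf_mem (kpair u w) W" for x u w
    using that
  proof (induction x arbitrary: u w)
    case Nil
    then show ?case using assms by simp
  next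
    case (Cons i x)
    show ?case
    proof (cases "i < n")
      case True
      have "hf_in2 F W u w" using hf_in2_iff[OF W(1) Cons.prems(1,2)] Cons.prems(3) by blast
      then have "hf_mult_step F n i g W u w" using st Cons.prems True by blast
      then obtain p where p: "p \<in> M" "hf_mem (kpair (hch i u) p) W" "hcf F i w = \<zero>"
        "\<And>x. hval x (hch i w) = hcf F i u \<otimes> hval x g \<oplus> hval x p"
        unfolding hf_mult_step_iff[OF W(1) Cons.prems(1,2) assms(1)] by blast
      have "conv F (V u) (V g) (i # x) = hcf F i u \<otimes> hval x g \<oplus> conv F (V (hch i u)) (V g) x"
        using conv_child[of "V u" "V g" i x] Cons.prems assms True by (simp add: V_child V_single) (simp add: V_def)
      also have "\<dots> = hval x (hch i w)" using Cons.IH[OF hch_HF[OF Cons.prems(1)] p(1,2)] p(4) by simp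
      finally show ?thesis using True p(3) by (cases "x = []") auto
    next
      case False
      have "V u [i] = \<zero>" "child i (V u) = (\<lambda>_. \<zero>)"
        using False by (auto simp: V_def child_def fun_eq_iff)
      then show ?thesis using conv_child[of "V u" "V g" i x] Cons.prems assms False by simp
    qed
  qed
  then have "hval x w0 = conv F (V u0) (V g) x" for x
    using W(2) hf_in2_iff[OF W(1) assms(2,3)] assms by blast
  then show "V w0 = conv F (V u0) (V g)" by (auto simp: V_def)
next
  assume eq: "V w0 = conv F (V u0) (V g)"
  obtain D where D: "finite D" "D \<subseteq> M" "u0 \<in> D" "\<forall>v\<in>D. \<forall>i<n. hch i v \<in> D"
    using hch_closure[OF assms(2), of n] by (elim exE conjE) (rule that)
  \<comment> \<open>The products of the descendants of \<open>u0\<close> with \<open>g\<close> need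
    not be coded by descendants of \<open>w0\<close>, so codes for them are chosen anew.
    \<open>w0\<close> is added separately, as it may differ from the chosen code of the same
    element.\<close>
  have "\<forall>u\<in>D. \<exists>p\<in>M. V p = conv F (V u) (V g)" using V_surj D(2) assms(1) by auto
  then obtain c where c: "\<forall>u\<in>D. c u \<in> M \<and> V (c u) = conv F (V u) (V g)" by metis
  let ?T = "{(u, w) \<in> D \<times> insert w0 (c ` D). V w = conv F (V u) (V g)}"
  let ?S = "(\<lambda>(u, w). kpair u w) ` ?T"
  have "?T \<subseteq> D \<times> insert w0 (c ` D)" by blast
  moreover have "finite (D \<times> insert w0 (c ` D))" using D(1) by blast
  ultimately have "finite ?T" by (rule finite_subset)
  then have "finite ?S" by (rule finite_imageI)
  moreover have "?S \<subseteq> M" using D(2) c assms(3) by auto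
  ultimately obtain W where W: "W \<in> M" "\<forall>v. hf_mem v W \<longleftrightarrow> v \<in> ?S" using finset_in_M[of ?S] by blast
  have mW: "hf_mem (kpair u w) W \<longleftrightarrow> u \<in> D \<and> w \<in> insert w0 (c ` D) \<and> V w = conv F (V u) (V g)" for u w
  proof -
    have "kpair u w \<in> ?S \<longleftrightarrow> (u, w) \<in> ?T" by (auto simp: image_iff)
    then show ?thesis using W(2) by simp
  qed
  have "hf_mult_step F n i g W u w" if i: "i < n" and uw: "u \<in> M" "w \<in> M" "hf_mem (kpair u w) W" for u w i
  proof -
    have m: "u \<in> D" "V w = conv F (V u) (V g)" using uw(3) mW by auto
    have u': "hch i u \<in> D" using D(4) m(1) i by blast
    have e: "V w (i # x) = hcf F i u \<otimes> hval x g \<oplus> hval x (c (hch i u))" for x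
      unfolding m(2) using conv_child[of "V u" "V g" i x] uw assms i c u'
      by (simp add: V_child V_single) (simp add: V_def fun_eq_iff)
    have p: "c (hch i u) \<in> M" using c u' by blast
    have ci: "hcf F i w = \<zero>" using e[of "[]"] i uw by (simp add: V_def)
    have "hval x (hch i w) = hcf F i u \<otimes> hval x g \<oplus> hval x (c (hch i u))" for x
      using e[of x] i uw by (cases "x = []") (auto simp: V_def)
    moreover have "hf_mem (kpair (hch i u) (c (hch i u))) W" unfolding mW using u' c by blast
    ultimately show ?thesis unfolding hf_mult_step_iff[OF W(1) uw(1,2) assms(1)] using ci p by blast
  qed
  moreover have "hf_in2 F W u0 w0"
    unfolding hf_in2_iff[OF W(1) assms(2,3)] mW using D(3) eq by blast
  ultimately show "hf_mult F n g u0 w0"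
    unfolding hf_mult_def using hf_in2_iff[OF W(1)] W(1) by (intro bexI[of _ W]) auto
qed

lemma hf_sum_iff:
  assumes "u \<in> M" "v \<in> M" "w \<in> M"
  shows "hf_sum F n u v w \<longleftrightarrow> V w = (\<lambda>x. V u x \<oplus> V v x)"
proof -
  have "(is_atom F \<alpha> \<and> (\<forall>b\<in>M. is_atom F b \<longrightarrow> atom_mult F \<alpha> b b)) \<longleftrightarrow> \<alpha> = Atom \<one>" if "\<alpha> \<in> M" for \<alpha>
  proof
    assume a: "is_atom F \<alpha> \<and> (\<forall>b\<in>M. is_atom F b \<longrightarrow> atom_mult F \<alpha> b b)"
    then have "atom_mult F \<alpha> (Atom \<one>) (Atom \<one>)" using is_atom_iff[of "Atom \<one>"] by simp
    then show "\<alpha> = Atom \<one>" by (auto simp: atom_mult_def)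
  next
    assume "\<alpha> = Atom \<one>"
    then show "is_atom F \<alpha> \<and> (\<forall>b\<in>M. is_atom F b \<longrightarrow> atom_mult F \<alpha> b b)"
      using that is_atom_iff by (auto simp: atom_mult_def)
  qed
  then have "hf_sum F n u v w \<longleftrightarrow> hf_lin F n (Atom \<one>) u v w"
    unfolding hf_sum_def using HF_Atom[of \<one> "carrier F"] one_closed by blast
  also have "\<dots> \<longleftrightarrow> (\<forall>x. hval x w = \<one> \<otimes> hval x u \<oplus> hval x v)" by (rule hf_lin_iff[OF one_closed assms])
  finally show ?thesis using assms by (simp add: V_def fun_eq_iff)
qed

lemma hf_term_val:
  assumes "\<And>i. e i \<in> M"
  shows "rterm_val FA (\<lambda>i. V (e i)) p \<in> FC \<and> (\<forall>u\<in>M. hf_term F n p e u \<longrightarrow> V u = rterm_val FA (\<lambda>i. V (e i)) p) \<and>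
    (\<exists>u\<in>M. hf_term F n p e u)"
proof (induction p)
  case (RVar i)
  then show ?case using assms by auto
next
  case RZero
  have "V (FinSet {||}) = (\<lambda>_. \<zero>)" by (auto simp: V_def)
  moreover have "FinSet {||} \<in> M" by simp
  ultimately show ?case using hf_empty_iff by auto
next
  case (RAdd p q)
  obtain v w where vw: "v \<in> M" "hf_term F n p e v" "w \<in> M" "hf_term F n q e w" using RAdd.IH by blast
  obtain u where u: "u \<in> M" "V u = (\<lambda>x. V v x \<oplus> V w x)" using V_surj[of "\<lambda>x. V v x \<oplus> V w x"] vw by auto
  have "\<exists>u\<in>M. hf_term F n (RAdd p q) e u"
    unfolding hf_term.simps using u vw hf_sum_iff[OF vw(1,3) u(1)] by blast
  moreover have "V u = rterm_val FA (\<lambda>i. V (e i)) (RAdd p q)" if u: "u \<in> M" "hf_term F n (RAdd p q) e u" for u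
  proof -
    obtain v w where vw: "v \<in> M" "hf_term F n p e v" "w \<in> M" "hf_term F n q e w" "hf_sum F n v w u"
      using u(2) unfolding hf_term.simps by blast
    have "V v = rterm_val FA (\<lambda>i. V (e i)) p" "V w = rterm_val FA (\<lambda>i. V (e i)) q" using RAdd.IH vw by blast+
    then show ?thesis using hf_sum_iff[OF vw(1,3) u(1)] vw(5) by simp
  qed
  ultimately show ?case using RAdd.IH by simp
next
  case (RMul p q)
  obtain v w where vw: "v \<in> M" "hf_term F n p e v" "w \<in> M" "hf_term F n q e w" using RMul.IH by blast
  obtain u where u: "u \<in> M" "V u = conv F (V v) (V w)" using V_surj[of "conv F (V v) (V w)"] vw by auto
  have "\<exists>u\<in>M. hf_term F n (RMul p q) e u"
    unfolding hf_term.simps using u vw hf_mult_iff[OF vw(3,1) u(1)] by blast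
  moreover have "V u = rterm_val FA (\<lambda>i. V (e i)) (RMul p q)" if u: "u \<in> M" "hf_term F n (RMul p q) e u" for u
  proof -
    obtain v w where vw: "v \<in> M" "hf_term F n p e v" "w \<in> M" "hf_term F n q e w" "hf_mult F n w v u"
      using u(2) unfolding hf_term.simps by blast
    have "V v = rterm_val FA (\<lambda>i. V (e i)) p" "V w = rterm_val FA (\<lambda>i. V (e i)) q" using RMul.IH vw by blast+
    then show ?thesis using hf_mult_iff[OF vw(3,1) u(1)] vw(5) by simp
  qed
  ultimately show ?case using RMul.IH by simp
qed

lemma alg_interp_iff:
  "(\<And>i. e i \<in> M) \<Longrightarrow> alg_interp F n \<phi> e \<longleftrightarrow> rform_sat FA (\<lambda>i. V (e i)) \<phi>"
proof (induction \<phi> arbitrary: e)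
  case (REq p q)
  note tp = hf_term_val[of e p, OF REq] and tq = hf_term_val[of e q, OF REq]
  have z: "FinSet {||} \<in> M" "V (FinSet {||}) = (\<lambda>_. \<zero>)" by (auto simp: V_def)
  have sz: "hf_sum F n u (FinSet {||}) v \<longleftrightarrow> V v = V u" if "u \<in> M" "v \<in> M" for u v
  proof -
    have "(\<lambda>x. V u x \<oplus> V (FinSet {||}) x) = V u" using that z by (auto simp: fun_eq_iff)
    then show ?thesis using hf_sum_iff[OF that(1) z(1) that(2)] by simp
  qed
  have "alg_interp F n (REq p q) e \<longleftrightarrow> (\<exists>u\<in>M. \<exists>v\<in>M. hf_term F n p e u \<and> hf_term F n q e v \<and> V v = V u)"
    unfolding alg_interp.simps using sz z hf_empty_iff by blast
  also have "\<dots> \<longleftrightarrow> rterm_val FA (\<lambda>i. V (e i)) p = rterm_val FA (\<lambda>i. V (e i)) q"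
  proof
    assume "\<exists>u\<in>M. \<exists>v\<in>M. hf_term F n p e u \<and> hf_term F n q e v \<and> V v = V u"
    then obtain u v where "u \<in> M" "v \<in> M" "hf_term F n p e u" "hf_term F n q e v" "V v = V u" by blast
    then show "rterm_val FA (\<lambda>i. V (e i)) p = rterm_val FA (\<lambda>i. V (e i)) q" using tp tq by metis
  next
    assume eq: "rterm_val FA (\<lambda>i. V (e i)) p = rterm_val FA (\<lambda>i. V (e i)) q"
    obtain u v where uv: "u \<in> M" "v \<in> M" "hf_term F n p e u" "hf_term F n q e v" using tp tq by blast
    then have "V v = V u" using tp tq eq by metis
    then show "\<exists>u\<in>M. \<exists>v\<in>M. hf_term F n p e u \<and> hf_term F n q e v \<and> V v = V u" using uv by blast
  qed
  finally show ?case by simp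
next
  case (RAll i \<phi>)
  have IH: "alg_interp F n \<phi> (e(i := a)) \<longleftrightarrow> rform_sat FA ((\<lambda>i. V (e i))(i := V a)) \<phi>" if "a \<in> M" for a
  proof -
    have eq: "(\<lambda>j. V ((e(i := a)) j)) = (\<lambda>i. V (e i))(i := V a)" by auto
    have "(e(i := a)) j \<in> M" for j using RAll.prems that by simp
    from RAll.IH[of "e(i := a)", OF this] show ?thesis unfolding eq .
  qed
  have "(\<forall>a\<in>M. rform_sat FA ((\<lambda>i. V (e i))(i := V a)) \<phi>) \<longleftrightarrow> (\<forall>f\<in>FC. rform_sat FA ((\<lambda>i. V (e i))(i := f)) \<phi>)"
  proof
    assume l: "\<forall>a\<in>M. rform_sat FA ((\<lambda>i. V (e i))(i := V a)) \<phi>"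
    show "\<forall>f\<in>FC. rform_sat FA ((\<lambda>i. V (e i))(i := f)) \<phi>"
    proof
      fix f assume "f \<in> FC"
      then obtain a where "a \<in> M" "f = V a" using V_surj by blast
      then show "rform_sat FA ((\<lambda>i. V (e i))(i := f)) \<phi>" using l by blast
    qed
  qed (use V_FC in blast)
  then show ?case using IH by simp
qed auto

end

section \<open>From hereditarily finite sets back to free algebras\<close>

lemma rform_sat_cong:
  "(\<And>i. i \<in> rform_free \<phi> \<Longrightarrow> e i = e' i) \<Longrightarrow> rform_sat R e \<phi> = rform_sat R e' \<phi>"
proof (induction \<phi> arbitrary: e e')
  case (REq p q)
  then show ?case using rterm_val_cong[of p e e' R] rterm_val_cong[of q e e' R] by simp
next
  case (RNeg \<phi>)
  have "rform_sat R e \<phi> = rform_sat R e' \<phi>" by (rule RNeg.IH) (use RNeg.prems in auto)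
  then show ?case by simp
next
  case (RAnd \<phi> \<psi>)
  have "rform_sat R e \<phi> = rform_sat R e' \<phi>" by (rule RAnd.IH(1)) (use RAnd.prems in auto)
  moreover have "rform_sat R e \<psi> = rform_sat R e' \<psi>" by (rule RAnd.IH(2)) (use RAnd.prems in auto)
  ultimately show ?case by simp
next
  case (RAll i \<phi>)
  have "rform_sat R (e(i := a)) \<phi> = rform_sat R (e'(i := a)) \<phi>" for a
    by (rule RAll.IH) (use RAll.prems in auto)
  then show ?case by simp
qed

lemma ring_models_closed:
  assumes "rform_free \<phi> = {}" "range e \<subseteq> carrier R"
  shows "ring_models R \<phi> \<longleftrightarrow> rform_sat R e \<phi>"
proof -
  have "rform_sat R e' \<phi> = rform_sat R e \<phi>" for e'
    by (rule rform_sat_cong) (use assms(1) in auto)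
  then show ?thesis unfolding ring_models_def using assms(2) by auto
qed

text \<open>The empty set is a definable starting valuation, so no parameter remains.\<close>

definition alg_sentence :: "('k, 'm) ring_scheme \<Rightarrow> nat \<Rightarrow> rform \<Rightarrow> bool" where
  "alg_sentence F n \<phi> \<longleftrightarrow> (\<exists>z\<in>HF (carrier F). hf_empty F z \<and> alg_interp F n \<phi> (\<lambda>_. z))"

lemma (in hf_coding) alg_sentence_iff:
  assumes "rform_free \<phi> = {}" shows "alg_sentence F n \<phi> \<longleftrightarrow> ring_models FA \<phi>"
proof -
  have z: "FinSet {||} \<in> M" by simp
  have "alg_sentence F n \<phi> \<longleftrightarrow> alg_interp F n \<phi> (\<lambda>_. FinSet {||})"
    unfolding alg_sentence_def using hf_empty_iff z by blast
  also have "\<dots> \<longleftrightarrow> rform_sat FA (\<lambda>i. V (FinSet {||})) \<phi>" using alg_interp_iff[of "\<lambda>_. FinSet {||}"] z by blast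
  also have "\<dots> \<longleftrightarrow> ring_models FA \<phi>" by (rule ring_models_closed[OF assms, symmetric]) (use V_FC[OF z] in auto)
  finally show ?thesis .
qed

theorem HF_elem_equiv_imp_elem_equiv:
  fixes n :: nat
  assumes "field F" "field G" "HF_elem_equiv F G"
  shows "ring_elem_equiv (free_alg F {..<n}) (free_alg G {..<n})"
proof -
  interpret F: hf_coding F n using assms(1) by (simp add: hf_coding_def)
  interpret G: hf_coding G n using assms(2) by (simp add: hf_coding_def)
  interpret hf_pair F G using assms(1,2) by (simp add: hf_pair_def)
  have "alg_sentence F n \<phi> = alg_sentence G n \<phi>" for \<phi>
  proof (rule elem_equiv_transfer[OF assms(3)])
    have "dfb (\<lambda>e. alg_interp F n \<phi> (\<lambda>_. e 0)) (\<lambda>e. alg_interp G n \<phi> (\<lambda>_. e 0))"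
      by (rule dfb_sub[OF dfb_alg_interp, where \<sigma> = "\<lambda>_ e. e 0" and \<tau> = "\<lambda>_ e. e 0"]) (rule T_var)
    then show "dfb (\<lambda>_. alg_sentence F n \<phi>) (\<lambda>_. alg_sentence G n \<phi>)"
      unfolding alg_sentence_def by (intro dfb_ex) (rule dfb_conj[OF dfb_hf_empty])
  qed
  then show ?thesis unfolding ring_elem_equiv_def
    using F.alg_sentence_iff G.alg_sentence_iff by blast
qed

section \<open>The centroid of a domain\<close>

text \<open>Extensional functions make equality of ring elements the same as agreement on the
  carrier.\<close>

definition centroid :: "('b, 'n) ring_scheme \<Rightarrow> ('b \<Rightarrow> 'b) ring" where
  "centroid B =
    \<lparr> carrier = {\<phi> \<in> carrier B \<rightarrow>\<^sub>E carrier B. \<forall>x\<in>carrier B. \<forall>y\<in>carrier B.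
        \<phi> (x \<oplus>\<^bsub>B\<^esub> y) = \<phi> x \<oplus>\<^bsub>B\<^esub> \<phi> y \<and> \<phi> (x \<otimes>\<^bsub>B\<^esub> y) = \<phi> x \<otimes>\<^bsub>B\<^esub> y \<and> \<phi> (x \<otimes>\<^bsub>B\<^esub> y) = x \<otimes>\<^bsub>B\<^esub> \<phi> y},
      mult = (\<lambda>\<phi> \<psi>. \<lambda>x\<in>carrier B. \<phi> (\<psi> x)),
      one = (\<lambda>x\<in>carrier B. x),
      zero = (\<lambda>x\<in>carrier B. \<zero>\<^bsub>B\<^esub>),
      add = (\<lambda>\<phi> \<psi>. \<lambda>x\<in>carrier B. \<phi> x \<oplus>\<^bsub>B\<^esub> \<psi> x) \<rparr>"

locale domain_rng = rng B for B :: "('b, 'n) ring_scheme" (structure) +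
  assumes domain: "ax_domain B"
    and nontrivial: "\<exists>x\<in>carrier B. x \<noteq> \<zero>"
begin

lemmas [simp] = m_closed

lemma integral: "a \<in> carrier B \<Longrightarrow> c \<in> carrier B \<Longrightarrow> a \<otimes> c = \<zero> \<Longrightarrow> a = \<zero> \<or> c = \<zero>"
  using domain unfolding ax_domain_def by blast

lemma cancel_right:
  assumes "a \<in> carrier B" "c \<in> carrier B" "x \<in> carrier B" "x \<noteq> \<zero>" "a \<otimes> x = c \<otimes> x" shows "a = c"
proof -
  have e: "(a \<ominus> c) \<oplus> c = a" using assms by (simp add: minus_eq a_assoc l_neg)
  have "(a \<ominus> c) \<otimes> x \<oplus> c \<otimes> x = a \<otimes> x" using l_distr[of "a \<ominus> c" c x] e assms by simp
  then have "(a \<ominus> c) \<otimes> x \<oplus> c \<otimes> x = \<zero> \<oplus> c \<otimes> x" using assms by simp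
  then have "(a \<ominus> c) \<otimes> x = \<zero>" using assms by (simp del: l_zero)
  then have "a \<ominus> c = \<zero>" using integral[of "a \<ominus> c" x] assms by simp
  then show ?thesis using e assms by simp
qed

lemma cancel_left:
  assumes "a \<in> carrier B" "c \<in> carrier B" "x \<in> carrier B" "x \<noteq> \<zero>" "x \<otimes> a = x \<otimes> c" shows "a = c"
proof -
  have e: "(a \<ominus> c) \<oplus> c = a" using assms by (simp add: minus_eq a_assoc l_neg)
  have "x \<otimes> (a \<ominus> c) \<oplus> x \<otimes> c = x \<otimes> a" using r_distr[of "a \<ominus> c" c x] e assms by simp
  then have "x \<otimes> (a \<ominus> c) \<oplus> x \<otimes> c = \<zero> \<oplus> x \<otimes> c" using assms by simp
  then have "x \<otimes> (a \<ominus> c) = \<zero>" using assms by (simp del: l_zero)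
  then have "a \<ominus> c = \<zero>" using integral[of x "a \<ominus> c"] assms by simp
  then show ?thesis using e assms by simp
qed

section \<open>The centroid is a field\<close>

abbreviation "K \<equiv> centroid B"

lemma K_simps:
  "mult K = (\<lambda>\<phi> \<psi>. \<lambda>x\<in>carrier B. \<phi> (\<psi> x))" "one K = (\<lambda>x\<in>carrier B. x)"
  "zero K = (\<lambda>x\<in>carrier B. \<zero>)" "add K = (\<lambda>\<phi> \<psi>. \<lambda>x\<in>carrier B. \<phi> x \<oplus> \<psi> x)"
  by (simp_all add: centroid_def)

lemma K_D:
  assumes "\<phi> \<in> carrier K" "x \<in> carrier B"
  shows "\<phi> x \<in> carrier B"
    and "y \<in> carrier B \<Longrightarrow> \<phi> (x \<oplus> y) = \<phi> x \<oplus> \<phi> y"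
    and "y \<in> carrier B \<Longrightarrow> \<phi> (x \<otimes> y) = \<phi> x \<otimes> y"
    and "y \<in> carrier B \<Longrightarrow> x \<otimes> \<phi> y = \<phi> x \<otimes> y"
  using assms by (auto simp: centroid_def) metis

lemma K_closed [simp]: "\<phi> \<in> carrier K \<Longrightarrow> x \<in> carrier B \<Longrightarrow> \<phi> x \<in> carrier B"
  by (rule K_D(1))

lemma K_I:
  assumes "\<And>x. x \<in> carrier B \<Longrightarrow> f x \<in> carrier B"
    and "\<And>x y. x \<in> carrier B \<Longrightarrow> y \<in> carrier B \<Longrightarrow> f (x \<oplus> y) = f x \<oplus> f y"
    and "\<And>x y. x \<in> carrier B \<Longrightarrow> y \<in> carrier B \<Longrightarrow> f (x \<otimes> y) = f x \<otimes> y"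
    and "\<And>x y. x \<in> carrier B \<Longrightarrow> y \<in> carrier B \<Longrightarrow> f (x \<otimes> y) = x \<otimes> f y"
  shows "(\<lambda>x\<in>carrier B. f x) \<in> carrier K"
  using assms by (auto simp: centroid_def)

lemma K_eqI:
  assumes "\<phi> \<in> carrier K" "\<psi> \<in> carrier K" "\<And>x. x \<in> carrier B \<Longrightarrow> \<phi> x = \<psi> x" shows "\<phi> = \<psi>"
  using assms by (auto simp: centroid_def intro: PiE_ext)

lemma K_zero: "\<phi> \<in> carrier K \<Longrightarrow> \<phi> \<zero> = \<zero>"
proof -
  assume "\<phi> \<in> carrier K"
  then have "\<phi> \<zero> \<oplus> \<phi> \<zero> = \<phi> \<zero> \<oplus> \<zero>" "\<phi> \<zero> \<in> carrier B" using K_D(2)[of \<phi> \<zero> \<zero>] by auto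
  then show ?thesis by (simp del: r_zero)
qed

lemma K_minus: "\<phi> \<in> carrier K \<Longrightarrow> x \<in> carrier B \<Longrightarrow> \<phi> (\<ominus> x) = \<ominus> \<phi> x"
proof -
  assume a: "\<phi> \<in> carrier K" "x \<in> carrier B"
  have "\<phi> (\<ominus> x) \<oplus> \<phi> x = \<zero>" using K_D(2)[of \<phi> "\<ominus> x" x] a K_zero[OF a(1)] by (simp add: l_neg)
  then show ?thesis using a by (intro minus_equality[symmetric]) auto
qed

text \<open>For every z the product \<phi> z x equals z \<phi> x, and the factor \<open>x\<close>
  can be cancelled.\<close>

lemma K_determined:
  assumes "\<phi> \<in> carrier K" "\<psi> \<in> carrier K" "x \<in> carrier B" "x \<noteq> \<zero>" "\<phi> x = \<psi> x" shows "\<phi> = \<psi>"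
proof (rule K_eqI[OF assms(1,2)])
  fix z assume z: "z \<in> carrier B"
  have "\<phi> z \<otimes> x = \<psi> z \<otimes> x" using K_D(4)[OF assms(1) z assms(3)] K_D(4)[OF assms(2) z assms(3)] assms(5) by simp
  then show "\<phi> z = \<psi> z" using cancel_right assms z K_D(1) by blast
qed

lemma K_mult_closed: "\<phi> \<in> carrier K \<Longrightarrow> \<psi> \<in> carrier K \<Longrightarrow> \<phi> \<otimes>\<^bsub>K\<^esub> \<psi> \<in> carrier K"
  unfolding K_simps by (intro K_I) (simp_all add: K_D(2,3), metis K_D(1,3,4) m_closed)

lemma K_add_closed: "\<phi> \<in> carrier K \<Longrightarrow> \<psi> \<in> carrier K \<Longrightarrow> \<phi> \<oplus>\<^bsub>K\<^esub> \<psi> \<in> carrier K"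
  unfolding K_simps
proof (rule K_I)
  fix x y assume a: "\<phi> \<in> carrier K" "\<psi> \<in> carrier K" "x \<in> carrier B" "y \<in> carrier B"
  show "\<phi> (x \<oplus> y) \<oplus> \<psi> (x \<oplus> y) = \<phi> x \<oplus> \<psi> x \<oplus> (\<phi> y \<oplus> \<psi> y)"
    using a by (simp add: K_D(2) a_assoc a_comm a_lcomm)
  show "\<phi> (x \<otimes> y) \<oplus> \<psi> (x \<otimes> y) = (\<phi> x \<oplus> \<psi> x) \<otimes> y" using a by (simp add: K_D(3) l_distr)
  show "\<phi> (x \<otimes> y) \<oplus> \<psi> (x \<otimes> y) = x \<otimes> (\<phi> y \<oplus> \<psi> y)" using a by (simp add: K_D(3,4) r_distr)
qed simp

lemma K_one: "\<one>\<^bsub>K\<^esub> \<in> carrier K"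
  unfolding K_simps by (intro K_I) auto

lemma K_zero_closed: "\<zero>\<^bsub>K\<^esub> \<in> carrier K"
  unfolding K_simps by (intro K_I) auto

text \<open>On a product of two factors the maps can be made to act on different factors, so both
  orders give \<psi> x \<phi> x at x x. By \<open>K_determined\<close> this one value
  suffices.\<close>

lemma K_commute:
  assumes "\<phi> \<in> carrier K" "\<psi> \<in> carrier K" shows "\<phi> \<otimes>\<^bsub>K\<^esub> \<psi> = \<psi> \<otimes>\<^bsub>K\<^esub> \<phi>"
proof -
  obtain x where x: "x \<in> carrier B" "x \<noteq> \<zero>" using nontrivial by blast
  have "\<phi> (\<psi> (x \<otimes> x)) = \<psi> x \<otimes> \<phi> x" using assms x by (simp add: K_D(3,4))
  moreover have "\<psi> (\<phi> (x \<otimes> x)) = \<psi> x \<otimes> \<phi> x"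
  proof -
    have "\<phi> (x \<otimes> x) = x \<otimes> \<phi> x" using assms x by (simp add: K_D(3,4))
    then show ?thesis using assms x by (simp add: K_D(3))
  qed
  ultimately have "(\<phi> \<otimes>\<^bsub>K\<^esub> \<psi>) (x \<otimes> x) = (\<psi> \<otimes>\<^bsub>K\<^esub> \<phi>) (x \<otimes> x)" using x by (simp add: K_simps)
  moreover have "x \<otimes> x \<noteq> \<zero>" using integral x by blast
  ultimately show ?thesis using K_determined[OF K_mult_closed[OF assms] K_mult_closed[OF assms(2,1)], of "x \<otimes> x"] x
    by simp
qed

lemma K_cring: "cring K"
proof (rule cringI)
  show "abelian_group K"
  proof (rule abelian_groupI)
    fix x y z assume a: "x \<in> carrier K" "y \<in> carrier K" "z \<in> carrier K"
    show "x \<oplus>\<^bsub>K\<^esub> y \<oplus>\<^bsub>K\<^esub> z = x \<oplus>\<^bsub>K\<^esub> (y \<oplus>\<^bsub>K\<^esub> z)"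
      by (rule K_eqI; (intro K_add_closed K_mult_closed K_one K_zero_closed a)?; use a in \<open>simp add: K_simps a_assoc\<close>)
  next
    fix x y assume a: "x \<in> carrier K" "y \<in> carrier K"
    show "x \<oplus>\<^bsub>K\<^esub> y = y \<oplus>\<^bsub>K\<^esub> x"
      by (rule K_eqI; (intro K_add_closed K_mult_closed K_one K_zero_closed a)?; use a in \<open>simp add: K_simps a_comm\<close>)
  next
    fix x assume a: "x \<in> carrier K"
    show "\<zero>\<^bsub>K\<^esub> \<oplus>\<^bsub>K\<^esub> x = x"
      by (rule K_eqI; (intro K_add_closed K_mult_closed K_one K_zero_closed a)?; use a in \<open>simp add: K_simps\<close>)
    have m: "(\<lambda>z\<in>carrier B. x (\<ominus> z)) \<in> carrier K"
    proof (rule K_I)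
      fix y z assume b: "y \<in> carrier B" "z \<in> carrier B"
      have xm: "x (\<ominus> y) \<otimes> z = \<ominus> (x y \<otimes> z)"
      proof -
        have "x (\<ominus> y) \<otimes> z \<oplus> x y \<otimes> z = \<zero>"
          using a b by (simp add: l_distr[symmetric] K_minus l_neg)
        then show ?thesis using a b by (intro minus_equality[symmetric]) auto
      qed
      show "x (\<ominus> (y \<oplus> z)) = x (\<ominus> y) \<oplus> x (\<ominus> z)" using a b by (simp add: minus_add K_D(2) a_comm)
      show "x (\<ominus> (y \<otimes> z)) = x (\<ominus> y) \<otimes> z" using a b xm by (simp add: K_minus K_D(3))
      have "y \<otimes> x (\<ominus> z) \<oplus> y \<otimes> x z = \<zero>"
        using a b by (simp add: r_distr[symmetric] K_minus l_neg)
      then have "y \<otimes> x (\<ominus> z) = \<ominus> (y \<otimes> x z)" using a b by (intro minus_equality[symmetric]) auto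
      then show "x (\<ominus> (y \<otimes> z)) = y \<otimes> x (\<ominus> z)" using a b by (simp add: K_minus K_D(3,4))
    qed (use a in simp)
    have "(\<lambda>z\<in>carrier B. x (\<ominus> z)) \<oplus>\<^bsub>K\<^esub> x = \<zero>\<^bsub>K\<^esub>"
      by (rule K_eqI; (intro K_add_closed K_mult_closed K_one K_zero_closed a m)?; use a in \<open>simp add: K_simps K_minus l_neg\<close>)
    then show "\<exists>y\<in>carrier K. y \<oplus>\<^bsub>K\<^esub> x = \<zero>\<^bsub>K\<^esub>" using m by blast
  qed (use K_add_closed K_zero_closed in auto)
  show "comm_monoid K"
  proof (rule comm_monoidI)
    fix x y z assume a: "x \<in> carrier K" "y \<in> carrier K" "z \<in> carrier K"
    show "x \<otimes>\<^bsub>K\<^esub> y \<otimes>\<^bsub>K\<^esub> z = x \<otimes>\<^bsub>K\<^esub> (y \<otimes>\<^bsub>K\<^esub> z)"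
      by (rule K_eqI; (intro K_add_closed K_mult_closed K_one K_zero_closed a)?; use a in \<open>simp add: K_simps\<close>)
  next
    fix x assume a: "x \<in> carrier K"
    show "\<one>\<^bsub>K\<^esub> \<otimes>\<^bsub>K\<^esub> x = x"
      by (rule K_eqI; (intro K_add_closed K_mult_closed K_one K_zero_closed a)?; use a in \<open>simp add: K_simps\<close>)
  qed (use K_mult_closed K_one K_commute in auto)
  fix x y z assume a: "x \<in> carrier K" "y \<in> carrier K" "z \<in> carrier K"
  show "(x \<oplus>\<^bsub>K\<^esub> y) \<otimes>\<^bsub>K\<^esub> z = x \<otimes>\<^bsub>K\<^esub> z \<oplus>\<^bsub>K\<^esub> y \<otimes>\<^bsub>K\<^esub> z"
    by (rule K_eqI; (intro K_add_closed K_mult_closed K_one K_zero_closed a)?; use a in \<open>simp add: K_simps\<close>)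
qed

lemma scalar_rel_centroid:
  assumes "x \<in> carrier B" "\<phi> \<in> carrier K" shows "scalar_rel B x (\<phi> x)"
  unfolding scalar_rel_def
proof
  fix z assume z: "z \<in> carrier B"
  show "\<exists>w\<in>carrier B. z \<otimes> \<phi> x = w \<otimes> x \<and> (\<forall>z'\<in>carrier B. z \<otimes> (z' \<otimes> \<phi> x) = w \<otimes> (z' \<otimes> x))"
  proof (intro bexI[of _ "\<phi> z"] conjI ballI)
    show "z \<otimes> \<phi> x = \<phi> z \<otimes> x" using K_D(4)[OF assms(2) z assms(1)] .
    fix z' assume z': "z' \<in> carrier B"
    have "z' \<otimes> \<phi> x = \<phi> (z' \<otimes> x)" using K_D(3,4)[OF assms(2) z' assms(1)] by simp
    then show "z \<otimes> (z' \<otimes> \<phi> x) = \<phi> z \<otimes> (z' \<otimes> x)" using K_D(4)[OF assms(2) z, of "z' \<otimes> x"] z' assms(1) by simp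
  qed (use assms z in simp)
qed

text \<open>The map sends \<open>z\<close> to its witness \<open>w\<close>. Cancelling
  \<open>x\<close>, the first clause of \<open>scalar_rel\<close> gives additivity and f (y z) = y f
  z, and the second clause gives f (y z) = f y z.\<close>

lemma centroid_of_scalar_rel:
  assumes x: "x \<in> carrier B" "x \<noteq> \<zero>" and l: "l \<in> carrier B" and sc: "scalar_rel B x l"
  shows "\<exists>\<phi>\<in>carrier K. l = \<phi> x"
proof -
  have "\<exists>f. \<forall>z\<in>carrier B. f z \<in> carrier B \<and> z \<otimes> l = f z \<otimes> x \<and>
      (\<forall>z'\<in>carrier B. z \<otimes> (z' \<otimes> l) = f z \<otimes> (z' \<otimes> x))"
    using sc unfolding scalar_rel_def by (intro bchoice) blast
  then obtain f where f: "\<And>z. z \<in> carrier B \<Longrightarrow> f z \<in> carrier B" "\<And>z. z \<in> carrier B \<Longrightarrow> z \<otimes> l = f z \<otimes> x"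
    "\<And>z z'. z \<in> carrier B \<Longrightarrow> z' \<in> carrier B \<Longrightarrow> z \<otimes> (z' \<otimes> l) = f z \<otimes> (z' \<otimes> x)" by blast
  have k: "(\<lambda>z\<in>carrier B. f z) \<in> carrier K"
  proof (rule K_I)
    fix y z assume a: "y \<in> carrier B" "z \<in> carrier B"
    have "f (y \<oplus> z) \<otimes> x = (f y \<oplus> f z) \<otimes> x"
      using f(2)[of "y \<oplus> z"] f(2)[OF a(1)] f(2)[OF a(2)] a f(1) l x by (simp add: l_distr)
    then show "f (y \<oplus> z) = f y \<oplus> f z" using cancel_right[of _ _ x] a f(1) x by simp
    have "f (y \<otimes> z) \<otimes> x = y \<otimes> (z \<otimes> l)" using f(2)[of "y \<otimes> z"] a l by (simp add: m_assoc)
    note e = this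
    have "f (y \<otimes> z) \<otimes> x = f y \<otimes> (z \<otimes> x)" unfolding e by (rule f(3)[OF a])
    also have "\<dots> = (f y \<otimes> z) \<otimes> x" by (rule m_assoc[symmetric]) (use a f(1) x in auto)
    finally have 1: "f (y \<otimes> z) \<otimes> x = (f y \<otimes> z) \<otimes> x" .
    have "f (y \<otimes> z) \<otimes> x = y \<otimes> (f z \<otimes> x)" unfolding e f(2)[OF a(2)] ..
    also have "\<dots> = (y \<otimes> f z) \<otimes> x" by (rule m_assoc[symmetric]) (use a f(1) x in auto)
    finally have 2: "f (y \<otimes> z) \<otimes> x = (y \<otimes> f z) \<otimes> x" .
    show "f (y \<otimes> z) = f y \<otimes> z" by (rule cancel_right[OF _ _ x 1]) (use a f(1) in auto)
    show "f (y \<otimes> z) = y \<otimes> f z" by (rule cancel_right[OF _ _ x 2]) (use a f(1) in auto)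
  qed (rule f(1))
  have "x \<otimes> f x = x \<otimes> l" using K_D(4)[OF k x(1) x(1)] f(2)[OF x(1)] x by simp
  then have "f x = l" using cancel_left[OF f(1)[OF x(1)] l x] by simp
  then show ?thesis using k x(1) by (intro bexI[of _ "\<lambda>z\<in>carrier B. f z"]) auto
qed

text \<open>\<open>ax_inverse\<close> provides a candidate \<psi> with \<phi> x \<psi> x = x x, so
  \<phi> \<psi> fixes the nonzero element x x and is the identity.\<close>

lemma K_field:
  assumes x: "x \<in> carrier B" "x \<noteq> \<zero>" and inv: "ax_inverse B x"
  shows "field K"
proof -
  interpret K: cring K by (rule K_cring)
  show ?thesis
  proof (rule K.cring_fieldI2)
    show "\<zero>\<^bsub>K\<^esub> \<noteq> \<one>\<^bsub>K\<^esub>"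
    proof
      assume "\<zero>\<^bsub>K\<^esub> = \<one>\<^bsub>K\<^esub>"
      then have "\<zero>\<^bsub>K\<^esub> x = \<one>\<^bsub>K\<^esub> x" by simp
      then show False using x by (simp add: K_simps)
    qed
    fix \<phi> assume \<phi>: "\<phi> \<in> carrier K" "\<phi> \<noteq> \<zero>\<^bsub>K\<^esub>"
    have "\<phi> x \<noteq> \<zero>" using K_determined[OF \<phi>(1) K_zero_closed x] \<phi>(2) x(1) by (auto simp: K_simps)
    then obtain m where m: "m \<in> carrier B" "scalar_rel B x m" "\<phi> x \<otimes> m = x \<otimes> x"
      using inv scalar_rel_centroid[OF x(1) \<phi>(1)] \<phi>(1) x(1) unfolding ax_inverse_def by (meson K_closed)
    obtain \<psi> where \<psi>: "\<psi> \<in> carrier K" "m = \<psi> x" using centroid_of_scalar_rel[OF x m(1,2)] by blast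
    have "\<phi> (\<psi> (x \<otimes> x)) = x \<otimes> x"
    proof -
      have "\<psi> (x \<otimes> x) = x \<otimes> \<psi> x" using K_D(3,4)[OF \<psi>(1) x(1) x(1)] by simp
      then show ?thesis using K_D(3)[OF \<phi>(1) x(1), of "\<psi> x"] m(3) \<psi> x(1) by simp
    qed
    then have "(\<phi> \<otimes>\<^bsub>K\<^esub> \<psi>) (x \<otimes> x) = \<one>\<^bsub>K\<^esub> (x \<otimes> x)" using x(1) by (simp add: K_simps)
    moreover have "x \<otimes> x \<noteq> \<zero>" using integral x by blast
    ultimately have "\<phi> \<otimes>\<^bsub>K\<^esub> \<psi> = \<one>\<^bsub>K\<^esub>"
      using K_determined[OF K_mult_closed[OF \<phi>(1) \<psi>(1)] K_one, of "x \<otimes> x"] x(1) by simp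
    then show "\<exists>\<psi>\<in>carrier K. \<phi> \<otimes>\<^bsub>K\<^esub> \<psi> = \<one>\<^bsub>K\<^esub>" using \<psi>(1) by blast
  qed
qed

section \<open>Rings of scalars\<close>

lemma nondegenerate: "nondegenerate B"
proof -
  obtain x where x: "x \<in> carrier B" "x \<noteq> \<zero>" using nontrivial by blast
  show ?thesis unfolding nondegenerate_def using integral x by auto
qed

lemma square_subgroup: "subgroup (square_set B) (add_monoid B)"
  unfolding square_set_def by (rule add.generate_is_subgroup) auto

lemma product_in_square: "x \<in> carrier B \<Longrightarrow> y \<in> carrier B \<Longrightarrow> x \<otimes> y \<in> square_set B"
  unfolding square_set_def by (rule generate.incl) auto

lemma square_carrier: "x \<in> square_set B \<Longrightarrow> x \<in> carrier B"
  using subgroup.subset[OF square_subgroup] by auto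

lemma square_induct [consumes 1, case_names zero product minus add]:
  assumes "u \<in> square_set B" "P \<zero>" "\<And>x y. x \<in> carrier B \<Longrightarrow> y \<in> carrier B \<Longrightarrow> P (x \<otimes> y)"
    and "\<And>u. u \<in> square_set B \<Longrightarrow> P u \<Longrightarrow> P (\<ominus> u)"
    and "\<And>u v. u \<in> square_set B \<Longrightarrow> v \<in> square_set B \<Longrightarrow> P u \<Longrightarrow> P v \<Longrightarrow> P (u \<oplus> v)"
  shows "P u"
  using assms(1) unfolding square_set_def
proof (induction rule: generate.induct)
  case one
  then show ?case using assms(2) by simp
next
  case (incl h)
  then show ?case using assms(3) by auto
next
  case (inv h)
  then obtain x y where h: "h = x \<otimes> y" "x \<in> carrier B" "y \<in> carrier B" by blast
  then have "P (\<ominus> h)" using assms(3,4) product_in_square by blast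
  then show ?case by (simp add: a_inv_def)
next
  case (eng h1 h2)
  then show ?case using assms(5) unfolding square_set_def by simp
qed

lemma abelian_group_with_smult: "abelian_group (with_smult B s)"
  by (rule abelian_groupI)
    (auto simp: with_smult_def a_assoc a_comm a_lcomm intro!: bexI[of _ "\<ominus> _"] l_neg)

lemma abelian_group_square: "abelian_group ((with_smult B s)\<lparr>carrier := square_set B\<rparr>)"
proof (rule abelian_groupI; simp add: with_smult_def)
  note cl = subgroup.m_closed[OF square_subgroup] subgroup.one_closed[OF square_subgroup]
    subgroup.m_inv_closed[OF square_subgroup]
  fix x assume x: "x \<in> square_set B"
  show "\<exists>y\<in>square_set B. y \<oplus> x = \<zero>"
    using cl(3)[OF x] square_carrier[OF x] by (intro bexI[of _ "\<ominus> x"]) (auto simp: a_inv_def[symmetric] l_neg)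
  show "\<zero> \<oplus> x = x" using square_carrier[OF x] by simp
  fix y assume y: "y \<in> square_set B"
  show "x \<oplus> y \<in> square_set B" using cl(1)[OF x y] by simp
  show "x \<oplus> y = y \<oplus> x" using x y square_carrier by (simp add: a_comm)
  fix z assume z: "z \<in> square_set B"
  show "x \<oplus> y \<oplus> z = x \<oplus> (y \<oplus> z)" using x y z square_carrier by (simp add: a_assoc)
next
  show "\<zero> \<in> square_set B" using subgroup.one_closed[OF square_subgroup] by simp
qed

lemma K_square: "\<phi> \<in> carrier K \<Longrightarrow> u \<in> square_set B \<Longrightarrow> \<phi> u \<in> square_set B"
proof -
  assume \<phi>: "\<phi> \<in> carrier K"
  show "u \<in> square_set B \<Longrightarrow> \<phi> u \<in> square_set B"
  proof (induction rule: square_induct)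
    case zero
    then show ?case using K_zero[OF \<phi>] subgroup.one_closed[OF square_subgroup] by simp
  next
    case (product x y)
    then show ?case using K_D(3)[OF \<phi> product] product_in_square \<phi> by simp
  next
    case (minus u)
    then show ?case using K_minus[OF \<phi>, of u] subgroup.m_inv_closed[OF square_subgroup minus(2)] square_carrier
      by (simp add: a_inv_def)
  next
    case (add u v)
    then show ?case using K_D(2)[OF \<phi>, of u v] subgroup.m_closed[OF square_subgroup add(3,4)] square_carrier by simp
  qed
qed

lemma ring_of_scalars_centroid: "ring_of_scalars B K (\<lambda>\<phi> x. \<phi> x) (\<lambda>\<phi> x. \<phi> x)"
  unfolding ring_of_scalars_def
proof (intro conjI nondegenerate K_cring)
  obtain x0 where x0: "x0 \<in> carrier B" "x0 \<noteq> \<zero>" using nontrivial by blast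
  show "faithful_module K (with_smult B (\<lambda>\<phi> x. \<phi> x))"
    unfolding faithful_module_def
  proof (intro conjI ballI impI)
    show "module K (with_smult B (\<lambda>\<phi> x. \<phi> x))"
      by (rule moduleI[OF K_cring abelian_group_with_smult])
        (auto simp: with_smult_def K_D K_simps)
    fix a assume a: "a \<in> carrier K" "\<forall>x\<in>carrier (with_smult B (\<lambda>\<phi> x. \<phi> x)).
        a \<odot>\<^bsub>with_smult B (\<lambda>\<phi> x. \<phi> x)\<^esub> x = \<zero>\<^bsub>with_smult B (\<lambda>\<phi> x. \<phi> x)\<^esub>"
    then show "a = \<zero>\<^bsub>K\<^esub>"
      by (intro K_eqI[OF a(1) K_zero_closed]) (auto simp: with_smult_def K_simps)
  qed
  show "faithful_module K ((with_smult B (\<lambda>\<phi> x. \<phi> x))\<lparr>carrier := square_set B\<rparr>)"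
    unfolding faithful_module_def
  proof (intro conjI ballI impI)
    show "module K ((with_smult B (\<lambda>\<phi> x. \<phi> x))\<lparr>carrier := square_set B\<rparr>)"
      by (rule moduleI[OF K_cring abelian_group_square])
        (auto simp: with_smult_def K_D K_simps K_square square_carrier)
    fix a assume a: "a \<in> carrier K"
      and z: "\<forall>x\<in>carrier ((with_smult B (\<lambda>\<phi> x. \<phi> x))\<lparr>carrier := square_set B\<rparr>).
        a \<odot>\<^bsub>(with_smult B (\<lambda>\<phi> x. \<phi> x))\<lparr>carrier := square_set B\<rparr>\<^esub> x =
          \<zero>\<^bsub>(with_smult B (\<lambda>\<phi> x. \<phi> x))\<lparr>carrier := square_set B\<rparr>\<^esub>"
    have "a (x0 \<otimes> x0) = \<zero>" using z product_in_square[OF x0(1) x0(1)] by (simp add: with_smult_def)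
    moreover have "x0 \<otimes> x0 \<noteq> \<zero>" using integral x0 by blast
    ultimately show "a = \<zero>\<^bsub>K\<^esub>"
      using K_determined[OF a K_zero_closed, of "x0 \<otimes> x0"] x0(1) by (simp add: K_simps)
  qed
  show "bilinear_map K (with_smult B (\<lambda>\<phi> x. \<phi> x)) ((with_smult B (\<lambda>\<phi> x. \<phi> x))\<lparr>carrier := square_set B\<rparr>) (\<otimes>)"
    unfolding bilinear_map_def
    by (auto simp: with_smult_def product_in_square l_distr r_distr K_D)
qed

lemma ring_of_scalarsD:
  assumes "ring_of_scalars B P s t" "a \<in> carrier P"
  shows "\<And>x. x \<in> carrier B \<Longrightarrow> s a x \<in> carrier B"
    and "\<And>x y. x \<in> carrier B \<Longrightarrow> y \<in> carrier B \<Longrightarrow> s a x \<otimes> y = t a (x \<otimes> y)"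
    and "\<And>x y. x \<in> carrier B \<Longrightarrow> y \<in> carrier B \<Longrightarrow> x \<otimes> s a y = t a (x \<otimes> y)"
    and "\<And>x y. x \<in> carrier B \<Longrightarrow> y \<in> carrier B \<Longrightarrow> s a (x \<oplus> y) = s a x \<oplus> s a y"
    and "\<And>x y. x \<in> square_set B \<Longrightarrow> y \<in> square_set B \<Longrightarrow> t a (x \<oplus> y) = t a x \<oplus> t a y"
    and "\<And>x. x \<in> square_set B \<Longrightarrow> t a x \<in> square_set B"
proof -
  have "module P (with_smult B s)" using assms(1) unfolding ring_of_scalars_def faithful_module_def by blast
  then interpret M: module P "with_smult B s" .
  have "module P ((with_smult B t)\<lparr>carrier := square_set B\<rparr>)"
    using assms(1) unfolding ring_of_scalars_def faithful_module_def by blast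
  then interpret N: module P "(with_smult B t)\<lparr>carrier := square_set B\<rparr>" .
  show "\<And>x. x \<in> carrier B \<Longrightarrow> s a x \<in> carrier B"
    using M.smult_closed[OF assms(2)] by (simp add: with_smult_def)
  show "\<And>x y. x \<in> carrier B \<Longrightarrow> y \<in> carrier B \<Longrightarrow> s a (x \<oplus> y) = s a x \<oplus> s a y"
    using M.smult_r_distr[OF assms(2)] by (simp add: with_smult_def)
  show "\<And>x y. x \<in> square_set B \<Longrightarrow> y \<in> square_set B \<Longrightarrow> t a (x \<oplus> y) = t a x \<oplus> t a y"
    using N.smult_r_distr[OF assms(2)] by (simp add: with_smult_def)
  show "\<And>x. x \<in> square_set B \<Longrightarrow> t a x \<in> square_set B"
    using N.smult_closed[OF assms(2)] by (simp add: with_smult_def)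
  have bl: "bilinear_map P (with_smult B s) ((with_smult B t)\<lparr>carrier := square_set B\<rparr>) (\<otimes>)"
    using assms(1) unfolding ring_of_scalars_def by blast
  show "\<And>x y. x \<in> carrier B \<Longrightarrow> y \<in> carrier B \<Longrightarrow> s a x \<otimes> y = t a (x \<otimes> y)"
    "\<And>x y. x \<in> carrier B \<Longrightarrow> y \<in> carrier B \<Longrightarrow> x \<otimes> s a y = t a (x \<otimes> y)"
    using bl assms(2) unfolding bilinear_map_def by (simp_all add: with_smult_def)
qed

text \<open>In a domain every compatible action on \<open>B\<close> is by centroid maps, so the
  embedding into the centroid restricts each action to the carrier; faithfulness makes it
  injective.\<close>

lemma maximal_centroid: "maximal_ring_of_scalars B K (\<lambda>\<phi> x. \<phi> x) (\<lambda>\<phi> x. \<phi> x)"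
  unfolding maximal_ring_of_scalars_def
proof (intro conjI ring_of_scalars_centroid allI impI)
  fix P :: "('b \<Rightarrow> 'b) ring" and s t assume rs: "ring_of_scalars B P s t"
  have mP: "module P (with_smult B s)" using rs unfolding ring_of_scalars_def faithful_module_def by blast
  then interpret M: module P "with_smult B s" .
  obtain x0 where x0: "x0 \<in> carrier B" "x0 \<noteq> \<zero>" using nontrivial by blast
  note D = ring_of_scalarsD[OF rs]
  \<comment> \<open>Bilinearity relates \<open>s\<close> to \<open>t\<close> only through products.
    Multiplying by a nonzero \<open>x0\<close> turns both sides into
    \<open>t a (x y x0)\<close>.\<close>
  have sm: "s a (x \<otimes> y) = s a x \<otimes> y" if "a \<in> carrier P" "x \<in> carrier B" "y \<in> carrier B" for a x y
  proof (rule cancel_right[OF _ _ x0])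
    show "s a (x \<otimes> y) \<otimes> x0 = s a x \<otimes> y \<otimes> x0"
      using D(2)[OF that(1), of "x \<otimes> y" x0] D(2)[OF that(1,2), of "y \<otimes> x0"] that x0 D(1)
      by (simp add: m_assoc)
  qed (use that D(1) in auto)
  let ?\<mu> = "\<lambda>a. \<lambda>x\<in>carrier B. s a x"
  have \<mu>: "?\<mu> a \<in> carrier K" if "a \<in> carrier P" for a
  proof (rule K_I)
    fix x y assume "x \<in> carrier B" "y \<in> carrier B"
    then show "s a (x \<otimes> y) = x \<otimes> s a y" using sm[OF that] D(2,3)[OF that] by simp
  qed (use D(1,4)[OF that] sm[OF that] in auto)
  have hom: "?\<mu> \<in> ring_hom P K"
  proof (rule ring_hom_memI)
    fix a c assume ac: "a \<in> carrier P" "c \<in> carrier P"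
    show "?\<mu> (a \<otimes>\<^bsub>P\<^esub> c) = ?\<mu> a \<otimes>\<^bsub>K\<^esub> ?\<mu> c"
      using M.smult_assoc1[OF ac] D(1) ac by (auto simp: K_simps with_smult_def fun_eq_iff restrict_def)
    show "?\<mu> (a \<oplus>\<^bsub>P\<^esub> c) = ?\<mu> a \<oplus>\<^bsub>K\<^esub> ?\<mu> c"
      using M.smult_l_distr[OF ac] by (auto simp: K_simps with_smult_def fun_eq_iff restrict_def)
  next
    show "?\<mu> \<one>\<^bsub>P\<^esub> = \<one>\<^bsub>K\<^esub>"
      using M.smult_one by (auto simp: K_simps with_smult_def fun_eq_iff restrict_def)
  qed (rule \<mu>)
  have faith: "a = \<zero>\<^bsub>P\<^esub>" if "a \<in> carrier P" "\<And>x. x \<in> carrier B \<Longrightarrow> s a x = \<zero>" for a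
    using rs that unfolding ring_of_scalars_def faithful_module_def by (simp add: with_smult_def)
  have inj: "inj_on ?\<mu> (carrier P)"
  proof (rule inj_onI)
    fix a c assume ac: "a \<in> carrier P" "c \<in> carrier P" "?\<mu> a = ?\<mu> c"
    have e: "s a x = s c x" if "x \<in> carrier B" for x using fun_cong[OF ac(3), of x] that by simp
    have da: "(a \<ominus>\<^bsub>P\<^esub> c) \<oplus>\<^bsub>P\<^esub> c = a" using ac by (simp add: M.R.minus_eq M.R.a_assoc M.R.l_neg)
    have "a \<ominus>\<^bsub>P\<^esub> c = \<zero>\<^bsub>P\<^esub>"
    proof (rule faith)
      fix x assume x: "x \<in> carrier B"
      have "s (a \<ominus>\<^bsub>P\<^esub> c) x \<oplus> s c x = s a x"
        using M.smult_l_distr[of "a \<ominus>\<^bsub>P\<^esub> c" c x] ac x da by (simp add: with_smult_def)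
      then have "s (a \<ominus>\<^bsub>P\<^esub> c) x \<oplus> s c x = \<zero> \<oplus> s c x" using e[OF x] D(1)[OF ac(2) x] by simp
      then show "s (a \<ominus>\<^bsub>P\<^esub> c) x = \<zero>" using D(1) ac x by (simp del: l_zero)
    qed (use ac in simp)
    then show "a = c" using da ac by simp
  qed
  \<comment> \<open>\<open>t\<close> is independent data, but it is forced to agree with
    \<open>s\<close> on products and hence on the additive group they generate.\<close>
  have ts: "t a u = s a u" if a: "a \<in> carrier P" and u: "u \<in> square_set B" for a u
  proof -
    have s0: "s a \<zero> = \<zero>"
      using K_zero[OF \<mu>[OF a]] by simp
    have z: "\<zero> \<in> square_set B" using subgroup.one_closed[OF square_subgroup] by simp
    have "t a \<zero> \<oplus> t a \<zero> = t a \<zero> \<oplus> \<zero>" "t a \<zero> \<in> carrier B"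
      using D(5)[OF a z z] square_carrier[OF D(6)[OF a z]] by auto
    then have t0: "t a \<zero> = \<zero>" by (simp del: r_zero)
    show ?thesis using u
    proof (induction rule: square_induct)
      case (product x y)
      then show ?case using D(2)[OF a product] sm[OF a product] by simp
    next
      case (minus u)
      have mu: "\<ominus> u \<in> square_set B" using subgroup.m_inv_closed[OF square_subgroup minus(1)] by (simp add: a_inv_def)
      have uc: "u \<in> carrier B" using square_carrier minus(1) .
      have 1: "t a (\<ominus> u) \<oplus> s a u = \<zero>" using D(5)[OF a mu minus(1)] minus(2) t0 uc by (simp add: l_neg)
      have 2: "s a (\<ominus> u) \<oplus> s a u = \<zero>" using D(4)[OF a, of "\<ominus> u" u] s0 uc by (simp add: l_neg)
      have "t a (\<ominus> u) \<oplus> s a u = s a (\<ominus> u) \<oplus> s a u" using 1 2 by simp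
      then show ?case using D(1)[OF a] uc square_carrier[OF D(6)[OF a mu]] by simp
    next
      case (add u v)
      then show ?case using D(4,5)[OF a] square_carrier by simp
    qed (use t0 s0 in simp)
  qed
  show "\<exists>\<mu>\<in>ring_hom P K. inj_on \<mu> (carrier P) \<and> (\<forall>a\<in>carrier P. (\<forall>x\<in>carrier B. s a x = \<mu> a x) \<and>
      (\<forall>x\<in>square_set B. t a x = \<mu> a x))"
    by (rule bexI[OF _ hom]) (use inj ts square_carrier in auto)
qed

text \<open>For an infinite chain \<open>w\<^sub>k = b w\<^sub>k\<^sub>+\<^sub>1\<close> the right ideals of all \<open>v\<close> with \<open>v b\<close> in \<open>w\<^sub>k C\<close> are
  ascending. If two consecutive ones agree then \<open>w\<^sub>N = w\<^sub>N u\<close> for some \<open>u\<close>, a left identity. The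
  factor \<open>b\<close> puts \<open>w\<^sub>k\<close> itself into its ideal although there is no unity.\<close>

lemma noetherian_wf_tags:
  assumes b: "b \<in> carrier B" and noeth: "noetherian_in B (centralizer B b)"
  shows "wf {(v, w). v \<in> carrier B \<and> w \<in> carrier B \<and> v \<noteq> \<zero> \<and> w \<noteq> \<zero> \<and>
        v \<otimes> b = b \<otimes> v \<and> w \<otimes> b = b \<otimes> w \<and> w = b \<otimes> v}" (is "wf ?R")
  unfolding wf_iff_no_infinite_down_chain
proof
  assume "\<exists>f. \<forall>i. (f (Suc i), f i) \<in> ?R"
  then obtain w where wR: "\<And>i. (w (Suc i), w i) \<in> ?R" by blast
  have *: "w (Suc i) \<in> carrier B \<and> w i \<in> carrier B \<and> w (Suc i) \<noteq> \<zero> \<and> w i \<noteq> \<zero> \<and>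
      w (Suc i) \<otimes> b = b \<otimes> w (Suc i) \<and> w i \<otimes> b = b \<otimes> w i \<and> w i = b \<otimes> w (Suc i)" for i
    using wR[of i] unfolding mem_Collect_eq prod.case .
  then have w: "\<And>i. w i \<in> carrier B" "\<And>i. w i \<noteq> \<zero>" "\<And>i. w i \<otimes> b = b \<otimes> w i" "\<And>i. w i = b \<otimes> w (Suc i)"
    by blast+
  let ?C = "centralizer B b"
  have C: "u \<in> ?C \<longleftrightarrow> u \<in> carrier B \<and> u \<otimes> b = b \<otimes> u" for u by (simp add: centralizer_def)
  define I where "I k = {v \<in> ?C. \<exists>u\<in>?C. v \<otimes> b = w k \<otimes> u}" for k
  have Cm: "u \<otimes> v \<in> ?C" if "u \<in> ?C" "v \<in> ?C" for u v
  proof -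
    have "u \<otimes> v \<otimes> b = u \<otimes> (b \<otimes> v)" using that b by (simp add: C m_assoc)
    also have "\<dots> = b \<otimes> (u \<otimes> v)" using that b by (simp add: C m_assoc[symmetric])
    finally show ?thesis using that by (simp add: C)
  qed
  have Ca: "u \<oplus> v \<in> ?C" if "u \<in> ?C" "v \<in> ?C" for u v
    using that b by (simp add: C l_distr r_distr)
  have neg: "\<ominus> u \<otimes> v = \<ominus> (u \<otimes> v)" "v \<otimes> \<ominus> u = \<ominus> (v \<otimes> u)" if "u \<in> carrier B" "v \<in> carrier B" for u v
  proof -
    have "\<ominus> u \<otimes> v \<oplus> u \<otimes> v = \<zero>" using that by (simp add: l_distr[symmetric] l_neg)
    then show "\<ominus> u \<otimes> v = \<ominus> (u \<otimes> v)" using that by (intro minus_equality[symmetric]) auto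
    have "v \<otimes> \<ominus> u \<oplus> v \<otimes> u = \<zero>" using that by (simp add: r_distr[symmetric] l_neg)
    then show "v \<otimes> \<ominus> u = \<ominus> (v \<otimes> u)" using that by (intro minus_equality[symmetric]) auto
  qed
  have Cn: "\<ominus> u \<in> ?C" if "u \<in> ?C" for u using that b by (simp add: C neg)
  have C0: "\<zero> \<in> ?C" using b by (simp add: C)
  have Cs: "s a u \<in> ?C" if "ring_of_scalars B P s t" "a \<in> carrier P" "u \<in> ?C" for P :: "('b \<Rightarrow> 'b) ring" and s t a u
    using ring_of_scalarsD(1-3)[OF that(1,2)] that(3) b by (simp add: C)
  have bC: "b \<in> ?C" using b by (simp add: C)
  have "right_ideal_in B ?C (I k)" for k
    unfolding right_ideal_in_def
  proof (intro conjI ballI)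
    show "I k \<subseteq> ?C" by (auto simp: I_def)
    show "subgroup (I k) (add_monoid B)"
    proof (rule add.subgroupI)
      show "I k \<subseteq> carrier B" by (auto simp: I_def C)
      have "\<zero> \<otimes> b = w k \<otimes> \<zero>" using b w(1)[of k] by simp
      then have "\<zero> \<in> I k" unfolding I_def using C0 by blast
      then show "I k \<noteq> {}" by blast
    next
      fix v assume "v \<in> I k"
      then obtain u where u: "v \<in> ?C" "u \<in> ?C" "v \<otimes> b = w k \<otimes> u" by (auto simp: I_def)
      have "\<ominus> v \<otimes> b = w k \<otimes> \<ominus> u" using u b w(1) by (simp add: neg C)
      then show "\<ominus> v \<in> I k" unfolding I_def using Cn u by blast
    next
      fix v v' assume "v \<in> I k" "v' \<in> I k"
      then obtain u u' where u: "v \<in> ?C" "u \<in> ?C" "v \<otimes> b = w k \<otimes> u"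
        "v' \<in> ?C" "u' \<in> ?C" "v' \<otimes> b = w k \<otimes> u'" by (auto simp: I_def)
      have "(v \<oplus> v') \<otimes> b = w k \<otimes> (u \<oplus> u')" using u b w(1) by (simp add: l_distr r_distr C)
      then show "v \<oplus> v' \<in> I k" unfolding I_def using Ca u by blast
    qed
    show "scalar_closed B (I k)" unfolding scalar_closed_def
    proof (intro allI impI)
      fix P :: "('b \<Rightarrow> 'b) ring" and s t assume rs: "ring_of_scalars B P s t"
      show "\<forall>a\<in>carrier P. \<forall>x\<in>I k. s a x \<in> I k"
      proof (intro ballI)
        fix a v assume a: "a \<in> carrier P" and "v \<in> I k"
        then obtain u where u: "v \<in> ?C" "u \<in> ?C" "v \<otimes> b = w k \<otimes> u" by (auto simp: I_def)
        have "s a v \<otimes> b = w k \<otimes> s a u"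
          using ring_of_scalarsD(2,3)[OF rs a] u b w(1) by (simp add: C)
        moreover have "s a v \<in> ?C" "s a u \<in> ?C" using Cs[OF rs a u(1)] Cs[OF rs a u(2)] .
        ultimately show "s a v \<in> I k" unfolding I_def by (intro CollectI conjI bexI[of _ "s a u"])
      qed
    qed
    fix c v assume c: "c \<in> ?C" and "v \<in> I k"
    then obtain u where u: "v \<in> ?C" "u \<in> ?C" "v \<otimes> b = w k \<otimes> u" by (auto simp: I_def)
    have vc: "v \<in> carrier B" "c \<in> carrier B" "c \<otimes> b = b \<otimes> c" using u(1) c by (simp_all add: C)
    then have "v \<otimes> c \<otimes> b = v \<otimes> (b \<otimes> c)" using b by (simp add: m_assoc)
    also have "\<dots> = v \<otimes> b \<otimes> c" using vc(1,2) b by (simp add: m_assoc)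
    also have "\<dots> = w k \<otimes> (u \<otimes> c)" unfolding u(3) using u(2) vc(2) w(1) by (simp add: C m_assoc)
    finally show "v \<otimes> c \<in> I k" unfolding I_def using Cm u c by blast
  qed
  moreover have "I k \<subseteq> I (Suc k)" for k
  proof
    fix v assume "v \<in> I k"
    then obtain u where u: "v \<in> ?C" "u \<in> ?C" "v \<otimes> b = w k \<otimes> u" by (auto simp: I_def)
    have "w k \<otimes> u = w (Suc k) \<otimes> (b \<otimes> u)"
      using w(3)[of "Suc k"] w(4)[of k] w(1)[of "Suc k"] b u(2) by (simp add: C m_assoc[symmetric])
    then show "v \<in> I (Suc k)" unfolding I_def using u Cm[OF bC u(2)] by auto
  qed
  ultimately have chain: "\<forall>k. right_ideal_in B ?C (I k) \<and> I k \<subseteq> I (Suc k)" by simp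
  have "ascending_chain_condition (right_ideal_in B ?C)" using noeth unfolding noetherian_in_def by simp
  from mp[OF spec[OF this[unfolded ascending_chain_condition_def], of I] chain]
  obtain N where "\<forall>k\<ge>N. I k = I N" ..
  then have N: "I (Suc N) = I N" by (rule allE[of _ "Suc N"]) (erule mp, simp)
  have "w (Suc N) \<in> ?C" unfolding C using w(1,3)[of "Suc N"] by (rule conjI)
  then have "w (Suc N) \<in> I (Suc N)" unfolding I_def using bC by (intro CollectI conjI bexI[of _ b] refl)
  then have "w (Suc N) \<in> I N" unfolding N .
  then obtain u where u: "u \<in> ?C" "w (Suc N) \<otimes> b = w N \<otimes> u" by (auto simp: I_def)
  \<comment> \<open>\<open>b\<close> commutes with \<open>w (Suc N)\<close>, so the left-hand side
    of the preceding equation is \<open>w N\<close>.\<close>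
  have wu: "w N \<otimes> u = w N" using u(2) w(3)[of "Suc N"] w(4)[of N] by simp
  have "u \<otimes> y = y" if "y \<in> carrier B" for y
  proof (rule cancel_left[OF _ that w(1)[of N] w(2)])
    show "w N \<otimes> (u \<otimes> y) = w N \<otimes> y" using wu that u(1) w(1)[of N] by (simp add: C m_assoc[symmetric])
  qed (use that u(1) in \<open>simp add: C\<close>)
  then show False using domain u(1) unfolding ax_domain_def C by blast
qed

end

section \<open>The theorem\<close>

lemma free_alg_relabel:
  assumes F: "field F" and fin: "finite X" and bij: "bij_betw \<beta> X Y"
  shows "\<exists>h. ring_iso_map h (free_alg F X) (free_alg F Y) \<and>
    (\<forall>a\<in>carrier F. \<forall>f\<in>carrier (free_alg F X). h (\<lambda>w. a \<otimes>\<^bsub>F\<^esub> f w) = (\<lambda>w. a \<otimes>\<^bsub>F\<^esub> h f w))"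
proof -
  have finY: "finite Y" using bij fin bij_betw_finite by blast
  interpret FX: free_algebra F X using F fin by (simp add: free_algebra_def free_algebra_axioms_def)
  interpret FY: free_algebra F Y using F finY by (simp add: free_algebra_def free_algebra_axioms_def)
  let ?\<gamma> = "inv_into X \<beta>"
  let ?h = "\<lambda>f w. if set w \<subseteq> Y then f (map ?\<gamma> w) else \<zero>\<^bsub>F\<^esub>"
  let ?k = "\<lambda>f w. if set w \<subseteq> X then f (map \<beta> w) else \<zero>\<^bsub>F\<^esub>"
  have h: "?h f \<in> FY.FC" if f: "f \<in> FX.FC" for f
    by (rule FY.FC_I[where k = "free_deg F f"]) (use f FX.free_degD[OF f] in \<open>auto split: if_splits\<close>)
  have k: "?k f \<in> FX.FC" if f: "f \<in> FY.FC" for f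
    by (rule FX.FC_I[where k = "free_deg F f"]) (use f FY.free_degD[OF f] in \<open>auto split: if_splits\<close>)
  have bj: "bij_betw ?h FX.FC FY.FC"
  proof (rule bij_betw_byWitness[where f' = ?k])
    show "\<forall>f\<in>FX.FC. ?k (?h f) = f"
    proof (intro ballI ext)
      fix f w assume f: "f \<in> FX.FC"
      show "?k (?h f) w = f w"
      proof (cases "set w \<subseteq> X")
        case True
        have "map ?\<gamma> (map \<beta> w) = w" using True bij by (auto simp: bij_betw_def intro!: map_idI)
        moreover have "set (map \<beta> w) \<subseteq> Y" using True bij by (auto simp: bij_betw_def)
        ultimately show ?thesis using True by simp
      next
        case False
        then show ?thesis using FX.FC_set[OF f, of w] by auto
      qed
    qed
    show "\<forall>f\<in>FY.FC. ?h (?k f) = f"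
    proof (intro ballI ext)
      fix f w assume f: "f \<in> FY.FC"
      show "?h (?k f) w = f w"
      proof (cases "set w \<subseteq> Y")
        case True
        have "map \<beta> (map ?\<gamma> w) = w"
          using True bij by (auto simp: bij_betw_def f_inv_into_f intro!: map_idI)
        moreover have "set (map ?\<gamma> w) \<subseteq> X" using True bij by (auto simp: bij_betw_def inv_into_into)
        ultimately show ?thesis using True by simp
      next
        case False
        then show ?thesis using FY.FC_set[OF f, of w] by auto
      qed
    qed
  qed (use h k in auto)
  have mult: "?h (conv F f g) = conv F (?h f) (?h g)" if fg: "f \<in> FX.FC" "g \<in> FX.FC" for f g
  proof
    fix w show "?h (conv F f g) w = conv F (?h f) (?h g) w"
    proof (cases "set w \<subseteq> Y")
      case True
      have "set (take i w) \<subseteq> Y \<and> set (drop i w) \<subseteq> Y" for i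
        using True set_take_subset[of i w] set_drop_subset[of i w] by blast
      then show ?thesis using True by (simp add: conv_def take_map drop_map)
    next
      case False
      then show ?thesis using FY.FC_set[OF FY.FA_mult[OF h[OF fg(1)] h[OF fg(2)]], of w] by auto
    qed
  qed
  show ?thesis
  proof (rule exI[of _ ?h], intro conjI ballI)
    show "ring_iso_map ?h (free_alg F X) (free_alg F Y)"
      unfolding ring_iso_map_def free_alg_simps
    proof (intro conjI ballI bj mult)
      fix f g show "?h (\<lambda>w. f w \<oplus>\<^bsub>F\<^esub> g w) = (\<lambda>w. ?h f w \<oplus>\<^bsub>F\<^esub> ?h g w)" by (rule ext) simp
    qed
    fix a f assume "a \<in> carrier F"
    then show "?h (\<lambda>w. a \<otimes>\<^bsub>F\<^esub> f w) = (\<lambda>w. a \<otimes>\<^bsub>F\<^esub> ?h f w)" by (intro ext) simp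
  qed
qed

text \<open>Over at most one letter, segments of equal length in a word coincide, so reversing the
  order of the cuts exchanges the factors.\<close>

lemma (in free_algebra) conv_commute:
  assumes "\<And>x y. x \<in> Z \<Longrightarrow> y \<in> Z \<Longrightarrow> x = y" "f \<in> FC" "g \<in> FC"
  shows "conv F f g = conv F g f"
proof
  fix w show "conv F f g w = conv F g f w"
  proof (cases "set w \<subseteq> Z")
    case True
    have flip: "take i w = drop (length w - i) w \<and> drop i w = take (length w - i) w" if "i \<le> length w" for i
    proof -
      have c: "w ! j = w ! k" if "j < length w" "k < length w" for j k
        using assms(1) True that by (meson nth_mem subsetD)
      show ?thesis using that by (auto intro!: nth_equalityI c)
    qed
    have "conv F f g w = finsum F (\<lambda>i. f (take i w) \<otimes> g (drop i w)) ((\<lambda>i. length w - i) ` {..length w})"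
    proof -
      have "(\<lambda>i. length w - i) ` {..length w} = {..length w}"
      proof (intro equalityI subsetI)
        fix i assume "i \<in> {..length w}"
        then show "i \<in> (\<lambda>i. length w - i) ` {..length w}" by (intro image_eqI[of _ _ "length w - i"]) auto
      qed auto
      then show ?thesis by (simp add: conv_def)
    qed
    also have "\<dots> = finsum F (\<lambda>i. f (take (length w - i) w) \<otimes> g (drop (length w - i) w)) {..length w}"
      using assms(2,3) by (intro finsum_reindex) (auto simp: inj_on_def)
    also have "\<dots> = conv F g f w" unfolding conv_def
    proof (rule finsum_cong')
      fix i assume "i \<in> {..length w}"
      then have "take (length w - i) w = drop i w" "drop (length w - i) w = take i w"
        using flip[of i] by auto
      then show "f (take (length w - i) w) \<otimes> g (drop (length w - i) w) = g (take i w) \<otimes> f (drop i w)"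
        using assms(2,3) by (simp add: m_comm)
    qed (use assms(2,3) in auto)
    finally show ?thesis .
  next
    case False
    then show ?thesis using FC_set[OF FA_mult[OF assms(2,3)], of w] FC_set[OF FA_mult[OF assms(3,2)], of w] by metis
  qed
qed

section \<open>The sentences carried from the free algebra to \<open>B\<close>\<close>

definition noncommutative :: "('a, 'm) ring_scheme \<Rightarrow> bool" where
  "noncommutative R \<longleftrightarrow> (\<exists>x\<in>carrier R. \<exists>y\<in>carrier R. x \<otimes>\<^bsub>R\<^esub> y \<noteq> y \<otimes>\<^bsub>R\<^esub> x)"

text \<open>The element with the Noetherian centralizer is singled out only in \<open>B\<close> and
  by no formula, so the axioms are asserted for every noncentral \<open>b\<close> and specialized
  after the transfer.\<close>

definition axioms_sentence :: "('a, 'm) ring_scheme \<Rightarrow> nat \<Rightarrow> bool" where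
  "axioms_sentence R n \<longleftrightarrow> (\<forall>b\<in>carrier R. (\<exists>z\<in>carrier R. b \<otimes>\<^bsub>R\<^esub> z \<noteq> z \<otimes>\<^bsub>R\<^esub> b) \<longrightarrow>
     (\<exists>a. (\<forall>i<n. a i \<in> carrier R) \<and> free_axioms R n b (\<lambda>i. a (if i < n then i else 0))))"

context ring_pair
begin

lemma dfb_noncommutative: "dfb (\<lambda>_. noncommutative R) (\<lambda>_. noncommutative S)"
  unfolding noncommutative_def by (rule dfb_simps)+

lemma dfb_axioms_sentence:
  fixes n :: nat
  assumes "2 \<le> n"
  shows "dfb (\<lambda>_. axioms_sentence R n) (\<lambda>_. axioms_sentence S n)"
proof -
  let ?g = "\<lambda>i. if i < n then i else (0::nat)"
  have g: "(if ?g i < n then a (?g i) else e (?g i)) = a (?g i)" for i and a e :: "nat \<Rightarrow> 'c"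
    using assms by simp
  have n: "\<not> n < n" by simp
  have nc: "dfb (\<lambda>e. \<exists>z\<in>carrier R. e n \<otimes>\<^bsub>R\<^esub> z \<noteq> z \<otimes>\<^bsub>R\<^esub> e n) (\<lambda>e. \<exists>z\<in>carrier S. e n \<otimes>\<^bsub>S\<^esub> z \<noteq> z \<otimes>\<^bsub>S\<^esub> e n)"
    by (rule dfb_simps)+
  from dfb_alln[OF dfb_imp[OF nc dfb_ex_block[OF dfb_free_axioms[of n n ?g], of n]], of n]
  show ?thesis unfolding axioms_sentence_def g if_not_P[OF n] fun_upd_same .
qed

end

lemma algebra_isomorphic_imp_ring_iso:
  assumes "algebra_isomorphic P (with_smult B s) (free_alg K Y)"
  shows "\<exists>h. ring_iso_map h B (free_alg K Y)"
  using assms unfolding algebra_isomorphic_def ring_iso_map_def by (auto simp: with_smult_def)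

lemma elem_equiv_free_alg_imp:
  fixes B :: "('b, 'n) ring_scheme" and n :: nat
  assumes K: "field K" "infinite (carrier K)" and B: "rng B" "has_proper_noetherian_centralizer B"
    and eq: "ring_elem_equiv (free_alg K {..<n}) B"
  shows "\<exists>(K1 :: ('b \<Rightarrow> 'b) ring) s t. maximal_ring_of_scalars B K1 s t \<and> field K1 \<and>
    (\<exists>Y :: 'b set. algebra_isomorphic K1 (with_smult B s) (free_alg K1 Y) \<and>
       HF_elem_equiv K K1 \<and> finite Y \<and> card Y = n)"
proof -
  interpret B: rng B by fact
  interpret A: free_algebra K "{..<n}" using K(1) by (simp add: free_algebra_def free_algebra_axioms_def)
  interpret ring_pair "free_alg K {..<n}" B .
  note transfer = elem_equiv_transfer[OF eq]
  have ne: "carrier (free_alg K {..<n}) \<noteq> {}" "carrier B \<noteq> {}" using A.FA_zero by auto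
  obtain b where b: "b \<in> carrier B" "centralizer B b \<noteq> carrier B" "noetherian_in B (centralizer B b)"
    using B(2) unfolding has_proper_noetherian_centralizer_def by blast
  obtain z where z: "z \<in> carrier B" "b \<otimes>\<^bsub>B\<^esub> z \<noteq> z \<otimes>\<^bsub>B\<^esub> b"
    using b(2) unfolding centralizer_def by (metis (mono_tags, lifting) Collect_cong Collect_mem_eq)
  have "noncommutative B" unfolding noncommutative_def using b(1) z by blast
  then have "noncommutative (free_alg K {..<n})" using transfer[OF dfb_noncommutative ne] by blast
  \<comment> \<open>Fewer than two letters would make the free algebra commutative, whereas a proper
    centralizer makes \<open>B\<close> noncommutative.\<close>
  then have n: "2 \<le> n"
  proof (rule contrapos_pp)
    assume "\<not> 2 \<le> n"
    then have "conv K f g = conv K g f" if "f \<in> A.FC" "g \<in> A.FC" for f g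
      using that by (intro A.conv_commute) auto
    then show "\<not> noncommutative (free_alg K {..<n})" unfolding noncommutative_def by auto
  qed
  interpret A2: free_algebra_fin K n using K(1) n by (simp add: free_algebra_fin_def free_algebra_fin_axioms_def)
  have "axioms_sentence (free_alg K {..<n}) n"
    unfolding axioms_sentence_def
  proof (intro ballI impI)
    fix b assume b: "b \<in> A.FC" "\<exists>z\<in>A.FC. b \<otimes>\<^bsub>A.FA\<^esub> z \<noteq> z \<otimes>\<^bsub>A.FA\<^esub> b"
    have "b \<noteq> (\<lambda>_. \<zero>\<^bsub>K\<^esub>)"
    proof
      assume e: "b = (\<lambda>_. \<zero>\<^bsub>K\<^esub>)"
      have "conv K b z = conv K z b" if "z \<in> A.FC" for z
        unfolding e using that by (intro ext) simp
      then show False using b(2) by simp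
    qed
    then have "free_axioms A.FA n b (letter K)" using A2.free_axioms_letters[OF K(2) b(1)] by blast
    then have "free_axioms A.FA n b (\<lambda>i. letter K (if i < n then i else 0))"
      using free_axioms_cong[of n "letter K" "\<lambda>i. letter K (if i < n then i else 0)" A.FA b, OF _ n] by simp
    then show "\<exists>a. (\<forall>i<n. a i \<in> A.FC) \<and> free_axioms A.FA n b (\<lambda>i. a (if i < n then i else 0))"
      using A2.X_FC' by (intro exI[of _ "letter K"]) auto
  qed
  then have "axioms_sentence B n" using transfer[OF dfb_axioms_sentence[OF n] ne] by blast
  then obtain x where x: "\<And>i. i < n \<Longrightarrow> x i \<in> carrier B" and "free_axioms B n b (\<lambda>i. x (if i < n then i else 0))"
    using b(1) z unfolding axioms_sentence_def by blast
  then have ax: "free_axioms B n b x"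
    using free_axioms_cong[of n "\<lambda>i. x (if i < n then i else 0)" x B b, OF _ n] by simp
  have x0: "x i \<noteq> \<zero>\<^bsub>B\<^esub>" if "i < n" for i using ax that unfolding free_axioms_def ax_unique_def by blast
  have dom: "ax_domain B" using ax unfolding free_axioms_def by blast
  interpret D: domain_rng B
    using B(1) dom x[of 0] x0[of 0] n unfolding domain_rng_def domain_rng_axioms_def by auto
  have "ax_inverse B (x 0)" using ax unfolding free_axioms_def by blast
  then have fK: "field (centroid B)" using D.K_field[of "x 0"] x[of 0] x0[of 0] n by auto
  interpret F: field "centroid B" by (rule fK)
  interpret G: axiomatic_free_algebra "centroid B" B "\<lambda>\<phi> y. \<phi> y" n b x
  proof
    show "scalar_rel B (x i) l \<longleftrightarrow> (\<exists>\<phi>\<in>carrier (centroid B). l = \<phi> (x i))" if "i < n" "l \<in> carrier B" for i l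
      using D.centroid_of_scalar_rel[OF x[OF that(1)] x0[OF that(1)] that(2)]
        D.scalar_rel_centroid[OF x[OF that(1)]] by blast
    show "\<phi> = \<zero>\<^bsub>centroid B\<^esub>" if "i < n" "\<phi> \<in> carrier (centroid B)" "\<phi> (x i) = \<zero>\<^bsub>B\<^esub>" for i \<phi>
      using D.K_determined[OF that(2) D.K_zero_closed x[OF that(1)] x0[OF that(1)]] that x by (simp add: D.K_simps)
    show "\<phi> a \<otimes>\<^bsub>B\<^esub> c = \<phi> (a \<otimes>\<^bsub>B\<^esub> c)" if "\<phi> \<in> carrier (centroid B)" "a \<in> carrier B" "c \<in> carrier B" for \<phi> a c
      using D.K_D(3)[OF that] by simp
    show "a \<otimes>\<^bsub>B\<^esub> \<phi> c = \<phi> (a \<otimes>\<^bsub>B\<^esub> c)" if "\<phi> \<in> carrier (centroid B)" "a \<in> carrier B" "c \<in> carrier B" for \<phi> a c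
      using D.K_D(3,4)[OF that] by simp
    show "wf {(v, w). v \<in> carrier B \<and> w \<in> carrier B \<and> v \<noteq> \<zero>\<^bsub>B\<^esub> \<and> w \<noteq> \<zero>\<^bsub>B\<^esub> \<and>
        v \<otimes>\<^bsub>B\<^esub> b = b \<otimes>\<^bsub>B\<^esub> v \<and> w \<otimes>\<^bsub>B\<^esub> b = b \<otimes>\<^bsub>B\<^esub> w \<and> w = b \<otimes>\<^bsub>B\<^esub> v}"
      by (rule D.noetherian_wf_tags[OF b(1,3)])
  qed (use ax x n in \<open>auto simp: D.K_D(2) D.K_simps\<close>)
  have iso: "ring_iso_map (\<lambda>a w. G.lt w a) B (free_alg (centroid B) {..<n})" by (rule G.lt_iso)
  have "ring_elem_equiv B (free_alg (centroid B) {..<n})"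
    by (rule ring_iso_imp_elem_equiv[OF iso B(1) G.FA_rng])
  then have HF: "HF_elem_equiv K (centroid B)"
    using elem_equiv_imp_HF_elem_equiv[OF K fK n] ring_elem_equiv_trans[OF eq] by blast
  have inj: "inj_on x {..<n}"
  proof (rule inj_onI)
    fix i j assume ij: "i \<in> {..<n}" "j \<in> {..<n}" "x i = x j"
    then have "letter (centroid B) i = letter (centroid B) j" using G.lt_x[of i] G.lt_x[of j] by simp
    then have "letter (centroid B) i [j] = letter (centroid B) j [j]" by simp
    then show "i = j" by (simp add: letter_def split: if_splits)
  qed
  \<comment> \<open>The letters have to be of type \<open>'b\<close>; the generators found in
    \<open>B\<close> serve as their own names.\<close>
  let ?Y = "x ` {..<n}"
  obtain h where h: "ring_iso_map h (free_alg (centroid B) {..<n}) (free_alg (centroid B) ?Y)"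
    "\<And>a f. a \<in> carrier (centroid B) \<Longrightarrow> f \<in> G.FC \<Longrightarrow>
       h (\<lambda>w. a \<otimes>\<^bsub>centroid B\<^esub> f w) = (\<lambda>w. a \<otimes>\<^bsub>centroid B\<^esub> h f w)"
    using free_alg_relabel[OF fK _ bij_betw_imageI[OF inj refl]] by blast
  have c: "ring_iso_map (h \<circ> (\<lambda>a w. G.lt w a)) B (free_alg (centroid B) ?Y)" by (rule ring_iso_map_comp[OF iso h(1)])
  have lin: "(h \<circ> (\<lambda>a w. G.lt w a)) (\<phi> y) = (\<lambda>w. \<phi> \<otimes>\<^bsub>centroid B\<^esub> (h \<circ> (\<lambda>a w. G.lt w a)) y w)"
    if "\<phi> \<in> carrier (centroid B)" "y \<in> carrier B" for \<phi> y
  proof -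
    have "(\<lambda>w. G.lt w (\<phi> y)) = (\<lambda>w. \<phi> \<otimes>\<^bsub>centroid B\<^esub> G.lt w y)" using G.lt_sm[OF that] by blast
    then show ?thesis using h(2)[OF that(1) G.lt_FC[OF that(2)]] by simp
  qed
  have "algebra_isomorphic (centroid B) (with_smult B (\<lambda>\<phi> y. \<phi> y)) (free_alg (centroid B) ?Y)"
    unfolding algebra_isomorphic_def
    by (rule exI[of _ "h \<circ> (\<lambda>a w. G.lt w a)"]) (use c lin in \<open>auto simp: ring_iso_map_def with_smult_def\<close>)
  moreover have "finite ?Y" "card ?Y = n" using inj by (auto simp: card_image)
  ultimately show ?thesis using D.maximal_centroid fK HF by blast
qed


theorem theorem9p4:
  fixes K :: "('k, 'm) ring_scheme" and X :: "'x set" and B :: "('b, 'n) ring_scheme"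
  assumes "field K" and "infinite (carrier K)" and "finite X"
    and "rng B" and "has_proper_noetherian_centralizer B"
  shows "ring_elem_equiv (free_alg K X) B \<longleftrightarrow>
    (\<exists>(K1 :: ('b \<Rightarrow> 'b) ring) s t.
        maximal_ring_of_scalars B K1 s t \<and> field K1 \<and>
        (\<exists>Y :: 'b set.
            algebra_isomorphic K1 (with_smult B s) (free_alg K1 Y) \<and>
            HF_elem_equiv K K1 \<and> X \<approx> Y))"
proof -
  \<comment> \<open>The letters are numbered, since the whole development uses initial segments of
    the natural numbers as alphabets.\<close>
  obtain \<beta> where \<beta>: "bij_betw \<beta> X {..<card X}"
    using ex_bij_betw_finite_nat[OF assms(3)] by (auto simp: atLeast0LessThan)
  interpret AX: free_algebra K X using assms(1,3) by (simp add: free_algebra_def free_algebra_axioms_def)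
  interpret AN: free_algebra K "{..<card X}" using assms(1) by (simp add: free_algebra_def free_algebra_axioms_def)
  obtain r where "ring_iso_map r (free_alg K X) (free_alg K {..<card X})"
    using free_alg_relabel[OF assms(1,3) \<beta>] by blast
  then have r: "ring_elem_equiv (free_alg K X) (free_alg K {..<card X})"
    by (rule ring_iso_imp_elem_equiv[OF _ AX.FA_rng AN.FA_rng])
  show ?thesis
  proof
    assume "ring_elem_equiv (free_alg K X) B"
    then have eq: "ring_elem_equiv (free_alg K {..<card X}) B"
      by (rule ring_elem_equiv_trans[OF ring_elem_equiv_sym[OF r]])
    have "X \<approx> Y" if "finite Y" "card Y = card X" for Y :: "'b set"
      using eqpoll_iff_card[OF assms(3) that(1)] that(2) by simp
    then show "\<exists>(K1 :: ('b \<Rightarrow> 'b) ring) s t. maximal_ring_of_scalars B K1 s t \<and> field K1 \<and>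
        (\<exists>Y :: 'b set. algebra_isomorphic K1 (with_smult B s) (free_alg K1 Y) \<and> HF_elem_equiv K K1 \<and> X \<approx> Y)"
      using elem_equiv_free_alg_imp[OF assms(1,2,4,5) eq] by blast
  next
    assume "\<exists>(K1 :: ('b \<Rightarrow> 'b) ring) s t. maximal_ring_of_scalars B K1 s t \<and> field K1 \<and>
        (\<exists>Y :: 'b set. algebra_isomorphic K1 (with_smult B s) (free_alg K1 Y) \<and> HF_elem_equiv K K1 \<and> X \<approx> Y)"
    then obtain K1 :: "('b \<Rightarrow> 'b) ring" and s and Y :: "'b set" where K1: "field K1"
      and iso: "algebra_isomorphic K1 (with_smult B s) (free_alg K1 Y)"
      and HF: "HF_elem_equiv K K1" and XY: "X \<approx> Y" by blast
    have Y: "finite Y" "card Y = card X" using eqpoll_finite_iff[OF XY] eqpoll_iff_card[of X Y] assms(3) XY by auto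
    obtain \<gamma> where \<gamma>: "bij_betw \<gamma> Y {..<card X}"
      using ex_bij_betw_finite_nat[OF Y(1)] Y(2) by (auto simp: atLeast0LessThan)
    interpret AY: free_algebra K1 Y using K1 Y(1) by (simp add: free_algebra_def free_algebra_axioms_def)
    interpret AM: free_algebra K1 "{..<card X}" using K1 by (simp add: free_algebra_def free_algebra_axioms_def)
    obtain h where "ring_iso_map h B (free_alg K1 Y)" using algebra_isomorphic_imp_ring_iso[OF iso] by blast
    then have 1: "ring_elem_equiv B (free_alg K1 Y)" by (rule ring_iso_imp_elem_equiv[OF _ assms(4) AY.FA_rng])
    obtain k where "ring_iso_map k (free_alg K1 Y) (free_alg K1 {..<card X})"
      using free_alg_relabel[OF K1 Y(1) \<gamma>] by blast
    then have 2: "ring_elem_equiv (free_alg K1 Y) (free_alg K1 {..<card X})"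
      by (rule ring_iso_imp_elem_equiv[OF _ AY.FA_rng AM.FA_rng])
    have 3: "ring_elem_equiv (free_alg K {..<card X}) (free_alg K1 {..<card X})"
      by (rule HF_elem_equiv_imp_elem_equiv[OF assms(1) K1 HF])
    show "ring_elem_equiv (free_alg K X) B"
      using ring_elem_equiv_trans[OF ring_elem_equiv_trans[OF r 3] ring_elem_equiv_sym[OF ring_elem_equiv_trans[OF 1 2]]] .
  qed
qed

end
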